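(* Let $c\in\mathbb{C}$ and $n\geq 1$, and let $g=[g_{0}:\cdots:g_{n}]$ be a holomorphic curve of $\mathbb{C}$ into $\mathbb{P}^n(\mathbb{C})$ with hyper-order $\varsigma(g)<1$, where $g_{0},\ldots,g_{n}$ are linearly independent over $\mathcal{P}_{c}^{1}$. Let $$f_{j}=\sum_{i=0}^{n}a_{ij}g_{i},\qquad j=0,\ldots,q,\quad q>n,$$ where $a_{ij}$ are $c$-periodic entire functions satisfying $T(r,a_{ij})=o(T_{g}(r))$, such that any $n+1$ of the $q+1$ functions $f_{0},\ldots,f_{q}$ are linearly independent over $\mathcal{P}_{c}^{1}$. Assume that $0$ is a derivative-like paired value of $f_{i}$ with the separation $c$ for all $i\in\{0,\ldots,q\}$. Then $$\sum_{j=0}^{q}\delta^{[n]}_{g}(0,f_{j})\leq n+1,$$ where $$\delta^{[n]}_{g}(0,f_{j})=1-\limsup_{r\to\infty}\frac{N_{n}\left(r,\frac{1}{f_{j}}\right)}{T_{g}(r)}.$$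
   Context: A holomorphic curve $g=[g_0:\cdots:g_n]:\mathbb{C}\to\mathbb{P}^n$ is given by a reduced representation, i.e. $g_0,\ldots,g_n$ are entire functions with no common zeros in $\mathbb{C}$. Its Cartan characteristic function is $$T_g(r)=\int_0^{2\pi}u(re^{i\theta})\frac{d\theta}{2\pi}-u(0),\qquad u(z)=\max_{0\le k\le n}\log|g_k(z)|,$$ and its hyper-order is $\varsigma(g)=\limsup_{r\to\infty}\frac{\log\log T_g(r)}{\log r}$. $\mathcal{P}_c^1$ is the field of meromorphic functions in $\mathbb{C}$ of period $c$ whose hyper-order (the same limsup with the Nevanlinna characteristic $T(r,f)$) is strictly less than one. $a$ is a derivative-like paired value of $f$ with the separation $c$ if the following holds for all except at most finitely many $a$-points of $f$: whenever $f(z)=a$ with multiplicity $m$, then also $f(z+c)=a$ with multiplicity $\max\{m-1,0\}$. For an entire function $f\not\equiv0$, $N_n(r,1/f)=N_n(r,0,f)$ is the truncated counting function of zeros: $n_n(r,0,f)$ is the number of zeros of $f$ in $\{|z|\le r\}$ where a zero of multiplicity $m$ is counted exactly $\min\{m,n\}$ times, and $$N_n(r,0,f)=n_n(0,0,f)\log r+\int_0^r\frac{n_n(t,0,f)-n_n(0,0,f)}{t}\,dt.$$ *)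

theory Defs
  imports "HOL-Complex_Analysis.Complex_Analysis" "HOL-Library.Landau_Symbols"
begin

section \<open>Counting functions\<close>

text \<open>
  A divisor is given by its multiplicity function \<open>\<mu>\<close>; its support is assumed to have no
  limit point, so that the sum below is finite.
\<close>

definition unint_count :: "(complex \<Rightarrow> nat) \<Rightarrow> real \<Rightarrow> nat" where
  "unint_count \<mu> t = (\<Sum>z\<in>{z \<in> cball 0 t. \<mu> z \<noteq> 0}. \<mu> z)"

definition int_count :: "(complex \<Rightarrow> nat) \<Rightarrow> real \<Rightarrow> real" where
  "int_count \<mu> r = real (unint_count \<mu> 0) * ln r
     + integral {0..r} (\<lambda>t. (real (unint_count \<mu> t) - real (unint_count \<mu> 0)) / t)"

text \<open>
  The two guards give the value \<open>0\<close> away from zeros (resp. poles); in particular the zero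
  function has no poles although its \<^const>\<open>zorder\<close> is unspecified.  The function
  \<open>zero_mult\<close> is only meaningful for functions that do not vanish identically.
\<close>

definition zero_mult :: "(complex \<Rightarrow> complex) \<Rightarrow> complex \<Rightarrow> nat" where
  "zero_mult f z = (if f z = 0 then nat (zorder f z) else 0)"

definition pole_mult :: "(complex \<Rightarrow> complex) \<Rightarrow> complex \<Rightarrow> nat" where
  "pole_mult f z = (if is_pole f z then nat (- zorder f z) else 0)"

text \<open>\<open>trunc_count_zeros n f r\<close> is $N_n(r,1/f)$.\<close>

definition trunc_count_zeros :: "nat \<Rightarrow> (complex \<Rightarrow> complex) \<Rightarrow> real \<Rightarrow> real" where
  "trunc_count_zeros n f = int_count (\<lambda>z. min (zero_mult f z) n)"


section \<open>Characteristic functions and hyper-order\<close>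

definition ln_plus :: "real \<Rightarrow> real" where
  "ln_plus x = ln (max 1 x)"

definition proximity :: "(complex \<Rightarrow> complex) \<Rightarrow> real \<Rightarrow> real" where
  "proximity f r = integral {0..2*pi} (\<lambda>\<theta>. ln_plus (norm (f (of_real r * cis \<theta>)))) / (2*pi)"

definition nevanlinna_char :: "(complex \<Rightarrow> complex) \<Rightarrow> real \<Rightarrow> real" where
  "nevanlinna_char f r = proximity f r + int_count (pole_mult f) r"

text \<open>
  A curve $[g_0:\cdots:g_n]$ is a family \<open>g :: nat \<Rightarrow> complex \<Rightarrow> complex\<close> of which only the
  components with index at most \<open>n\<close> matter.  Indices with \<open>g k z = 0\<close> would contribute
  $\log 0 = -\infty$ to the maximum and are left out; at least one index remains because the
  components have no common zero.
\<close>

definition reduced_rep :: "nat \<Rightarrow> (nat \<Rightarrow> complex \<Rightarrow> complex) \<Rightarrow> bool" where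
  "reduced_rep n g \<longleftrightarrow> (\<forall>k\<le>n. g k holomorphic_on UNIV) \<and> (\<forall>z. \<exists>k\<le>n. g k z \<noteq> 0)"

definition max_log :: "nat \<Rightarrow> (nat \<Rightarrow> complex \<Rightarrow> complex) \<Rightarrow> complex \<Rightarrow> real" where
  "max_log n g z = Max ((\<lambda>k. ln (norm (g k z))) ` {k. k \<le> n \<and> g k z \<noteq> 0})"

definition cartan_char :: "nat \<Rightarrow> (nat \<Rightarrow> complex \<Rightarrow> complex) \<Rightarrow> real \<Rightarrow> real" where
  "cartan_char n g r =
     integral {0..2*pi} (\<lambda>\<theta>. max_log n g (of_real r * cis \<theta>)) / (2*pi) - max_log n g 0"

text \<open>
  The iterated logarithm is taken with \<^const>\<open>ln_plus\<close>, which changes nothing if \<open>T\<close> tends to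
  infinity and gives hyper-order \<open>0\<close> to constants, whose characteristic is bounded.
\<close>

definition hyper_order :: "(real \<Rightarrow> real) \<Rightarrow> ereal" where
  "hyper_order T = Limsup at_top (\<lambda>r. ereal (ln_plus (ln_plus (T r)) / ln r))"


section \<open>The field of periodic functions and linear independence over it\<close>

text \<open>
  Meromorphic functions are represented by their normal form in the sense of
  \<open>nicely_meromorphic_on\<close> (removable singularities removed, value \<open>0\<close> at poles), so
  that each one is represented by exactly one function.  Since the value at a pole is a dummy,
  identities between meromorphic functions are required only off a set without limit points.
\<close>

definition periodic_field :: "complex \<Rightarrow> (complex \<Rightarrow> complex) set" where
  "periodic_field c = {h. h nicely_meromorphic_on UNIV \<and> (\<forall>z. h (z + c) = h z)
                          \<and> hyper_order (nevanlinna_char h) < 1}"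

definition lin_indep_over_periodic ::
    "complex \<Rightarrow> nat set \<Rightarrow> (nat \<Rightarrow> complex \<Rightarrow> complex) \<Rightarrow> bool" where
  "lin_indep_over_periodic c I f \<longleftrightarrow>
     (\<forall>h. (\<forall>i\<in>I. h i \<in> periodic_field c) \<and> (\<forall>\<^sub>\<approx>z\<in>UNIV. (\<Sum>i\<in>I. h i z * f i z) = 0)
          \<longrightarrow> (\<forall>i\<in>I. h i = (\<lambda>_. 0)))"


section \<open>Derivative-like paired values and deficiency\<close>

text \<open>
  For an \<open>a\<close>-point of multiplicity \<open>m \<ge> 1\<close> the subtraction of natural numbers is
  $\max\{m-1,0\}$; multiplicity \<open>0\<close> at \<open>z + c\<close> means that \<open>f (z + c) \<noteq> a\<close>.
\<close>

definition derivative_like_paired ::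
    "complex \<Rightarrow> complex \<Rightarrow> (complex \<Rightarrow> complex) \<Rightarrow> bool" where
  "derivative_like_paired c a f \<longleftrightarrow>
     finite {z. f z = a \<and>
       zero_mult (\<lambda>w. f w - a) (z + c) \<noteq> zero_mult (\<lambda>w. f w - a) z - 1}"

text \<open>
  The first argument \<open>m\<close> is the truncation level and the second one, \<open>n\<close>, the dimension of
  the projective space.
\<close>

definition trunc_deficiency ::
    "nat \<Rightarrow> nat \<Rightarrow> (nat \<Rightarrow> complex \<Rightarrow> complex) \<Rightarrow> (complex \<Rightarrow> complex) \<Rightarrow> ereal" where
  "trunc_deficiency m n g f =
     1 - Limsup at_top (\<lambda>r. ereal (trunc_count_zeros m f r / cartan_char n g r))"

end

theory Submission
  imports Defs "Jordan_Normal_Form.Determinant" "HOL-Real_Asymp.Real_Asymp"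
begin

text \<open>
  Cartan's proof of the second main theorem uses only few properties of the derivatives
  \<open>g, g', \<dots>\<close>: a nonvanishing determinant, a lemma on logarithmic derivatives, and the fact that
  differentiation lowers the order of a zero by at most one.  Outside a finite set of points,
  the pairing hypothesis gives the last property to the shift \<open>f(z) \<mapsto> f(z + c)\<close>, and the
  Poisson-Jensen formula together with the hyper-order condition shows that
  \<open>log |f(z + c) / f(z)|\<close>, suitably normalised, has mean \<open>o(T(r))\<close> on arbitrarily large circles.
  The Casorati determinant does not vanish: otherwise Cramer's rule would produce a linear
  relation with periodic coefficients of hyper-order less than one.

  The finitely many exceptional points cost a term \<open>O(log r)\<close>, which is negligible unless
  \<open>T(r) = O(log r)\<close> along a sequence.  In that case the curve is rational up to a common factor,
  the coefficients are constant, and Cartan's original argument with the Wronskian applies.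
\<close>

section \<open>Means over circles and the Poisson formula\<close>

text \<open>The targets move: g is recovered from n+1 of the f_j by Cramer's rule, and the
  coefficient determinants that enter cost only characteristics of the a_ij, which are o(T). Because
  the coefficients are periodic, a shifted f_j is the same combination of the shifted components.
  Large counting functions on arbitrarily large circles suffice. These circles avoid a countable set
  of radii, so that all logarithms are continuous on them, and T at most doubles on
  [r, r + r^\<beta>]; hyper-order below 1 provides such r. The window leaves room for an outer
  circle at a distance tending to infinity, as the difference estimates need. The Cramer
  coefficients of a Casorati relation escape this choice: hyper-order is an upper limit over all
  radii, so circles through zeros and poles must be controlled too. T depends only on the curve,
  while log |f_j| depends on the representation; hence only the quotients f_j / g_0 are compared
  with their shifts. If log r = o(T) fails, T = O(log r) is known on a sequence of radii only, which
  is still enough to produce polynomials.\<close>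

definition circle_mean :: "(complex \<Rightarrow> real) \<Rightarrow> real \<Rightarrow> real" where
  "circle_mean u r = integral {0..2*pi} (\<lambda>\<theta>. u (of_real r * cis \<theta>)) / (2*pi)"

lemma continuous_on_circle:
  assumes "continuous_on (sphere 0 r) u" "r \<ge> 0"
  shows "continuous_on A (\<lambda>\<theta>. u (of_real r * cis \<theta>))"
  by (rule continuous_on_compose2[OF assms(1)])
     (use assms(2) in \<open>auto intro!: continuous_intros simp: norm_mult\<close>)

lemma integrable_on_circle:
  fixes u :: "complex \<Rightarrow> 'a::banach"
  assumes "continuous_on (sphere 0 r) u" "r \<ge> 0"
  shows "(\<lambda>\<theta>. u (of_real r * cis \<theta>)) integrable_on {a..b}"
  by (intro integrable_continuous_interval continuous_on_circle assms)

context
  fixes r :: real and u v :: "complex \<Rightarrow> real"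
  assumes r: "r \<ge> 0" and u: "continuous_on (sphere 0 r) u" and v: "continuous_on (sphere 0 r) v"
begin

lemma circle_mean_add: "circle_mean (\<lambda>z. u z + v z) r = circle_mean u r + circle_mean v r"
  unfolding circle_mean_def
  by (simp add: integral_add integrable_on_circle[OF u r] integrable_on_circle[OF v r] add_divide_distrib)

lemma circle_mean_diff: "circle_mean (\<lambda>z. u z - v z) r = circle_mean u r - circle_mean v r"
  unfolding circle_mean_def
  by (simp add: integral_diff integrable_on_circle[OF u r] integrable_on_circle[OF v r] diff_divide_distrib)

lemma circle_mean_mono:
  assumes "\<And>z. norm z = r \<Longrightarrow> u z \<le> v z"
  shows "circle_mean u r \<le> circle_mean v r"
  unfolding circle_mean_def
  by (intro divide_right_mono integral_le integrable_on_circle u v assms r)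
     (use r in \<open>auto simp: norm_mult\<close>)

end

lemma circle_mean_cmult: "circle_mean (\<lambda>z. k * u z) r = k * circle_mean u r"
  unfolding circle_mean_def by simp

lemma circle_mean_const [simp]: "circle_mean (\<lambda>_. k) r = k"
  unfolding circle_mean_def by simp

lemma circle_mean_cong:
  assumes "\<And>z. norm z = r \<Longrightarrow> u z = v z" "r \<ge> 0"
  shows "circle_mean u r = circle_mean v r"
  unfolding circle_mean_def using assms by (simp add: norm_mult)

lemma circle_mean_sum:
  assumes "finite I" "r \<ge> 0" "\<And>i. i \<in> I \<Longrightarrow> continuous_on (sphere 0 r) (u i)"
  shows "circle_mean (\<lambda>z. \<Sum>i\<in>I. u i z) r = (\<Sum>i\<in>I. circle_mean (u i) r)"
  unfolding circle_mean_def
  by (subst integral_sum) (auto intro!: integrable_on_circle assms simp: sum_divide_distrib)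

lemma circle_mean_nonneg:
  assumes "r \<ge> 0" "continuous_on (sphere 0 r) u" "\<And>z. norm z = r \<Longrightarrow> u z \<ge> 0"
  shows "circle_mean u r \<ge> 0"
  using circle_mean_mono[OF assms(1) continuous_on_const assms(2), of 0] assms(3) by simp

section \<open>The Poisson kernel and the Poisson integral\<close>

definition poisson_kernel :: "real \<Rightarrow> complex \<Rightarrow> complex \<Rightarrow> real" where
  "poisson_kernel R z \<zeta> = (R\<^sup>2 - (norm z)\<^sup>2) / (norm (\<zeta> - z))\<^sup>2"

definition poisson :: "real \<Rightarrow> (complex \<Rightarrow> real) \<Rightarrow> complex \<Rightarrow> real" where
  "poisson R u z = circle_mean (\<lambda>\<zeta>. poisson_kernel R z \<zeta> * u \<zeta>) R"

lemma continuous_on_poisson_kernel: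
  assumes "norm z < R"
  shows "continuous_on (sphere 0 R) (poisson_kernel R z)"
  unfolding poisson_kernel_def using assms by (auto intro!: continuous_intros)

lemma poisson_kernel_pos:
  assumes "norm z < R" "norm \<zeta> = R"
  shows "poisson_kernel R z \<zeta> > 0"
proof -
  have "(norm z)\<^sup>2 < R\<^sup>2" using assms by (intro power_strict_mono) auto
  moreover have "\<zeta> \<noteq> z" using assms by auto
  ultimately show ?thesis unfolding poisson_kernel_def by simp
qed

lemma poisson_kernel_le:
  assumes "norm z < R" "norm \<zeta> = R"
  shows "poisson_kernel R z \<zeta> \<le> (R + norm z) / (R - norm z)"
proof -
  have d: "norm (\<zeta> - z) \<ge> R - norm z" using norm_triangle_ineq2[of \<zeta> z] assms by simp
  have "poisson_kernel R z \<zeta> \<le> (R\<^sup>2 - (norm z)\<^sup>2) / (R - norm z)\<^sup>2"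
    unfolding poisson_kernel_def
    by (intro divide_left_mono power_mono d mult_pos_pos)
       (use assms d in \<open>auto intro!: power_mono zero_less_power\<close>)
  also have "\<dots> = (R + norm z) / (R - norm z)"
    using assms by (simp add: power2_eq_square square_diff_square_factored)
  finally show ?thesis .
qed

text \<open>Cauchy's formula for h times (R^2 - |z|^2) / (R^2 - cnj z w). The extra factor is
  holomorphic on the closed disc and equals 1 at w = z; on |w| = R, where R^2 = w cnj w, it turns
  Cauchy's kernel into the Poisson kernel.\<close>

theorem poisson_Re:
  assumes h: "h holomorphic_on cball 0 R" and z: "norm z < R"
  shows "Re (h z) = poisson R (\<lambda>w. Re (h w)) z"
proof -
  have R: "R > 0" using z norm_ge_zero[of z] by linarith
  define k where "k w = h w * of_real (R\<^sup>2 - (norm z)\<^sup>2) / (of_real (R\<^sup>2) - cnj z * w)" for w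
  have nz: "of_real (R\<^sup>2) - cnj z * w \<noteq> 0" if "norm w \<le> R" for w
  proof
    assume "of_real (R\<^sup>2) - cnj z * w = 0"
    hence "norm (cnj z * w) = R\<^sup>2" using R by (metis eq_iff_diff_eq_0 norm_of_real abs_power2)
    moreover have "norm (cnj z * w) \<le> norm z * R" using that by (simp add: norm_mult mult_left_mono)
    moreover have "norm z * R < R * R" using z R by simp
    ultimately show False by (simp add: power2_eq_square)
  qed
  have "k holomorphic_on cball 0 R" unfolding k_def
    by (intro holomorphic_intros h) (use nz in auto)
  hence "((\<lambda>u. k u/(u-z)) has_contour_integral (2 * of_real pi * \<i> * k z)) (circlepath 0 R)"
    by (rule Cauchy_integral_circlepath_simple) (use z in simp)
  hence "((\<lambda>t. k (0 + of_real R * cis t) / (0 + of_real R * cis t - z) * of_real R * \<i> * cis t) has_integral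
      (2 * of_real pi * \<i> * k z)) {0..2*pi}"
    unfolding circlepath_def by (subst (asm) has_contour_integral_part_circlepath_iff) auto
  hence "((\<lambda>t. (k (of_real R * cis t) / (of_real R * cis t - z) * of_real R * \<i> * cis t) * (1 / (2 * of_real pi * \<i>))) has_integral
      (2 * of_real pi * \<i> * k z) * (1 / (2 * of_real pi * \<i>))) {0..2*pi}"
    by (intro has_integral_mult_left) simp
  moreover have "2 * of_real pi * \<i> * k z * (1 / (2 * of_real pi * \<i>)) = h z"
  proof -
    have "of_real (R\<^sup>2 - (norm z)\<^sup>2) = of_real (R\<^sup>2) - cnj z * z"
      by (simp add: complex_norm_square mult.commute del: of_real_power)
    thus ?thesis using nz[of z] z unfolding k_def by simp
  qed
  moreover have "(k (of_real R * cis t) / (of_real R * cis t - z) * of_real R * \<i> * cis t) * (1 / (2 * of_real pi * \<i>))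
     = of_real (poisson_kernel R z (of_real R * cis t) / (2*pi)) * h (of_real R * cis t)" for t
  proof -
    let ?w = "of_real R * cis t"
    have ww: "of_real (R\<^sup>2) - cnj z * ?w = ?w * cnj (?w - z)"
      by (simp add: algebra_simps power2_eq_square cis_cnj) (simp add: cis_mult)
    have "?w \<noteq> z" using z R by (auto simp: norm_mult)
    hence n0: "?w - z \<noteq> 0" by simp
    have nn: "of_real ((norm (?w - z))\<^sup>2) = (?w - z) * cnj (?w - z)"
      by (rule complex_norm_square)
    have w0: "?w \<noteq> 0" using R by simp
    have c0: "cnj (?w - z) \<noteq> 0" using n0 by (metis complex_cnj_zero_iff)
    define a b where "a = ?w - z" and "b = cnj (?w - z)"
    have "(k ?w / a * of_real R * \<i> * cis t) * (1 / (2 * of_real pi * \<i>))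
       = h ?w * of_real (R\<^sup>2 - (norm z)\<^sup>2) / (?w * b) / a * ?w / (2 * of_real pi)"
    proof -
      have "(H * P / (w * b) / a * x * \<i> * y) * (1 / (2 * p * \<i>)) = H * P / (w * b) / a * w / (2 * p)"
        if "w = x * y" for H P w x y p :: complex
        using that by simp
      thus ?thesis unfolding k_def ww b_def[symmetric] by blast
    qed
    also have "\<dots> = h ?w * of_real (R\<^sup>2 - (norm z)\<^sup>2) / (a * b) / (2 * of_real pi)"
      using w0 n0 c0 unfolding a_def[symmetric] b_def[symmetric] by (simp add: divide_simps)
    also have "a * b = of_real ((norm (?w - z))\<^sup>2)" unfolding a_def b_def nn ..
    finally show ?thesis unfolding a_def poisson_kernel_def by simp
  qed
  ultimately have "((\<lambda>t. of_real (poisson_kernel R z (of_real R * cis t) / (2*pi)) * h (of_real R * cis t)) has_integral h z) {0..2*pi}"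
    by simp
  from has_integral_Re[OF this]
  have "((\<lambda>t. poisson_kernel R z (of_real R * cis t) * Re (h (of_real R * cis t)) / (2*pi)) has_integral Re (h z)) {0..2*pi}"
    by (simp add: Re_divide_of_real)
  from integral_unique[OF this] show ?thesis unfolding poisson_def circle_mean_def by simp
qed

lemma poisson_const: "norm z < R \<Longrightarrow> poisson R (\<lambda>_. k) z = k"
  using poisson_Re[of "\<lambda>_. of_real k" R z] by simp

lemma poisson_0: "R > 0 \<Longrightarrow> poisson R u 0 = circle_mean u R"
  unfolding poisson_def by (rule circle_mean_cong) (auto simp: poisson_kernel_def)

context
  fixes R :: real and z :: complex and u v :: "complex \<Rightarrow> real"
  assumes z: "norm z < R" and u: "continuous_on (sphere 0 R) u" and v: "continuous_on (sphere 0 R) v"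
begin

lemma poisson_add: "poisson R (\<lambda>w. u w + v w) z = poisson R u z + poisson R v z"
proof -
  have "R \<ge> 0" using z norm_ge_zero[of z] by linarith
  thus ?thesis unfolding poisson_def
    by (subst circle_mean_add[symmetric])
       (auto intro!: continuous_intros u v continuous_on_poisson_kernel z simp: algebra_simps)
qed

lemma poisson_diff: "poisson R (\<lambda>w. u w - v w) z = poisson R u z - poisson R v z"
proof -
  have "R \<ge> 0" using z norm_ge_zero[of z] by linarith
  thus ?thesis unfolding poisson_def
    by (subst circle_mean_diff[symmetric])
       (auto intro!: continuous_intros u v continuous_on_poisson_kernel z simp: algebra_simps)
qed

lemma poisson_mono:
  assumes "\<And>w. norm w = R \<Longrightarrow> u w \<le> v w"
  shows "poisson R u z \<le> poisson R v z"
proof -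
  have "R \<ge> 0" using z norm_ge_zero[of z] by linarith
  thus ?thesis unfolding poisson_def
    by (intro circle_mean_mono continuous_intros u v continuous_on_poisson_kernel z mult_left_mono
      assms less_imp_le[OF poisson_kernel_pos[OF z]])
qed

lemma poisson_le_circle_mean:
  assumes "\<And>w. norm w = R \<Longrightarrow> u w \<ge> 0"
  shows "poisson R u z \<le> (R + norm z) / (R - norm z) * circle_mean u R"
proof -
  have "R \<ge> 0" using z norm_ge_zero[of z] by linarith
  thus ?thesis unfolding poisson_def circle_mean_cmult[symmetric]
    by (intro circle_mean_mono continuous_intros u continuous_on_poisson_kernel z mult_right_mono
      assms poisson_kernel_le)
qed

end

lemma poisson_sum:
  assumes "finite I" "norm z < R" "\<And>i. i \<in> I \<Longrightarrow> continuous_on (sphere 0 R) (u i)"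
  shows "poisson R (\<lambda>w. \<Sum>i\<in>I. u i w) z = (\<Sum>i\<in>I. poisson R (u i) z)"
proof -
  have "R \<ge> 0" using assms(2) norm_ge_zero[of z] by linarith
  thus ?thesis unfolding poisson_def sum_distrib_left
    by (intro circle_mean_sum) (auto intro!: continuous_intros continuous_on_poisson_kernel assms)
qed

lemma poisson_cmult: "poisson R (\<lambda>w. k * u w) z = k * poisson R u z"
  unfolding poisson_def circle_mean_cmult[symmetric] by (simp add: mult_ac)

text \<open>Conjugation followed by rotation by \<open>cis (s+t)\<close> is an isometry that
  interchanges the two angles. It lets an integral over the inner circle be read as a Poisson
  integral of the constant 1.\<close>

lemma poisson_kernel_circle_symmetric:
  "poisson_kernel R (of_real r * cis s) (of_real R * cis t) = poisson_kernel R (of_real r * cis t) (of_real R * cis s)"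
proof -
  have "norm (of_real R * cis t - of_real r * cis s) = norm (cis (s+t) * cnj (of_real R * cis t - of_real r * cis s))"
    by (simp only: norm_mult complex_mod_cnj norm_cis mult_1)
  also have "cis (s+t) * cnj (of_real R * cis t - of_real r * cis s) = of_real R * cis s - of_real r * cis t"
    by (simp add: algebra_simps cis_cnj) (simp add: cis_mult algebra_simps)
  finally show ?thesis unfolding poisson_kernel_def by (simp add: norm_mult)
qed

text \<open>After Fubini and the symmetry of the kernel, the inner integral is a Poisson integral of
  1.\<close>

theorem circle_mean_poisson:
  assumes r: "0 \<le> r" "r < R" and u: "continuous_on (sphere 0 R) u"
  shows "circle_mean (poisson R u) r = circle_mean u R"
proof -
  let ?K = "\<lambda>s t. poisson_kernel R (of_real r * cis s) (of_real R * cis t) * u (of_real R * cis t)"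
  have cont: "continuous_on UNIV (\<lambda>(s,t). ?K s t)"
  proof -
    have "R * R - r * r > 0" using r mult_strict_mono[of r R r R] by simp
    moreover have "of_real R * cis (snd x) - of_real r * cis (fst x) \<noteq> 0" for x :: "real \<times> real"
    proof
      assume "of_real R * cis (snd x) - of_real r * cis (fst x) = 0"
      hence "norm (of_real R * cis (snd x)) = norm (of_real r * cis (fst x))" by simp
      thus False using r by (simp add: norm_mult)
    qed
    moreover have "continuous_on UNIV (\<lambda>x::real\<times>real. u (of_real R * cis (snd x)))"
      by (rule continuous_on_compose2[OF u]) (use r in \<open>auto intro!: continuous_intros simp: norm_mult\<close>)
    ultimately show ?thesis unfolding poisson_kernel_def case_prod_unfold
      by (auto intro!: continuous_intros)
  qed
  have "integral {0..2*pi} (\<lambda>s. integral {0..2*pi} (?K s)) = integral {0..2*pi} (\<lambda>t. integral {0..2*pi} (\<lambda>s. ?K s t))"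
    using integral_swap_continuous[OF continuous_on_subset[OF cont subset_UNIV], of 0 "2*pi" 0 "2*pi"]
    by (simp add: cbox_interval)
  also have "(\<lambda>t. integral {0..2*pi} (\<lambda>s. ?K s t)) = (\<lambda>t. 2*pi*u (of_real R * cis t))"
  proof
    fix t
    have "poisson R (\<lambda>_. 1) (of_real r * cis t) = 1" using r by (intro poisson_const) (auto simp: norm_mult)
    hence "integral {0..2*pi} (\<lambda>s. poisson_kernel R (of_real r * cis s) (of_real R * cis t)) = 2*pi"
      unfolding poisson_def circle_mean_def poisson_kernel_circle_symmetric[of R r _ t] by simp
    thus "integral {0..2*pi} (\<lambda>s. ?K s t) = 2*pi*u (of_real R * cis t)"
      by simp
  qed
  finally show ?thesis
    unfolding circle_mean_def poisson_def by simp
qed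

text \<open>With t = |c| / (R - r) \<le> 1/2, each of R - |z|, R + |z| and |\<zeta> - z| changes by
  a factor between 1 - t and 1 + t. The constant 16 is the least one with (1+t)^2 / (1-t)^2 \<le> 1
  + 16 t up to t = 1/2.\<close>

lemma poisson_kernel_shift:
  assumes z: "norm z \<le> r" and R: "norm \<zeta> = R" and c: "2 * norm c \<le> R - r" "r < R"
  shows "\<bar>poisson_kernel R (z + c) \<zeta> - poisson_kernel R z \<zeta>\<bar> \<le> 16 * (norm c / (R - r)) * poisson_kernel R z \<zeta>"
proof -
  define \<rho> t where "\<rho> = R - norm z" and "t = norm c / (R - r)"
  have r0: "r \<ge> 0" using z norm_ge_zero[of z] by linarith
  have t: "0 \<le> t" "t \<le> 1/2" using c unfolding t_def by (auto simp: field_simps)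
  have ct: "norm c \<le> t * \<rho>" unfolding t_def \<rho>_def using c z
    by (simp add: divide_simps mult_left_mono)
  have zc: "\<bar>norm (z + c) - norm z\<bar> \<le> t * \<rho>"
    using ct norm_triangle_ineq[of z c] norm_triangle_ineq2[of z "-c"] by simp
  have \<rho>: "\<rho> > 0" "\<rho> \<le> norm (\<zeta> - z)" "\<rho> \<le> R + norm z"
    unfolding \<rho>_def using z c R norm_triangle_ineq2[of \<zeta> z] by auto
  have d: "\<bar>norm (\<zeta> - (z + c)) - norm (\<zeta> - z)\<bar> \<le> t * norm (\<zeta> - z)"
  proof -
    have "\<bar>norm (\<zeta> - (z + c)) - norm (\<zeta> - z)\<bar> \<le> norm c"
      using norm_triangle_ineq3[of "\<zeta> - (z+c)" "\<zeta> - z"] by simp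
    also note ct
    also have "t * \<rho> \<le> t * norm (\<zeta> - z)" using t \<rho> by (intro mult_left_mono)
    finally show ?thesis .
  qed
  define D where "D = norm (\<zeta> - z)"
  define S where "S = R + norm z"
  define D' where "D' = norm (\<zeta> - (z + c))"
  define p' where "p' = R - norm (z+c)"
  define S' where "S' = R + norm (z+c)"
  have tS: "t * \<rho> \<le> t * S" using t \<rho> unfolding S_def by (intro mult_left_mono)
  have b: "(1-t)*D \<le> D'" "D' \<le> (1+t)*D" "(1-t)*\<rho> \<le> p'" "p' \<le> (1+t)*\<rho>" "(1-t)*S \<le> S'" "S' \<le> (1+t)*S"
    using d zc tS unfolding D_def D'_def p'_def \<rho>_def S'_def S_def by (auto simp: algebra_simps abs_le_iff)
  have pos: "D > 0" "S > 0" using \<rho> unfolding D_def S_def by linarith+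
  have t1: "1 - t > 0" using t by simp
  have "(1-t)*D > 0" "(1-t)*\<rho> > 0" "(1-t)*S > 0" using pos t1 \<rho> by simp_all
  hence pos': "D' > 0" "p' > 0" "S' > 0" using b by linarith+
  have e: "poisson_kernel R z \<zeta> = \<rho> * S / D\<^sup>2" "poisson_kernel R (z+c) \<zeta> = p' * S' / D'\<^sup>2"
    unfolding poisson_kernel_def \<rho>_def S_def D_def p'_def S'_def D'_def
    by (simp_all add: power2_eq_square algebra_simps)
  have up: "poisson_kernel R (z+c) \<zeta> \<le> (1 + 16*t) * poisson_kernel R z \<zeta>"
  proof -
    have "p' * S' / D'\<^sup>2 \<le> ((1+t)*\<rho> * ((1+t)*S)) / ((1-t)*D)\<^sup>2"
      using b pos pos' t1 \<rho> t by (intro frac_le mult_mono power_mono) auto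
    also have "\<dots> = (1+t)\<^sup>2/(1-t)\<^sup>2 * (\<rho> * S / D\<^sup>2)" by (simp add: power2_eq_square field_simps)
    also have "(1+t)\<^sup>2/(1-t)\<^sup>2 \<le> 1 + 16*t"
    proof -
      have "(1+16*t)*(1-t)\<^sup>2 - (1+t)\<^sup>2 = 4*t*(3 - 8*t + 4*t\<^sup>2)" by (simp add: power2_eq_square algebra_simps)
      also have "3 - 8*t + 4*t\<^sup>2 = (1-2*t)*(3-2*t)" by (simp add: power2_eq_square algebra_simps)
      also have "4*t*((1-2*t)*(3-2*t)) \<ge> 0" using t by (intro mult_nonneg_nonneg) auto
      finally have "(1+t)\<^sup>2 \<le> (1+16*t)*(1-t)\<^sup>2" by simp
      thus ?thesis using t1 by (simp add: divide_le_eq)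
    qed
    finally show ?thesis unfolding e using pos \<rho> by (simp add: mult_right_mono divide_right_mono)
  qed
  have lo: "poisson_kernel R (z+c) \<zeta> \<ge> (1 - 16*t) * poisson_kernel R z \<zeta>"
  proof -
    have "1 - 16*t \<le> (1-t)\<^sup>2/(1+t)\<^sup>2"
    proof -
      have "(1-t)\<^sup>2 - (1-16*t)*(1+t)\<^sup>2 = 4*t*(3+8*t+4*t\<^sup>2)" by (simp add: power2_eq_square algebra_simps)
      also have "\<dots> \<ge> 0" using t by simp
      finally have "(1-16*t)*(1+t)\<^sup>2 \<le> (1-t)\<^sup>2" by simp
      thus ?thesis using t by (simp add: le_divide_eq)
    qed
    hence "(1 - 16*t) * (\<rho> * S / D\<^sup>2) \<le> (1-t)\<^sup>2/(1+t)\<^sup>2 * (\<rho> * S / D\<^sup>2)"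
      using pos \<rho> by (intro mult_right_mono) auto
    also have "\<dots> = ((1-t)*\<rho> * ((1-t)*S)) / ((1+t)*D)\<^sup>2" by (simp add: power2_eq_square field_simps)
    also have "\<dots> \<le> p' * S' / D'\<^sup>2"
      using b pos pos' t1 \<rho> t by (intro frac_le mult_mono power_mono) auto
    finally show ?thesis unfolding e .
  qed
  show ?thesis using up lo unfolding t_def[symmetric] by (simp add: abs_le_iff algebra_simps)
qed

text \<open>The kernel changes by a relative amount, so the error is a Poisson integral of |u|. By
  \<open>circle_mean_poisson\<close> its average over |z| = r is exactly the mean of |u| over the
  outer circle.\<close>

lemma poisson_shift:
  assumes z: "norm z \<le> r" and u: "continuous_on (sphere 0 R) u" and c: "2 * norm c \<le> R - r" "r < R"
  shows "\<bar>poisson R u (z + c) - poisson R u z\<bar> \<le> 16 * (norm c / (R - r)) * poisson R (\<lambda>w. \<bar>u w\<bar>) z"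
proof -
  have R: "R \<ge> 0" using z c norm_ge_zero[of z] by linarith
  have zR: "norm z < R" "norm (z + c) < R" using z c norm_triangle_ineq[of z c] by linarith+
  note ci = continuous_intros u continuous_on_poisson_kernel zR
  let ?k = "16 * (norm c / (R - r))"
  have eq: "poisson R u (z + c) - poisson R u z
      = circle_mean (\<lambda>w. (poisson_kernel R (z+c) w - poisson_kernel R z w) * u w) R"
    unfolding poisson_def by (subst circle_mean_diff[symmetric]) (intro ci R | simp add: left_diff_distrib)+
  have bd: "\<bar>(poisson_kernel R (z+c) w - poisson_kernel R z w) * u w\<bar> \<le> ?k * (poisson_kernel R z w * \<bar>u w\<bar>)"
    if "norm w = R" for w
    using mult_right_mono[OF poisson_kernel_shift[OF z that c] abs_ge_zero[of "u w"]]
    by (simp add: abs_mult mult.assoc)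
  have "circle_mean (\<lambda>w. (poisson_kernel R (z+c) w - poisson_kernel R z w) * u w) R
      \<le> circle_mean (\<lambda>w. ?k * (poisson_kernel R z w * \<bar>u w\<bar>)) R"
    by (intro circle_mean_mono ci R) (use bd abs_le_D1 in blast)
  moreover have "circle_mean (\<lambda>w. (-1) * ((poisson_kernel R (z+c) w - poisson_kernel R z w) * u w)) R
      \<le> circle_mean (\<lambda>w. ?k * (poisson_kernel R z w * \<bar>u w\<bar>)) R"
    by (intro circle_mean_mono ci R) (use bd in \<open>fastforce simp: abs_le_iff\<close>)
  ultimately show ?thesis unfolding eq circle_mean_cmult unfolding poisson_def by (simp add: abs_le_iff)
qed

section \<open>The formulas of Poisson-Jensen and Jensen\<close>

lemma entire_factor_at:
  fixes f :: "complex \<Rightarrow> complex"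
  assumes "f holomorphic_on UNIV" "\<exists>w. f w \<noteq> 0"
  obtains k where "k holomorphic_on UNIV" "\<And>w. f w = (w - z) ^ zero_mult f z * k w" "k z \<noteq> 0"
proof -
  have "(if f z = 0 then zorder f z > 0 else zorder f z = 0) \<and> (\<exists>r>0. cball z r \<subseteq> UNIV \<and>
      zor_poly f z holomorphic_on cball z r \<and>
      (\<forall>w\<in>cball z r. f w = zor_poly f z w * (w - z) ^ nat (zorder f z) \<and> zor_poly f z w \<noteq> 0))"
    by (rule zorder_exist_zero[OF assms(1) open_UNIV connected_UNIV UNIV_I]) (use assms(2) in blast)
  then obtain r where n: "if f z = 0 then zorder f z > 0 else zorder f z = 0" and r: "r > 0"
    and g: "zor_poly f z holomorphic_on cball z r"
      "\<And>w. w \<in> cball z r \<Longrightarrow> f w = zor_poly f z w * (w - z) ^ nat (zorder f z) \<and> zor_poly f z w \<noteq> 0"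
    by blast
  have m: "zero_mult f z = nat (zorder f z)" using n unfolding zero_mult_def by (auto split: if_splits)
  \<comment> \<open>Near z the cofactor is the local \<open>zor_poly\<close>, elsewhere the
    quotient; the two agree on the punctured ball, so k is entire.\<close>
  define k where "k w = (if w \<in> ball z r then zor_poly f z w else f w / (w - z) ^ zero_mult f z)" for w
  have e: "k w = f w / (w - z) ^ zero_mult f z" if "w \<noteq> z" for w
    using g(2)[of w] that unfolding k_def m by (auto simp: dist_commute)
  have "k holomorphic_on ball z r"
    by (rule holomorphic_transform[OF holomorphic_on_subset[OF g(1)]]) (auto simp: k_def)
  moreover have "k holomorphic_on -{z}"
    by (rule holomorphic_transform[of "\<lambda>w. f w / (w - z) ^ zero_mult f z"])
       (use e in \<open>auto intro!: holomorphic_intros holomorphic_on_subset[OF assms(1)]\<close>)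
  ultimately have "k holomorphic_on (ball z r \<union> -{z})"
    by (intro holomorphic_on_Un) auto
  moreover have "ball z r \<union> -{z} = UNIV" using r by auto
  ultimately have "k holomorphic_on UNIV" by simp
  moreover have kz: "k z \<noteq> 0" using g(2)[of z] r unfolding k_def by auto
  moreover have "f w = (w - z) ^ zero_mult f z * k w" for w
    using g(2)[of z] r e[of w] by (cases "w = z") (auto simp: k_def m)
  ultimately show ?thesis by (intro that[of k]) auto
qed

lemma zero_mult_unique:
  assumes "k holomorphic_on UNIV" "\<And>w. f w = (w - z) ^ m * k w" "k z \<noteq> 0"
  shows "zero_mult f z = m"
proof (cases "m = 0")
  case True
  thus ?thesis using assms(2)[of z] assms(3) unfolding zero_mult_def by simp
next
  case False
  have "zorder f z = int m"
    by (rule zorder_eqI[of UNIV z k]) (use assms in auto)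
  thus ?thesis using False assms(2)[of z] unfolding zero_mult_def by simp
qed

lemma zero_mult_pos_iff:
  assumes "f holomorphic_on UNIV" "\<exists>w. f w \<noteq> 0"
  shows "zero_mult f z > 0 \<longleftrightarrow> f z = 0"
proof -
  obtain k where "k holomorphic_on UNIV" and k: "\<And>w. f w = (w - z) ^ zero_mult f z * k w" "k z \<noteq> 0"
    using entire_factor_at[OF assms, of z] by blast
  define m where "m = zero_mult f z"
  have "f z = 0 ^ m * k z" using k(1)[of z] unfolding m_def[symmetric] diff_self .
  thus ?thesis unfolding m_def[symmetric] using k(2) by (cases m) auto
qed

lemma zero_mult_factor:
  assumes f: "f holomorphic_on UNIV" "\<exists>w. f w \<noteq> 0"
    and p: "p holomorphic_on UNIV" "p z \<noteq> 0" and eq: "\<And>w. g w = p w * f w"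
  shows "zero_mult g z = zero_mult f z"
proof -
  obtain k where k: "k holomorphic_on UNIV" "\<And>w. f w = (w - z) ^ zero_mult f z * k w" "k z \<noteq> 0"
    using entire_factor_at[OF f, of z] by blast
  show ?thesis
    by (rule zero_mult_unique[of "\<lambda>w. p w * k w"]) (use k p eq in \<open>auto intro!: holomorphic_intros\<close>)
qed

lemma entire_factor_finite:
  assumes f: "f holomorphic_on UNIV" "\<exists>w. f w \<noteq> 0" and "finite Z"
  shows "\<exists>k. k holomorphic_on UNIV \<and> (\<forall>w. f w = (\<Prod>a\<in>Z. (w - a) ^ zero_mult f a) * k w) \<and> (\<forall>a\<in>Z. k a \<noteq> 0)"
  using assms(3)
proof (induction Z)
  case empty
  show ?case using f by (intro exI[of _ f]) auto
next
  case (insert b Z)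
  then obtain k where k: "k holomorphic_on UNIV" "\<And>w. f w = (\<Prod>a\<in>Z. (w - a) ^ zero_mult f a) * k w"
    "\<And>a. a \<in> Z \<Longrightarrow> k a \<noteq> 0" by blast
  obtain w where "f w \<noteq> 0" using f(2) by blast
  hence nz: "\<exists>w. k w \<noteq> 0" using k(2)[of w] by auto
  obtain k' where k': "k' holomorphic_on UNIV" "\<And>w. k w = (w - b) ^ zero_mult k b * k' w" "k' b \<noteq> 0"
    using entire_factor_at[OF k(1) nz, of b] by blast
  have mb: "zero_mult f b = zero_mult k b"
    by (rule zero_mult_factor[OF k(1) nz _ _ k(2)]) (use insert in \<open>auto intro!: holomorphic_intros\<close>)
  have kn: "k' a \<noteq> 0" if "a \<in> Z" for a using k(3)[OF that] k'(2)[of a] by auto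
  have fw: "f w = (w - b) ^ zero_mult k b * (\<Prod>a\<in>Z. (w - a) ^ zero_mult f a) * k' w" for w
    unfolding k(2)[of w] k'(2)[of w] by (simp only: mult_ac)
  show ?case
  proof (intro exI[of _ k'] conjI allI ballI)
    show "f w = (\<Prod>a\<in>insert b Z. (w - a) ^ zero_mult f a) * k' w" for w
      unfolding prod.insert[OF insert.hyps] mb by (rule fw)
  qed (use k' kn in auto)
qed

definition zeros_in :: "(complex \<Rightarrow> complex) \<Rightarrow> real \<Rightarrow> complex set" where
  "zeros_in f R = {a \<in> cball 0 R. f a = 0}"

lemma finite_zeros_in:
  assumes "f holomorphic_on UNIV" "\<exists>w. f w \<noteq> 0"
  shows "finite (zeros_in f R)"
proof (cases "f constant_on UNIV")
  case True
  then obtain y where "\<And>x. f x = y" unfolding constant_on_def by blast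
  with assms(2) have "f x \<noteq> 0" for x by auto
  thus ?thesis unfolding zeros_in_def by simp
next
  case False
  show ?thesis unfolding zeros_in_def
    by (rule holomorphic_compact_finite_zeros[OF assms(1) _ _ _ _ False]) auto
qed

lemma countable_zeros:
  assumes "f holomorphic_on UNIV" "\<exists>w. f w \<noteq> 0"
  shows "countable {a. f a = 0}"
proof -
  have "{a. f a = 0} = (\<Union>n::nat. zeros_in f (real n))"
    unfolding zeros_in_def by (auto simp: real_arch_simple)
  thus ?thesis using finite_zeros_in[OF assms] by (simp add: countable_finite)
qed

text \<open>Green's function of the disc of radius R with pole a. The numerator has modulus R |z -
  a| on the circle and, for a nonzero, vanishes at the reflected point R^2 / cnj a outside.\<close>

definition green :: "real \<Rightarrow> complex \<Rightarrow> complex \<Rightarrow> real" where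
  "green R z a = ln (norm (of_real (R\<^sup>2) - cnj a * z) / (R * norm (z - a)))"

text \<open>The squares of the two sides differ by (R^2 - |a|^2) (R^2 - |z|^2). This is the
  nonnegativity of Green's function.\<close>

lemma norm_diff_le_reflected:
  assumes "norm z \<le> R" "norm a \<le> R"
  shows "R * norm (z - a) \<le> norm (of_real (R\<^sup>2) - cnj a * z)"
proof -
  have R: "R \<ge> 0" using assms norm_ge_zero[of z] by linarith
  have "(norm (of_real (R\<^sup>2) - cnj a * z))\<^sup>2 - (R * norm (z - a))\<^sup>2 = (R\<^sup>2 - (norm a)\<^sup>2) * (R\<^sup>2 - (norm z)\<^sup>2)"
  proof -
    have "(norm (of_real (R\<^sup>2) - cnj a * z))\<^sup>2 = (R\<^sup>2 - (Re a * Re z + Im a * Im z))\<^sup>2 + (Im a * Re z - Re a * Im z)\<^sup>2"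
      unfolding cmod_power2 by (simp add: power2_eq_square algebra_simps)
    thus ?thesis unfolding power_mult_distrib cmod_power2[of a] cmod_power2[of z] cmod_power2[of "z - a"] minus_complex.sel
      by (simp only: power2_eq_square) (simp add: algebra_simps)
  qed
  moreover have "(norm a)\<^sup>2 \<le> R\<^sup>2" "(norm z)\<^sup>2 \<le> R\<^sup>2" using assms by (auto intro!: power_mono)
  ultimately have "(R * norm (z - a))\<^sup>2 \<le> (norm (of_real (R\<^sup>2) - cnj a * z))\<^sup>2"
    using mult_nonneg_nonneg[of "R\<^sup>2 - (norm a)\<^sup>2" "R\<^sup>2 - (norm z)\<^sup>2"] by linarith
  thus ?thesis by (rule power2_le_imp_le) simp
qed

lemma green_nonneg:
  assumes "norm z \<le> R" "norm a \<le> R" "z \<noteq> a" "R > 0"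
  shows "green R z a \<ge> 0"
  unfolding green_def using norm_diff_le_reflected[OF assms(1,2)] assms(3,4)
  by (intro ln_ge_zero) (simp add: le_divide_eq)

lemma green_le:
  assumes "norm z < R" "norm a \<le> R" "z \<noteq> a" "R > 0"
  shows "green R z a \<le> ln (2 * R / norm (z - a))"
proof -
  have "norm (of_real (R\<^sup>2) - cnj a * z) \<le> norm (complex_of_real (R\<^sup>2)) + norm (cnj a * z)" by (rule norm_triangle_ineq4)
  also have "norm (cnj a * z) \<le> R * R"
    unfolding norm_mult using assms by (intro mult_mono) auto
  also have "norm (complex_of_real (R\<^sup>2)) = R * R" by (metis abs_power2 norm_of_real power2_eq_square)
  finally have 1: "norm (of_real (R\<^sup>2) - cnj a * z) \<le> 2 * R * R" by simp
  have "R * norm (z - a) > 0" using assms by simp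
  with norm_diff_le_reflected[of z R a] assms have "norm (of_real (R\<^sup>2) - cnj a * z) > 0" by linarith
  thus ?thesis unfolding green_def using 1 assms
    by (intro ln_mono) (auto simp: field_simps)
qed

lemma one_minus_mult_nonzero:
  fixes b w :: complex
  assumes "norm b * norm w < 1"
  shows "1 - b * w \<noteq> 0"
proof
  assume "1 - b * w = 0"
  hence "norm (b * w) = norm (1::complex)" by simp
  thus False using assms by (simp add: norm_mult)
qed

text \<open>As |b| R < 1, the values 1 - b w stay in the right half-plane for |w| \<le> R, where the
  principal logarithm is holomorphic.\<close>

lemma poisson_ln_linear:
  assumes "norm b * R < 1" "norm z < R"
  shows "poisson R (\<lambda>w. ln (norm (1 - b * w))) z = ln (norm (1 - b * z))"
proof -
  have R: "R > 0" using assms(2) norm_ge_zero[of z] by linarith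
  have pos: "Re (1 - b * w) > 0" if "norm w \<le> R" for w
  proof -
    have "norm (b * w) < 1" using that assms(1) mult_left_mono[OF that, of "norm b"] by (simp add: norm_mult)
    thus ?thesis using complex_Re_le_cmod[of "b * w"] by simp
  qed
  have "1 - b * w \<notin> \<real>\<^sub>\<le>\<^sub>0" if "norm w \<le> R" for w
  proof
    assume "1 - b * w \<in> \<real>\<^sub>\<le>\<^sub>0"
    hence "Re (1 - b * w) \<le> 0" by (simp only: complex_nonpos_Reals_iff)
    thus False using pos[OF that] by linarith
  qed
  hence "(\<lambda>w. Ln (1 - b * w)) holomorphic_on cball 0 R" by (intro holomorphic_intros) auto
  from poisson_Re[OF this assms(2)]
  have "Re (Ln (1 - b * z)) = poisson R (\<lambda>w. Re (Ln (1 - b * w))) z" .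
  moreover have "Re (Ln (1 - b * w)) = ln (norm (1 - b * w))" if "norm w \<le> R" for w
    using pos[OF that] by (intro Re_Ln) (metis less_irrefl zero_complex.simps(1))
  moreover from this have "poisson R (\<lambda>w. Re (Ln (1 - b * w))) z = poisson R (\<lambda>w. ln (norm (1 - b * w))) z"
    unfolding poisson_def using R by (intro circle_mean_cong) auto
  ultimately show ?thesis using assms(2) by simp
qed

text \<open>On the circle |w - a| equals K |1 - b w|, where 1 - b w has no zero in the closed disc:
  K = R and b = cnj a / R^2 if |a| < R (reflection of the zero), K = |a| and b = 1/a if |a| > R.
  Only reflection changes the value inside, and the change is Green's function.\<close>

lemma poisson_ln_norm_diff:
  assumes "norm a \<noteq> R" "norm z < R" "z \<noteq> a"
  shows "poisson R (\<lambda>w. ln (norm (w - a))) z = ln (norm (z - a)) + (if norm a < R then green R z a else 0)"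
proof -
  have R: "R > 0" using assms(2) norm_ge_zero[of z] by linarith
  have c: "continuous_on (sphere 0 R) (\<lambda>w. ln (norm (1 - b * w)))" if "norm b * R < 1" for b :: complex
  proof -
    have "1 - b * w \<noteq> 0" if "norm w = R" for w
      using that \<open>norm b * R < 1\<close> one_minus_mult_nonzero[of b w] by simp
    thus ?thesis by (auto intro!: continuous_intros)
  qed
  have main: "poisson R (\<lambda>w. ln (norm (w - a))) z = ln K + ln (norm (1 - b * z))"
    if K: "K > 0" and b: "norm b * R < 1" and e: "\<And>w. norm w = R \<Longrightarrow> norm (w - a) = K * norm (1 - b * w)" for K :: real and b :: complex
  proof -
    have "norm (1 - b * w) > 0" if "norm w = R" for w
      using that b one_minus_mult_nonzero[of b w] by simp
    hence "ln (norm (w - a)) = ln K + ln (norm (1 - b * w))" if "norm w = R" for w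
      using that e[OF that] K by (simp add: ln_mult_pos)
    hence "poisson R (\<lambda>w. ln (norm (w - a))) z = poisson R (\<lambda>w. ln K + ln (norm (1 - b * w))) z"
      unfolding poisson_def using R by (intro circle_mean_cong) auto
    also have "\<dots> = ln K + ln (norm (1 - b * z))"
      using assms(2) b by (subst poisson_add) (auto intro!: c simp: poisson_const poisson_ln_linear)
    finally show ?thesis .
  qed
  show ?thesis
  proof (cases "norm a < R")
    case True
    define b where "b = cnj a / of_real (R\<^sup>2)"
    have b: "norm b * R < 1"
    proof -
      have "norm (complex_of_real (R\<^sup>2)) = R * R" by (metis abs_power2 norm_of_real power2_eq_square)
      thus ?thesis using True R unfolding b_def norm_divide by simp
    qed
    have e1: "of_real (R\<^sup>2) - cnj a * w = of_real (R\<^sup>2) * (1 - b * w)" for w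
      using R unfolding b_def by (simp add: field_simps)
    have "norm (w - a) = R * norm (1 - b * w)" if w: "norm w = R" for w
    proof -
      have "of_real (R\<^sup>2) = w * cnj w" using complex_norm_square[of w] w by simp
      hence "of_real (R\<^sup>2) - cnj a * w = w * cnj (w - a)" by (simp add: algebra_simps)
      hence "norm (of_real (R\<^sup>2) - cnj a * w) = R * norm (w - a)" using w by (simp only: norm_mult complex_mod_cnj)
      also have "norm (of_real (R\<^sup>2) - cnj a * w) = R\<^sup>2 * norm (1 - b * w)"
        unfolding e1 by (simp add: norm_mult norm_power)
      finally show ?thesis using R by (simp add: power2_eq_square)
    qed
    from main[OF R b this] have "poisson R (\<lambda>w. ln (norm (w - a))) z = ln R + ln (norm (1 - b * z))" .
    also have "\<dots> = ln (norm (z - a)) + green R z a"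
    proof -
      have "norm b * norm z \<le> norm b * R" using assms(2) by (intro mult_left_mono) auto
      hence "norm (b * z) < 1" using b by (simp add: norm_mult)
      hence "norm (1 - b * z) > 0" by auto
      moreover have "norm (of_real (R\<^sup>2) - cnj a * z) / (R * norm (z - a)) = R * norm (1 - b * z) / norm (z - a)"
        unfolding e1 using R by (simp add: norm_mult norm_power power2_eq_square)
      moreover have "norm (z - a) > 0" using assms(3) by simp
      ultimately show ?thesis unfolding green_def using R by (simp add: ln_div ln_mult_pos)
    qed
    finally show ?thesis using True by simp
  next
    case False
    hence a: "norm a > R" using assms(1) by simp
    hence a0: "a \<noteq> 0" using R by auto
    have e: "norm (w - a) = norm a * norm (1 - 1/a * w)" for w
    proof -
      have "w - a = - (a * (1 - 1/a * w))" using a0 by (simp add: field_simps)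
      thus ?thesis by (metis norm_minus_cancel norm_mult)
    qed
    have "poisson R (\<lambda>w. ln (norm (w - a))) z = ln (norm a) + ln (norm (1 - 1/a * z))"
      by (rule main) (use a a0 e R in \<open>auto simp: norm_divide\<close>)
    also have "\<dots> = ln (norm (z - a))"
    proof -
      have "norm (1 - 1/a * z) > 0" using e[of z] assms(3) a0 by auto
      thus ?thesis unfolding e[of z] using a0 by (simp add: ln_mult_pos)
    qed
    finally show ?thesis using False by simp
  qed
qed

lemma continuous_on_ln_norm:
  assumes "f holomorphic_on UNIV" "\<And>w. w \<in> A \<Longrightarrow> f w \<noteq> 0"
  shows "continuous_on A (\<lambda>w. ln (norm (f w)))"
  using assms by (auto intro!: continuous_intros holomorphic_on_imp_continuous_on[OF holomorphic_on_subset])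

text \<open>Dividing out the zeros in the disc of radius R + 1 leaves a function with a holomorphic
  logarithm near the closed disc of radius R, so only linear factors remain to be treated. Zeros of
  modulus above R give no Green term by \<open>poisson_ln_norm_diff\<close>.\<close>

theorem poisson_jensen:
  assumes f: "f holomorphic_on UNIV" and nz: "\<And>w. norm w = R \<Longrightarrow> f w \<noteq> 0"
    and z: "norm z < R" "f z \<noteq> 0"
  shows "ln (norm (f z)) = poisson R (\<lambda>w. ln (norm (f w))) z - (\<Sum>a\<in>zeros_in f R. zero_mult f a * green R z a)"
proof -
  have R: "R > 0" using z norm_ge_zero[of z] by linarith
  have f0: "\<exists>w. f w \<noteq> 0" using z by blast
  define Z where "Z = zeros_in f (R + 1)"
  have fZ: "finite Z" unfolding Z_def by (rule finite_zeros_in[OF f f0])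
  obtain k where k: "k holomorphic_on UNIV" "\<And>w. f w = (\<Prod>a\<in>Z. (w - a) ^ zero_mult f a) * k w"
    "\<And>a. a \<in> Z \<Longrightarrow> k a \<noteq> 0" using entire_factor_finite[OF f f0 fZ] by blast
  have kn: "k w \<noteq> 0" if "w \<in> ball 0 (R+1)" for w
    using k(2)[of w] k(3)[of w] that unfolding Z_def zeros_in_def by (cases "f w = 0") auto
  obtain h where h: "h holomorphic_on ball 0 (R+1)" "\<And>w. w \<in> ball 0 (R+1) \<Longrightarrow> exp (h w) = k w"
    using holomorphic_logarithm_exists[of "ball 0 (R+1)" k 0] kn holomorphic_on_subset[OF k(1)] R by auto
  have lk: "ln (norm (k w)) = Re (h w)" if "norm w \<le> R" for w
  proof -
    have "k w = exp (h w)" using h(2)[of w] that by simp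
    thus ?thesis by (simp add: norm_exp_eq_Re)
  qed
  have pk: "poisson R (\<lambda>w. ln (norm (k w))) z = ln (norm (k z))"
  proof -
    have "h holomorphic_on cball 0 R" by (rule holomorphic_on_subset[OF h(1)]) auto
    from poisson_Re[OF this z(1)] have "Re (h z) = poisson R (\<lambda>w. Re (h w)) z" .
    also have "\<dots> = poisson R (\<lambda>w. ln (norm (k w))) z"
      unfolding poisson_def using R lk by (intro circle_mean_cong) auto
    finally show ?thesis using lk z(1) by simp
  qed
  have lf: "ln (norm (f w)) = (\<Sum>a\<in>Z. zero_mult f a * ln (norm (w - a))) + ln (norm (k w))"
    if "f w \<noteq> 0" "norm w \<le> R" for w
  proof -
    have kw: "k w \<noteq> 0" and nza: "\<And>a. a \<in> Z \<Longrightarrow> w \<noteq> a" using that kn[of w] unfolding Z_def zeros_in_def by auto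
    have "ln (norm (\<Prod>a\<in>Z. (w - a) ^ zero_mult f a)) = (\<Sum>a\<in>Z. zero_mult f a * ln (norm (w - a)))"
      unfolding prod_norm[symmetric] using fZ nza
      by (subst ln_prod) (auto simp: norm_power ln_realpow)
    moreover have "norm (\<Prod>a\<in>Z. (w - a) ^ zero_mult f a) > 0" using fZ nza by simp
    ultimately show ?thesis unfolding k(2)[of w] norm_mult using kw
      by (subst ln_mult_pos) auto
  qed
  have aR: "norm a \<noteq> R" "a \<noteq> z" if "a \<in> Z" for a using that nz z unfolding Z_def zeros_in_def by auto
  have ca: "continuous_on (sphere 0 R) (\<lambda>w. real (zero_mult f a) * ln (norm (w - a)))" if "a \<in> Z" for a
    using aR[OF that] by (auto intro!: continuous_intros)
  have ck: "continuous_on (sphere 0 R) (\<lambda>w. ln (norm (k w)))"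
    by (rule continuous_on_ln_norm[OF k(1)]) (use kn in auto)
  have "poisson R (\<lambda>w. ln (norm (f w))) z = poisson R (\<lambda>w. (\<Sum>a\<in>Z. zero_mult f a * ln (norm (w - a))) + ln (norm (k w))) z"
    unfolding poisson_def using R lf nz by (intro circle_mean_cong) auto
  also have "\<dots> = (\<Sum>a\<in>Z. zero_mult f a * poisson R (\<lambda>w. ln (norm (w - a))) z) + ln (norm (k z))"
    using fZ z ca ck pk
    by (subst poisson_add) (auto intro!: continuous_on_sum simp: poisson_sum poisson_cmult)
  also have "(\<Sum>a\<in>Z. zero_mult f a * poisson R (\<lambda>w. ln (norm (w - a))) z) =
     (\<Sum>a\<in>Z. zero_mult f a * ln (norm (z - a)) + (if norm a < R then zero_mult f a * green R z a else 0))"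
  proof (rule sum.cong[OF refl])
    fix a assume a: "a \<in> Z"
    show "zero_mult f a * poisson R (\<lambda>w. ln (norm (w - a))) z =
      zero_mult f a * ln (norm (z - a)) + (if norm a < R then zero_mult f a * green R z a else 0)"
      using poisson_ln_norm_diff[OF aR(1)[OF a] z(1) aR(2)[OF a, symmetric]] by (auto simp: algebra_simps)
  qed
  also have "\<dots> = (\<Sum>a\<in>Z. zero_mult f a * ln (norm (z - a))) + (\<Sum>a\<in>{a\<in>Z. norm a < R}. zero_mult f a * green R z a)"
    using fZ by (simp add: sum.distrib sum.If_cases Int_def)
  also have "{a\<in>Z. norm a < R} = zeros_in f R"
    unfolding Z_def zeros_in_def using nz by (auto simp: less_le)
  finally show ?thesis using lf[of z] z by simp
qed

section \<open>Counting functions as logarithmic sums, and Jensen's formula\<close>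

lemma int_count_eq:
  assumes r: "r > 0" and fin: "finite {z \<in> cball 0 r. \<mu> z \<noteq> 0}"
  shows "int_count \<mu> r = \<mu> 0 * ln r + (\<Sum>a\<in>{z \<in> cball 0 r. \<mu> z \<noteq> 0} - {0}. \<mu> a * ln (r / norm a))"
proof -
  define S where "S = {z \<in> cball 0 r. \<mu> z \<noteq> 0} - {0}"
  have fS: "finite S" using fin unfolding S_def by simp
  have n0: "unint_count \<mu> 0 = \<mu> 0"
  proof -
    have "{z \<in> cball 0 0. \<mu> z \<noteq> 0} = (if \<mu> 0 = 0 then {} else {0})" by auto
    thus ?thesis unfolding unint_count_def by auto
  qed
  have nt: "real (unint_count \<mu> t) - real (unint_count \<mu> 0) = (\<Sum>a\<in>S. if norm a \<le> t then real (\<mu> a) else 0)"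
    if t: "0 \<le> t" "t \<le> r" for t
  proof -
    have fin': "finite {z \<in> cball 0 t. \<mu> z \<noteq> 0}" by (rule finite_subset[OF _ fin]) (use t in auto)
    have "unint_count \<mu> t = \<mu> 0 + (\<Sum>a\<in>{z \<in> cball 0 t. \<mu> z \<noteq> 0} - {0}. \<mu> a)"
    proof (cases "\<mu> 0 = 0")
      case True
      hence "{z \<in> cball 0 t. \<mu> z \<noteq> 0} - {0} = {z \<in> cball 0 t. \<mu> z \<noteq> 0}" by auto
      thus ?thesis using True unfolding unint_count_def by simp
    next
      case False
      thus ?thesis unfolding unint_count_def by (subst sum.remove[OF fin', of 0]) (use t in auto)
    qed
    also have "{z \<in> cball 0 t. \<mu> z \<noteq> 0} - {0} = {a\<in>S. norm a \<le> t}" unfolding S_def using t by auto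
    finally show ?thesis unfolding n0 using fS by (simp add: sum.If_cases Int_def)
  qed
  have hi: "((\<lambda>t. (if norm a \<le> t then real (\<mu> a) else 0) / t) has_integral \<mu> a * ln (r / norm a)) {0..r}"
    if a: "a \<in> S" for a
  proof -
    have a0: "norm a > 0" "norm a \<le> r" using a unfolding S_def by auto
    have "((\<lambda>t. real (\<mu> a) / t) has_integral (\<mu> a * ln r - \<mu> a * ln (norm a))) {norm a..r}"
      by (intro fundamental_theorem_of_calculus)
         (use a0 in \<open>auto intro!: derivative_eq_intros simp del: zero_less_norm_iff simp flip: has_real_derivative_iff_has_vector_derivative\<close>)
    hence "((\<lambda>t. if t \<in> {norm a..r} then real (\<mu> a) / t else 0) has_integral (\<mu> a * ln r - \<mu> a * ln (norm a))) {0..r}"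
      by (subst has_integral_restrict) auto
    moreover have "\<mu> a * ln r - \<mu> a * ln (norm a) = \<mu> a * ln (r / norm a)"
      using a0 r by (simp add: ln_div algebra_simps)
    ultimately have "((\<lambda>t. if t \<in> {norm a..r} then real (\<mu> a) / t else 0) has_integral \<mu> a * ln (r / norm a)) {0..r}"
      by simp
    thus ?thesis by (rule has_integral_eq[rotated]) auto
  qed
  have "((\<lambda>t. \<Sum>a\<in>S. (if norm a \<le> t then real (\<mu> a) else 0) / t) has_integral (\<Sum>a\<in>S. \<mu> a * ln (r / norm a))) {0..r}"
    using fS hi by (intro has_integral_sum)
  hence "((\<lambda>t. (real (unint_count \<mu> t) - real (unint_count \<mu> 0)) / t) has_integral (\<Sum>a\<in>S. \<mu> a * ln (r / norm a))) {0..r}"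
    by (rule has_integral_eq[rotated]) (simp add: nt sum_divide_distrib)
  thus ?thesis unfolding int_count_def n0 S_def[symmetric] by (simp add: integral_unique)
qed

lemma zero_mult_support:
  assumes "f holomorphic_on UNIV" "\<exists>w. f w \<noteq> 0"
  shows "{z \<in> cball 0 r. zero_mult f z \<noteq> 0} = zeros_in f r"
  unfolding zeros_in_def using zero_mult_pos_iff[OF assms] by auto

lemma int_count_zeros:
  assumes "f holomorphic_on UNIV" "\<exists>w. f w \<noteq> 0" "r > 0"
  shows "int_count (zero_mult f) r = zero_mult f 0 * ln r + (\<Sum>a\<in>zeros_in f r - {0}. zero_mult f a * ln (r / norm a))"
  using int_count_eq[OF assms(3), of "zero_mult f"] finite_zeros_in[OF assms(1,2)] zero_mult_support[OF assms(1,2)] by simp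

text \<open>Poisson-Jensen at the origin, where the kernel is 1, after a power of z has been split
  off. K is the logarithm of the modulus of the first nonzero Taylor coefficient; that it does not
  depend on R lets means of log |f| and counting functions be exchanged up to a constant.\<close>

theorem jensen:
  assumes f: "f holomorphic_on UNIV" "\<exists>w. f w \<noteq> 0"
  obtains K where "\<And>R. R > 0 \<Longrightarrow> (\<And>w. norm w = R \<Longrightarrow> f w \<noteq> 0) \<Longrightarrow>
    circle_mean (\<lambda>w. ln (norm (f w))) R = K + int_count (zero_mult f) R"
proof -
  obtain k where k: "k holomorphic_on UNIV" "\<And>w. f w = w ^ zero_mult f 0 * k w" "k 0 \<noteq> 0"
    using entire_factor_at[OF f, of 0] by auto
  have k0: "\<exists>w. k w \<noteq> 0" using k(3) by blast
  have mk: "zero_mult f a = zero_mult k a" if "a \<noteq> 0" for a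
    by (rule zero_mult_factor[OF k(1) k0 _ _ k(2)]) (use that in \<open>auto intro!: holomorphic_intros\<close>)
  have zk: "zeros_in k R = zeros_in f R - {0}" for R
    unfolding zeros_in_def using k(2,3) by auto
  show ?thesis
  proof (rule that[of "ln (norm (k 0))"])
    fix R :: real assume R: "R > 0" and nz: "\<And>w. norm w = R \<Longrightarrow> f w \<noteq> 0"
    have nk: "k w \<noteq> 0" if "norm w = R" for w using nz[OF that] k(2)[of w] by auto
    have g: "green R 0 a = ln (R / norm a)" if "a \<noteq> 0" for a
      using R unfolding green_def by (simp add: power2_eq_square norm_mult)
    have "ln (norm (k 0)) = circle_mean (\<lambda>w. ln (norm (k w))) R - (\<Sum>a\<in>zeros_in f R - {0}. zero_mult f a * ln (R / norm a))"
      using poisson_jensen[OF k(1) nk, where z=0] R k(3)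
      by (simp add: poisson_0 zk mk g)
    moreover have "circle_mean (\<lambda>w. ln (norm (f w))) R = zero_mult f 0 * ln R + circle_mean (\<lambda>w. ln (norm (k w))) R"
    proof -
      have "circle_mean (\<lambda>w. ln (norm (f w))) R = circle_mean (\<lambda>w. zero_mult f 0 * ln R + ln (norm (k w))) R"
      proof (rule circle_mean_cong)
        fix w :: complex assume w: "norm w = R"
        show "ln (norm (f w)) = zero_mult f 0 * ln R + ln (norm (k w))"
          unfolding k(2)[of w] using nk[OF w] w R by (simp add: norm_mult norm_power ln_mult_pos ln_realpow)
      qed (use R in simp)
      also have "\<dots> = zero_mult f 0 * ln R + circle_mean (\<lambda>w. ln (norm (k w))) R"
        using R nk by (subst circle_mean_add) (auto intro!: continuous_on_ln_norm k(1))
      finally show ?thesis .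
    qed
    ultimately show "circle_mean (\<lambda>w. ln (norm (f w))) R = ln (norm (k 0)) + int_count (zero_mult f) R"
      unfolding int_count_zeros[OF f R] by simp
  qed
qed

text \<open>A point of modulus at most r weighs ln (s / r) more at radius s than at radius r. This
  turns a bound for the integrated count at s into one for the number of points up to r.\<close>

lemma int_count_mono_radius:
  assumes fin: "finite {z \<in> cball 0 s. \<mu> z \<noteq> 0}" and r: "0 < r" "r \<le> s"
  shows "int_count \<mu> r + (\<Sum>a\<in>{z \<in> cball 0 r. \<mu> z \<noteq> 0}. \<mu> a) * ln (s / r) \<le> int_count \<mu> s"
proof -
  let ?S = "\<lambda>t. {z \<in> cball 0 t. \<mu> z \<noteq> 0}"
  have sub: "?S r \<subseteq> ?S s" using r by auto
  have fr: "finite (?S r)" by (rule finite_subset[OF sub fin])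
  have sp: "s > 0" using r by simp
  have ls: "ln (s / r) \<ge> 0" using r by simp
  have "(\<Sum>a\<in>?S r - {0}. \<mu> a * ln (r / norm a)) + (\<Sum>a\<in>?S r - {0}. real (\<mu> a)) * ln (s / r)
      = (\<Sum>a\<in>?S r - {0}. \<mu> a * ln (s / norm a))"
    unfolding sum_distrib_right sum.distrib[symmetric]
    by (rule sum.cong) (use r sp in \<open>auto simp: ln_div algebra_simps\<close>)
  also have "\<dots> \<le> (\<Sum>a\<in>?S s - {0}. \<mu> a * ln (s / norm a))"
    by (rule sum_mono2) (use fin sub in auto)
  finally have 1: "(\<Sum>a\<in>?S r - {0}. \<mu> a * ln (r / norm a)) + (\<Sum>a\<in>?S r - {0}. real (\<mu> a)) * ln (s / r)
     \<le> (\<Sum>a\<in>?S s - {0}. \<mu> a * ln (s / norm a))" .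
  have 2: "real (\<Sum>a\<in>?S r. \<mu> a) = \<mu> 0 + (\<Sum>a\<in>?S r - {0}. real (\<mu> a))"
  proof (cases "\<mu> 0 = 0")
    case True
    hence "?S r - {0} = ?S r" by auto
    thus ?thesis using True by simp
  next
    case False
    thus ?thesis using r by (subst sum.remove[OF fr, of 0]) auto
  qed
  have 3: "\<mu> 0 * ln r + \<mu> 0 * ln (s / r) = \<mu> 0 * ln s" using r sp by (simp add: ln_div algebra_simps)
  have 4: "(\<Sum>a\<in>?S r. real (\<mu> a)) * ln (s / r) = \<mu> 0 * ln (s / r) + (\<Sum>a\<in>?S r - {0}. real (\<mu> a)) * ln (s / r)"
    unfolding 2[unfolded of_nat_sum] by (rule distrib_right)
  have "m1 + X + Z \<le> m3 + Y" if "X + B \<le> Y" "m1 + m2 = m3" "Z = m2 + B" for m1 m2 m3 X Y Z B :: real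
    using that by linarith
  from this[OF 1 3 4] show ?thesis
    unfolding int_count_eq[OF r(1) fr] int_count_eq[OF sp fin] .
qed

lemma int_count_nonneg:
  assumes "finite {z \<in> cball 0 r. \<mu> z \<noteq> 0}" "r \<ge> 1"
  shows "int_count \<mu> r \<ge> 0"
proof -
  have r: "r > 0" using assms by simp
  show ?thesis unfolding int_count_eq[OF r assms(1)]
    by (intro add_nonneg_nonneg sum_nonneg mult_nonneg_nonneg) (use assms(2) in auto)
qed

section \<open>Logarithmic differences\<close>

text \<open>The right-hand side is a third of the distance to the nearest multiple of pi. For 0
  \<le> y \<le> pi/3 the function sin y - y/2 increases from 0; for pi/3 \<le> y \<le> pi/2, sin y
  \<ge> sin (pi/3) \<ge> pi/6 \<ge> y/3.\<close>

lemma abs_sin_ge: "\<bar>sin x\<bar> \<ge> \<bar>x - of_int (round (x / pi)) * pi\<bar> / 3"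
proof -
  have small: "y / 3 \<le> sin y" if y: "0 \<le> y" "y \<le> pi / 2" for y :: real
  proof -
    have half: "y / 2 \<le> sin y" if y: "0 \<le> y" "y \<le> pi / 3" for y :: real
    proof -
      have "(\<lambda>y. sin y - y / 2) 0 \<le> (\<lambda>y. sin y - y / 2) y"
      proof (rule DERIV_nonneg_imp_nondecreasing[OF y(1)])
        fix x assume x: "0 \<le> x" "x \<le> y"
        have "((\<lambda>y. sin y - y / 2) has_real_derivative cos x - 1/2) (at x)"
          by (auto intro!: derivative_eq_intros)
        moreover have "cos x \<ge> cos (pi / 3)" using x y by (intro cos_monotone_0_pi_le) auto
        hence "cos x - 1/2 \<ge> 0" by (simp add: cos_60)
        ultimately show "\<exists>d. ((\<lambda>y. sin y - y / 2) has_real_derivative d) (at x) \<and> 0 \<le> d" by blast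
      qed
      thus ?thesis by simp
    qed
    show ?thesis
    proof (cases "y \<le> pi / 3")
      case True
      thus ?thesis using half[OF y(1)] y by simp
    next
      case False
      have "sin (pi/3) \<le> sin y" using False y by (intro sin_monotone_2pi_le) auto
      moreover have "pi/3/2 \<le> sin (pi/3)" by (rule half) auto
      ultimately show ?thesis using y by simp
    qed
  qed
  define k where "k = round (x / pi)"
  define y where "y = x - of_int k * pi"
  have "\<bar>of_int k - x / pi\<bar> \<le> 1/2" unfolding k_def by (rule of_int_round_abs_le)
  hence "\<bar>of_int k - x / pi\<bar> * pi \<le> 1/2 * pi" by (intro mult_right_mono) auto
  also have "\<bar>of_int k - x / pi\<bar> * pi = \<bar>(of_int k - x / pi) * pi\<bar>" by (simp add: abs_mult)
  also have "(of_int k - x / pi) * pi = - y" unfolding y_def by (simp add: field_simps)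
  finally have y: "\<bar>y\<bar> \<le> pi / 2" by simp
  have s0: "sin (of_int k * pi) = 0" by (simp add: sin_zero_iff_int2)
  hence "\<bar>cos (of_int k * pi)\<bar> = 1"
    by (metis abs_1 abs_one cos_one_sin_zero power2_eq_1_iff abs_minus_cancel sin_zero_abs_cos_one)
  moreover have "sin x = sin y * cos (of_int k * pi)"
    using sin_add[of y "of_int k * pi"] s0 unfolding y_def by simp
  ultimately have "\<bar>sin x\<bar> = \<bar>sin y\<bar>" by (simp add: abs_mult)
  also have "\<dots> \<ge> \<bar>y\<bar> / 3"
  proof (cases "y \<ge> 0")
    case True thus ?thesis using small[of y] y by simp
  next
    case False thus ?thesis using small[of "-y"] y by simp
  qed
  finally show ?thesis unfolding y_def k_def .
qed

text \<open>The lower bound is the distance from the point of the circle to a line through 0 and a.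
  It does not involve |a|, which makes the estimates below uniform in a.\<close>

lemma norm_circle_diff_ge:
  assumes "r \<ge> 0"
  shows "norm (of_real r * cis t - a) \<ge> r * \<bar>sin (t - Arg a)\<bar>"
proof -
  define \<rho> \<alpha> where "\<rho> = norm a" and "\<alpha> = Arg a"
  have a: "a = of_real \<rho> * cis \<alpha>" using rcis_cmod_Arg[of a] unfolding \<rho>_def \<alpha>_def by (simp add: rcis_def)
  have "(of_real r * cis t - of_real \<rho> * cis \<alpha>) * cis (- \<alpha>) = of_real r * cis (t - \<alpha>) - of_real \<rho>"
    by (simp add: left_diff_distrib mult.assoc cis_mult)
  hence "(of_real r * cis t - a) * cis (- Arg a) = of_real r * cis (t - Arg a) - of_real (norm a)"
    unfolding a[symmetric] unfolding \<rho>_def \<alpha>_def .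
  hence "norm (of_real r * cis t - a) = norm (of_real r * cis (t - Arg a) - of_real (norm a))"
    by (metis norm_mult norm_cis mult.right_neutral)
  also have "\<dots> \<ge> \<bar>Im (of_real r * cis (t - Arg a) - of_real (norm a))\<bar>" by (rule abs_Im_le_cmod)
  finally show ?thesis using assms by (simp add: abs_mult)
qed

text \<open>A singularity |z - a|^(-\<delta>) with \<delta> < 1 has a mean of order r^(-\<delta>) on
  |z| = r, uniformly in a, also for a on the circle. Stating it through a majorant separates the
  estimate from the integrability of the singular function.\<close>

lemma circle_powr_majorant:
  fixes \<delta> :: real
  assumes \<delta>: "0 < \<delta>" "\<delta> < 1"
  obtains K where "K > 0" "\<And>r (a::complex). r > 0 \<Longrightarrow> \<exists>\<phi> I. (\<phi> has_integral I) {0..2*pi} \<and> I \<le> K * r powr (-\<delta>) \<and>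
    (\<forall>t\<in>{0..2*pi}. norm (of_real r * cis t - a) powr (-\<delta>) \<le> \<phi> t)"
proof -
  define J where "J = (4*pi) powr (-\<delta>+1) / (-\<delta>+1)"
  have J: "((\<lambda>x. x powr (-\<delta>)) has_integral J) {0..4*pi}"
    unfolding J_def by (rule has_integral_powr_from_0) (use \<delta> in auto)
  have "((\<lambda>x. \<bar>x\<bar> powr (-\<delta>)) has_integral J) {0..4*pi}" by (rule has_integral_eq[OF _ J]) simp
  moreover from this have "((\<lambda>x. \<bar>-x\<bar> powr (-\<delta>)) has_integral J) {-(4*pi)..-0}"
    by (subst has_integral_reflect_real)
  ultimately have J2: "((\<lambda>x. \<bar>x\<bar> powr (-\<delta>)) has_integral (J + J)) {-(4*pi)..4*pi}"
    by (intro has_integral_combine[of _ 0]) auto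
  have J0: "J > 0" unfolding J_def using \<delta> by simp
  have shifted: "(\<lambda>x. \<bar>x - b\<bar> powr (-\<delta>)) integrable_on {0..2*pi} \<and> integral {0..2*pi} (\<lambda>x. \<bar>x - b\<bar> powr (-\<delta>)) \<le> 2 * J"
    if b: "-2*pi \<le> b" "b \<le> 4*pi" for b
  proof -
    have hi: "((\<lambda>x. \<bar>x + (-b)\<bar> powr (-\<delta>)) has_integral (J + J)) {-(4*pi) - (-b)..4*pi - (-b)}"
      by (rule has_integral_shift_real_ivl[OF J2])
    have sub: "{0..2*pi} \<subseteq> {-(4*pi) - (-b)..4*pi - (-b)}" using b by auto
    have i1: "(\<lambda>x. \<bar>x - b\<bar> powr (-\<delta>)) integrable_on {-(4*pi) - (-b)..4*pi - (-b)}"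
      using hi by (auto simp: integrable_on_def)
    hence i2: "(\<lambda>x. \<bar>x - b\<bar> powr (-\<delta>)) integrable_on {0..2*pi}"
      by (rule integrable_on_subinterval[OF _ sub])
    have "integral {0..2*pi} (\<lambda>x. \<bar>x - b\<bar> powr (-\<delta>)) \<le> integral {-(4*pi) - (-b)..4*pi - (-b)} (\<lambda>x. \<bar>x - b\<bar> powr (-\<delta>))"
      by (rule integral_subset_le[OF sub i2 i1]) simp
    also have "\<dots> = 2 * J" using integral_unique[OF hi] by simp
    finally show ?thesis using i2 by simp
  qed
  define K where "K = 3 powr \<delta> * (5 * (2 * J))"
  show ?thesis
  proof (rule that[of K])
    show "K > 0" unfolding K_def using J0 by simp
    fix r :: real and a :: complex
    assume r: "r > 0"
    \<comment> \<open>As -pi < Arg a \<le> pi, the quotient (t - Arg a) / pi lies in [-1, 3) for t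
      in [0, 2 pi], so the nearest multiple of pi has an index from -1 to 3.\<close>
    define S where "S t = (\<Sum>k\<in>{-1..3::int}. \<bar>t - (Arg a + of_int k * pi)\<bar> powr (-\<delta>))" for t
    define N where "N t = norm (of_real r * cis t - a) powr (-\<delta>)" for t
    define bad where "bad = (\<lambda>k. Arg a + of_int k * pi) ` {-1..3::int}"
    \<comment> \<open>At a point of \<open>bad\<close> one summand of S is a negative power of 0,
      which has the value 0 instead of being infinite. There \<phi> takes the value to be majorized;
      finitely many points do not change the integral.\<close>
    define \<phi> where "\<phi> t = (if t \<in> bad then N t else (r/3) powr (-\<delta>) * S t)" for t
    have bk: "-2*pi \<le> Arg a + of_int k * pi \<and> Arg a + of_int k * pi \<le> 4*pi" if "k \<in> {-1..3}" for k :: int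
    proof -
      have "(-1) * pi \<le> of_int k * pi" "of_int k * pi \<le> 3 * pi"
        using that by (intro mult_right_mono; simp)+
      thus ?thesis using Arg_bounded[of a] by linarith
    qed
    have Si: "S integrable_on {0..2*pi}" unfolding S_def
      by (intro integrable_sum) (use shifted bk in auto)
    have SI: "integral {0..2*pi} S \<le> 5 * (2 * J)"
    proof -
      have "integral {0..2*pi} S = (\<Sum>k\<in>{-1..3::int}. integral {0..2*pi} (\<lambda>t. \<bar>t - (Arg a + of_int k * pi)\<bar> powr (-\<delta>)))"
        unfolding S_def by (intro integral_sum) (use shifted bk in auto)
      also have "\<dots> \<le> (\<Sum>k\<in>{-1..3::int}. 2 * J)" by (intro sum_mono) (use shifted bk in auto)
      finally show ?thesis by simp
    qed
    have "((\<lambda>t. (r/3) powr (-\<delta>) * S t) has_integral (r/3) powr (-\<delta>) * integral {0..2*pi} S) {0..2*pi}"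
      by (intro has_integral_mult_right integrable_integral Si)
    hence hi: "(\<phi> has_integral (r/3) powr (-\<delta>) * integral {0..2*pi} S) {0..2*pi}"
      by (rule has_integral_spike_finite[rotated 2, where S=bad]) (auto simp: bad_def \<phi>_def)
    have "(r/3) powr (-\<delta>) * integral {0..2*pi} S \<le> (r/3) powr (-\<delta>) * (5 * (2 * J))"
      by (intro mult_left_mono SI) simp
    also have "\<dots> = K * r powr (-\<delta>)" unfolding K_def using r
      by (simp add: powr_divide powr_minus divide_simps)
    finally have le: "(r/3) powr (-\<delta>) * integral {0..2*pi} S \<le> K * r powr (-\<delta>)" .
    have bd: "N t \<le> \<phi> t" if t: "t \<in> {0..2*pi}" for t
    proof (cases "t \<in> bad")
      case True
      thus ?thesis unfolding \<phi>_def by simp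
    next
      case False
      define k where "k = round ((t - Arg a) / pi)"
      define y where "y = t - (Arg a + of_int k * pi)"
      have k: "k \<in> {-1..3}"
      proof -
        have "(t - Arg a) / pi \<ge> -1" "(t - Arg a) / pi < 3"
          using t Arg_bounded[of a] by (simp_all add: divide_simps)
        hence "(t - Arg a) / pi + 1/2 \<ge> -1" "(t - Arg a) / pi + 1/2 < 4" by simp_all
        thus ?thesis unfolding k_def round_def by (auto simp: le_floor_iff floor_le_iff)
      qed
      hence y0: "\<bar>y\<bar> > 0" using False unfolding bad_def y_def by auto
      have "r * (\<bar>y\<bar> / 3) \<le> r * \<bar>sin (t - Arg a)\<bar>"
        using abs_sin_ge[of "t - Arg a"] r unfolding y_def k_def by (intro mult_left_mono) (auto simp: algebra_simps)
      also have "\<dots> \<le> norm (of_real r * cis t - a)" using r by (intro norm_circle_diff_ge) simp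
      finally have ge: "r / 3 * \<bar>y\<bar> \<le> norm (of_real r * cis t - a)" by simp
      have "N t \<le> (r / 3 * \<bar>y\<bar>) powr (-\<delta>)"
        unfolding N_def by (rule powr_mono2') (use \<delta> r y0 ge in auto)
      also have "\<dots> = (r/3) powr (-\<delta>) * \<bar>y\<bar> powr (-\<delta>)" using r y0 by (intro powr_mult)
      also have "\<bar>y\<bar> powr (-\<delta>) \<le> S t" unfolding S_def y_def
        by (rule member_le_sum[OF k, of "\<lambda>k. \<bar>t - (Arg a + of_int k * pi)\<bar> powr (-\<delta>)"]) auto
      finally show ?thesis using False unfolding \<phi>_def by (simp add: mult_left_mono)
    qed
    show "\<exists>\<phi> I. (\<phi> has_integral I) {0..2*pi} \<and> I \<le> K * r powr (-\<delta>) \<and>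
        (\<forall>t\<in>{0..2*pi}. norm (of_real r * cis t - a) powr (-\<delta>) \<le> \<phi> t)"
      using hi le bd unfolding N_def by blast
  qed
qed

lemma ln_one_plus_le_powr:
  fixes x \<delta> :: real
  assumes "0 < \<delta>" "\<delta> < 1" "x > 0"
  shows "ln (1 + x) \<le> (1 + 1 / \<delta>) * x powr \<delta>"
proof (cases "x \<le> 1")
  case True
  have "ln (1 + x) \<le> x" using assms by (intro ln_add_one_self_le_self) simp
  also have "x = x powr 1" using assms by simp
  also have "x powr 1 \<le> x powr \<delta>" using assms True by (intro powr_mono') auto
  also have "\<dots> \<le> (1 + 1 / \<delta>) * x powr \<delta>" using assms by (simp add: field_simps)
  finally show ?thesis .
next
  case False
  have "ln (1 + x) \<le> ln (2 * x)" using False by simp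
  also have "\<dots> = ln 2 + ln x" using False by (simp add: ln_mult)
  also have "ln 2 \<le> (1::real)" using ln_2_less_1 by simp
  also have "1 \<le> x powr \<delta>" using False assms by (intro ge_one_powr_ge_zero) auto
  also have "ln x \<le> x powr \<delta> / \<delta>" using False assms by (intro ln_powr_bound) auto
  finally show ?thesis by (simp add: field_simps)
qed

text \<open>Replacing ln (1 + x) by a multiple of x^\<delta> loses the logarithm but gains the decay
  r^(-\<delta>) of \<open>circle_powr_majorant\<close>, uniformly in the position of a.\<close>

lemma circle_mean_ln_one_plus_le:
  fixes \<delta> s :: real
  assumes \<delta>: "0 < \<delta>" "\<delta> < 1" and s: "s \<ge> 0"
  obtains K where "K > 0" "\<And>r a. r > 0 \<Longrightarrow> norm a \<noteq> r \<Longrightarrow>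
    circle_mean (\<lambda>z. ln (1 + s / norm (z - a))) r \<le> K * r powr (-\<delta>)"
proof -
  obtain K where K: "K > 0" "\<And>r (a::complex). r > 0 \<Longrightarrow> \<exists>\<phi> I. (\<phi> has_integral I) {0..2*pi} \<and> I \<le> K * r powr (-\<delta>) \<and>
    (\<forall>t\<in>{0..2*pi}. norm (of_real r * cis t - a) powr (-\<delta>) \<le> \<phi> t)"
    using circle_powr_majorant[OF \<delta>] by blast
  define C where "C = (1 + 1 / \<delta>) * s powr \<delta>"
  have C: "C \<ge> 0" unfolding C_def using \<delta> by simp
  show ?thesis
  proof (rule that[of "C * K / (2 * pi) + 1"])
    show "C * K / (2 * pi) + 1 > 0" using C K(1) by (intro add_nonneg_pos) auto
    fix r and a :: complex assume r: "r > 0" and a: "norm a \<noteq> r"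
    obtain \<phi> I where \<phi>: "(\<phi> has_integral I) {0..2*pi}" "I \<le> K * r powr (-\<delta>)"
      "\<And>t. t \<in> {0..2*pi} \<Longrightarrow> norm (of_real r * cis t - a) powr (-\<delta>) \<le> \<phi> t" using K(2)[OF r] by blast
    have ne: "z \<noteq> a" if "norm z = r" for z using that a by auto
    have "continuous_on (sphere 0 r) (\<lambda>z. ln (1 + s / norm (z - a)))"
    proof (intro continuous_intros ballI)
      fix z :: complex assume "z \<in> sphere 0 r"
      thus "norm (z - a) \<noteq> 0" using ne by auto
      have "s / norm (z - a) \<ge> 0" using s by simp
      thus "1 + s / norm (z - a) \<noteq> 0" by linarith
    qed
    hence i: "(\<lambda>t. ln (1 + s / norm (of_real r * cis t - a))) integrable_on {0..2*pi}"
      by (rule integrable_on_circle) (use r in simp)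
    have "integral {0..2*pi} (\<lambda>t. ln (1 + s / norm (of_real r * cis t - a))) \<le> C * I"
    proof (rule has_integral_le[OF integrable_integral[OF i] has_integral_mult_right[OF \<phi>(1), of C]])
      fix t assume t: "t \<in> {0..2*pi}"
      have pos: "norm (of_real r * cis t - a) > 0" using ne[of "of_real r * cis t"] r by (simp add: norm_mult)
      show "ln (1 + s / norm (of_real r * cis t - a)) \<le> C * \<phi> t"
      proof (cases "s = 0")
        case True
        thus ?thesis unfolding C_def by simp
      next
        case False
        hence "ln (1 + s / norm (of_real r * cis t - a)) \<le> (1 + 1 / \<delta>) * (s / norm (of_real r * cis t - a)) powr \<delta>"
          using s pos by (intro ln_one_plus_le_powr \<delta>) auto
        also have "\<dots> = C * norm (of_real r * cis t - a) powr (-\<delta>)"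
          unfolding C_def using s by (simp add: powr_divide powr_minus divide_simps)
        also have "\<dots> \<le> C * \<phi> t" using \<phi>(3)[OF t] C by (rule mult_left_mono)
        finally show ?thesis .
      qed
    qed
    also have "\<dots> \<le> C * (K * r powr (-\<delta>))" using \<phi>(2) C by (rule mult_left_mono)
    finally have "circle_mean (\<lambda>z. ln (1 + s / norm (z - a))) r \<le> C * (K * r powr (-\<delta>)) / (2 * pi)"
      unfolding circle_mean_def by (rule divide_right_mono) simp
    also have "\<dots> \<le> (C * K / (2 * pi) + 1) * r powr (-\<delta>)" by (simp add: algebra_simps)
    finally show "circle_mean (\<lambda>z. ln (1 + s / norm (z - a))) r \<le> (C * K / (2 * pi) + 1) * r powr (-\<delta>)" .
  qed
qed

section \<open>A difference analogue of the lemma on the logarithmic derivative\<close>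

lemma continuous_on_poisson:
  assumes r: "0 \<le> r" "r < R" and u: "continuous_on (sphere 0 R) u"
  shows "continuous_on (cball 0 r) (poisson R u)"
proof -
  have "continuous_on (cball 0 r \<times> cbox 0 (2*pi)) (\<lambda>(z,t). poisson_kernel R z (of_real R * cis t) * u (of_real R * cis t))"
  proof -
    have "of_real R * cis (snd x) - fst x \<noteq> 0" if "x \<in> cball 0 r \<times> cbox 0 (2*pi)" for x :: "complex \<times> real"
    proof
      assume "of_real R * cis (snd x) - fst x = 0"
      hence "norm (of_real R * cis (snd x)) = norm (fst x)" by simp
      thus False using r that by (auto simp: norm_mult)
    qed
    moreover have "continuous_on (cball 0 r \<times> cbox 0 (2*pi)) (\<lambda>x::complex\<times>real. u (of_real R * cis (snd x)))"
      by (rule continuous_on_compose2[OF u]) (use r in \<open>auto intro!: continuous_intros simp: norm_mult\<close>)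
    ultimately show ?thesis unfolding poisson_kernel_def case_prod_unfold
      by (auto intro!: continuous_intros)
  qed
  from integral_continuous_on_param[OF this] show ?thesis
    unfolding poisson_def circle_mean_def by (auto intro!: continuous_intros simp: cbox_interval)
qed

definition zeros_number :: "(complex \<Rightarrow> complex) \<Rightarrow> real \<Rightarrow> real" where
  "zeros_number f R = (\<Sum>a\<in>zeros_in f R. real (zero_mult f a))"

lemma abs_ln_diff_le:
  fixes X Y :: real
  assumes "X > 0" "Y > 0" "\<bar>X - Y\<bar> \<le> s"
  shows "\<bar>ln X - ln Y\<bar> \<le> ln (1 + s / Y) + ln (1 + s / X)"
proof -
  have *: "ln X - ln Y \<le> ln (1 + s / Y)" if "X > 0" "Y > 0" "\<bar>X - Y\<bar> \<le> s" for X Y :: real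
  proof -
    have "ln X - ln Y = ln (X / Y)" using that by (simp add: ln_div)
    also have "X / Y \<le> 1 + s / Y" using that by (simp add: field_simps abs_le_iff)
    hence "ln (X / Y) \<le> ln (1 + s / Y)" using that by (intro ln_mono) auto
    finally show ?thesis .
  qed
  have s: "s \<ge> 0" using assms by linarith
  have "ln (1 + s / Y) \<ge> 0" "ln (1 + s / X) \<ge> 0" using assms s by simp_all
  moreover have "ln Y - ln X \<le> ln (1 + s / X)" using *[of Y X] assms by (simp add: abs_minus_commute)
  ultimately show ?thesis using *[OF assms] by linarith
qed

text \<open>Poisson-Jensen for log |A / B| at z and at z + c. The Poisson parts differ by a relative
  error of order |c| / (R - r); each zero contributes logarithms of the distances to it and to its
  reflection, and their changes under the shift have means O(r^(-\<delta>)). A and B stay separate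
  entire functions and may have common zeros.\<close>

theorem log_difference_mean_le:
  fixes c :: complex and \<delta> :: real
  assumes \<delta>: "0 < \<delta>" "\<delta> < 1"
  obtains K where "K > 0"
   "\<And>A B r R. A holomorphic_on UNIV \<Longrightarrow> B holomorphic_on UNIV \<Longrightarrow> 0 < r \<Longrightarrow> r < R \<Longrightarrow> 2 * norm c \<le> R - r \<Longrightarrow>
     (\<And>z. norm z = r \<Longrightarrow> A z \<noteq> 0 \<and> B z \<noteq> 0 \<and> A (z + c) \<noteq> 0 \<and> B (z + c) \<noteq> 0) \<Longrightarrow>
     (\<And>z. norm z = R \<Longrightarrow> A z \<noteq> 0 \<and> B z \<noteq> 0) \<Longrightarrow>
     circle_mean (\<lambda>z. \<bar>(ln (norm (A (z + c))) - ln (norm (B (z + c)))) - (ln (norm (A z)) - ln (norm (B z)))\<bar>) r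
      \<le> 16 * (norm c / (R - r)) * circle_mean (\<lambda>w. \<bar>ln (norm (A w)) - ln (norm (B w))\<bar>) R
         + K * r powr (-\<delta>) * (zeros_number A R + zeros_number B R)"
proof -
  obtain K where K: "K > 0" "\<And>r a. r > 0 \<Longrightarrow> norm a \<noteq> r \<Longrightarrow>
    circle_mean (\<lambda>z. ln (1 + norm c / norm (z - a))) r \<le> K * r powr (-\<delta>)"
    using circle_mean_ln_one_plus_le[OF \<delta>, of "norm c"] norm_ge_zero by blast
  show ?thesis
  proof (rule that[of "4 * K"])
    show "4 * K > 0" using K by simp
  next
    fix A B r R
    assume A: "A holomorphic_on UNIV" and B: "B holomorphic_on UNIV" and r: "0 < r" "r < R" and c: "2 * norm c \<le> R - r"
      and nzr: "\<And>z. norm z = r \<Longrightarrow> A z \<noteq> 0 \<and> B z \<noteq> 0 \<and> A (z + c) \<noteq> 0 \<and> B (z + c) \<noteq> 0"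
      and nzR: "\<And>z. norm z = R \<Longrightarrow> A z \<noteq> 0 \<and> B z \<noteq> 0"
    define u where "u w = ln (norm (A w)) - ln (norm (B w))" for w
    define l where "l a z = ln (1 + norm c / norm (z - a)) + ln (1 + norm c / norm (z - (a - c)))" for a z
    \<comment> \<open>The reflected point, where the numerator of Green's function vanishes. For a =
      0 that numerator is constant, and 2 R is a placeholder outside the disc to which the same
      estimates apply.\<close>
    define b where "b a = (if a = 0 then of_real (2 * R) else of_real (R\<^sup>2) / cnj a)" for a :: complex
    define e where "e a z = l a z + l (b a) z" for a z
    have nb: "norm (b a) > R" if "norm a < R" for a
    proof -
      have "norm (complex_of_real (R\<^sup>2)) = R * R" by (metis abs_power2 norm_of_real power2_eq_square)
      hence "norm (b a) = (if a = 0 then 2 * R else R * R / norm a)"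
        unfolding b_def using r by (cases "a = 0") (simp, simp only: norm_divide complex_mod_cnj if_False)
      thus ?thesis using that r by (auto simp: divide_simps)
    qed
    have rc: "r + norm c < R"
      using c r norm_ge_zero[of c] by linarith
    have bc: "norm (b a - c) > r" if "norm a < R" for a
      using nb[OF that] rc norm_triangle_ineq2[of "b a" c] by linarith
    have l_nonneg: "l a z \<ge> 0" for a z unfolding l_def by simp
    have lcont: "continuous_on (sphere 0 r) (l a)" and lmean: "circle_mean (l a) r \<le> 2 * K * r powr (-\<delta>)"
      if "norm a \<noteq> r" "norm (a - c) \<noteq> r" for a
    proof -
      have 1: "continuous_on (sphere 0 r) (\<lambda>z. ln (1 + norm c / norm (z - a)))" if "norm a \<noteq> r" for a :: complex
      proof (intro continuous_intros ballI)
        fix z :: complex assume "z \<in> sphere 0 r"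
        thus "norm (z - a) \<noteq> 0" using that by auto
        have "norm c / norm (z - a) \<ge> 0" by simp
        thus "1 + norm c / norm (z - a) \<noteq> 0" by linarith
      qed
      show "continuous_on (sphere 0 r) (l a)" unfolding l_def by (intro continuous_on_add 1 that)
      have "circle_mean (l a) r = circle_mean (\<lambda>z. ln (1 + norm c / norm (z - a))) r + circle_mean (\<lambda>z. ln (1 + norm c / norm (z - (a - c)))) r"
        unfolding l_def by (rule circle_mean_add) (use r 1 that in auto)
      also have "\<dots> \<le> K * r powr (-\<delta>) + K * r powr (-\<delta>)" by (intro add_mono K r that)
      finally show "circle_mean (l a) r \<le> 2 * K * r powr (-\<delta>)" by simp
    qed
    have aux: "norm a < R \<and> norm a \<noteq> r \<and> norm (a - c) \<noteq> r" if "a \<in> zeros_in A R \<or> a \<in> zeros_in B R" for a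
      using that nzr[of "a - c"] nzr[of a] nzR[of a] unfolding zeros_in_def by (auto simp: less_le)
    have econt: "continuous_on (sphere 0 r) (e a)" and emean: "circle_mean (e a) r \<le> 4 * K * r powr (-\<delta>)"
      if "a \<in> zeros_in A R \<or> a \<in> zeros_in B R" for a
    proof -
      note a = aux[OF that]
      have b: "norm (b a) \<noteq> r" "norm (b a - c) \<noteq> r" using nb[of a] bc[of a] a r by auto
      show "continuous_on (sphere 0 r) (e a)" unfolding e_def by (intro continuous_on_add lcont b) (use a in auto)
      have "circle_mean (e a) r = circle_mean (l a) r + circle_mean (l (b a)) r"
        unfolding e_def by (rule circle_mean_add) (use r b a in \<open>auto intro!: lcont\<close>)
      also have "\<dots> \<le> 2 * K * r powr (-\<delta>) + 2 * K * r powr (-\<delta>)" by (intro add_mono lmean b) (use a in auto)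
      finally show "circle_mean (e a) r \<le> 4 * K * r powr (-\<delta>)" by simp
    qed
    have le: "\<bar>ln (norm (z + c - a)) - ln (norm (z - a))\<bar> \<le> l a z" if "z + c \<noteq> a" "z \<noteq> a" for a z
    proof -
      have "\<bar>norm (z + c - a) - norm (z - a)\<bar> \<le> norm c" using norm_triangle_ineq3[of "z + c - a" "z - a"] by simp
      from abs_ln_diff_le[OF _ _ this] that show ?thesis unfolding l_def by (simp add: algebra_simps)
    qed
    have green: "\<bar>green R (z + c) a - green R z a\<bar> \<le> e a z"
      if z: "norm z = r" and a: "norm a < R" "z \<noteq> a" "z + c \<noteq> a" for z a
    proof -
      have ne: "b a \<noteq> z" "b a \<noteq> z + c" using nb[OF a(1)] z r bc[OF a(1)] by (auto simp: algebra_simps)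
      have g: "green R w a = ln (if a = 0 then R\<^sup>2 else norm a * norm (w - b a)) - ln R - ln (norm (w - a))"
        if "w \<noteq> a" "w \<noteq> b a" for w
      proof -
        have "norm (of_real (R\<^sup>2) - cnj a * w) = (if a = 0 then R\<^sup>2 else norm a * norm (w - b a))"
        proof (cases "a = 0")
          case False
          hence "of_real (R\<^sup>2) - cnj a * w = - (cnj a * (w - b a))" unfolding b_def by (simp add: field_simps)
          thus ?thesis using False by (simp only: norm_minus_cancel norm_mult complex_mod_cnj if_False)
        qed (simp add: norm_power)
        moreover have "(if a = 0 then R\<^sup>2 else norm a * norm (w - b a)) > 0" using that r by auto
        ultimately show ?thesis unfolding green_def using r that by (simp add: ln_div ln_mult_pos)
      qed
      have "\<bar>green R (z + c) a - green R z a\<bar> \<le> \<bar>ln (norm (z + c - a)) - ln (norm (z - a))\<bar>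
          + \<bar>ln (norm (z + c - b a)) - ln (norm (z - b a))\<bar>"
        using g[OF a(2) ne(1)[symmetric]] g[OF a(3) ne(2)[symmetric]] ne by (auto simp: ln_mult_pos)
      also have "\<dots> \<le> e a z" unfolding e_def using le[of z a] le[of z "b a"] ne a by (intro add_mono) auto
      finally show ?thesis .
    qed
    have A0: "\<exists>w. A w \<noteq> 0" "\<exists>w. B w \<noteq> 0"
      using nzr[of "of_real r"] r by auto
    note fin = finite_zeros_in[OF A A0(1)] finite_zeros_in[OF B A0(2)]
    have ucont: "continuous_on (sphere 0 R) u" unfolding u_def
      by (intro continuous_on_diff continuous_on_ln_norm A B) (use nzR in auto)
    have cA: "continuous_on (sphere 0 R) (\<lambda>w. ln (norm (A w)))" "continuous_on (sphere 0 R) (\<lambda>w. ln (norm (B w)))"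
      by (intro continuous_on_ln_norm A B; use nzR in auto)+
    have pj: "u w = poisson R u w - (\<Sum>a\<in>zeros_in A R. zero_mult A a * green R w a) + (\<Sum>a\<in>zeros_in B R. zero_mult B a * green R w a)"
      if "norm w < R" "A w \<noteq> 0" "B w \<noteq> 0" for w
      using poisson_jensen[OF A _ that(1,2)] poisson_jensen[OF B _ that(1,3)] nzR poisson_diff[OF that(1) cA]
      unfolding u_def by simp
    have gs: "\<bar>\<Sum>a\<in>zeros_in f R. zero_mult f a * green R (z + c) a - zero_mult f a * green R z a\<bar>
       \<le> (\<Sum>a\<in>zeros_in f R. zero_mult f a * e a z)"
      if z: "norm z = r" and f: "f = A \<or> f = B" for z f
    proof -
      have "\<bar>\<Sum>a\<in>zeros_in f R. zero_mult f a * green R (z + c) a - zero_mult f a * green R z a\<bar>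
        \<le> (\<Sum>a\<in>zeros_in f R. \<bar>zero_mult f a * green R (z + c) a - zero_mult f a * green R z a\<bar>)"
        by (rule sum_abs)
      also have "\<dots> \<le> (\<Sum>a\<in>zeros_in f R. zero_mult f a * e a z)"
      proof (rule sum_mono)
        fix a assume a: "a \<in> zeros_in f R"
        hence "norm a < R" "z \<noteq> a" "z + c \<noteq> a"
          using f aux[of a] nzr[OF z] unfolding zeros_in_def by auto
        from mult_left_mono[OF green[OF z this], of "zero_mult f a"]
        show "\<bar>zero_mult f a * green R (z + c) a - zero_mult f a * green R z a\<bar> \<le> zero_mult f a * e a z"
          by (simp add: abs_mult flip: right_diff_distrib)
      qed
      finally show ?thesis .
    qed
    let ?k = "16 * (norm c / (R - r))"
    have pt: "\<bar>u (z + c) - u z\<bar> \<le> (?k * poisson R (\<lambda>w. \<bar>u w\<bar>) z + (\<Sum>a\<in>zeros_in A R. zero_mult A a * e a z))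
       + (\<Sum>a\<in>zeros_in B R. zero_mult B a * e a z)" if z: "norm z = r" for z
    proof -
      have zR: "norm z < R" "norm (z + c) < R" using z r rc norm_triangle_ineq[of z c] by linarith+
      have "\<bar>poisson R u (z + c) - poisson R u z\<bar> \<le> ?k * poisson R (\<lambda>w. \<bar>u w\<bar>) z"
        by (rule poisson_shift[OF _ ucont c r(2)]) (use z in simp)
      thus ?thesis
        using pj[OF zR(1)] pj[OF zR(2)] nzr[OF z] gs[OF z, of A] gs[OF z, of B]
        by (simp add: sum_subtractf abs_le_iff)
    qed
    have c1: "continuous_on (sphere 0 r) (\<lambda>z. \<Sum>a\<in>zeros_in A R. zero_mult A a * e a z)"
         "continuous_on (sphere 0 r) (\<lambda>z. \<Sum>a\<in>zeros_in B R. zero_mult B a * e a z)"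
      by (intro continuous_intros econt; simp)+
    have c2: "continuous_on (sphere 0 r) (\<lambda>z. ?k * poisson R (\<lambda>w. \<bar>u w\<bar>) z)"
      by (intro continuous_intros continuous_on_subset[OF continuous_on_poisson[of r R]]) (use r ucont in \<open>auto intro: continuous_intros\<close>)
    have c3: "continuous_on (sphere 0 r) (\<lambda>z. \<bar>u (z + c) - u z\<bar>)"
    proof -
      have "(\<lambda>z. A (z + c)) holomorphic_on UNIV" "(\<lambda>z. B (z + c)) holomorphic_on UNIV"
        by (auto intro!: holomorphic_on_compose_gen[unfolded o_def, OF _ A] holomorphic_on_compose_gen[unfolded o_def, OF _ B] holomorphic_intros)
      thus ?thesis unfolding u_def
        by (intro continuous_on_rabs continuous_on_diff continuous_on_ln_norm A B) (use nzr in auto)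
    qed
    have ms: "circle_mean (\<lambda>z. \<Sum>a\<in>zeros_in f R. zero_mult f a * e a z) r \<le> 4 * K * r powr (-\<delta>) * zeros_number f R"
      if f: "f = A \<or> f = B" for f
    proof -
      have "circle_mean (\<lambda>z. \<Sum>a\<in>zeros_in f R. zero_mult f a * e a z) r = (\<Sum>a\<in>zeros_in f R. zero_mult f a * circle_mean (e a) r)"
        using f fin r by (subst circle_mean_sum) (auto intro!: continuous_intros econt simp: circle_mean_cmult)
      also have "\<dots> \<le> (\<Sum>a\<in>zeros_in f R. zero_mult f a * (4 * K * r powr (-\<delta>)))"
        by (intro sum_mono mult_left_mono emean) (use f in auto)
      also have "\<dots> = 4 * K * r powr (-\<delta>) * zeros_number f R"
        unfolding zeros_number_def by (simp add: sum_distrib_left mult_ac)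
      finally show ?thesis .
    qed
    have "circle_mean (\<lambda>z. \<bar>u (z + c) - u z\<bar>) r \<le> circle_mean (\<lambda>z. (?k * poisson R (\<lambda>w. \<bar>u w\<bar>) z + (\<Sum>a\<in>zeros_in A R. zero_mult A a * e a z))
       + (\<Sum>a\<in>zeros_in B R. zero_mult B a * e a z)) r"
      by (rule circle_mean_mono) (use r c1 c2 c3 pt in \<open>auto intro: continuous_on_add\<close>)
    also have "\<dots> = ?k * circle_mean (\<lambda>w. \<bar>u w\<bar>) R + circle_mean (\<lambda>z. \<Sum>a\<in>zeros_in A R. zero_mult A a * e a z) r
       + circle_mean (\<lambda>z. \<Sum>a\<in>zeros_in B R. zero_mult B a * e a z) r"
    proof -
      have "circle_mean (poisson R (\<lambda>w. \<bar>u w\<bar>)) r = circle_mean (\<lambda>w. \<bar>u w\<bar>) R"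
        by (rule circle_mean_poisson) (use r ucont in \<open>auto intro: continuous_intros\<close>)
      hence "circle_mean (\<lambda>z. ?k * poisson R (\<lambda>w. \<bar>u w\<bar>) z) r = ?k * circle_mean (\<lambda>w. \<bar>u w\<bar>) R"
        unfolding circle_mean_cmult by simp
      thus ?thesis using circle_mean_add[OF less_imp_le[OF r(1)] continuous_on_add[OF c2 c1(1)] c1(2)]
        circle_mean_add[OF less_imp_le[OF r(1)] c2 c1(1)] by linarith
    qed
    also have "\<dots> \<le> ?k * circle_mean (\<lambda>w. \<bar>u w\<bar>) R + 4 * K * r powr (-\<delta>) * zeros_number A R + 4 * K * r powr (-\<delta>) * zeros_number B R"
      by (intro add_mono ms) auto
    finally show "circle_mean (\<lambda>z. \<bar>(ln (norm (A (z + c))) - ln (norm (B (z + c)))) - (ln (norm (A z)) - ln (norm (B z)))\<bar>) r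
      \<le> ?k * circle_mean (\<lambda>w. \<bar>ln (norm (A w)) - ln (norm (B w))\<bar>) R
         + 4 * K * r powr (-\<delta>) * (zeros_number A R + zeros_number B R)"
      unfolding u_def by (simp add: algebra_simps)
  qed
qed

section \<open>Growth of increasing functions of small hyper-order\<close>

lemma ex_not_countable:
  fixes a b :: real
  assumes "countable C" "a < b"
  obtains x where "a < x" "x < b" "x \<notin> C"
proof -
  have "\<not> {a<..<b} \<subseteq> C" using assms uncountable_open_interval countable_subset by blast
  then obtain x where "x \<in> {a<..<b}" "x \<notin> C" by blast
  thus ?thesis using that by auto
qed

text \<open>A step from x to x + x^\<beta> raises x^(1-\<beta>) by at most 1, because (1 +
  y)^(1-\<beta>) \<le> 1 + y. In \<open>growth_window\<close> this power therefore counts the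
  windows passed.\<close>

lemma powr_add_powr_le:
  fixes x \<beta> :: real
  assumes "0 < \<beta>" "\<beta> < 1" "x \<ge> 1"
  shows "(x + x powr \<beta>) powr (1 - \<beta>) \<le> x powr (1 - \<beta>) + 1"
proof -
  have e: "x + x powr \<beta> = x * (1 + x powr (\<beta> - 1))" using assms by (simp add: powr_diff field_simps)
  have "(x + x powr \<beta>) powr (1 - \<beta>) = x powr (1 - \<beta>) * (1 + x powr (\<beta> - 1)) powr (1 - \<beta>)"
    unfolding e using assms by (simp add: powr_mult)
  also have "\<dots> \<le> x powr (1 - \<beta>) * (1 + x powr (\<beta> - 1)) powr 1"
    using assms by (intro mult_left_mono powr_mono) auto
  also have "x powr (1 - \<beta>) * (1 + x powr (\<beta> - 1)) powr 1 = x powr (1 - \<beta>) + 1"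
    using assms by (simp add: distrib_left flip: powr_add)
  finally show ?thesis by simp
qed

text \<open>
  If the value more than doubled on each window, then along a sequence with
  $\varrho_k^{1-\beta} \le A + k$ it would exceed $2^k$, contradicting the bound on the growth.
\<close>

lemma growth_window:
  fixes T :: "real \<Rightarrow> real"
  assumes C: "countable C" and \<beta>: "0 < \<beta>" "\<beta> < 1 - \<sigma>" and \<sigma>: "\<sigma> \<ge> 0"
    and T: "\<And>r. r \<ge> r1 \<Longrightarrow> r \<notin> C \<Longrightarrow> 1 \<le> T r \<and> T r \<le> exp (r powr \<sigma>)"
  shows "\<exists>r\<ge>r0. r \<notin> C \<and> (\<forall>s. s \<notin> C \<longrightarrow> r \<le> s \<longrightarrow> s \<le> r + r powr \<beta> \<longrightarrow> T s \<le> 2 * T r)"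
proof (rule ccontr)
  assume contr: "\<not> ?thesis"
  define R where "R = max 1 (max r0 r1)"
  have step: "\<exists>s. s \<notin> C \<and> r \<le> s \<and> s \<le> r + r powr \<beta> \<and> 2 * T r < T s" if "r \<ge> R" "r \<notin> C" for r
  proof -
    have "r \<ge> r0" using that unfolding R_def by simp
    with contr that have "\<not> (\<forall>s. s \<notin> C \<longrightarrow> r \<le> s \<longrightarrow> s \<le> r + r powr \<beta> \<longrightarrow> T s \<le> 2 * T r)" by blast
    thus ?thesis by (auto simp: not_le)
  qed
  then obtain h where h: "\<And>r. r \<ge> R \<Longrightarrow> r \<notin> C \<Longrightarrow> h r \<notin> C \<and> r \<le> h r \<and> h r \<le> r + r powr \<beta> \<and> 2 * T r < T (h r)"
    by metis
  obtain x where x: "R < x" "x \<notin> C" using ex_not_countable[OF C, of R "R + 1"] by auto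
  define \<rho> where "\<rho> k = (h ^^ k) x" for k :: nat
  have \<rho>S: "\<rho> (Suc k) = h (\<rho> k)" for k unfolding \<rho>_def by simp
  have inv: "\<rho> k \<ge> R \<and> \<rho> k \<notin> C \<and> T (\<rho> k) \<ge> 2 ^ k \<and> \<rho> k powr (1 - \<beta>) \<le> x powr (1 - \<beta>) + real k" for k
  proof (induction k)
    case 0
    have "x \<ge> r1" using x unfolding R_def by simp
    from T[OF this x(2)] show ?case using x unfolding \<rho>_def by simp
  next
    case (Suc k)
    note hk = h[of "\<rho> k"]
    have R1: "\<rho> k \<ge> 1" using Suc unfolding R_def by simp
    have "h (\<rho> k) powr (1 - \<beta>) \<le> (\<rho> k + \<rho> k powr \<beta>) powr (1 - \<beta>)"
      using hk Suc R1 \<beta> \<sigma> by (intro powr_mono2) auto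
    also have "\<dots> \<le> \<rho> k powr (1 - \<beta>) + 1" by (rule powr_add_powr_le) (use \<beta> \<sigma> R1 in auto)
    finally show ?case unfolding \<rho>S using hk Suc by auto
  qed
  \<comment> \<open>The condition \<beta> < 1 - \<sigma> says exactly that \<gamma> < 1. After k
    doublings, k ln 2 \<le> (A + k)^\<gamma>, which fails for large k.\<close>
  define \<gamma> where "\<gamma> = \<sigma> / (1 - \<beta>)"
  define A where "A = x powr (1 - \<beta>)"
  have x1: "x > 1" using x unfolding R_def by simp
  have \<gamma>: "0 \<le> \<gamma>" "\<gamma> < 1" unfolding \<gamma>_def using \<beta> \<sigma> by (auto simp: field_simps)
  have A: "A > 0" unfolding A_def using x1 by simp
  have bound: "real k * ln 2 \<le> (A + real k) powr \<gamma>" for k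
  proof -
    have R1: "\<rho> k \<ge> 1" "\<rho> k \<ge> r1" using inv[of k] unfolding R_def by auto
    have "2 ^ k \<le> T (\<rho> k)" using inv by blast
    also have "\<dots> \<le> exp (\<rho> k powr \<sigma>)" using T[of "\<rho> k"] inv[of k] R1 by blast
    finally have "ln (2 ^ k) \<le> \<rho> k powr \<sigma>" by (metis exp_gt_zero ln_exp ln_le_cancel_iff zero_less_numeral zero_less_power)
    also have "\<rho> k powr \<sigma> = (\<rho> k powr (1 - \<beta>)) powr \<gamma>"
      unfolding \<gamma>_def using \<beta> \<sigma> by (simp add: powr_powr)
    also have "\<dots> \<le> (A + real k) powr \<gamma>" unfolding A_def using inv[of k] \<gamma> by (intro powr_mono2) auto
    finally show ?thesis by (simp add: ln_realpow)
  qed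
  have "((\<lambda>k. (A + real k) powr \<gamma> / real k) \<longlongrightarrow> 0) sequentially"
    using \<gamma> A by real_asymp
  moreover have "ln 2 > (0::real)" by simp
  ultimately have "eventually (\<lambda>k. (A + real k) powr \<gamma> / real k < ln 2) sequentially"
    by (rule order_tendstoD)
  hence "eventually (\<lambda>k. False) sequentially"
    using eventually_gt_at_top[of 0]
  proof eventually_elim
    case (elim k)
    thus ?case using bound[of k] by (simp add: field_simps)
  qed
  thus False by simp
qed

section \<open>Counting functions of shifted functions\<close>

text \<open>Compares the weight of a zero of a shifted function, of modulus at least x - s, with the
  weight of the original zero, of modulus x. Both logarithms vanish at x = r + s, and the condition
  on s and \<eta> makes their weighted difference monotone, so zeros far from the origin lose only a
  factor 1 + \<eta>.\<close>

lemma ln_shift_le: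
  fixes r s x \<eta> :: real
  assumes "\<eta> > 0" "s \<ge> 0" "x > s" "s * (1 + \<eta>) \<le> \<eta> * x" "x \<le> r + s" "r > 0"
  shows "ln (r / (x - s)) \<le> (1 + \<eta>) * ln ((r + s) / x)"
proof -
  define \<phi> where "\<phi> y = (1 + \<eta>) * (ln (r + s) - ln y) - ln r + ln (y - s)" for y
  have "\<phi> (r + s) \<le> \<phi> x"
  proof (rule DERIV_nonpos_imp_nonincreasing[OF assms(5)])
    fix y assume y: "x \<le> y" "y \<le> r + s"
    have "(\<phi> has_real_derivative (1 + \<eta>) * (0 - 1 / y) + 1 / (y - s)) (at y)"
      unfolding \<phi>_def using y assms by (auto intro!: derivative_eq_intros)
    moreover have "(1 + \<eta>) * (0 - 1 / y) + 1 / (y - s) \<le> 0"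
    proof -
      have "\<eta> * x \<le> \<eta> * y" using y assms by simp
      moreover have "(1 + \<eta>) * (y - s) = y + \<eta> * y - s * (1 + \<eta>)" by (simp add: algebra_simps)
      ultimately have "y \<le> (1 + \<eta>) * (y - s)" using assms(4) by linarith
      thus ?thesis using y assms by (simp add: divide_simps)
    qed
    ultimately show "\<exists>d. (\<phi> has_real_derivative d) (at y) \<and> d \<le> 0" by blast
  qed
  hence "0 \<le> \<phi> x" unfolding \<phi>_def by simp
  thus ?thesis unfolding \<phi>_def using assms by (simp add: ln_div)
qed

lemma shift_holomorphic:
  assumes "f holomorphic_on UNIV"
  shows "(\<lambda>z. f (z + w)) holomorphic_on UNIV"
  by (rule holomorphic_on_compose_gen[unfolded o_def, OF _ assms]) (auto intro!: holomorphic_intros)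

lemma zero_mult_shift:
  assumes "f holomorphic_on UNIV" "\<exists>w. f w \<noteq> 0"
  shows "zero_mult (\<lambda>z. f (z + w)) b = zero_mult f (b + w)"
proof -
  obtain k where k: "k holomorphic_on UNIV" "\<And>z. f z = (z - (b + w)) ^ zero_mult f (b + w) * k z" "k (b + w) \<noteq> 0"
    using entire_factor_at[OF assms, of "b + w"] by blast
  show ?thesis
  proof (rule zero_mult_unique[of "\<lambda>z. k (z + w)"])
    show "f (z + w) = (z - b) ^ zero_mult f (b + w) * k (z + w)" for z
      using k(2)[of "z + w"] by simp
  qed (use k shift_holomorphic in auto)
qed

text \<open>Counterpart of \<open>int_count_mono_radius\<close>: no zero in the larger disc gains
  more than ln (s / r).\<close>

lemma int_count_radius_le:
  assumes f: "f holomorphic_on UNIV" "\<exists>w. f w \<noteq> 0" and r: "0 < r" "r \<le> s"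
  shows "int_count (zero_mult f) s \<le> int_count (zero_mult f) r + zeros_number f s * ln (s / r)"
proof -
  let ?Z = "\<lambda>r. zeros_in f r - {0}"
  have sub: "?Z r \<subseteq> ?Z s" using r unfolding zeros_in_def by auto
  have fs: "finite (zeros_in f s)" by (rule finite_zeros_in[OF f])
  have sp: "s > 0" using r by simp
  have ls: "ln (s / r) \<ge> 0" using r by simp
  have "(\<Sum>a\<in>?Z s. zero_mult f a * ln (s / norm a)) \<le> (\<Sum>a\<in>?Z s. (if a \<in> ?Z r then zero_mult f a * ln (r / norm a) else 0) + zero_mult f a * ln (s / r))"
  proof (rule sum_mono)
    fix a assume a: "a \<in> ?Z s"
    show "zero_mult f a * ln (s / norm a) \<le> (if a \<in> ?Z r then zero_mult f a * ln (r / norm a) else 0) + zero_mult f a * ln (s / r)"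
    proof (cases "norm a \<le> r")
      case True
      hence "a \<in> ?Z r" using a unfolding zeros_in_def by auto
      thus ?thesis using a r sp by (simp add: ln_div algebra_simps)
    next
      case False
      hence a0: "norm a > 0" using r by linarith
      hence "s / norm a \<le> s / r" using False r sp by (intro divide_left_mono) auto
      hence "ln (s / norm a) \<le> ln (s / r)" using a0 r sp by (intro ln_mono divide_pos_pos)
      moreover have "a \<notin> ?Z r" using False unfolding zeros_in_def by auto
      ultimately show ?thesis by (subst if_not_P) (auto intro: mult_left_mono)
    qed
  qed
  also have "\<dots> = (\<Sum>a\<in>?Z r. zero_mult f a * ln (r / norm a)) + (\<Sum>a\<in>?Z s. real (zero_mult f a)) * ln (s / r)"
  proof -
    have "?Z s \<inter> {a. a \<in> ?Z r} = ?Z r" using sub by auto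
    thus ?thesis using fs by (simp only: sum.distrib sum.If_cases finite_Diff sum_distrib_right sum.neutral_const add_0_right)
  qed
  finally have 1: "(\<Sum>a\<in>?Z s. zero_mult f a * ln (s / norm a)) \<le> (\<Sum>a\<in>?Z r. zero_mult f a * ln (r / norm a)) + (\<Sum>a\<in>?Z s. real (zero_mult f a)) * ln (s / r)" .
  have 2: "zeros_number f s = zero_mult f 0 + (\<Sum>a\<in>?Z s. real (zero_mult f a))"
  proof (cases "f 0 = 0")
    case True
    hence "0 \<in> zeros_in f s" using sp unfolding zeros_in_def by simp
    thus ?thesis unfolding zeros_number_def by (subst sum.remove[OF fs]) auto
  next
    case False
    hence "zero_mult f 0 = 0" "?Z s = zeros_in f s" unfolding zero_mult_def zeros_in_def by auto
    thus ?thesis unfolding zeros_number_def by simp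
  qed
  have 3: "zero_mult f 0 * ln s = zero_mult f 0 * ln r + zero_mult f 0 * ln (s / r)"
    using r sp by (simp add: ln_div algebra_simps)
  show ?thesis unfolding int_count_zeros[OF f r(1)] int_count_zeros[OF f sp] 2 distrib_right
    using 1 3 by linarith
qed

lemma zeros_number_le:
  assumes f: "f holomorphic_on UNIV" "\<exists>w. f w \<noteq> 0" and r: "1 \<le> r" "r < s"
  shows "zeros_number f r * ln (s / r) \<le> int_count (zero_mult f) s"
proof -
  have fin: "finite {z \<in> cball 0 s. zero_mult f z \<noteq> 0}"
    unfolding zero_mult_support[OF f] by (rule finite_zeros_in[OF f])
  have finr: "finite {z \<in> cball 0 r. zero_mult f z \<noteq> 0}"
    unfolding zero_mult_support[OF f] by (rule finite_zeros_in[OF f])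
  show ?thesis
    using int_count_mono_radius[OF fin, of r] int_count_nonneg[OF finr] r
    unfolding zero_mult_support[OF f] zeros_number_def by simp
qed

lemma zeros_number_nonneg [simp]: "zeros_number f r \<ge> 0"
  unfolding zeros_number_def by (intro sum_nonneg) auto

text \<open>The finitely many zeros near the origin contribute O(log r), the others obey
  \<open>ln_shift_le\<close>. That \<eta> is arbitrary matters: a fixed factor would give a change
  of order T instead of o(T) in \<open>small_shift_mean\<close>.\<close>

theorem shifted_count_le:
  assumes B: "B holomorphic_on UNIV" "\<exists>z. B z \<noteq> 0" and \<eta>: "\<eta> > 0"
  obtains K where "K \<ge> 0" "\<And>r. r \<ge> 1 \<Longrightarrow> int_count (zero_mult (\<lambda>z. B (z + w))) r
    \<le> (1 + \<eta>) * int_count (zero_mult B) (r + norm w) + K * (1 + ln r)"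
proof -
  define s where "s = norm w"
  \<comment> \<open>Chosen so that every modulus x > \<rho> meets the two conditions s < x and s (1
    + \<eta>) \<le> \<eta> x of \<open>ln_shift_le\<close>.\<close>
  define \<rho> where "\<rho> = s * (1 + \<eta>) / \<eta> + s + 1"
  define Bw where "Bw z = B (z + w)" for z
  have s0: "s \<ge> 0" unfolding s_def by simp
  have "s * (1 + \<eta>) / \<eta> \<ge> 0" using \<eta> s0 by simp
  hence \<rho>: "\<rho> > s" "s * (1 + \<eta>) / \<eta> \<le> \<rho>" unfolding \<rho>_def using s0 by auto
  hence \<rho>2: "s * (1 + \<eta>) \<le> \<eta> * \<rho>" using \<eta> by (simp add: field_simps)
  have Bw: "Bw holomorphic_on UNIV" "\<exists>z. Bw z \<noteq> 0"
  proof -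
    show "Bw holomorphic_on UNIV" unfolding Bw_def by (rule shift_holomorphic[OF B(1)])
    obtain z where "B z \<noteq> 0" using B(2) by blast
    thus "\<exists>z. Bw z \<noteq> 0" unfolding Bw_def by (intro exI[of _ "z - w"]) simp
  qed
  have m: "zero_mult Bw b = zero_mult B (b + w)" for b unfolding Bw_def by (rule zero_mult_shift[OF B])
  define Z where "Z = (\<lambda>a. a - w) ` zeros_in B \<rho>"
  have fZ: "finite Z" unfolding Z_def using finite_zeros_in[OF B] by simp
  define K where "K = zero_mult Bw 0 + (\<Sum>b\<in>Z. zero_mult Bw b * (1 + \<bar>ln (norm b)\<bar>))"
  have K0: "K \<ge> 0" unfolding K_def by (intro add_nonneg_nonneg sum_nonneg mult_nonneg_nonneg) auto
  show ?thesis
  proof (rule that[OF K0])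
    fix r :: real assume r: "r \<ge> 1"
    have rp: "r > 0" "r + s > 0" and lr: "ln r \<ge> 0" using r s0 by auto
    define Y where "Y = zeros_in Bw r - {0}"
    have fY: "finite Y" unfolding Y_def using finite_zeros_in[OF Bw] by simp
    have small: "(\<Sum>b\<in>Y \<inter> Z. zero_mult Bw b * ln (r / norm b)) \<le> (\<Sum>b\<in>Z. zero_mult Bw b * (1 + \<bar>ln (norm b)\<bar>)) * (1 + ln r)"
    proof -
      have "(\<Sum>b\<in>Y \<inter> Z. zero_mult Bw b * ln (r / norm b)) \<le> (\<Sum>b\<in>Y \<inter> Z. zero_mult Bw b * (1 + \<bar>ln (norm b)\<bar>) * (1 + ln r))"
      proof (rule sum_mono)
        fix b assume b: "b \<in> Y \<inter> Z"
        hence "norm b > 0" unfolding Y_def by simp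
        hence "ln (r / norm b) = ln r - ln (norm b)" using rp by (simp add: ln_div)
        also have "\<dots> \<le> (1 + \<bar>ln (norm b)\<bar>) * (1 + ln r)"
        proof -
          have "\<bar>ln (norm b)\<bar> * ln r \<ge> 0" using lr by simp
          thus ?thesis by (simp add: algebra_simps)
        qed
        finally show "zero_mult Bw b * ln (r / norm b) \<le> zero_mult Bw b * (1 + \<bar>ln (norm b)\<bar>) * (1 + ln r)"
          by (simp add: mult.assoc mult_left_mono)
      qed
      also have "\<dots> \<le> (\<Sum>b\<in>Z. zero_mult Bw b * (1 + \<bar>ln (norm b)\<bar>) * (1 + ln r))"
        by (rule sum_mono2) (use fZ lr in auto)
      finally show ?thesis by (simp add: sum_distrib_right)
    qed
    have big: "(\<Sum>b\<in>Y - Z. zero_mult Bw b * ln (r / norm b)) \<le> (1 + \<eta>) * (\<Sum>a\<in>zeros_in B (r + s) - {0}. zero_mult B a * ln ((r + s) / norm a))"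
    proof -
      have bY: "norm (b + w) > \<rho> \<and> norm (b + w) \<le> r + s \<and> B (b + w) = 0" if "b \<in> Y - Z" for b
      proof -
        have 1: "norm b \<le> r" "B (b + w) = 0" using that unfolding Y_def zeros_in_def Bw_def by auto
        moreover have "norm (b + w) > \<rho>"
        proof (rule ccontr)
          assume "\<not> norm (b + w) > \<rho>"
          hence "b + w \<in> zeros_in B \<rho>" using 1 unfolding zeros_in_def by simp
          hence "b + w - w \<in> Z" unfolding Z_def by (rule imageI)
          thus False using that by simp
        qed
        ultimately show ?thesis unfolding s_def using norm_triangle_ineq[of b w] by linarith
      qed
      have "(\<Sum>b\<in>Y - Z. zero_mult Bw b * ln (r / norm b)) \<le> (\<Sum>b\<in>Y - Z. (1 + \<eta>) * (zero_mult B (b + w) * ln ((r + s) / norm (b + w))))"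
      proof (rule sum_mono)
        fix b assume b: "b \<in> Y - Z"
        note bb = bY[OF b]
        define x where "x = norm (b + w)"
        have x: "x > s" "x \<le> r + s" "x > \<rho>" using bb \<rho> unfolding x_def by auto
        have nb: "norm b \<ge> x - s" unfolding x_def s_def using norm_triangle_ineq[of b w] by simp
        have "s * (1 + \<eta>) \<le> \<eta> * x" using \<rho>2 x \<eta> by (meson less_imp_le mult_left_mono order_trans)
        hence "ln (r / (x - s)) \<le> (1 + \<eta>) * ln ((r + s) / x)" using \<eta> s0 x rp by (intro ln_shift_le) auto
        moreover have "ln (r / norm b) \<le> ln (r / (x - s))"
        proof (intro ln_mono divide_left_mono mult_pos_pos divide_pos_pos)
          show "norm b > 0" using b unfolding Y_def by simp
        qed (use nb x rp in \<open>auto simp: s_def[symmetric]\<close>)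
        ultimately have "ln (r / norm b) \<le> (1 + \<eta>) * ln ((r + s) / x)" by simp
        hence "real (zero_mult Bw b) * ln (r / norm b) \<le> real (zero_mult Bw b) * ((1 + \<eta>) * ln ((r + s) / x))"
          by (rule mult_left_mono) simp
        thus "zero_mult Bw b * ln (r / norm b) \<le> (1 + \<eta>) * (zero_mult B (b + w) * ln ((r + s) / norm (b + w)))"
          unfolding m x_def by (simp add: mult_ac)
      qed
      also have "\<dots> = (1 + \<eta>) * (\<Sum>a\<in>(\<lambda>b. b + w) ` (Y - Z). zero_mult B a * ln ((r + s) / norm a))"
        unfolding sum_distrib_left by (subst sum.reindex) (auto simp: inj_on_def)
      also have "\<dots> \<le> (1 + \<eta>) * (\<Sum>a\<in>zeros_in B (r + s) - {0}. zero_mult B a * ln ((r + s) / norm a))"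
      proof (intro mult_left_mono sum_mono2)
        show "(\<lambda>b. b + w) ` (Y - Z) \<subseteq> zeros_in B (r + s) - {0}"
        proof
          fix a assume "a \<in> (\<lambda>b. b + w) ` (Y - Z)"
          then obtain b where b: "b \<in> Y - Z" "a = b + w" by blast
          from bY[OF b(1)] have "norm a > 0" "norm a \<le> r + s" "B a = 0" unfolding b(2) using \<rho> s0 by linarith+
          thus "a \<in> zeros_in B (r + s) - {0}" unfolding zeros_in_def by auto
        qed
        show "0 \<le> zero_mult B b * ln ((r + s) / norm b)" if "b \<in> zeros_in B (r + s) - {0} - (\<lambda>b. b + w) ` (Y - Z)" for b
          using that unfolding zeros_in_def by (intro mult_nonneg_nonneg) auto
      qed (use finite_zeros_in[OF B] \<eta> in auto)
      finally show ?thesis .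
    qed
    have "(\<Sum>b\<in>Y. zero_mult Bw b * ln (r / norm b)) = (\<Sum>b\<in>Y \<inter> Z. zero_mult Bw b * ln (r / norm b)) + (\<Sum>b\<in>Y - Z. zero_mult Bw b * ln (r / norm b))"
      using fY sum.Int_Diff by blast
    moreover have "(\<Sum>a\<in>zeros_in B (r + s) - {0}. zero_mult B a * ln ((r + s) / norm a)) \<le> int_count (zero_mult B) (r + s)"
      unfolding int_count_zeros[OF B rp(2)] using r s0 by simp
    hence "(1 + \<eta>) * (\<Sum>a\<in>zeros_in B (r + s) - {0}. zero_mult B a * ln ((r + s) / norm a)) \<le> (1 + \<eta>) * int_count (zero_mult B) (r + s)"
      using \<eta> by (intro mult_left_mono) auto
    moreover have "zero_mult Bw 0 * ln r \<le> zero_mult Bw 0 * (1 + ln r)" by (intro mult_left_mono) auto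
    moreover have Kd: "K * (1 + ln r) = zero_mult Bw 0 * (1 + ln r) + (\<Sum>b\<in>Z. zero_mult Bw b * (1 + \<bar>ln (norm b)\<bar>)) * (1 + ln r)"
      unfolding K_def by (rule distrib_right)
    ultimately have "int_count (zero_mult Bw) r \<le> (1 + \<eta>) * int_count (zero_mult B) (r + s) + K * (1 + ln r)"
      unfolding int_count_zeros[OF Bw rp(1)] Y_def[symmetric] using small big Kd by linarith
    thus "int_count (zero_mult (\<lambda>z. B (z + w))) r \<le> (1 + \<eta>) * int_count (zero_mult B) (r + norm w) + K * (1 + ln r)"
      unfolding Bw_def s_def .
  qed
qed

section \<open>The characteristic function of a curve\<close>

lemma continuous_on_Max_family:
  fixes f :: "'i \<Rightarrow> 'a::topological_space \<Rightarrow> real"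
  assumes "finite I" "I \<noteq> {}" "\<And>i. i \<in> I \<Longrightarrow> continuous_on S (f i)"
  shows "continuous_on S (\<lambda>z. Max ((\<lambda>i. f i z) ` I))"
  using assms
proof (induction rule: finite_ne_induct)
  case (insert i I)
  have "Max ((\<lambda>i. f i z) ` insert i I) = max (f i z) (Max ((\<lambda>i. f i z) ` I))" for z
    using insert.hyps by simp
  thus ?case using insert by (auto intro!: continuous_on_max)
qed simp

locale curve =
  fixes n :: nat and g :: "nat \<Rightarrow> complex \<Rightarrow> complex"
  assumes rep: "reduced_rep n g"
begin

lemma holo: "k \<le> n \<Longrightarrow> g k holomorphic_on UNIV"
  using rep unfolding reduced_rep_def by blast

abbreviation U where "U \<equiv> max_log n g"
abbreviation T where "T \<equiv> cartan_char n g"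

lemma index_set: "finite {k. k \<le> n \<and> g k z \<noteq> 0}" "{k. k \<le> n \<and> g k z \<noteq> 0} \<noteq> {}"
  using rep unfolding reduced_rep_def by auto

lemma ln_norm_le: "k \<le> n \<Longrightarrow> g k z \<noteq> 0 \<Longrightarrow> ln (norm (g k z)) \<le> U z"
  unfolding max_log_def using index_set[of z] by (intro Max_ge) auto

lemma norm_le: "k \<le> n \<Longrightarrow> norm (g k z) \<le> exp (U z)"
  using ln_norm_le[of k z] by (cases "g k z = 0") (simp, metis exp_le_cancel_iff exp_ln zero_less_norm_iff)

lemma attained: "\<exists>k\<le>n. g k z \<noteq> 0 \<and> U z = ln (norm (g k z))"
proof -
  have "U z \<in> (\<lambda>k. ln (norm (g k z))) ` {k. k \<le> n \<and> g k z \<noteq> 0}"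
    unfolding max_log_def using index_set[of z] by (intro Max_in) auto
  thus ?thesis by blast
qed

text \<open>The index set in \<open>max_log\<close> varies with z. As the logarithm of a maximum
  over all indices, U is a continuous function of finitely many continuous ones.\<close>

lemma continuous_on_U: "continuous_on S U"
proof -
  have e: "U z = ln (Max ((\<lambda>k. norm (g k z)) ` {..n}))" and p: "Max ((\<lambda>k. norm (g k z)) ` {..n}) > 0" for z
  proof -
    obtain k where k: "k \<le> n" "g k z \<noteq> 0" "U z = ln (norm (g k z))" using attained by blast
    have "norm (g j z) \<le> norm (g k z)" if "j \<le> n" for j
      using norm_le[OF that, of z] k by simp
    hence "Max ((\<lambda>k. norm (g k z)) ` {..n}) = norm (g k z)" using k by (intro Max_eqI) auto
    thus "U z = ln (Max ((\<lambda>k. norm (g k z)) ` {..n}))" "Max ((\<lambda>k. norm (g k z)) ` {..n}) > 0" using k by auto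
  qed
  have "continuous_on S (\<lambda>z. ln (Max ((\<lambda>k. norm (g k z)) ` {..n})))"
  proof (intro continuous_on_ln continuous_on_Max_family)
    show "continuous_on S (\<lambda>z. norm (g k z))" if "k \<in> {..n}" for k
      using that by (intro continuous_on_norm holomorphic_on_imp_continuous_on holomorphic_on_subset[OF holo[of k]]) auto
    show "\<forall>z\<in>S. Max ((\<lambda>k. norm (g k z)) ` {..n}) \<noteq> 0"
    proof
      fix z show "Max ((\<lambda>k. norm (g k z)) ` {..n}) \<noteq> 0" using p[of z] by linarith
    qed
  qed auto
  thus ?thesis unfolding e .
qed

lemma circle_mean_U: "circle_mean U r = T r + U 0"
  unfolding cartan_char_def circle_mean_def by simp

text \<open>Treats the components of g (any \<kappa> \<ge> 0) and the targets f_j (\<kappa>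
  measuring the coefficients) alike. The inequality is restricted to f z \<noteq> 0 because
  \<open>ln 0\<close> has the value 0.\<close>

definition majorized :: "(complex \<Rightarrow> real) \<Rightarrow> (complex \<Rightarrow> complex) \<Rightarrow> bool" where
  "majorized \<kappa> f \<longleftrightarrow> f holomorphic_on UNIV \<and> (\<exists>z. f z \<noteq> 0) \<and> (\<forall>z. f z \<noteq> 0 \<longrightarrow> ln (norm (f z)) \<le> U z + \<kappa> z)"

lemma majorized_component: "k \<le> n \<Longrightarrow> \<exists>z. g k z \<noteq> 0 \<Longrightarrow> (\<And>z. \<kappa> z \<ge> 0) \<Longrightarrow> majorized \<kappa> (g k)"
  unfolding majorized_def using holo ln_norm_le by (fastforce intro: add_increasing2)

context
  fixes \<kappa> :: "complex \<Rightarrow> real"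
  assumes \<kappa>: "continuous_on UNIV \<kappa>"
begin

lemma continuous_on_majorant: "continuous_on S (\<lambda>z. U z + \<kappa> z)"
  by (intro continuous_on_add continuous_on_U continuous_on_subset[OF \<kappa>]) auto

lemma circle_mean_majorant: "r \<ge> 0 \<Longrightarrow> circle_mean (\<lambda>z. U z + \<kappa> z) r = T r + U 0 + circle_mean \<kappa> r"
  by (subst circle_mean_add) (auto simp: circle_mean_U intro: continuous_on_U continuous_on_subset[OF \<kappa>])

text \<open>Jensen's formula with log |f| \<le> U + \<kappa>: the easy half of a first main
  theorem.\<close>

lemma int_count_majorized:
  assumes "majorized \<kappa> f"
  obtains K where "\<And>R. R > 0 \<Longrightarrow> (\<And>w. norm w = R \<Longrightarrow> f w \<noteq> 0) \<Longrightarrow> int_count (zero_mult f) R \<le> T R + circle_mean \<kappa> R + K"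
proof -
  have f: "f holomorphic_on UNIV" "\<exists>w. f w \<noteq> 0" and le: "\<And>z. f z \<noteq> 0 \<Longrightarrow> ln (norm (f z)) \<le> U z + \<kappa> z"
    using assms unfolding majorized_def by auto
  obtain K where K: "\<And>R. R > 0 \<Longrightarrow> (\<And>w. norm w = R \<Longrightarrow> f w \<noteq> 0) \<Longrightarrow>
    circle_mean (\<lambda>w. ln (norm (f w))) R = K + int_count (zero_mult f) R" using jensen[OF f] by blast
  show ?thesis
  proof (rule that[of "U 0 - K"])
    fix R :: real assume R: "R > 0" and nz: "\<And>w. norm w = R \<Longrightarrow> f w \<noteq> 0"
    have "circle_mean (\<lambda>w. ln (norm (f w))) R \<le> circle_mean (\<lambda>z. U z + \<kappa> z) R"
      by (rule circle_mean_mono) (use R nz f le in \<open>auto intro!: continuous_on_ln_norm continuous_on_majorant\<close>)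
    thus "int_count (zero_mult f) R \<le> T R + circle_mean \<kappa> R + (U 0 - K)"
      using K[OF R nz] R by (simp add: circle_mean_majorant)
  qed
qed

text \<open>If x and y are at most m, then |x - y| \<le> 2 m - (x + y). By Jensen the mean of x + y
  is bounded below by a constant, since counting functions are nonnegative for R \<ge> 1.\<close>

lemma circle_mean_abs_quotient:
  assumes "majorized \<kappa> A" "majorized \<kappa> B"
  obtains K where "\<And>R. R \<ge> 1 \<Longrightarrow> (\<And>w. norm w = R \<Longrightarrow> A w \<noteq> 0 \<and> B w \<noteq> 0) \<Longrightarrow>
    circle_mean (\<lambda>w. \<bar>ln (norm (A w)) - ln (norm (B w))\<bar>) R \<le> 2 * T R + 2 * circle_mean \<kappa> R + K"
proof -
  have A: "A holomorphic_on UNIV" "\<exists>w. A w \<noteq> 0" "\<And>z. A z \<noteq> 0 \<Longrightarrow> ln (norm (A z)) \<le> U z + \<kappa> z"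
    and B: "B holomorphic_on UNIV" "\<exists>w. B w \<noteq> 0" "\<And>z. B z \<noteq> 0 \<Longrightarrow> ln (norm (B z)) \<le> U z + \<kappa> z"
    using assms unfolding majorized_def by auto
  obtain K where K: "\<And>R. R > 0 \<Longrightarrow> (\<And>w. norm w = R \<Longrightarrow> A w \<noteq> 0) \<Longrightarrow>
    circle_mean (\<lambda>w. ln (norm (A w))) R = K + int_count (zero_mult A) R" using jensen[OF A(1,2)] by blast
  obtain K' where K': "\<And>R. R > 0 \<Longrightarrow> (\<And>w. norm w = R \<Longrightarrow> B w \<noteq> 0) \<Longrightarrow>
    circle_mean (\<lambda>w. ln (norm (B w))) R = K' + int_count (zero_mult B) R" using jensen[OF B(1,2)] by blast
  show ?thesis
  proof (rule that[of "2 * U 0 - K - K'"])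
    fix R :: real assume R: "R \<ge> 1" and nz: "\<And>w. norm w = R \<Longrightarrow> A w \<noteq> 0 \<and> B w \<noteq> 0"
    have R0: "R \<ge> 0" "R > 0" using R by auto
    have cA: "continuous_on (sphere 0 R) (\<lambda>w. ln (norm (A w)))" "continuous_on (sphere 0 R) (\<lambda>w. ln (norm (B w)))"
      by (intro continuous_on_ln_norm A B; use nz in auto)+
    have c2: "continuous_on (sphere 0 R) (\<lambda>w. 2 * (U w + \<kappa> w))"
      by (intro continuous_on_mult_left continuous_on_majorant)
    have "circle_mean (\<lambda>w. \<bar>ln (norm (A w)) - ln (norm (B w))\<bar>) R
       \<le> circle_mean (\<lambda>w. 2 * (U w + \<kappa> w) - (ln (norm (A w)) + ln (norm (B w)))) R"
    proof (rule circle_mean_mono)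
      fix w :: complex assume "norm w = R"
      thus "\<bar>ln (norm (A w)) - ln (norm (B w))\<bar> \<le> 2 * (U w + \<kappa> w) - (ln (norm (A w)) + ln (norm (B w)))"
        using A(3)[of w] B(3)[of w] nz[of w] by (simp add: abs_le_iff)
    qed (use R cA c2 in \<open>auto intro!: continuous_intros\<close>)
    also have "\<dots> = 2 * (T R + U 0 + circle_mean \<kappa> R) - (circle_mean (\<lambda>w. ln (norm (A w))) R + circle_mean (\<lambda>w. ln (norm (B w))) R)"
      by (simp only: circle_mean_diff[OF R0(1) c2 continuous_on_add[OF cA]] circle_mean_add[OF R0(1) cA] circle_mean_cmult
          circle_mean_majorant[OF R0(1)])
    also have "\<dots> \<le> 2 * (T R + U 0 + circle_mean \<kappa> R) - (K + K')"
    proof -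
      have "int_count (zero_mult A) R \<ge> 0" "int_count (zero_mult B) R \<ge> 0"
        by (intro int_count_nonneg R; simp only: zero_mult_support[OF A(1,2)] zero_mult_support[OF B(1,2)] finite_zeros_in A B)+
      thus ?thesis using K[OF R0(2)] K'[OF R0(2)] nz by simp
    qed
    finally show "circle_mean (\<lambda>w. \<bar>ln (norm (A w)) - ln (norm (B w))\<bar>) R \<le> 2 * T R + 2 * circle_mean \<kappa> R + (2 * U 0 - K - K')"
      by simp
  qed
qed

end

end

lemma hyper_order_bound:
  assumes "hyper_order S < 1"
  obtains \<sigma> where "0 \<le> \<sigma>" "\<sigma> < 1" "eventually (\<lambda>r. S r \<le> exp (r powr \<sigma>)) at_top"
proof -
  obtain s where s: "hyper_order S < ereal s" "ereal s < 1"
    using assms ereal_dense2 by blast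
  have s1: "s < 1" using s(2) by simp
  have ev: "eventually (\<lambda>r. ereal (ln_plus (ln_plus (S r)) / ln r) < ereal s) at_top"
    using s(1) unfolding hyper_order_def by (rule Limsup_lessD)
  have ln_plus: "x \<le> exp (ln_plus x)" for x :: real unfolding ln_plus_def by (auto simp: max_def)
  show ?thesis
  proof (rule that[of "max 0 s"])
    show "eventually (\<lambda>r. S r \<le> exp (r powr max 0 s)) at_top"
      using ev eventually_gt_at_top[of 1]
    proof eventually_elim
      case (elim r)
      hence "ln_plus (ln_plus (S r)) \<le> s * ln r" by (simp add: field_simps)
      also have "\<dots> \<le> max 0 s * ln r" using elim by (intro mult_right_mono) auto
      finally have "exp (ln_plus (ln_plus (S r))) \<le> exp (max 0 s * ln r)" by simp
      with ln_plus[of "ln_plus (S r)"] have "ln_plus (S r) \<le> exp (max 0 s * ln r)" by (rule order_trans)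
      hence "ln_plus (S r) \<le> r powr max 0 s" using elim by (simp add: powr_def)
      thus ?case using ln_plus[of "S r"] by (meson exp_le_cancel_iff order_trans)
    qed
  qed (use s1 in auto)
qed

section \<open>Error terms along radii with controlled growth\<close>

definition covers :: "real set \<Rightarrow> (complex \<Rightarrow> complex) \<Rightarrow> bool" where
  "covers C f \<longleftrightarrow> (\<forall>w. f w = 0 \<longrightarrow> norm w \<in> C)"

lemma coversD: "covers C f \<Longrightarrow> R \<notin> C \<Longrightarrow> norm w = R \<Longrightarrow> f w \<noteq> 0"
  unfolding covers_def by auto

text \<open>The setting of the difference estimates. \<open>ln_small\<close> is the hypothesis that
  separates these curves from those of logarithmic growth; it makes constants and terms O(log r)
  negligible.\<close>

locale growing_curve = curve +
  fixes C :: "real set" and \<kappa> :: "complex \<Rightarrow> real" and \<beta> :: real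
  assumes \<kappa>: "continuous_on UNIV \<kappa>" "\<And>z. \<kappa> z \<ge> 0"
    and \<beta>: "0 < \<beta>" "\<beta> < 1"
    and countable_C: "countable C"
    and ln_small: "\<And>\<epsilon>. \<epsilon> > 0 \<Longrightarrow> eventually (\<lambda>r. r \<notin> C \<longrightarrow> ln r \<le> \<epsilon> * T r) at_top"
    and \<kappa>_small: "\<And>\<epsilon>. \<epsilon> > 0 \<Longrightarrow> eventually (\<lambda>r. r \<notin> C \<longrightarrow> circle_mean \<kappa> r \<le> \<epsilon> * T r) at_top"
begin

definition win :: "real \<Rightarrow> bool" where
  "win r \<longleftrightarrow> r \<notin> C \<and> (\<forall>s. s \<notin> C \<longrightarrow> r \<le> s \<longrightarrow> s \<le> r + r powr \<beta> \<longrightarrow> T s \<le> 2 * T r)"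

text \<open>o(T) along the radii with controlled growth. One-sided, because every error term enters
  as an upper bound.\<close>

definition small :: "(real \<Rightarrow> real) \<Rightarrow> bool" where
  "small E \<longleftrightarrow> (\<forall>\<epsilon>>0. eventually (\<lambda>r. win r \<longrightarrow> E r \<le> \<epsilon> * T r) at_top)"

lemma const_le_T: "eventually (\<lambda>r. r \<notin> C \<longrightarrow> K \<le> T r) at_top"
proof -
  have "eventually (\<lambda>r. K \<le> ln r) at_top"
    using ln_at_top by (auto simp: filterlim_at_top)
  with ln_small[of 1] show ?thesis by (rule eventually_elim2) auto
qed

lemma window_bound:
  assumes "eventually (\<lambda>r. r \<notin> C \<longrightarrow> P r) at_top"
  shows "eventually (\<lambda>r. \<forall>R. R \<notin> C \<longrightarrow> r \<le> R \<longrightarrow> P R) at_top"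
  using assms unfolding eventually_at_top_linorder by (meson order_trans)

lemma small_add: "small E \<Longrightarrow> small E' \<Longrightarrow> small (\<lambda>r. E r + E' r)"
  unfolding small_def
proof (intro allI impI)
  fix \<epsilon> :: real assume E: "\<forall>\<epsilon>>0. \<forall>\<^sub>F r in at_top. win r \<longrightarrow> E r \<le> \<epsilon> * T r"
    "\<forall>\<epsilon>>0. \<forall>\<^sub>F r in at_top. win r \<longrightarrow> E' r \<le> \<epsilon> * T r" and e: "\<epsilon> > 0"
  have "\<epsilon> / 2 > 0" using e by simp
  from E(1)[rule_format, OF this] E(2)[rule_format, OF this]
  show "\<forall>\<^sub>F r in at_top. win r \<longrightarrow> E r + E' r \<le> \<epsilon> * T r"
  proof eventually_elim
    case (elim r)
    have "\<epsilon> * T r = \<epsilon> / 2 * T r + \<epsilon> / 2 * T r" by simp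
    thus ?case using elim by linarith
  qed
qed

lemma small_zero: "small (\<lambda>_. 0)"
  unfolding small_def
proof (intro allI impI)
  fix \<epsilon> :: real assume "\<epsilon> > 0"
  thus "\<forall>\<^sub>F r in at_top. win r \<longrightarrow> 0 \<le> \<epsilon> * T r"
    using const_le_T[of 0] unfolding win_def by (auto elim!: eventually_mono)
qed

lemma small_sum: "finite I \<Longrightarrow> (\<And>i. i \<in> I \<Longrightarrow> small (E i)) \<Longrightarrow> small (\<lambda>r. \<Sum>i\<in>I. E i r)"
  by (induction I rule: finite_induct) (auto intro: small_zero small_add)

lemma small_mono: "small E \<Longrightarrow> eventually (\<lambda>r. win r \<longrightarrow> E' r \<le> E r) at_top \<Longrightarrow> small E'"
  unfolding small_def by (fastforce elim: eventually_elim2)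

lemma small_cmult:
  assumes "small E" "k > 0"
  shows "small (\<lambda>r. k * E r)"
  unfolding small_def
proof (intro allI impI)
  fix \<epsilon> :: real assume "\<epsilon> > 0"
  hence "\<epsilon> / k > 0" using assms(2) by simp
  with assms(1) have "\<forall>\<^sub>F r in at_top. win r \<longrightarrow> E r \<le> \<epsilon> / k * T r" unfolding small_def by blast
  thus "\<forall>\<^sub>F r in at_top. win r \<longrightarrow> k * E r \<le> \<epsilon> * T r"
    by eventually_elim (use assms(2) in \<open>auto simp: field_simps\<close>)
qed

lemma small_const: "small (\<lambda>_. K)"
  unfolding small_def
proof (intro allI impI)
  fix \<epsilon> :: real assume e: "\<epsilon> > 0"
  from const_le_T[of "K / \<epsilon>"] show "\<forall>\<^sub>F r in at_top. win r \<longrightarrow> K \<le> \<epsilon> * T r"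
    by eventually_elim (use e in \<open>auto simp: win_def field_simps\<close>)
qed

lemma small_ln: "small ln"
  unfolding small_def
proof (intro allI impI)
  fix \<epsilon> :: real assume "\<epsilon> > 0"
  from ln_small[OF this] show "\<forall>\<^sub>F r in at_top. win r \<longrightarrow> ln r \<le> \<epsilon> * T r"
    by eventually_elim (auto simp: win_def)
qed

lemma small_powr:
  assumes "\<alpha> > 0"
  shows "small (\<lambda>r. M * r powr (-\<alpha>) * T r)"
  unfolding small_def
proof (intro allI impI)
  fix \<epsilon> :: real assume e: "\<epsilon> > 0"
  have "((\<lambda>r. M * r powr (-\<alpha>)) \<longlongrightarrow> M * 0) at_top"
    using assms by (intro tendsto_mult_left tendsto_neg_powr filterlim_ident) auto
  hence "eventually (\<lambda>r. M * r powr (-\<alpha>) < \<epsilon>) at_top" using e by (intro order_tendstoD) auto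
  thus "\<forall>\<^sub>F r in at_top. win r \<longrightarrow> M * r powr (-\<alpha>) * T r \<le> \<epsilon> * T r"
    using const_le_T[of 0] by eventually_elim (auto simp: win_def intro!: mult_right_mono)
qed

lemma count_window:
  assumes A: "majorized \<kappa> A" "covers C A"
  shows "eventually (\<lambda>r. r \<notin> C \<longrightarrow> int_count (zero_mult A) r \<le> 3 * T r) at_top"
proof -
  obtain K where K: "\<And>R. R > 0 \<Longrightarrow> (\<And>w. norm w = R \<Longrightarrow> A w \<noteq> 0) \<Longrightarrow> int_count (zero_mult A) R \<le> T R + circle_mean \<kappa> R + K"
    using int_count_majorized[OF \<kappa>(1) A(1)] by blast
  from const_le_T[of K] \<kappa>_small[of 1, simplified] eventually_gt_at_top[of 0]
  show ?thesis
  proof eventually_elim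
    case (elim r)
    show ?case
    proof
      assume r: "r \<notin> C"
      have "int_count (zero_mult A) r \<le> T r + circle_mean \<kappa> r + K"
        by (rule K[OF elim(3)]) (use coversD[OF A(2) r] in auto)
      thus "int_count (zero_mult A) r \<le> 3 * T r" using elim(1,2) r by simp
    qed
  qed
qed

text \<open>For S near the end of the window, n(R) ln (S / R) \<le> N(S) \<le> 3 T(S) \<le> 6 T(r),
  where ln (S / R) \<ge> (S - R) / S \<ge> r^(\<beta>-1) / 8; hence 48 = 6 * 8.\<close>

lemma zeros_number_window:
  assumes A: "majorized \<kappa> A" "covers C A"
  shows "eventually (\<lambda>r. win r \<longrightarrow> (\<forall>R. r \<le> R \<longrightarrow> R \<le> r + r powr \<beta> / 2 \<longrightarrow>
    zeros_number A R \<le> 48 * r powr (1 - \<beta>) * T r)) at_top"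
  using window_bound[OF count_window[OF A]] eventually_ge_at_top[of 1]
proof eventually_elim
  case (elim r)
  show ?case
  proof (intro impI allI)
    fix R assume win: "win r" and R: "r \<le> R" "R \<le> r + r powr \<beta> / 2"
    have rp: "r powr \<beta> > 0" using elim by simp
    have rb: "r powr \<beta> \<le> r" using powr_mono[of \<beta> 1 r] \<beta> elim by simp
    obtain S where S: "r + 3/4 * r powr \<beta> < S" "S < r + r powr \<beta>" "S \<notin> C"
      using ex_not_countable[OF countable_C, of "r + 3/4 * r powr \<beta>" "r + r powr \<beta>"] rp by auto
    have RS: "R < S" using R S rp by linarith
    have f: "A holomorphic_on UNIV" "\<exists>z. A z \<noteq> 0" using A(1) unfolding majorized_def by auto
    have "zeros_number A R * ln (S / R) \<le> int_count (zero_mult A) S"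
      by (rule zeros_number_le[OF f]) (use elim R RS in auto)
    also have "\<dots> \<le> 3 * T S" using elim(1) S R RS by auto
    also have "\<dots> \<le> 6 * T r" using win S R RS unfolding win_def by auto
    finally have 1: "zeros_number A R * ln (S / R) \<le> 6 * T r" .
    have "ln (S / R) \<ge> 1 - R / S"
    proof -
      have "ln (R / S) \<le> R / S - 1" using R RS elim by (intro ln_le_minus_one divide_pos_pos) auto
      moreover have "ln (R / S) = - ln (S / R)" using R RS elim by (simp add: ln_div)
      ultimately show ?thesis by simp
    qed
    also have "1 - R / S = (S - R) / S" using R RS elim by (simp add: field_simps)
    finally have "ln (S / R) \<ge> (S - R) / S" .
    moreover have "(S - R) / S \<ge> (r powr \<beta> / 4) / (2 * r)"
      by (rule frac_le) (use R RS S elim rb in auto)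
    ultimately have "ln (S / R) \<ge> r powr \<beta> / (8 * r)" by simp
    hence "zeros_number A R * (r powr \<beta> / (8 * r)) \<le> 6 * T r"
      using 1 mult_left_mono[of "r powr \<beta> / (8 * r)" "ln (S / R)" "zeros_number A R"] by simp
    hence "zeros_number A R \<le> 48 * (r / r powr \<beta>) * T r"
      using elim rp by (simp add: field_simps)
    also have "r / r powr \<beta> = r powr (1 - \<beta>)" using elim by (simp add: powr_diff)
    finally show "zeros_number A R \<le> 48 * r powr (1 - \<beta>) * T r" .
  qed
qed

lemma abs_quotient_window:
  assumes "majorized \<kappa> A" "majorized \<kappa> B" "covers C A" "covers C B"
  shows "eventually (\<lambda>r. r \<notin> C \<longrightarrow> circle_mean (\<lambda>w. \<bar>ln (norm (A w)) - ln (norm (B w))\<bar>) r \<le> 5 * T r) at_top"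
proof -
  obtain K where K: "\<And>R. R \<ge> 1 \<Longrightarrow> (\<And>w. norm w = R \<Longrightarrow> A w \<noteq> 0 \<and> B w \<noteq> 0) \<Longrightarrow>
    circle_mean (\<lambda>w. \<bar>ln (norm (A w)) - ln (norm (B w))\<bar>) R \<le> 2 * T R + 2 * circle_mean \<kappa> R + K"
    using circle_mean_abs_quotient[OF \<kappa>(1) assms(1,2)] by blast
  from const_le_T[of K] \<kappa>_small[of 1, simplified] eventually_ge_at_top[of 1]
  show ?thesis
  proof eventually_elim
    case (elim r)
    show ?case
    proof
      assume r: "r \<notin> C"
      have "circle_mean (\<lambda>w. \<bar>ln (norm (A w)) - ln (norm (B w))\<bar>) r \<le> 2 * T r + 2 * circle_mean \<kappa> r + K"
        by (rule K[OF elim(3)]) (use coversD[OF assms(3) r] coversD[OF assms(4) r] in auto)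
      thus "circle_mean (\<lambda>w. \<bar>ln (norm (A w)) - ln (norm (B w))\<bar>) r \<le> 5 * T r" using elim(1,2) r by simp
    qed
  qed
qed

lemma small_log_difference:
  assumes AB: "majorized \<kappa> A" "majorized \<kappa> B" "covers C A" "covers C B"
    "covers C (\<lambda>z. A (z + w))" "covers C (\<lambda>z. B (z + w))"
  shows "small (\<lambda>r. circle_mean (\<lambda>z. \<bar>(ln (norm (A (z + w))) - ln (norm (B (z + w)))) - (ln (norm (A z)) - ln (norm (B z)))\<bar>) r)"
proof -
  \<comment> \<open>With this exponent the zeros cost r^(-\<delta>) r^(1-\<beta>) T = r^(-\<beta>/2)
    T, while R - r \<ge> r^\<beta> / 4 makes the Poisson part cost O(r^(-\<beta>) T).\<close>
  define \<delta> where "\<delta> = 1 - \<beta> / 2"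
  have \<delta>: "0 < \<delta>" "\<delta> < 1" unfolding \<delta>_def using \<beta> by auto
  have f: "A holomorphic_on UNIV" "B holomorphic_on UNIV" using AB(1,2) unfolding majorized_def by auto
  define D where "D r = circle_mean (\<lambda>z. \<bar>(ln (norm (A (z + w))) - ln (norm (B (z + w)))) - (ln (norm (A z)) - ln (norm (B z)))\<bar>) r" for r
  show ?thesis
  proof (rule log_difference_mean_le[OF \<delta>, of w])
    fix K :: real assume K0: "K > 0" and KK:
     "\<And>A B r R. A holomorphic_on UNIV \<Longrightarrow> B holomorphic_on UNIV \<Longrightarrow> 0 < r \<Longrightarrow> r < R \<Longrightarrow> 2 * norm w \<le> R - r \<Longrightarrow>
       (\<And>z. norm z = r \<Longrightarrow> A z \<noteq> 0 \<and> B z \<noteq> 0 \<and> A (z + w) \<noteq> 0 \<and> B (z + w) \<noteq> 0) \<Longrightarrow>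
       (\<And>z. norm z = R \<Longrightarrow> A z \<noteq> 0 \<and> B z \<noteq> 0) \<Longrightarrow>
       circle_mean (\<lambda>z. \<bar>(ln (norm (A (z + w))) - ln (norm (B (z + w)))) - (ln (norm (A z)) - ln (norm (B z)))\<bar>) r
        \<le> 16 * (norm w / (R - r)) * circle_mean (\<lambda>w. \<bar>ln (norm (A w)) - ln (norm (B w))\<bar>) R
           + K * r powr (-\<delta>) * (zeros_number A R + zeros_number B R)"
    note K = K0 KK[OF f, folded D_def]
    have far: "eventually (\<lambda>r. 2 * norm w \<le> r powr \<beta> / 4) at_top"
    proof -
      have "filterlim (\<lambda>r::real. r powr \<beta>) at_top at_top" using \<beta> by real_asymp
      hence "eventually (\<lambda>r. 8 * norm w \<le> r powr \<beta>) at_top" by (auto simp: filterlim_at_top)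
      thus ?thesis by eventually_elim auto
    qed
    have "small (\<lambda>r. (640 * norm w) * r powr (-\<beta>) * T r + (96 * K) * r powr (-(\<beta>/2)) * T r)"
      by (intro small_add small_powr) (use \<beta> in auto)
    moreover have "eventually (\<lambda>r. win r \<longrightarrow> D r \<le> (640 * norm w) * r powr (-\<beta>) * T r + (96 * K) * r powr (-(\<beta>/2)) * T r) at_top"
      using far eventually_ge_at_top[of 1] zeros_number_window[OF AB(1,3)] zeros_number_window[OF AB(2,4)]
        window_bound[OF abs_quotient_window[OF AB(1-4)]]
    proof eventually_elim
      case (elim r)
      show ?case
      proof
        assume win: "win r"
        have rp: "r powr \<beta> > 0" using elim by simp
        obtain R where R: "r + 1/4 * r powr \<beta> < R" "R < r + 1/2 * r powr \<beta>" "R \<notin> C"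
          using ex_not_countable[OF countable_C, of "r + 1/4 * r powr \<beta>" "r + 1/2 * r powr \<beta>"] rp by auto
        have rC: "r \<notin> C" using win unfolding win_def by simp
        have TR: "T R \<le> 2 * T r" using win R rp unfolding win_def by auto
        have "D r \<le> 16 * (norm w / (R - r)) * circle_mean (\<lambda>w. \<bar>ln (norm (A w)) - ln (norm (B w))\<bar>) R
           + K * r powr (-\<delta>) * (zeros_number A R + zeros_number B R)"
          by (rule K(2)) (use elim R rp coversD[OF AB(3) R(3)] coversD[OF AB(4) R(3)] coversD[OF AB(3) rC] coversD[OF AB(4) rC]
            coversD[OF AB(5) rC] coversD[OF AB(6) rC] in auto)
        also have "\<dots> \<le> 16 * (norm w / (r powr \<beta> / 4)) * (10 * T r) + K * r powr (-\<delta>) * (48 * r powr (1 - \<beta>) * T r + 48 * r powr (1 - \<beta>) * T r)"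
        proof (intro add_mono mult_mono mult_left_mono divide_left_mono)
          show "circle_mean (\<lambda>w. \<bar>ln (norm (A w)) - ln (norm (B w))\<bar>) R \<le> 10 * T r"
            using elim(5)[rule_format, OF R(3)] TR R rp by auto
          show "zeros_number A R \<le> 48 * r powr (1 - \<beta>) * T r" "zeros_number B R \<le> 48 * r powr (1 - \<beta>) * T r"
            using elim(3,4) win R rp by auto
          show "0 \<le> circle_mean (\<lambda>w. \<bar>ln (norm (A w)) - ln (norm (B w))\<bar>) R"
            using R rp elim coversD[OF AB(3) R(3)] coversD[OF AB(4) R(3)]
            by (intro circle_mean_nonneg continuous_intros continuous_on_ln_norm f) auto
        qed (use R rp K(1) in \<open>auto intro!: mult_pos_pos\<close>)
        also have "\<dots> = (640 * norm w) * r powr (-\<beta>) * T r + (96 * K) * (r powr (-\<delta>) * r powr (1 - \<beta>)) * T r"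
          by (simp add: powr_minus field_simps)
        also have "r powr (-\<delta>) * r powr (1 - \<beta>) = r powr (-(\<beta>/2))"
          unfolding \<delta>_def by (simp flip: powr_add)
        finally show "D r \<le> (640 * norm w) * r powr (-\<beta>) * T r + (96 * K) * r powr (-(\<beta>/2)) * T r" .
      qed
    qed
    ultimately show ?thesis unfolding D_def by (rule small_mono)
  qed
qed

text \<open>Jensen turns both means into counting functions. The shift costs a factor 1 + \<eta> and
  an increase of the radius by s = |w|, and the latter changes N by at most n(r + s) s / r =
  O(r^(-\<beta>) T).\<close>

lemma small_shift_mean:
  assumes B: "majorized \<kappa> B" "covers C B" "covers C (\<lambda>z. B (z + w))"
  shows "small (\<lambda>r. circle_mean (\<lambda>z. ln (norm (B (z + w)))) r - circle_mean (\<lambda>z. ln (norm (B z))) r)"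
  unfolding small_def
proof (intro allI impI)
  fix \<epsilon> :: real assume e: "\<epsilon> > 0"
  \<comment> \<open>Within the window N(r + s) \<le> 3 T(R) \<le> 6 T(r), so \<eta> N(r + s) uses up
    half of \<epsilon> T(r).\<close>
  define \<eta> where "\<eta> = \<epsilon> / 12"
  have \<eta>: "\<eta> > 0" unfolding \<eta>_def using e by simp
  define s where "s = norm w"
  have f: "B holomorphic_on UNIV" "\<exists>z. B z \<noteq> 0" using B(1) unfolding majorized_def by auto
  have f': "(\<lambda>z. B (z + w)) holomorphic_on UNIV" "\<exists>z. B (z + w) \<noteq> 0"
    using shift_holomorphic[OF f(1)] f(2) by (auto intro: exI[of _ "_ - w"])
  obtain K1 where K1: "\<And>R. R > 0 \<Longrightarrow> (\<And>w. norm w = R \<Longrightarrow> B w \<noteq> 0) \<Longrightarrow>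
    circle_mean (\<lambda>w. ln (norm (B w))) R = K1 + int_count (zero_mult B) R" using jensen[OF f] by blast
  obtain K2 where K2: "\<And>R. R > 0 \<Longrightarrow> (\<And>z. norm z = R \<Longrightarrow> B (z + w) \<noteq> 0) \<Longrightarrow>
    circle_mean (\<lambda>z. ln (norm (B (z + w)))) R = K2 + int_count (zero_mult (\<lambda>z. B (z + w))) R" using jensen[OF f'] by blast
  obtain K3 where K3: "K3 \<ge> 0" "\<And>r. r \<ge> 1 \<Longrightarrow> int_count (zero_mult (\<lambda>z. B (z + w))) r
    \<le> (1 + \<eta>) * int_count (zero_mult B) (r + s) + K3 * (1 + ln r)"
    unfolding s_def using shifted_count_le[OF f \<eta>, of w] by blast
  have far: "eventually (\<lambda>r. s \<le> r powr \<beta> / 4) at_top"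
  proof -
    have "filterlim (\<lambda>r::real. r powr \<beta>) at_top at_top" using \<beta> by real_asymp
    hence "eventually (\<lambda>r. 4 * s \<le> r powr \<beta>) at_top" by (auto simp: filterlim_at_top)
    thus ?thesis by eventually_elim auto
  qed
  define E where "E r = (K2 - K1 + K3) + (K3 + 1) * ln r + (48 * s) * r powr (-\<beta>) * T r" for r
  have "small E" unfolding E_def
    by (intro small_add small_const small_cmult[OF small_ln] small_powr \<beta>) (use K3 in auto)
  moreover have "\<epsilon> / 2 > 0" using e by simp
  ultimately have "eventually (\<lambda>r. win r \<longrightarrow> E r \<le> \<epsilon>/2 * T r) at_top" unfolding small_def by blast
  thus "eventually (\<lambda>r. win r \<longrightarrow> circle_mean (\<lambda>z. ln (norm (B (z + w)))) r - circle_mean (\<lambda>z. ln (norm (B z))) r \<le> \<epsilon> * T r) at_top"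
    using far eventually_ge_at_top[of 1] zeros_number_window[OF B(1,2)] window_bound[OF count_window[OF B(1,2)]]
  proof eventually_elim
    case (elim r)
    show ?case
    proof
      assume win: "win r"
      have rp: "r powr \<beta> > 0" using elim by simp
      have s0: "s \<ge> 0" unfolding s_def by simp
      obtain R where R: "r + 1/4 * r powr \<beta> < R" "R < r + 1/2 * r powr \<beta>" "R \<notin> C"
        using ex_not_countable[OF countable_C, of "r + 1/4 * r powr \<beta>" "r + 1/2 * r powr \<beta>"] rp by auto
      have rC: "r \<notin> C" using win unfolding win_def by simp
      have TR: "T R \<le> 2 * T r" using win R rp unfolding win_def by auto
      have rs: "r + s \<le> R" using elim R by auto
      have fin: "finite {z \<in> cball 0 R. zero_mult B z \<noteq> 0}"
        unfolding zero_mult_support[OF f] by (rule finite_zeros_in[OF f])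
      have "int_count (zero_mult B) (r + s) \<le> int_count (zero_mult B) R"
      proof -
        have "(\<Sum>a\<in>{z \<in> cball 0 (r+s). zero_mult B z \<noteq> 0}. real (zero_mult B a)) * ln (R / (r + s)) \<ge> 0"
          using rs elim(3) s0 by (intro mult_nonneg_nonneg sum_nonneg) auto
        moreover have "0 < r + s" using elim(3) s0 by linarith
        ultimately show ?thesis using int_count_mono_radius[OF fin _ rs] by linarith
      qed
      also have "\<dots> \<le> 3 * T R" using elim(5)[rule_format, OF R(3)] R rp by auto
      finally have N1: "\<eta> * int_count (zero_mult B) (r + s) \<le> \<eta> * (6 * T r)"
        using TR \<eta> by (intro mult_left_mono) auto
      have zn: "zeros_number B (r + s) \<le> 48 * r powr (1 - \<beta>) * T r"
        using elim(4) win elim s0 by auto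
      have "ln ((r + s) / r) \<le> s / r" using ln_add_one_self_le_self[of "s/r"] s0 elim by (simp add: add_divide_distrib)
      hence "zeros_number B (r + s) * ln ((r + s) / r) \<le> zeros_number B (r + s) * (s / r)" by (intro mult_left_mono) auto
      also have "\<dots> \<le> 48 * r powr (1 - \<beta>) * T r * (s / r)" using s0 elim by (intro mult_right_mono zn) auto
      also have "\<dots> = (48 * s) * r powr (-\<beta>) * T r"
        using elim by (simp add: powr_diff powr_minus field_simps)
      finally have "zeros_number B (r + s) * ln ((r + s) / r) \<le> (48 * s) * r powr (-\<beta>) * T r" .
      moreover have "int_count (zero_mult B) (r + s) \<le> int_count (zero_mult B) r + zeros_number B (r + s) * ln ((r + s) / r)"
        by (rule int_count_radius_le[OF f]) (use elim s0 in auto)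
      moreover have "circle_mean (\<lambda>z. ln (norm (B (z + w)))) r = K2 + int_count (zero_mult (\<lambda>z. B (z + w))) r"
        by (rule K2) (use elim coversD[OF B(3) rC] in auto)
      moreover have "circle_mean (\<lambda>z. ln (norm (B z))) r = K1 + int_count (zero_mult B) r"
        by (rule K1) (use elim coversD[OF B(2) rC] in auto)
      moreover have "(1 + \<eta>) * int_count (zero_mult B) (r + s) = int_count (zero_mult B) (r + s) + \<eta> * int_count (zero_mult B) (r + s)"
        by (simp add: distrib_right)
      moreover have "K3 * (1 + ln r) \<le> K3 + (K3 + 1) * ln r" using elim by (simp add: algebra_simps)
      moreover have "\<eta> * (6 * T r) = \<epsilon>/2 * T r" unfolding \<eta>_def by simp
      moreover have "(K2 - K1 + K3) + (K3 + 1) * ln r + (48 * s) * r powr (-\<beta>) * T r \<le> \<epsilon>/2 * T r"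
        using elim(1) win unfolding E_def by blast
      moreover have "\<epsilon> * T r = \<epsilon>/2 * T r + \<epsilon>/2 * T r" by simp
      moreover note K3(2)[OF elim(3)] N1
      ultimately show "circle_mean (\<lambda>z. ln (norm (B (z + w)))) r - circle_mean (\<lambda>z. ln (norm (B z))) r \<le> \<epsilon> * T r"
        by linarith
    qed
  qed
qed

end

section \<open>Determinants of matrices of functions\<close>

text \<open>Taking a plain two-index family makes entries that depend on a point easy to write, and
  leading minors arise by changing N alone.\<close>

definition fdet :: "nat \<Rightarrow> (nat \<Rightarrow> nat \<Rightarrow> complex) \<Rightarrow> complex" where
  "fdet N f = Determinant.det (Matrix.mat N N (\<lambda>(i,j). f i j))"

lemma fdet_expand:
  "fdet N f = (\<Sum>p\<in>{p. p permutes {0..<N}}. signof p * (\<Prod>i=0..<N. f i (p i)))"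
proof -
  have "(\<Prod>i=0..<N. Matrix.mat N N (\<lambda>(i,j). f i j) $$ (i, p i)) = (\<Prod>i=0..<N. f i (p i))"
    if "p permutes {0..<N}" for p
  proof (rule prod.cong)
    fix i assume "i \<in> {0..<N}"
    moreover from this have "p i \<in> {0..<N}" using permutes_in_image[OF that] by blast
    ultimately show "Matrix.mat N N (\<lambda>(i,j). f i j) $$ (i, p i) = f i (p i)" by simp
  qed simp
  thus ?thesis unfolding fdet_def
    by (subst det_def'[of _ N]) (auto intro!: sum.cong)
qed

lemma fdet_cong:
  assumes "\<And>i j. i < N \<Longrightarrow> j < N \<Longrightarrow> f i j = h i j"
  shows "fdet N f = fdet N h"
  unfolding fdet_def by (rule arg_cong[where f = Determinant.det]) (auto intro!: eq_matI simp: assms)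

lemma abs_sign: "\<bar>real_of_int (sign p)\<bar> = 1"
  by (simp add: sign_def)

lemma fdet_mult: "fdet N (\<lambda>i k. \<Sum>j<N. f i j * h j k) = fdet N f * fdet N h"
proof -
  have "Matrix.mat N N (\<lambda>(i,k). \<Sum>j<N. f i j * h j k) = Matrix.mat N N (\<lambda>(i,j). f i j) * Matrix.mat N N (\<lambda>(i,j). h i j)"
    by (rule eq_matI) (auto simp: scalar_prod_def atLeast0LessThan)
  moreover have "Determinant.det (Matrix.mat N N (\<lambda>(i,j). f i j) * Matrix.mat N N (\<lambda>(i,j). h i j))
      = Determinant.det (Matrix.mat N N (\<lambda>(i,j). f i j)) * Determinant.det (Matrix.mat N N (\<lambda>(i,j). h i j))"
    by (rule Determinant.det_mult[of _ N]) auto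
  ultimately show ?thesis unfolding fdet_def by (simp only:)
qed

lemma fdet_cramer:
  assumes "k < N"
  shows "fdet N (\<lambda>i j. if j = k then \<Sum>j<N. f i j * x j else f i j) = x k * fdet N f"
proof -
  let ?A = "Matrix.mat N N (\<lambda>(i,j). f i j)" and ?x = "Matrix.vec N x"
  have "Matrix.mat N N (\<lambda>(i,j). if j = k then \<Sum>j<N. f i j * x j else f i j) = replace_col ?A (?A *\<^sub>v ?x) k"
    unfolding replace_col_def by (rule eq_matI) (auto simp: scalar_prod_def atLeast0LessThan)
  moreover have "Determinant.det (replace_col ?A (?A *\<^sub>v ?x) k) = Matrix.vec_index ?x k * Determinant.det ?A"
    by (rule cramer_lemma_mat) (use assms in auto)
  ultimately show ?thesis unfolding fdet_def using assms by (simp only: index_vec)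
qed

lemma fdet_holomorphic:
  assumes "\<And>i j. i < N \<Longrightarrow> j < N \<Longrightarrow> f i j holomorphic_on S"
  shows "(\<lambda>z. fdet N (\<lambda>i j. f i j z)) holomorphic_on S"
proof (subst fdet_expand, rule holomorphic_on_sum)
  fix p assume p: "p \<in> {p. p permutes {0..<N}}"
  have "(\<lambda>z. \<Prod>i=0..<N. f i (p i) z) holomorphic_on S"
  proof (rule holomorphic_on_prod)
    fix i assume i: "i \<in> {0..<N}"
    hence "p i \<in> {0..<N}" using permutes_in_image[of p "{0..<N}" i] p by simp
    thus "f i (p i) holomorphic_on S" using assms[of i "p i"] i by simp
  qed
  thus "(\<lambda>z. signof p * (\<Prod>i=0..<N. f i (p i) z)) holomorphic_on S"
    by (rule holomorphic_on_mult[OF holomorphic_on_const])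
qed

lemma norm_fdet_le:
  assumes "\<And>p. p permutes {0..<N} \<Longrightarrow> (\<Prod>i=0..<N. norm (f i (p i))) \<le> b"
  shows "norm (fdet N f) \<le> fact N * b"
proof -
  have "norm (fdet N f) \<le> (\<Sum>p\<in>{p. p permutes {0..<N}}. norm (signof p * (\<Prod>i=0..<N. f i (p i))))"
    by (subst fdet_expand) (rule norm_sum)
  also have "\<dots> = (\<Sum>p\<in>{p. p permutes {0..<N}}. (\<Prod>i=0..<N. norm (f i (p i))))"
    by (simp add: norm_mult prod_norm abs_sign)
  also have "\<dots> \<le> (\<Sum>p\<in>{p. p permutes {0..<N}}. b)" by (intro sum_mono assms) simp
  also have "\<dots> = fact N * b" by (simp add: card_permutations)
  finally show ?thesis .
qed

text \<open>Vanishing to order at least m as divisibility. Unlike \<open>zero_mult\<close> it is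
  meaningful for the zero function, so sums, products and determinants can be treated without
  nonvanishing hypotheses.\<close>

definition ord_ge :: "(complex \<Rightarrow> complex) \<Rightarrow> complex \<Rightarrow> nat \<Rightarrow> bool" where
  "ord_ge f z m \<longleftrightarrow> (\<exists>e. e holomorphic_on UNIV \<and> (\<forall>w. f w = (w - z) ^ m * e w))"

lemma ord_ge_zero_mult:
  assumes "f holomorphic_on UNIV" "\<exists>w. f w \<noteq> 0"
  shows "ord_ge f z m \<longleftrightarrow> m \<le> zero_mult f z"
proof -
  obtain k where k: "k holomorphic_on UNIV" "\<And>w. f w = (w - z) ^ zero_mult f z * k w" "k z \<noteq> 0"
    using entire_factor_at[OF assms, of z] by blast
  show ?thesis
  proof
    assume "m \<le> zero_mult f z"
    hence "f w = (w - z) ^ m * ((w - z) ^ (zero_mult f z - m) * k w)" for w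
      by (subst k(2)) (simp flip: power_add mult.assoc)
    thus "ord_ge f z m" unfolding ord_ge_def
      by (intro exI[of _ "\<lambda>w. (w - z) ^ (zero_mult f z - m) * k w"]) (auto intro!: holomorphic_intros k)
  next
    assume "ord_ge f z m"
    then obtain e where e: "e holomorphic_on UNIV" "\<And>w. f w = (w - z) ^ m * e w" unfolding ord_ge_def by blast
    have e0: "\<exists>w. e w \<noteq> 0" using assms(2) e(2) by (metis mult_zero_right)
    obtain h where h: "h holomorphic_on UNIV" "\<And>w. e w = (w - z) ^ zero_mult e z * h w" "h z \<noteq> 0"
      using entire_factor_at[OF e(1) e0, of z] by blast
    have "zero_mult f z = m + zero_mult e z"
      by (rule zero_mult_unique[OF h(1) _ h(3)]) (simp add: e(2) power_add h(2)[symmetric] mult.assoc)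
    thus "m \<le> zero_mult f z" by simp
  qed
qed

lemma ord_ge_mono: "ord_ge f z m \<Longrightarrow> k \<le> m \<Longrightarrow> ord_ge f z k"
  unfolding ord_ge_def
proof (elim exE conjE)
  fix e assume e: "e holomorphic_on UNIV" "\<forall>w. f w = (w - z) ^ m * e w" and k: "k \<le> m"
  show "\<exists>e. e holomorphic_on UNIV \<and> (\<forall>w. f w = (w - z) ^ k * e w)"
    by (intro exI[of _ "\<lambda>w. (w - z) ^ (m - k) * e w"])
       (use e k in \<open>auto intro!: holomorphic_intros simp flip: power_add mult.assoc\<close>)
qed

lemma ord_ge_0: "f holomorphic_on UNIV \<Longrightarrow> ord_ge f z 0"
  unfolding ord_ge_def by auto

lemma ord_ge_mult: "ord_ge f z m \<Longrightarrow> ord_ge h z k \<Longrightarrow> ord_ge (\<lambda>w. f w * h w) z (m + k)"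
  unfolding ord_ge_def
proof (elim exE conjE)
  fix e e' assume "e holomorphic_on UNIV" "\<forall>w. f w = (w - z) ^ m * e w" "e' holomorphic_on UNIV" "\<forall>w. h w = (w - z) ^ k * e' w"
  thus "\<exists>e. e holomorphic_on UNIV \<and> (\<forall>w. f w * h w = (w - z) ^ (m + k) * e w)"
    by (intro exI[of _ "\<lambda>w. e w * e' w"]) (auto intro!: holomorphic_intros simp: power_add)
qed

lemma ord_ge_sum:
  assumes "finite I" "\<And>i. i \<in> I \<Longrightarrow> ord_ge (f i) z m"
  shows "ord_ge (\<lambda>w. \<Sum>i\<in>I. f i w) z m"
proof -
  have "\<forall>i\<in>I. \<exists>e. e holomorphic_on UNIV \<and> (\<forall>w. f i w = (w - z) ^ m * e w)"
    using assms(2) unfolding ord_ge_def by blast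
  then obtain e where e: "\<And>i. i \<in> I \<Longrightarrow> e i holomorphic_on UNIV" "\<And>i w. i \<in> I \<Longrightarrow> f i w = (w - z) ^ m * e i w"
    by metis
  have "(\<Sum>i\<in>I. f i w) = (w - z) ^ m * (\<Sum>i\<in>I. e i w)" for w
    unfolding sum_distrib_left by (rule sum.cong) (use e in auto)
  moreover have "(\<lambda>w. \<Sum>i\<in>I. e i w) holomorphic_on UNIV" by (intro holomorphic_intros e)
  ultimately show ?thesis unfolding ord_ge_def by blast
qed

lemma ord_ge_prod:
  assumes "finite I" "\<And>i. i \<in> I \<Longrightarrow> ord_ge (f i) z (m i)"
  shows "ord_ge (\<lambda>w. \<Prod>i\<in>I. f i w) z (\<Sum>i\<in>I. m i)"
  using assms
proof (induction I rule: finite_induct)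
  case empty
  show ?case by (simp add: ord_ge_0)
next
  case (insert i I)
  thus ?case using ord_ge_mult[of "f i" z "m i" "\<lambda>w. \<Prod>i\<in>I. f i w"] by simp
qed

lemma ord_ge_fdet:
  assumes "\<And>p. p permutes {0..<N} \<Longrightarrow> ord_ge (\<lambda>w. \<Prod>i=0..<N. f i (p i) w) z m"
  shows "ord_ge (\<lambda>w. fdet N (\<lambda>i j. f i j w)) z m"
proof (subst fdet_expand, rule ord_ge_sum)
  fix p assume "p \<in> {p. p permutes {0..<N}}"
  hence "ord_ge (\<lambda>w. \<Prod>i=0..<N. f i (p i) w) z m" using assms by simp
  from ord_ge_mult[OF ord_ge_0[of "\<lambda>_. signof p"] this]
  show "ord_ge (\<lambda>w. signof p * (\<Prod>i=0..<N. f i (p i) w)) z m" by simp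
qed (simp add: finite_permutations)

lemma zero_mult_mult:
  assumes "f holomorphic_on UNIV" "\<exists>w. f w \<noteq> 0" "h holomorphic_on UNIV" "\<exists>w. h w \<noteq> 0"
  shows "zero_mult (\<lambda>w. f w * h w) z = zero_mult f z + zero_mult h z"
proof -
  obtain k where k: "k holomorphic_on UNIV" "\<And>w. f w = (w - z) ^ zero_mult f z * k w" "k z \<noteq> 0"
    using entire_factor_at[OF assms(1,2), of z] by blast
  obtain l where l: "l holomorphic_on UNIV" "\<And>w. h w = (w - z) ^ zero_mult h z * l w" "l z \<noteq> 0"
    using entire_factor_at[OF assms(3,4), of z] by blast
  show ?thesis
  proof (rule zero_mult_unique[of "\<lambda>w. k w * l w"])
    fix w
    show "f w * h w = (w - z) ^ (zero_mult f z + zero_mult h z) * (k w * l w)"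
      unfolding k(2)[of w] l(2)[of w] by (simp add: power_add)
  qed (use k l in \<open>auto intro!: holomorphic_intros\<close>)
qed

text \<open>Greedy choice of a minimum m times. It serves for the values |f_j z| and, with negated
  values, for multiplicities.\<close>

lemma ex_subset_least:
  fixes v :: "'a \<Rightarrow> 'b::linorder"
  assumes "finite S" "m \<le> card S"
  shows "\<exists>J\<subseteq>S. card J = m \<and> (\<forall>j\<in>S - J. \<forall>i\<in>J. v i \<le> v j)"
  using assms(2)
proof (induction m)
  case 0
  show ?case by (intro exI[of _ "{}"]) auto
next
  case (Suc m)
  then obtain J where J: "J \<subseteq> S" "card J = m" "\<forall>j\<in>S - J. \<forall>i\<in>J. v i \<le> v j" by auto
  have fJ: "finite J" using J(1) assms(1) finite_subset by blast
  have ne: "S - J \<noteq> {}"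
  proof
    assume "S - J = {}"
    hence "card S \<le> card J" by (intro card_mono fJ) auto
    thus False using J(2) Suc.prems by simp
  qed
  have fin: "finite (S - J)" using assms(1) by simp
  have "Min (v ` (S - J)) \<in> v ` (S - J)" using ne fin by (intro Min_in) auto
  then obtain k where k0: "k \<in> S - J" "v k = Min (v ` (S - J))" by auto
  have k: "k \<in> S - J" "\<And>j. j \<in> S - J \<Longrightarrow> v k \<le> v j" using k0 fin by auto
  show ?case
    by (intro exI[of _ "insert k J"]) (use J k fJ in auto)
qed

section \<open>The second main inequality for a family of operators\<close>

lemma ln_plus_nonneg [simp]: "ln_plus x \<ge> 0"
  unfolding ln_plus_def by simp

lemma le_exp_ln_plus: "x \<le> exp (ln_plus x)"
  unfolding ln_plus_def by (auto simp: max_def)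

lemma ln_le_ln_plus: "x > 0 \<Longrightarrow> ln x \<le> ln_plus x"
  unfolding ln_plus_def by (auto simp: max_def)

lemma ln_plus_diff: "x > 0 \<Longrightarrow> ln_plus x - ln_plus (1 / x) = ln x"
  unfolding ln_plus_def by (auto simp: max_def ln_div)

lemma continuous_on_ln_plus: "continuous_on S u \<Longrightarrow> continuous_on S (\<lambda>z. ln_plus (u z))"
  unfolding ln_plus_def by (intro continuous_intros) (auto simp: max_def)

lemma sum_inj_le:
  fixes u :: "'b \<Rightarrow> real"
  assumes "inj_on h I" "h ` I \<subseteq> S" "finite S" "\<And>s. s \<in> S \<Longrightarrow> u s \<ge> 0"
  shows "(\<Sum>i\<in>I. u (h i)) \<le> (\<Sum>s\<in>S. u s)"
proof -
  have "(\<Sum>i\<in>I. u (h i)) = (\<Sum>s\<in>h ` I. u s)" using assms(1) by (simp add: sum.reindex)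
  also have "\<dots> \<le> (\<Sum>s\<in>S. u s)" by (rule sum_mono2) (use assms in auto)
  finally show ?thesis .
qed

lemma prod_permutes:
  assumes "p permutes {0..<N}"
  shows "(\<Prod>l=0..<N. u (p l)) = (\<Prod>i=0..<N. u i)"
  using prod.permute[OF assms, of u] by (simp add: o_def)

text \<open>The weight with which a point counts in \<open>int_count\<close>; the value at 0 stems
  from the term n(0) log r. With it, inequalities between multiplicities can be integrated point by
  point.\<close>

definition log_weight :: "real \<Rightarrow> complex \<Rightarrow> real" where
  "log_weight r a = (if a = 0 then ln r else ln (r / norm a))"

lemma log_weight_nonneg: "1 \<le> r \<Longrightarrow> norm a \<le> r \<Longrightarrow> log_weight r a \<ge> 0"
  unfolding log_weight_def by auto

lemma int_count_eq_sum:
  assumes "r > 0" "finite W" "W \<subseteq> cball 0 r" "\<And>z. norm z \<le> r \<Longrightarrow> \<mu> z \<noteq> 0 \<Longrightarrow> z \<in> W"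
  shows "int_count \<mu> r = (\<Sum>a\<in>W. \<mu> a * log_weight r a)"
proof -
  let ?S = "{z \<in> cball 0 r. \<mu> z \<noteq> 0}"
  have sub: "?S \<subseteq> W" using assms(4) by auto
  have fin: "finite ?S" by (rule finite_subset[OF sub assms(2)])
  have "(\<Sum>a\<in>W. \<mu> a * log_weight r a) = (\<Sum>a\<in>?S. \<mu> a * log_weight r a)"
    by (rule sum.mono_neutral_right[OF assms(2) sub]) (use assms(3) in auto)
  also have "\<dots> = \<mu> 0 * ln r + (\<Sum>a\<in>?S - {0}. \<mu> a * log_weight r a)"
  proof (cases "\<mu> 0 = 0")
    case True
    hence "?S - {0} = ?S" by auto
    thus ?thesis using True by simp
  next
    case False
    thus ?thesis by (subst sum.remove[OF fin, of 0]) (use assms(1) in \<open>auto simp: log_weight_def\<close>)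
  qed
  also have "(\<Sum>a\<in>?S - {0}. \<mu> a * log_weight r a) = (\<Sum>a\<in>?S - {0}. \<mu> a * ln (r / norm a))"
    by (rule sum.cong) (auto simp: log_weight_def)
  finally show ?thesis unfolding int_count_eq[OF assms(1) fin] by simp
qed

definition enum :: "nat set \<Rightarrow> nat \<Rightarrow> nat" where
  "enum J l = sorted_list_of_set J ! l"

lemma bij_betw_enum:
  assumes "finite J" "card J = N"
  shows "bij_betw (enum J) {0..<N} J"
proof -
  have "bij_betw ((!) (sorted_list_of_set J)) {..<N} J"
    by (rule bij_betw_nth) (use assms in auto)
  thus ?thesis unfolding enum_def[abs_def] atLeast0LessThan .
qed

text \<open>\<open>ord\<close> is stated for the combinations of the \<open>L k i\<close> with the
  coefficients. They are the k-th operator applied to f_j once the coefficients commute with the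
  operators: periodic ones with shifts, constant ones with derivatives.\<close>

locale operator_curve = curve n g for n g +
  fixes q :: nat and a :: "nat \<Rightarrow> nat \<Rightarrow> complex \<Rightarrow> complex" and f :: "nat \<Rightarrow> complex \<Rightarrow> complex"
    and L :: "nat \<Rightarrow> nat \<Rightarrow> complex \<Rightarrow> complex" and E :: "complex set"
  assumes q: "n < q"
    and a_holo: "\<And>i j. i \<le> n \<Longrightarrow> j \<le> q \<Longrightarrow> a i j holomorphic_on UNIV"
    and f_eq: "\<And>j z. j \<le> q \<Longrightarrow> f j z = (\<Sum>i\<le>n. a i j z * g i z)"
    and f_nz: "\<And>j. j \<le> q \<Longrightarrow> \<exists>z. f j z \<noteq> 0"
    and detA_nz: "\<And>J. J \<subseteq> {..q} \<Longrightarrow> card J = Suc n \<Longrightarrow> \<exists>z. fdet (Suc n) (\<lambda>l i. a i (enum J l) z) \<noteq> 0"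
    and L_holo: "\<And>k i. k \<le> n \<Longrightarrow> i \<le> n \<Longrightarrow> L k i holomorphic_on UNIV"
    and detL_nz: "\<exists>z. fdet (Suc n) (\<lambda>i k. L k i z) \<noteq> 0"
    and finite_E: "finite E"
    and ord: "\<And>z k j. z \<notin> E \<Longrightarrow> k \<le> n \<Longrightarrow> j \<le> q \<Longrightarrow>
      ord_ge (\<lambda>w. \<Sum>i\<le>n. a i j w * L k i w) z (zero_mult (f j) z - n)"
begin

definition M :: "nat \<Rightarrow> nat \<Rightarrow> complex \<Rightarrow> complex" where
  "M k j z = (\<Sum>i\<le>n. a i j z * L k i z)"

definition detA :: "nat set \<Rightarrow> complex \<Rightarrow> complex" where
  "detA J z = fdet (Suc n) (\<lambda>l i. a i (enum J l) z)"

definition detL :: "complex \<Rightarrow> complex" where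
  "detL z = fdet (Suc n) (\<lambda>i k. L k i z)"

definition JJ :: "nat set set" where
  "JJ = {J. J \<subseteq> {..q} \<and> card J = Suc n}"

text \<open>One function that dominates all coefficients and their minors. In both applications its
  circle means are negligible against T.\<close>

definition A :: "complex \<Rightarrow> real" where
  "A z = (\<Sum>(i,j)\<in>{..n} \<times> {..q}. ln_plus (norm (a i j z)))"

lemma finite_JJ: "finite JJ"
  unfolding JJ_def by simp

lemma enum_bij: "J \<in> JJ \<Longrightarrow> bij_betw (enum J) {0..<Suc n} J"
  unfolding JJ_def by (intro bij_betw_enum) (auto intro: finite_subset)

lemma enum_le: "J \<in> JJ \<Longrightarrow> l < Suc n \<Longrightarrow> enum J l \<in> J \<and> enum J l \<le> q"
  using enum_bij[of J] unfolding JJ_def bij_betw_def by auto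

lemma f_holo: "j \<le> q \<Longrightarrow> f j holomorphic_on UNIV"
proof -
  assume "j \<le> q"
  hence "(\<lambda>z. \<Sum>i\<le>n. a i j z * g i z) holomorphic_on UNIV"
    by (intro holomorphic_on_sum holomorphic_on_mult a_holo holo) auto
  thus ?thesis using f_eq[OF \<open>j \<le> q\<close>] by (simp cong: holomorphic_cong)
qed

lemma M_holo: "k \<le> n \<Longrightarrow> j \<le> q \<Longrightarrow> M k j holomorphic_on UNIV"
  unfolding M_def[abs_def] by (intro holomorphic_on_sum holomorphic_on_mult a_holo L_holo) auto

lemma detA_holo: "J \<in> JJ \<Longrightarrow> detA J holomorphic_on UNIV"
  unfolding detA_def[abs_def] by (intro fdet_holomorphic a_holo) (use enum_le in auto)

lemma detL_holo: "detL holomorphic_on UNIV"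
  unfolding detL_def[abs_def] by (intro fdet_holomorphic L_holo) auto

lemma detA_nonzero: "J \<in> JJ \<Longrightarrow> \<exists>z. detA J z \<noteq> 0"
  unfolding JJ_def detA_def using detA_nz by auto

lemma detL_nonzero: "\<exists>z. detL z \<noteq> 0"
  unfolding detL_def by (rule detL_nz)

lemma A_nonneg: "A z \<ge> 0"
  unfolding A_def by (intro sum_nonneg) auto

lemma A_continuous: "continuous_on S A"
  unfolding A_def[abs_def] case_prod_unfold
  by (intro continuous_on_sum continuous_on_ln_plus continuous_on_norm holomorphic_on_imp_continuous_on
      holomorphic_on_subset[OF a_holo]) auto

lemma detM_eq:
  assumes "J \<in> JJ"
  shows "fdet (Suc n) (\<lambda>l k. M k (enum J l) z) = detA J z * detL z"
proof -
  have "fdet (Suc n) (\<lambda>l k. M k (enum J l) z) = fdet (Suc n) (\<lambda>l k. \<Sum>i<Suc n. a i (enum J l) z * L k i z)"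
    unfolding M_def by (rule fdet_cong) (simp only: lessThan_Suc_atMost)
  also have "\<dots> = detA J z * detL z" unfolding detA_def detL_def by (rule fdet_mult)
  finally show ?thesis .
qed

lemma cramer:
  assumes "J \<in> JJ" "k \<le> n"
  shows "g k z * detA J z = fdet (Suc n) (\<lambda>l i. if i = k then f (enum J l) z else a i (enum J l) z)"
proof -
  have "g k z * detA J z = fdet (Suc n) (\<lambda>l i. if i = k then \<Sum>j<Suc n. a j (enum J l) z * g j z else a i (enum J l) z)"
    unfolding detA_def using assms(2) by (intro fdet_cramer[symmetric]) simp
  also have "\<dots> = fdet (Suc n) (\<lambda>l i. if i = k then f (enum J l) z else a i (enum J l) z)"
  proof (rule fdet_cong)
    fix l i assume "l < Suc n" "i < Suc n"
    thus "(if i = k then \<Sum>j<Suc n. a j (enum J l) z * g j z else a i (enum J l) z)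
      = (if i = k then f (enum J l) z else a i (enum J l) z)"
      using f_eq[of "enum J l" z] enum_le[OF assms(1)] by (simp only: lessThan_Suc_atMost)
  qed
  finally show ?thesis .
qed

text \<open>The pairs \<open>(p l, enum J l)\<close> are distinct, so the factors belong to
  different summands of A, and the remaining summands are nonnegative.\<close>

lemma prod_entries_le:
  assumes J: "J \<in> JJ" and p: "p permutes {0..<Suc n}"
  shows "(\<Prod>l=0..<Suc n. exp (ln_plus (norm (a (p l) (enum J l) z)))) \<le> exp (A z)"
proof -
  have "(\<Sum>l=0..<Suc n. (\<lambda>(i,j). ln_plus (norm (a i j z))) ((\<lambda>l. (p l, enum J l)) l)) \<le> A z"
    unfolding A_def
  proof (rule sum_inj_le)
    show "inj_on (\<lambda>l. (p l, enum J l)) {0..<Suc n}"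
      using bij_betw_imp_inj_on[OF enum_bij[OF J]] by (auto simp: inj_on_def)
    show "(\<lambda>l. (p l, enum J l)) ` {0..<Suc n} \<subseteq> {..n} \<times> {..q}"
    proof clarify
      fix l assume l: "l \<in> {0..<Suc n}"
      hence "p l \<in> {0..<Suc n}" using permutes_in_image[OF p, of l] by simp
      thus "p l \<in> {..n} \<and> enum J l \<in> {..q}" using enum_le[OF J, of l] l by auto
    qed
  qed auto
  moreover have "(\<Prod>l=0..<Suc n. exp (ln_plus (norm (a (p l) (enum J l) z)))) = exp (\<Sum>l=0..<Suc n. ln_plus (norm (a (p l) (enum J l) z)))"
    by (rule exp_sum[symmetric]) simp
  ultimately show ?thesis by (simp only: case_prod_conv exp_le_cancel_iff)
qed

text \<open>Cramer's rule writes g_k times \<open>detA J\<close> as a determinant whose k-th column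
  consists of values of f on J. If these are small, so is every component.\<close>

lemma U_le:
  assumes J: "J \<in> JJ" and d: "detA J z \<noteq> 0" and F: "F > 0" "\<And>i. i \<in> J \<Longrightarrow> norm (f i z) \<le> F"
  shows "U z \<le> ln F + ln (fact (Suc n)) + A z + ln_plus (1 / norm (detA J z))"
proof -
  obtain k where k: "k \<le> n" "g k z \<noteq> 0" "U z = ln (norm (g k z))" using attained by blast
  have "norm (g k z * detA J z) \<le> fact (Suc n) * (F * exp (A z))"
    unfolding cramer[OF J k(1)]
  proof (rule norm_fdet_le)
    fix p assume p: "p permutes {0..<Suc n}"
    have "(\<Prod>l=0..<Suc n. norm (if p l = k then f (enum J l) z else a (p l) (enum J l) z))
       \<le> (\<Prod>l=0..<Suc n. (if p l = k then F else 1) * exp (ln_plus (norm (a (p l) (enum J l) z))))"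
    proof (rule prod_mono)
      fix l assume "l \<in> {0..<Suc n}"
      hence e: "enum J l \<in> J" using enum_le[OF J, of l] by simp
      show "0 \<le> norm (if p l = k then f (enum J l) z else a (p l) (enum J l) z) \<and>
        norm (if p l = k then f (enum J l) z else a (p l) (enum J l) z)
         \<le> (if p l = k then F else 1) * exp (ln_plus (norm (a (p l) (enum J l) z)))"
      proof (cases "p l = k")
        case True
        have "norm (f (enum J l) z) * 1 \<le> F * exp (ln_plus (norm (a (p l) (enum J l) z)))"
          using F e by (intro mult_mono) auto
        thus ?thesis using True by simp
      next
        case False
        thus ?thesis using le_exp_ln_plus by simp
      qed
    qed
    also have "\<dots> = (\<Prod>l=0..<Suc n. (if p l = k then F else 1)) * (\<Prod>l=0..<Suc n. exp (ln_plus (norm (a (p l) (enum J l) z))))"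
      by (rule prod.distrib)
    also have "(\<Prod>l=0..<Suc n. (if p l = k then F else 1)) = (\<Prod>i=0..<Suc n. (if i = k then F else 1))"
      by (rule prod_permutes[OF p, of "\<lambda>i. if i = k then F else 1"])
    also have "\<dots> = F" using k(1) by (subst prod.delta) auto
    also have "F * (\<Prod>l=0..<Suc n. exp (ln_plus (norm (a (p l) (enum J l) z)))) \<le> F * exp (A z)"
      using F prod_entries_le[OF J p] by (intro mult_left_mono) auto
    finally show "(\<Prod>l=0..<Suc n. norm (if p l = k then f (enum J l) z else a (p l) (enum J l) z)) \<le> F * exp (A z)" .
  qed
  hence le: "norm (g k z) * norm (detA J z) \<le> fact (Suc n) * (F * exp (A z))" by (simp only: norm_mult)
  have pos: "norm (g k z) > 0" "norm (detA J z) > 0" using k d by auto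
  have "ln (norm (g k z) * norm (detA J z)) \<le> ln (fact (Suc n) * (F * exp (A z)))"
    using le pos F by (intro ln_mono) auto
  also have "\<dots> = ln (fact (Suc n)) + (ln F + A z)" using F by (simp only: ln_mult_pos fact_gt_zero exp_gt_zero mult_pos_pos ln_exp)
  finally have "ln (norm (g k z)) + ln (norm (detA J z)) \<le> ln (fact (Suc n)) + (ln F + A z)"
    using pos by (simp only: ln_mult_pos)
  moreover have "- ln (norm (detA J z)) \<le> ln_plus (1 / norm (detA J z))"
    using ln_le_ln_plus[of "1 / norm (detA J z)"] pos by (simp add: ln_div)
  ultimately show ?thesis using k(3) by simp
qed

text \<open>Each product in the Leibniz expansion uses every operator index k exactly once, so the
  weights contribute the same factor, the product of all \<omega> k, to every term.\<close>

lemma detM_le: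
  assumes J: "J \<in> JJ" and f0: "\<And>j. j \<le> q \<Longrightarrow> f j z \<noteq> 0" and d: "detA J z \<noteq> 0" "detL z \<noteq> 0"
    and \<omega>: "\<And>k. k \<le> n \<Longrightarrow> \<omega> k > (0::real)"
  defines "X \<equiv> (\<Sum>(k,j)\<in>{..n} \<times> {..q}. ln_plus (norm (M k j z) * \<omega> k / norm (f j z)))"
  shows "ln (norm (detA J z)) + ln (norm (detL z)) + (\<Sum>k\<le>n. ln (\<omega> k))
    \<le> ln (fact (Suc n)) + X + (\<Sum>j\<in>J. ln (norm (f j z)))"
proof -
  define W where "W = (\<Prod>k=0..<Suc n. \<omega> k)"
  define F where "F = (\<Prod>l=0..<Suc n. norm (f (enum J l) z))"
  have W: "W > 0" unfolding W_def using \<omega> by (intro prod_pos) auto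
  have F: "F > 0" unfolding F_def using f0 enum_le[OF J] by (intro prod_pos) auto
  have "norm (detA J z * detL z) \<le> fact (Suc n) * (exp X * F / W)"
    unfolding detM_eq[OF J, symmetric]
  proof (rule norm_fdet_le)
    fix p assume p: "p permutes {0..<Suc n}"
    have pl: "p l \<le> n" if "l \<in> {0..<Suc n}" for l using permutes_in_image[OF p, of l] that by simp
    have "(\<Sum>l=0..<Suc n. (\<lambda>(k,j). ln_plus (norm (M k j z) * \<omega> k / norm (f j z))) ((\<lambda>l. (p l, enum J l)) l)) \<le> X"
      unfolding X_def
    proof (rule sum_inj_le)
      show "inj_on (\<lambda>l. (p l, enum J l)) {0..<Suc n}"
        using bij_betw_imp_inj_on[OF enum_bij[OF J]] by (auto simp: inj_on_def)
      show "(\<lambda>l. (p l, enum J l)) ` {0..<Suc n} \<subseteq> {..n} \<times> {..q}"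
        using pl enum_le[OF J] by auto
    qed auto
    moreover have "(\<Prod>l=0..<Suc n. exp (ln_plus (norm (M (p l) (enum J l) z) * \<omega> (p l) / norm (f (enum J l) z))))
        = exp (\<Sum>l=0..<Suc n. ln_plus (norm (M (p l) (enum J l) z) * \<omega> (p l) / norm (f (enum J l) z)))"
      by (rule exp_sum[symmetric]) simp
    ultimately have X: "(\<Prod>l=0..<Suc n. exp (ln_plus (norm (M (p l) (enum J l) z) * \<omega> (p l) / norm (f (enum J l) z)))) \<le> exp X"
      by (simp only: case_prod_conv exp_le_cancel_iff)
    have "(\<Prod>l=0..<Suc n. norm (M (p l) (enum J l) z)) * W = (\<Prod>l=0..<Suc n. norm (M (p l) (enum J l) z)) * (\<Prod>l=0..<Suc n. \<omega> (p l))"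
      unfolding W_def by (subst prod_permutes[OF p]) simp
    also have "\<dots> = (\<Prod>l=0..<Suc n. (norm (M (p l) (enum J l) z) * \<omega> (p l) / norm (f (enum J l) z)) * norm (f (enum J l) z))"
      unfolding prod.distrib[symmetric] by (rule prod.cong) (use f0 enum_le[OF J] in auto)
    also have "\<dots> \<le> (\<Prod>l=0..<Suc n. exp (ln_plus (norm (M (p l) (enum J l) z) * \<omega> (p l) / norm (f (enum J l) z))) * norm (f (enum J l) z))"
    proof (rule prod_mono)
      fix l assume l: "l \<in> {0..<Suc n}"
      have "\<omega> (p l) > 0" using \<omega> pl[OF l] by simp
      thus "0 \<le> norm (M (p l) (enum J l) z) * \<omega> (p l) / norm (f (enum J l) z) * norm (f (enum J l) z) \<and>
         norm (M (p l) (enum J l) z) * \<omega> (p l) / norm (f (enum J l) z) * norm (f (enum J l) z)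
         \<le> exp (ln_plus (norm (M (p l) (enum J l) z) * \<omega> (p l) / norm (f (enum J l) z))) * norm (f (enum J l) z)"
        by (intro conjI mult_right_mono le_exp_ln_plus mult_nonneg_nonneg divide_nonneg_nonneg) auto
    qed
    also have "\<dots> = (\<Prod>l=0..<Suc n. exp (ln_plus (norm (M (p l) (enum J l) z) * \<omega> (p l) / norm (f (enum J l) z)))) * F"
      unfolding F_def by (rule prod.distrib)
    also have "\<dots> \<le> exp X * F" using X F by (intro mult_right_mono) auto
    finally show "(\<Prod>l=0..<Suc n. norm (M (p l) (enum J l) z)) \<le> exp X * F / W" using W by (simp add: field_simps)
  qed
  hence le: "norm (detA J z) * norm (detL z) \<le> fact (Suc n) * (exp X * F / W)" by (simp only: norm_mult)
  have pos: "norm (detA J z) > 0" "norm (detL z) > 0" using d by auto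
  have "ln (norm (detA J z) * norm (detL z)) \<le> ln (fact (Suc n) * (exp X * F / W))"
    using le pos F W by (intro ln_mono) auto
  also have "\<dots> = ln (fact (Suc n)) + (X + ln F - ln W)"
  proof -
    have "exp X * F > 0" "exp X * F / W > 0" using F W by simp_all
    moreover from this have "ln (exp X * F / W) = ln (exp X * F) - ln W" using F W by (simp add: ln_div)
    ultimately show ?thesis using F by (simp only: ln_mult_pos fact_gt_zero exp_gt_zero ln_exp)
  qed
  finally have "ln (norm (detA J z)) + ln (norm (detL z)) \<le> ln (fact (Suc n)) + (X + ln F - ln W)"
    using pos by (simp only: ln_mult_pos)
  moreover have "ln W = (\<Sum>k\<le>n. ln (\<omega> k))"
    unfolding W_def atLeast0LessThan lessThan_Suc_atMost
    by (rule ln_prod) (use \<omega>[THEN less_imp_neq] in auto)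
  moreover have "ln F = (\<Sum>j\<in>J. ln (norm (f j z)))"
  proof -
    have "ln F = (\<Sum>l=0..<Suc n. ln (norm (f (enum J l) z)))"
      unfolding F_def using f0 enum_le[OF J] by (subst ln_prod) auto
    also have "\<dots> = (\<Sum>j\<in>J. ln (norm (f j z)))" using enum_bij[OF J] by (rule sum.reindex_bij_betw)
    finally show ?thesis .
  qed
  ultimately show ?thesis by linarith
qed

text \<open>
  Take for \<open>J\<close> the \<open>n + 1\<close> smallest values \<open>|f j z|\<close>: by Cramer's rule each remaining \<open>|f j z|\<close>
  dominates \<open>exp (U z)\<close>, and the minor of \<open>M\<close> with rows in \<open>J\<close> is \<open>detA J * detL\<close>.
\<close>

lemma archimedean_bound:
  assumes f0: "\<And>j. j \<le> q \<Longrightarrow> f j z \<noteq> 0" and d: "\<And>J. J \<in> JJ \<Longrightarrow> detA J z \<noteq> 0" "detL z \<noteq> 0"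
    and \<omega>: "\<And>k. k \<le> n \<Longrightarrow> \<omega> k > (0::real)"
  shows "real (q - n) * U z \<le> (\<Sum>j\<le>q. ln (norm (f j z))) - ln (norm (detL z)) - (\<Sum>k\<le>n. ln (\<omega> k))
    + (\<Sum>(k,j)\<in>{..n} \<times> {..q}. ln_plus (norm (M k j z) * \<omega> k / norm (f j z)))
    + (\<Sum>J\<in>JJ. real (q - n + 1) * ln_plus (1 / norm (detA J z)))
    + real (q - n) * A z + real (q - n + 1) * ln (fact (Suc n))"
proof -
  have "\<exists>J\<subseteq>{..q}. card J = Suc n \<and> (\<forall>j\<in>{..q} - J. \<forall>i\<in>J. norm (f i z) \<le> norm (f j z))"
    by (rule ex_subset_least) (use q in auto)
  then obtain J where J0: "J \<subseteq> {..q}" "card J = Suc n" and le: "\<And>i j. j \<in> {..q} - J \<Longrightarrow> i \<in> J \<Longrightarrow> norm (f i z) \<le> norm (f j z)"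
    by blast
  have J: "J \<in> JJ" using J0 unfolding JJ_def by simp
  have fJ: "finite J" using J0(1) finite_subset by blast
  define lp where "lp = ln_plus (1 / norm (detA J z))"
  define X where "X = (\<Sum>(k,j)\<in>{..n} \<times> {..q}. ln_plus (norm (M k j z) * \<omega> k / norm (f j z)))"
  have "real (q - n) * (U z - ln (fact (Suc n)) - A z - lp) = (\<Sum>j\<in>{..q} - J. U z - ln (fact (Suc n)) - A z - lp)"
  proof -
    have "card ({..q} - J) = q - n" using J0 fJ by (subst card_Diff_subset) auto
    thus ?thesis by simp
  qed
  also have "\<dots> \<le> (\<Sum>j\<in>{..q} - J. ln (norm (f j z)))"
  proof (rule sum_mono)
    fix j assume j: "j \<in> {..q} - J"
    have "U z \<le> ln (norm (f j z)) + ln (fact (Suc n)) + A z + lp"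
      unfolding lp_def by (rule U_le[OF J d(1)[OF J]]) (use f0 j le in auto)
    thus "U z - ln (fact (Suc n)) - A z - lp \<le> ln (norm (f j z))" by simp
  qed
  finally have 1: "real (q - n) * (U z - ln (fact (Suc n)) - A z - lp) \<le> (\<Sum>j\<in>{..q} - J. ln (norm (f j z)))" .
  have 2: "ln (norm (detA J z)) + ln (norm (detL z)) + (\<Sum>k\<le>n. ln (\<omega> k)) \<le> ln (fact (Suc n)) + X + (\<Sum>j\<in>J. ln (norm (f j z)))"
    unfolding X_def by (rule detM_le[OF J f0 d(1)[OF J] d(2) \<omega>])
  have 3: "(\<Sum>j\<le>q. ln (norm (f j z))) = (\<Sum>j\<in>{..q} - J. ln (norm (f j z))) + (\<Sum>j\<in>J. ln (norm (f j z)))"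
    by (rule sum.subset_diff[OF J0(1)]) simp
  have 4: "- lp \<le> ln (norm (detA J z))"
    unfolding lp_def using ln_le_ln_plus[of "1 / norm (detA J z)"] d(1)[OF J] by (simp add: ln_div)
  have 5: "real (q - n + 1) * lp \<le> (\<Sum>J\<in>JJ. real (q - n + 1) * ln_plus (1 / norm (detA J z)))"
    unfolding lp_def using J finite_JJ
    by (intro member_le_sum[where f = "\<lambda>J. real (q - n + 1) * ln_plus (1 / norm (detA J z))"]) auto
  have 6: "real (q - n + 1) * lp = real (q - n) * lp + lp" by (simp add: algebra_simps)
  have 7: "real (q - n + 1) * ln (fact (Suc n)) = real (q - n) * ln (fact (Suc n)) + ln (fact (Suc n))" by (simp add: distrib_right)
  have 8: "real (q - n) * (U z - ln (fact (Suc n)) - A z - lp) = real (q - n) * U z - real (q - n) * ln (fact (Suc n)) - real (q - n) * A z - real (q - n) * lp"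
    by (simp add: right_diff_distrib)
  have "a1 \<le> S - D - W + Y + JS + a3 + c"
    if "a0 \<le> S1" "a0 = a1 - a2 - a3 - a4" "dA + D + W \<le> F + Y + S2" "S = S1 + S2" "- l \<le> dA" "b \<le> JS" "b = a4 + l" "c = a2 + F"
    for a0 a1 a2 a3 a4 S S1 S2 D W Y JS c dA F b l :: real
    using that by linarith
  from this[OF 1 8 2 3 4 5 6 7] show ?thesis unfolding X_def .
qed

text \<open>
  Here \<open>J\<close> consists of the \<open>n + 1\<close> largest multiplicities; since \<open>g\<close> has no common zero, the
  remaining ones are bounded by the multiplicity of \<open>detA J\<close>.
\<close>

lemma nonarchimedean_bound:
  assumes z: "z \<notin> E"
  shows "(\<Sum>j\<le>q. zero_mult (f j) z) \<le> zero_mult detL z + (\<Sum>j\<le>q. min (zero_mult (f j) z) n) + (q - n + 1) * (\<Sum>J\<in>JJ. zero_mult (detA J) z)"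
proof -
  define m where "m j = zero_mult (f j) z" for j
  have "\<exists>J\<subseteq>{..q}. card J = Suc n \<and> (\<forall>j\<in>{..q} - J. \<forall>i\<in>J. - int (m i) \<le> - int (m j))"
    by (rule ex_subset_least) (use q in auto)
  then obtain J where J0: "J \<subseteq> {..q}" "card J = Suc n" and le: "\<And>i j. j \<in> {..q} - J \<Longrightarrow> i \<in> J \<Longrightarrow> m j \<le> m i"
    by fastforce
  have J: "J \<in> JJ" using J0 unfolding JJ_def by simp
  have fJ: "finite J" using J0(1) finite_subset by blast
  define d where "d = zero_mult (detA J) z"
  define \<mu> where "\<mu> = Min (m ` J)"
  have Jne: "J \<noteq> {}" using J0(2) by auto
  have \<mu>_le: "\<mu> \<le> m i" if "i \<in> J" for i unfolding \<mu>_def using that fJ by simp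
  \<comment> \<open>Otherwise, by Cramer's rule, every g_k times \<open>detA J\<close> would vanish
    at z to an order above that of \<open>detA J\<close>, and z would be a common zero of the
    g_k.\<close>
  have "\<mu> \<le> d"
  proof (rule ccontr)
    assume "\<not> \<mu> \<le> d"
    hence lt: "d < \<mu>" by simp
    obtain h where h: "h holomorphic_on UNIV" "\<And>w. detA J w = (w - z) ^ zero_mult (detA J) z * h w" "h z \<noteq> 0"
      using entire_factor_at[OF detA_holo[OF J] detA_nonzero[OF J], of z] by blast
    have "g k z = 0" if k: "k \<le> n" for k
    proof -
      have "ord_ge (\<lambda>w. fdet (Suc n) (\<lambda>l i. (if i = k then f (enum J l) else a i (enum J l)) w)) z \<mu>"
      proof (rule ord_ge_fdet)
        fix p assume p: "p permutes {0..<Suc n}"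
        have bij: "bij_betw p {0..<Suc n} {0..<Suc n}" by (rule permutes_imp_bij[OF p])
        obtain l0 where l0: "l0 \<in> {0..<Suc n}" "p l0 = k"
          using bij k unfolding bij_betw_def by (metis (no_types, lifting) atLeastLessThan_iff imageE le0 less_Suc_eq_le)
        have "ord_ge (\<lambda>w. \<Prod>l=0..<Suc n. (if p l = k then f (enum J l) else a (p l) (enum J l)) w) z
          (\<Sum>l=0..<Suc n. if l = l0 then \<mu> else 0)"
        proof (rule ord_ge_prod)
          fix l assume l: "l \<in> {0..<Suc n}"
          note el = enum_le[OF J, of l]
          have pl: "p l \<le> n" using permutes_in_image[OF p, of l] l by simp
          show "ord_ge (if p l = k then f (enum J l) else a (p l) (enum J l)) z (if l = l0 then \<mu> else 0)"
          proof (cases "l = l0")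
            case True
            have "ord_ge (f (enum J l)) z (m (enum J l))"
              using ord_ge_zero_mult[OF f_holo f_nz] el l unfolding m_def by auto
            hence "ord_ge (f (enum J l)) z \<mu>" by (rule ord_ge_mono) (use \<mu>_le el l in auto)
            thus ?thesis using True l0 by simp
          next
            case False
            have "(if p l = k then f (enum J l) else a (p l) (enum J l)) holomorphic_on UNIV"
              using f_holo a_holo pl el l by auto
            thus ?thesis using False ord_ge_0 by simp
          qed
        qed simp
        moreover have "(\<Sum>l=0..<Suc n. if l = l0 then \<mu> else 0) = \<mu>" using l0(1) by (subst sum.delta) auto
        ultimately show "ord_ge (\<lambda>w. \<Prod>l=0..<Suc n. (if p l = k then f (enum J l) else a (p l) (enum J l)) w) z \<mu>"
          by simp
      qed
      then obtain e where e: "e holomorphic_on UNIV" "\<And>w. fdet (Suc n) (\<lambda>l i. (if i = k then f (enum J l) else a i (enum J l)) w) = (w - z) ^ \<mu> * e w"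
        unfolding ord_ge_def by blast
      have eq: "g k w * h w = (w - z) ^ (\<mu> - d) * e w" if "w \<noteq> z" for w
      proof -
        have "fdet (Suc n) (\<lambda>l i. (if i = k then f (enum J l) else a i (enum J l)) w) = g k w * detA J w"
          unfolding cramer[OF J k] by (rule fdet_cong) simp
        hence "g k w * ((w - z) ^ d * h w) = (w - z) ^ \<mu> * e w" using e(2)[of w] h(2)[of w] unfolding d_def by simp
        also have "(w - z) ^ \<mu> = (w - z) ^ d * (w - z) ^ (\<mu> - d)" using lt by (simp flip: power_add)
        finally have "(w - z) ^ d * (g k w * h w) = (w - z) ^ d * ((w - z) ^ (\<mu> - d) * e w)" by (simp add: mult_ac)
        thus ?thesis using that by simp
      qed
      have "((\<lambda>w. g k w * h w) \<longlongrightarrow> g k z * h z) (at z)"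
        using holomorphic_on_imp_continuous_on[OF holomorphic_on_mult[OF holo[OF k] h(1)]]
        by (simp add: continuous_on_eq_continuous_at isCont_def)
      moreover have "((\<lambda>w. g k w * h w) \<longlongrightarrow> (z - z) ^ (\<mu> - d) * e z) (at z)"
      proof (rule Lim_transform_eventually)
        have "continuous_on UNIV (\<lambda>w. (w - z) ^ (\<mu> - d) * e w)"
          by (intro continuous_intros holomorphic_on_imp_continuous_on[OF e(1)])
        hence "isCont (\<lambda>w. (w - z) ^ (\<mu> - d) * e w) z" by (simp add: continuous_on_eq_continuous_at)
        thus "((\<lambda>w. (w - z) ^ (\<mu> - d) * e w) \<longlongrightarrow> (z - z) ^ (\<mu> - d) * e z) (at z)"
          unfolding isCont_def .
        show "\<forall>\<^sub>F w in at z. (w - z) ^ (\<mu> - d) * e w = g k w * h w"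
          using eq by (auto simp: eventually_at_filter)
      qed
      ultimately have gh: "g k z * h z = (z - z) ^ (\<mu> - d) * e z" by (rule tendsto_unique[rotated]) simp
      have p0: "(z - z) ^ (\<mu> - d) = 0" using lt by (simp add: power_0_left)
      have "g k z * h z = 0" unfolding gh p0 by simp
      thus ?thesis using h(3) by simp
    qed
    thus False using attained[of z] by blast
  qed
  have outside: "m j \<le> d" if "j \<in> {..q} - J" for j
  proof -
    have "\<mu> \<in> m ` J" unfolding \<mu>_def using fJ Jne by (intro Min_in) auto
    then obtain i where "i \<in> J" "\<mu> = m i" by blast
    thus ?thesis using le[OF that] \<open>\<mu> \<le> d\<close> by fastforce
  qed
  have inside: "(\<Sum>j\<in>J. m j - n) \<le> d + zero_mult detL z"
  proof -
    have "ord_ge (\<lambda>w. fdet (Suc n) (\<lambda>l k. M k (enum J l) w)) z (\<Sum>j\<in>J. m j - n)"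
    proof (rule ord_ge_fdet)
      fix p assume p: "p permutes {0..<Suc n}"
      have "ord_ge (\<lambda>w. \<Prod>l=0..<Suc n. M (p l) (enum J l) w) z (\<Sum>l=0..<Suc n. m (enum J l) - n)"
      proof (rule ord_ge_prod)
        fix l assume l: "l \<in> {0..<Suc n}"
        have pl: "p l \<le> n" using permutes_in_image[OF p, of l] l by simp
        show "ord_ge (M (p l) (enum J l)) z (m (enum J l) - n)"
          using ord[OF z pl, of "enum J l"] enum_le[OF J, of l] l unfolding m_def M_def[abs_def] by simp
      qed simp
      moreover have "(\<Sum>l=0..<Suc n. m (enum J l) - n) = (\<Sum>j\<in>J. m j - n)"
        using enum_bij[OF J] by (rule sum.reindex_bij_betw)
      ultimately show "ord_ge (\<lambda>w. \<Prod>l=0..<Suc n. M (p l) (enum J l) w) z (\<Sum>j\<in>J. m j - n)" by simp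
    qed
    hence o: "ord_ge (\<lambda>w. detA J w * detL w) z (\<Sum>j\<in>J. m j - n)" unfolding detM_eq[OF J] .
    have "(\<lambda>w. detA J w * detL w) holomorphic_on UNIV" by (intro holomorphic_on_mult detA_holo J detL_holo)
    moreover have "\<exists>w. detA J w * detL w \<noteq> 0"
    proof (rule ccontr)
      assume "\<not> ?thesis"
      hence zero: "\<And>w. detA J w = 0 \<or> detL w = 0" by auto
      have "uncountable (UNIV :: complex set)" by (rule uncountable_UNIV_complex)
      moreover have "UNIV \<subseteq> {w. detA J w = 0} \<union> {w. detL w = 0}" using zero by auto
      moreover have "countable ({w. detA J w = 0} \<union> {w. detL w = 0})"
        using countable_zeros[OF detA_holo[OF J] detA_nonzero[OF J]] countable_zeros[OF detL_holo detL_nonzero] by simp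
      ultimately show False using countable_subset by blast
    qed
    ultimately have "(\<Sum>j\<in>J. m j - n) \<le> zero_mult (\<lambda>w. detA J w * detL w) z" using ord_ge_zero_mult o by blast
    also have "\<dots> = d + zero_mult detL z" unfolding d_def
      by (rule zero_mult_mult[OF detA_holo[OF J] detA_nonzero[OF J] detL_holo detL_nonzero])
    finally show ?thesis .
  qed
  \<comment> \<open>In natural numbers m = min m n + (m - n): only the part of a multiplicity above
    n is charged to \<open>detL\<close>, and this is the origin of the truncation level.\<close>
  have "(\<Sum>j\<le>q. m j) = (\<Sum>j\<le>q. min (m j) n) + (\<Sum>j\<le>q. m j - n)"
    unfolding sum.distrib[symmetric] by (rule sum.cong) auto
  also have "(\<Sum>j\<le>q. m j - n) = (\<Sum>j\<in>{..q} - J. m j - n) + (\<Sum>j\<in>J. m j - n)"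
    by (rule sum.subset_diff[OF J0(1)]) simp
  also have "(\<Sum>j\<in>{..q} - J. m j - n) \<le> (\<Sum>j\<in>{..q} - J. d)" by (intro sum_mono) (use outside in \<open>auto intro: le_trans[OF diff_le_self]\<close>)
  also have "\<dots> = (q - n) * d" using J0 fJ by (simp add: card_Diff_subset)
  finally have "(\<Sum>j\<le>q. m j) \<le> (\<Sum>j\<le>q. min (m j) n) + zero_mult detL z + (q - n + 1) * d"
    using inside by (simp add: algebra_simps)
  also have "(q - n + 1) * d \<le> (q - n + 1) * (\<Sum>J\<in>JJ. zero_mult (detA J) z)"
    unfolding d_def by (intro mult_left_mono member_le_sum[where f = "\<lambda>J. zero_mult (detA J) z"] J finite_JJ) auto
  finally show ?thesis unfolding m_def by simp
qed

end

section \<open>Integration of the pointwise bounds\<close>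

context operator_curve
begin

text \<open>Since log^+ (1/x) + log x = log^+ x, Jensen's formula for \<open>detA J\<close> bounds
  both the proximity to 0 and the number of its zeros by the mean of A.\<close>

lemma detA_mean_le:
  assumes J: "J \<in> JJ"
  obtains K where "\<And>r. r \<ge> 1 \<Longrightarrow> (\<And>w. norm w = r \<Longrightarrow> detA J w \<noteq> 0) \<Longrightarrow>
    circle_mean (\<lambda>z. ln_plus (1 / norm (detA J z))) r + int_count (zero_mult (detA J)) r \<le> circle_mean A r + K"
proof -
  note h = detA_holo[OF J] detA_nonzero[OF J]
  obtain K where K: "\<And>R. R > 0 \<Longrightarrow> (\<And>w. norm w = R \<Longrightarrow> detA J w \<noteq> 0) \<Longrightarrow>
    circle_mean (\<lambda>w. ln (norm (detA J w))) R = K + int_count (zero_mult (detA J)) R" using jensen[OF h] by blast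
  have le: "ln_plus (norm (detA J z)) \<le> ln (fact (Suc n)) + A z" if "detA J z \<noteq> 0" for z
  proof -
    have "norm (detA J z) \<le> fact (Suc n) * exp (A z)"
      unfolding detA_def
    proof (rule norm_fdet_le)
      fix p assume p: "p permutes {0..<Suc n}"
      have "(\<Prod>l=0..<Suc n. norm (a (p l) (enum J l) z)) \<le> (\<Prod>l=0..<Suc n. exp (ln_plus (norm (a (p l) (enum J l) z))))"
        by (rule prod_mono) (use le_exp_ln_plus in auto)
      also have "\<dots> \<le> exp (A z)" by (rule prod_entries_le[OF J p])
      finally show "(\<Prod>l=0..<Suc n. norm (a (p l) (enum J l) z)) \<le> exp (A z)" .
    qed
    moreover have "1 \<le> fact (Suc n) * exp (A z)"
    proof -
      have "1 * 1 \<le> fact (Suc n) * exp (A z)"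
        by (rule mult_mono) (use A_nonneg[of z] fact_ge_1[of "Suc n"] in \<open>auto simp del: fact_Suc\<close>)
      thus ?thesis by simp
    qed
    ultimately have "ln_plus (norm (detA J z)) \<le> ln (fact (Suc n) * exp (A z))"
      unfolding ln_plus_def by (intro ln_mono) auto
    thus ?thesis by (simp only: ln_mult_pos fact_gt_zero exp_gt_zero ln_exp)
  qed
  show ?thesis
  proof (rule that[of "ln (fact (Suc n)) - K"])
    fix r :: real assume r: "r \<ge> 1" and nz: "\<And>w. norm w = r \<Longrightarrow> detA J w \<noteq> 0"
    have r0: "r \<ge> 0" "r > 0" using r by auto
    have cont: "continuous_on (sphere 0 r) (\<lambda>w. ln (norm (detA J w)))"
      by (rule continuous_on_ln_norm[OF h(1)]) (use nz in auto)
    have contn: "continuous_on (sphere 0 r) (\<lambda>w. norm (detA J w))"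
      by (intro continuous_on_norm holomorphic_on_imp_continuous_on holomorphic_on_subset[OF h(1)]) auto
    have c1: "continuous_on (sphere 0 r) (\<lambda>w. ln_plus (1 / norm (detA J w)))"
      by (intro continuous_on_ln_plus continuous_on_divide continuous_on_const contn) (use nz in auto)
    have "circle_mean (\<lambda>z. ln_plus (1 / norm (detA J z)) + ln (norm (detA J z))) r \<le> circle_mean (\<lambda>z. ln (fact (Suc n)) + A z) r"
    proof (rule circle_mean_mono[OF r0(1) continuous_on_add[OF c1 cont]])
      fix z :: complex assume "norm z = r"
      hence "detA J z \<noteq> 0" using nz by blast
      thus "ln_plus (1 / norm (detA J z)) + ln (norm (detA J z)) \<le> ln (fact (Suc n)) + A z"
        using le[of z] ln_plus_diff[of "norm (detA J z)"] by simp
    qed (intro continuous_intros A_continuous)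
    also have "\<dots> = ln (fact (Suc n)) + circle_mean A r"
      by (subst circle_mean_add[OF r0(1)]) (auto intro: A_continuous)
    finally show "circle_mean (\<lambda>z. ln_plus (1 / norm (detA J z))) r + int_count (zero_mult (detA J)) r \<le> circle_mean A r + (ln (fact (Suc n)) - K)"
      using circle_mean_add[OF r0(1) c1 cont] K[OF r0(2) nz] by simp
  qed
qed

definition admissible :: "real \<Rightarrow> bool" where
  "admissible r \<longleftrightarrow> r \<ge> 1 \<and> (\<forall>w. norm w = r \<longrightarrow> (\<forall>j\<le>q. f j w \<noteq> 0) \<and> (\<forall>J\<in>JJ. detA J w \<noteq> 0) \<and> detL w \<noteq> 0)"

text \<open>\<open>nonarchimedean_bound\<close> summed with the weights of the counting functions.
  Points of E are estimated trivially; the case distinction keeps log r out when E is empty, as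
  needed for rational curves, where log r is not negligible.\<close>

lemma count_bound:
  obtains K where "K \<ge> 0" "\<And>r. r \<ge> 1 \<Longrightarrow>
    (\<Sum>j\<le>q. int_count (zero_mult (f j)) r) - int_count (zero_mult detL) r
     \<le> (\<Sum>j\<le>q. trunc_count_zeros n (f j) r) + real (q - n + 1) * (\<Sum>J\<in>JJ. int_count (zero_mult (detA J)) r)
       + K * (if E = {} then 0 else 1 + ln r)"
proof -
  define e where "e z = (\<Sum>j\<le>q. zero_mult (f j) z)" for z
  define K where "K = (\<Sum>z\<in>E. real (e z) * (1 + \<bar>ln (norm z)\<bar>))"
  have K0: "K \<ge> 0" unfolding K_def by (intro sum_nonneg) auto
  show ?thesis
  proof (rule that[OF K0])
    fix r :: real assume r: "r \<ge> 1"
    have r0: "r > 0" "ln r \<ge> 0" using r by auto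
    define W where "W = (\<Union>j\<le>q. zeros_in (f j) r) \<union> zeros_in detL r \<union> (\<Union>J\<in>JJ. zeros_in (detA J) r)"
    have fW: "finite W" unfolding W_def
      using finite_zeros_in[OF f_holo f_nz] finite_zeros_in[OF detL_holo detL_nonzero]
        finite_zeros_in[OF detA_holo detA_nonzero] finite_JJ by auto
    have sW: "W \<subseteq> cball 0 r" unfolding W_def zeros_in_def by auto
    have supp: "z \<in> W" if "norm z \<le> r" "f j z = 0" "j \<le> q" for z j
      using that unfolding W_def zeros_in_def by auto
    have N: "int_count (zero_mult (f j)) r = (\<Sum>z\<in>W. zero_mult (f j) z * log_weight r z)"
         "trunc_count_zeros n (f j) r = (\<Sum>z\<in>W. min (zero_mult (f j) z) n * log_weight r z)" if "j \<le> q" for j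
      unfolding trunc_count_zeros_def
      by (rule int_count_eq_sum[OF r0(1) fW sW]; use supp that in \<open>auto simp: zero_mult_def split: if_splits\<close>)+
    have NL: "int_count (zero_mult detL) r = (\<Sum>z\<in>W. zero_mult detL z * log_weight r z)"
      by (rule int_count_eq_sum[OF r0(1) fW sW]) (auto simp: zero_mult_def W_def zeros_in_def split: if_splits)
    have NA: "int_count (zero_mult (detA J)) r = (\<Sum>z\<in>W. zero_mult (detA J) z * log_weight r z)" if "J \<in> JJ" for J
      by (rule int_count_eq_sum[OF r0(1) fW sW]) (use that in \<open>auto simp: zero_mult_def W_def zeros_in_def split: if_splits\<close>)
    have pt: "real (\<Sum>j\<le>q. zero_mult (f j) z) * log_weight r z
       \<le> zero_mult detL z * log_weight r z + real (\<Sum>j\<le>q. min (zero_mult (f j) z) n) * log_weight r z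
         + real (q - n + 1) * (real (\<Sum>J\<in>JJ. zero_mult (detA J) z) * log_weight r z)
         + (if z \<in> E then real (e z) * log_weight r z else 0)" if z: "z \<in> W" for z
    proof -
      have lw: "log_weight r z \<ge> 0" using z sW r by (intro log_weight_nonneg) auto
      show ?thesis
      proof (cases "z \<in> E")
        case True
        have "0 \<le> zero_mult detL z * log_weight r z" "0 \<le> real (\<Sum>j\<le>q. min (zero_mult (f j) z) n) * log_weight r z"
          "0 \<le> real (q - n + 1) * (real (\<Sum>J\<in>JJ. zero_mult (detA J) z) * log_weight r z)"
          using lw by (intro mult_nonneg_nonneg of_nat_0_le_iff; assumption)+
        thus ?thesis using True unfolding e_def by simp
      next
        case False
        have "real (\<Sum>j\<le>q. zero_mult (f j) z) \<le> real (zero_mult detL z + (\<Sum>j\<le>q. min (zero_mult (f j) z) n) + (q - n + 1) * (\<Sum>J\<in>JJ. zero_mult (detA J) z))"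
          using nonarchimedean_bound[OF False] by (rule of_nat_mono)
        from mult_right_mono[OF this lw] show ?thesis using False
          by (simp add: distrib_right mult.assoc)
      qed
    qed
    have "(\<Sum>j\<le>q. int_count (zero_mult (f j)) r) = (\<Sum>z\<in>W. real (\<Sum>j\<le>q. zero_mult (f j) z) * log_weight r z)"
    proof -
      have "(\<Sum>j\<le>q. int_count (zero_mult (f j)) r) = (\<Sum>j\<le>q. \<Sum>z\<in>W. zero_mult (f j) z * log_weight r z)"
        by (rule sum.cong) (use N in auto)
      also have "\<dots> = (\<Sum>z\<in>W. \<Sum>j\<le>q. zero_mult (f j) z * log_weight r z)" by (rule sum.swap)
      finally show ?thesis by (simp add: sum_distrib_right)
    qed
    also have "\<dots> \<le> (\<Sum>z\<in>W. zero_mult detL z * log_weight r z + real (\<Sum>j\<le>q. min (zero_mult (f j) z) n) * log_weight r z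
         + real (q - n + 1) * (real (\<Sum>J\<in>JJ. zero_mult (detA J) z) * log_weight r z)
         + (if z \<in> E then real (e z) * log_weight r z else 0))"
      by (rule sum_mono) (rule pt)
    also have "\<dots> = int_count (zero_mult detL) r + (\<Sum>z\<in>W. real (\<Sum>j\<le>q. min (zero_mult (f j) z) n) * log_weight r z)
         + real (q - n + 1) * (\<Sum>z\<in>W. real (\<Sum>J\<in>JJ. zero_mult (detA J) z) * log_weight r z)
         + (\<Sum>z\<in>W. if z \<in> E then real (e z) * log_weight r z else 0)"
      unfolding NL sum.distrib sum_distrib_left ..
    also have "(\<Sum>z\<in>W. real (\<Sum>j\<le>q. min (zero_mult (f j) z) n) * log_weight r z) = (\<Sum>j\<le>q. trunc_count_zeros n (f j) r)"
    proof -
      have "(\<Sum>j\<le>q. trunc_count_zeros n (f j) r) = (\<Sum>j\<le>q. \<Sum>z\<in>W. min (zero_mult (f j) z) n * log_weight r z)"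
        by (rule sum.cong) (use N in auto)
      also have "\<dots> = (\<Sum>z\<in>W. \<Sum>j\<le>q. min (zero_mult (f j) z) n * log_weight r z)" by (rule sum.swap)
      finally show ?thesis by (simp add: sum_distrib_right)
    qed
    also have "(\<Sum>z\<in>W. real (\<Sum>J\<in>JJ. zero_mult (detA J) z) * log_weight r z) = (\<Sum>J\<in>JJ. int_count (zero_mult (detA J)) r)"
    proof -
      have "(\<Sum>J\<in>JJ. int_count (zero_mult (detA J)) r) = (\<Sum>J\<in>JJ. \<Sum>z\<in>W. zero_mult (detA J) z * log_weight r z)"
        by (rule sum.cong) (use NA in auto)
      also have "\<dots> = (\<Sum>z\<in>W. \<Sum>J\<in>JJ. zero_mult (detA J) z * log_weight r z)" by (rule sum.swap)
      finally show ?thesis by (simp add: sum_distrib_right)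
    qed
    also have "(\<Sum>z\<in>W. if z \<in> E then real (e z) * log_weight r z else 0) \<le> K * (if E = {} then 0 else 1 + ln r)"
    proof (cases "E = {}")
      case False
      have "(\<Sum>z\<in>W. if z \<in> E then real (e z) * log_weight r z else 0) = (\<Sum>z\<in>W \<inter> E. real (e z) * log_weight r z)"
        using fW by (simp add: sum.If_cases)
      also have "\<dots> \<le> (\<Sum>z\<in>W \<inter> E. real (e z) * (1 + \<bar>ln (norm z)\<bar>) * (1 + ln r))"
      proof (rule sum_mono)
        fix z assume "z \<in> W \<inter> E"
        have "log_weight r z \<le> ln r + \<bar>ln (norm z)\<bar>" unfolding log_weight_def using r0 by (auto simp: ln_div)
        also have "\<dots> \<le> (1 + \<bar>ln (norm z)\<bar>) * (1 + ln r)"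
        proof -
          have "\<bar>ln (norm z)\<bar> * ln r \<ge> 0" using r0 by simp
          thus ?thesis by (simp add: algebra_simps)
        qed
        finally show "real (e z) * log_weight r z \<le> real (e z) * (1 + \<bar>ln (norm z)\<bar>) * (1 + ln r)"
          by (simp add: mult.assoc mult_left_mono)
      qed
      also have "\<dots> \<le> (\<Sum>z\<in>E. real (e z) * (1 + \<bar>ln (norm z)\<bar>) * (1 + ln r))"
        by (rule sum_mono2) (use finite_E r0 in auto)
      also have "\<dots> = K * (1 + ln r)" unfolding K_def sum_distrib_right ..
      finally show ?thesis using False by simp
    qed auto
    finally show "(\<Sum>j\<le>q. int_count (zero_mult (f j)) r) - int_count (zero_mult detL) r
     \<le> (\<Sum>j\<le>q. trunc_count_zeros n (f j) r) + real (q - n + 1) * (\<Sum>J\<in>JJ. int_count (zero_mult (detA J)) r)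
       + K * (if E = {} then 0 else 1 + ln r)" by simp
  qed
qed

text \<open>
  The operators \<open>L k\<close> play the role of the derivatives in Cartan's proof: they are shifts by
  \<open>k c\<close> for transcendental curves and derivatives for rational ones.  The weights \<open>\<omega>\<close> make it
  possible to compare a shifted function with the original one after division by \<open>g 0\<close>.
\<close>

theorem second_main_inequality:
  obtains K where "K \<ge> 0" "\<And>r \<omega>. admissible r \<Longrightarrow>
    (\<And>k. k \<le> n \<Longrightarrow> continuous_on (sphere 0 r) (\<omega> k)) \<Longrightarrow> (\<And>k z. k \<le> n \<Longrightarrow> norm z = r \<Longrightarrow> \<omega> k z > (0::real)) \<Longrightarrow>
    real (q - n) * T r \<le> (\<Sum>j\<le>q. trunc_count_zeros n (f j) r) - (\<Sum>k\<le>n. circle_mean (\<lambda>z. ln (\<omega> k z)) r)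
     + (\<Sum>(k,j)\<in>{..n} \<times> {..q}. circle_mean (\<lambda>z. ln_plus (norm (M k j z) * \<omega> k z / norm (f j z))) r)
     + K * (1 + circle_mean A r) + K * (if E = {} then 0 else ln r)"
proof -
  obtain K1 where K1: "K1 \<ge> 0" "\<And>r. r \<ge> 1 \<Longrightarrow>
    (\<Sum>j\<le>q. int_count (zero_mult (f j)) r) - int_count (zero_mult detL) r
     \<le> (\<Sum>j\<le>q. trunc_count_zeros n (f j) r) + real (q - n + 1) * (\<Sum>J\<in>JJ. int_count (zero_mult (detA J)) r)
       + K1 * (if E = {} then 0 else 1 + ln r)" using count_bound by blast
  have "\<forall>J\<in>JJ. \<exists>K. \<forall>r\<ge>1. (\<forall>w. norm w = r \<longrightarrow> detA J w \<noteq> 0) \<longrightarrow>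
    circle_mean (\<lambda>z. ln_plus (1 / norm (detA J z))) r + int_count (zero_mult (detA J)) r \<le> circle_mean A r + K"
  proof
    fix J assume J: "J \<in> JJ"
    show "\<exists>K. \<forall>r\<ge>1. (\<forall>w. norm w = r \<longrightarrow> detA J w \<noteq> 0) \<longrightarrow>
      circle_mean (\<lambda>z. ln_plus (1 / norm (detA J z))) r + int_count (zero_mult (detA J)) r \<le> circle_mean A r + K"
      by (rule detA_mean_le[OF J]) blast
  qed
  then obtain KA where KA: "\<And>J r. J \<in> JJ \<Longrightarrow> r \<ge> 1 \<Longrightarrow> (\<And>w. norm w = r \<Longrightarrow> detA J w \<noteq> 0) \<Longrightarrow>
    circle_mean (\<lambda>z. ln_plus (1 / norm (detA J z))) r + int_count (zero_mult (detA J)) r \<le> circle_mean A r + KA J"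
    by metis
  have "\<forall>j\<in>{..q}. \<exists>K. \<forall>R>0. (\<forall>w. norm w = R \<longrightarrow> f j w \<noteq> 0) \<longrightarrow>
    circle_mean (\<lambda>w. ln (norm (f j w))) R = K + int_count (zero_mult (f j)) R"
  proof
    fix j assume "j \<in> {..q}"
    hence j: "j \<le> q" by simp
    show "\<exists>K. \<forall>R>0. (\<forall>w. norm w = R \<longrightarrow> f j w \<noteq> 0) \<longrightarrow>
      circle_mean (\<lambda>w. ln (norm (f j w))) R = K + int_count (zero_mult (f j)) R"
      by (rule jensen[OF f_holo[OF j] f_nz[OF j]]) blast
  qed
  then obtain KF where KF: "\<And>j R. j \<le> q \<Longrightarrow> R > 0 \<Longrightarrow> (\<And>w. norm w = R \<Longrightarrow> f j w \<noteq> 0) \<Longrightarrow>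
    circle_mean (\<lambda>w. ln (norm (f j w))) R = KF j + int_count (zero_mult (f j)) R"
    by (metis atMost_iff)
  obtain KL where KL: "\<And>R. R > 0 \<Longrightarrow> (\<And>w. norm w = R \<Longrightarrow> detL w \<noteq> 0) \<Longrightarrow>
    circle_mean (\<lambda>w. ln (norm (detL w))) R = KL + int_count (zero_mult detL) R"
    using jensen[OF detL_holo detL_nonzero] by blast
  define c where "c = real (q - n + 1)"
  define K0 where "K0 = (\<Sum>j\<le>q. KF j) - KL + c * (\<Sum>J\<in>JJ. KA J) + c * ln (fact (Suc n)) - real (q - n) * U 0 + K1"
  define K2 where "K2 = real (q - n) + c * card JJ"
  have c0: "c \<ge> 0" unfolding c_def by simp
  have K20: "K2 \<ge> 0" unfolding K2_def using c0 by simp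
  define K where "K = max K0 (max K1 K2)"
  have K: "K \<ge> K0" "K \<ge> K1" "K \<ge> K2" "K \<ge> 0" unfolding K_def using K1(1) by auto
  show ?thesis
  proof (rule that[OF K(4)])
    fix r and \<omega> :: "nat \<Rightarrow> complex \<Rightarrow> real"
    assume adm: "admissible r" and \<omega>c: "\<And>k. k \<le> n \<Longrightarrow> continuous_on (sphere 0 r) (\<omega> k)"
      and \<omega>p: "\<And>k z. k \<le> n \<Longrightarrow> norm z = r \<Longrightarrow> \<omega> k z > 0"
    have r: "r \<ge> 1" "r \<ge> 0" "r > 0" using adm unfolding admissible_def by auto
    have nz: "\<And>j w. norm w = r \<Longrightarrow> j \<le> q \<Longrightarrow> f j w \<noteq> 0" "\<And>J w. norm w = r \<Longrightarrow> J \<in> JJ \<Longrightarrow> detA J w \<noteq> 0"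
      "\<And>w. norm w = r \<Longrightarrow> detL w \<noteq> 0" using adm unfolding admissible_def by auto
    let ?S = "sphere (0::complex) r"
    define X where "X = (\<lambda>(k,j) z. ln_plus (norm (M k j z) * \<omega> k z / norm (f j z)))"
    have cf: "continuous_on ?S (\<lambda>z. ln (norm (f j z)))" if "j \<le> q" for j
      by (rule continuous_on_ln_norm[OF f_holo[OF that]]) (use nz that in auto)
    have cl: "continuous_on ?S (\<lambda>z. ln (norm (detL z)))"
      by (rule continuous_on_ln_norm[OF detL_holo]) (use nz in auto)
    have c\<omega>: "continuous_on ?S (\<lambda>z. ln (\<omega> k z))" if "k \<le> n" for k
      by (intro continuous_on_ln \<omega>c that) (use \<omega>p[OF that] in force)
    have cX: "continuous_on ?S (X p)" if "p \<in> {..n} \<times> {..q}" for p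
    proof -
      obtain k j where p: "p = (k,j)" "k \<le> n" "j \<le> q" using \<open>p \<in> _\<close> by auto
      have "continuous_on ?S (\<lambda>z. ln_plus (norm (M k j z) * \<omega> k z / norm (f j z)))"
        by (intro continuous_on_ln_plus continuous_on_divide continuous_on_mult continuous_on_norm \<omega>c
            holomorphic_on_imp_continuous_on holomorphic_on_subset[OF f_holo] holomorphic_on_subset[OF M_holo] p)
           (use nz p in auto)
      thus ?thesis unfolding p X_def by simp
    qed
    have cA: "continuous_on ?S (\<lambda>z. ln_plus (1 / norm (detA J z)))" if "J \<in> JJ" for J
      by (intro continuous_on_ln_plus continuous_on_divide continuous_on_const continuous_on_norm
          holomorphic_on_imp_continuous_on holomorphic_on_subset[OF detA_holo] that) (use nz that in auto)
    define s1 where "s1 = (\<lambda>z. \<Sum>j\<le>q. ln (norm (f j z)))"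
    define s2 where "s2 = (\<lambda>z. \<Sum>k\<le>n. ln (\<omega> k z))"
    define s3 where "s3 = (\<lambda>z. \<Sum>p\<in>{..n} \<times> {..q}. X p z)"
    define s4 where "s4 = (\<lambda>z. \<Sum>J\<in>JJ. c * ln_plus (1 / norm (detA J z)))"
    have cs: "continuous_on ?S s1" "continuous_on ?S s2" "continuous_on ?S s3" "continuous_on ?S s4"
      unfolding s1_def s2_def s3_def s4_def
      by (intro continuous_on_sum continuous_on_mult_left cf c\<omega> cX cA; simp)+
    have m1: "circle_mean s1 r = (\<Sum>j\<le>q. circle_mean (\<lambda>z. ln (norm (f j z))) r)"
      unfolding s1_def by (rule circle_mean_sum) (use r cf in auto)
    have m2: "circle_mean s2 r = (\<Sum>k\<le>n. circle_mean (\<lambda>z. ln (\<omega> k z)) r)"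
      unfolding s2_def by (rule circle_mean_sum) (use r c\<omega> in auto)
    have m3: "circle_mean s3 r = (\<Sum>p\<in>{..n} \<times> {..q}. circle_mean (X p) r)"
      unfolding s3_def by (rule circle_mean_sum) (use r cX in auto)
    have m4: "circle_mean s4 r = c * (\<Sum>J\<in>JJ. circle_mean (\<lambda>z. ln_plus (1 / norm (detA J z))) r)"
      unfolding s4_def sum_distrib_left circle_mean_cmult[symmetric]
      by (rule circle_mean_sum) (use r cA finite_JJ in \<open>auto intro: continuous_on_mult_left\<close>)
    define D where "D = (\<lambda>z. ln (norm (detL z)))"
    have cD: "continuous_on ?S D" unfolding D_def by (rule cl)
    have cqA: "continuous_on ?S (\<lambda>z. real (q - n) * A z)" by (intro continuous_on_mult_left A_continuous)
    have "circle_mean (\<lambda>z. real (q - n) * U z) r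
       \<le> circle_mean (\<lambda>z. s1 z - D z - s2 z + s3 z + s4 z + real (q - n) * A z + c * ln (fact (Suc n))) r"
    proof (rule circle_mean_mono[OF r(2)])
      fix z :: complex assume z: "norm z = r"
      show "real (q - n) * U z \<le> s1 z - D z - s2 z + s3 z + s4 z + real (q - n) * A z + c * ln (fact (Suc n))"
        using archimedean_bound[of z "\<lambda>k. \<omega> k z"] nz z \<omega>p
        unfolding s1_def D_def s2_def s3_def s4_def X_def c_def by (simp add: case_prod_unfold)
    qed (intro continuous_intros continuous_on_U cs cD A_continuous)+
    also have "\<dots> = circle_mean s1 r - circle_mean D r - circle_mean s2 r + circle_mean s3 r + circle_mean s4 r
        + real (q - n) * circle_mean A r + c * ln (fact (Suc n))"
    proof -
      note k1 = continuous_on_diff[OF cs(1) cD]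
      note k2 = continuous_on_diff[OF k1 cs(2)]
      note k3 = continuous_on_add[OF k2 cs(3)]
      note k4 = continuous_on_add[OF k3 cs(4)]
      note k5 = continuous_on_add[OF k4 cqA]
      show ?thesis
        by (simp only: circle_mean_add[OF r(2) k5 continuous_on_const] circle_mean_add[OF r(2) k4 cqA] circle_mean_add[OF r(2) k3 cs(4)]
            circle_mean_add[OF r(2) k2 cs(3)] circle_mean_diff[OF r(2) k1 cs(2)] circle_mean_diff[OF r(2) cs(1) cD]
            circle_mean_const circle_mean_cmult)
    qed
    finally have main: "real (q - n) * (T r + U 0) \<le> circle_mean s1 r - circle_mean D r - circle_mean s2 r + circle_mean s3 r + circle_mean s4 r
        + real (q - n) * circle_mean A r + c * ln (fact (Suc n))"
      unfolding circle_mean_cmult circle_mean_U .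
    have j1: "circle_mean s1 r = (\<Sum>j\<le>q. KF j) + (\<Sum>j\<le>q. int_count (zero_mult (f j)) r)"
      unfolding m1 sum.distrib[symmetric] by (rule sum.cong) (use KF[OF _ r(3)] nz in auto)
    have j2: "circle_mean D r = KL + int_count (zero_mult detL) r"
      unfolding D_def using KL[OF r(3)] nz by blast
    have j3: "(\<Sum>J\<in>JJ. circle_mean (\<lambda>z. ln_plus (1 / norm (detA J z))) r) + (\<Sum>J\<in>JJ. int_count (zero_mult (detA J)) r)
       \<le> card JJ * circle_mean A r + (\<Sum>J\<in>JJ. KA J)"
    proof -
      have "(\<Sum>J\<in>JJ. circle_mean (\<lambda>z. ln_plus (1 / norm (detA J z))) r) + (\<Sum>J\<in>JJ. int_count (zero_mult (detA J)) r)
        \<le> (\<Sum>J\<in>JJ. circle_mean A r + KA J)"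
        unfolding sum.distrib[symmetric] by (intro sum_mono KA r nz)
      thus ?thesis by (simp add: sum.distrib)
    qed
    from mult_left_mono[OF this c0]
    have j3': "circle_mean s4 r + c * (\<Sum>J\<in>JJ. int_count (zero_mult (detA J)) r) \<le> c * card JJ * circle_mean A r + c * (\<Sum>J\<in>JJ. KA J)"
      unfolding m4 by (simp add: distrib_left mult.assoc)
    have j4: "K1 * (if E = {} then 0 else 1 + ln r) \<le> K1 + K * (if E = {} then 0 else ln r)"
    proof (cases "E = {}")
      case True thus ?thesis using K1(1) by simp
    next
      case False
      have "K1 * ln r \<le> K * ln r" using K(2) r by (intro mult_right_mono) auto
      thus ?thesis using False by (simp add: distrib_left)
    qed
    have A0: "circle_mean A r \<ge> 0" by (rule circle_mean_nonneg[OF r(2) A_continuous A_nonneg])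
    have j5: "K2 * circle_mean A r \<le> K * circle_mean A r" by (rule mult_right_mono[OF K(3) A0])
    have j6: "K2 * circle_mean A r = real (q - n) * circle_mean A r + c * card JJ * circle_mean A r"
      unfolding K2_def by (rule distrib_right)
    have j7: "K * (1 + circle_mean A r) = K + K * circle_mean A r" by (simp add: distrib_left)
    have j8: "real (q - n) * (T r + U 0) = real (q - n) * T r + real (q - n) * U 0" by (rule distrib_left)
    have j9: "(\<Sum>j\<le>q. int_count (zero_mult (f j)) r) - int_count (zero_mult detL) r
     \<le> (\<Sum>j\<le>q. trunc_count_zeros n (f j) r) + c * (\<Sum>J\<in>JJ. int_count (zero_mult (detA J)) r)
       + K1 * (if E = {} then 0 else 1 + ln r)" unfolding c_def by (rule K1(2)[OF r(1)])
    have j10: "(\<Sum>j\<le>q. KF j) - KL + c * (\<Sum>J\<in>JJ. KA J) + c * ln (fact (Suc n)) - real (q - n) * U 0 + K1 \<le> K"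
      using K(1) unfolding K0_def .
    \<comment> \<open>Pure linear bookkeeping, with every mean and every sum replaced by a real
      variable.\<close>
    have "t \<le> Nn - s2 + s3 + KA1 + El"
      if "tu \<le> m1 - md - s2 + s3 + m4 + qA + cl" "m1 = kf + N" "md = kl + NL" "m4 + cNA \<le> cA + ck"
        "ke \<le> k1 + El" "k2A \<le> kA" "k2A = qA + cA" "KA1 = k + kA" "tu = t + tu0" "N - NL \<le> Nn + cNA + ke"
        "kf - kl + ck + cl - tu0 + k1 \<le> k"
      for t Nn s2 s3 KA1 El tu m1 md m4 qA cl kf N kl NL cNA cA ck ke k1 k2A kA k tu0 :: real
      using that by linarith
    from this[OF main j1 j2 j3' j4 j5 j6 j7 j8 j9 j10]
    show "real (q - n) * T r \<le> (\<Sum>j\<le>q. trunc_count_zeros n (f j) r) - (\<Sum>k\<le>n. circle_mean (\<lambda>z. ln (\<omega> k z)) r)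
     + (\<Sum>(k,j)\<in>{..n} \<times> {..q}. circle_mean (\<lambda>z. ln_plus (norm (M k j z) * \<omega> k z / norm (f j z))) r)
     + K * (1 + circle_mean A r) + K * (if E = {} then 0 else ln r)"
      unfolding m2 m3 X_def by (simp add: case_prod_unfold)
  qed
qed

end

section \<open>The characteristic function of a quotient of entire functions\<close>

lemma hyper_order_le:
  assumes "eventually (\<lambda>r. S r \<le> exp (r powr \<sigma>)) at_top" "\<sigma> \<ge> 0"
  shows "hyper_order S \<le> ereal \<sigma>"
  unfolding hyper_order_def
proof (rule Limsup_bounded)
  show "eventually (\<lambda>r. ereal (ln_plus (ln_plus (S r)) / ln r) \<le> ereal \<sigma>) at_top"
    using assms(1) eventually_gt_at_top[of 1]
  proof eventually_elim
    case (elim r)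
    have "max 1 (S r) \<le> exp (r powr \<sigma>)" using elim by simp
    hence "ln (max 1 (S r)) \<le> ln (exp (r powr \<sigma>))" by (intro ln_mono) auto
    hence 1: "ln_plus (S r) \<le> r powr \<sigma>" unfolding ln_plus_def by simp
    have "1 \<le> r powr \<sigma>" using elim assms(2) by (simp add: ge_one_powr_ge_zero)
    hence "max 1 (ln_plus (S r)) \<le> r powr \<sigma>" using 1 by simp
    hence "ln_plus (ln_plus (S r)) \<le> ln (r powr \<sigma>)" unfolding ln_plus_def by (intro ln_mono) auto
    thus ?case using elim by (simp add: ln_powr field_simps)
  qed
qed

context
  fixes D C :: "complex \<Rightarrow> complex" and V :: "complex \<Rightarrow> real" and H :: "complex \<Rightarrow> complex"
  assumes D: "D holomorphic_on UNIV" "\<exists>w. D w \<noteq> 0" and C: "C holomorphic_on UNIV" "\<exists>w. C w \<noteq> 0"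
    and V: "continuous_on UNIV V" "\<And>z. D z \<noteq> 0 \<Longrightarrow> ln (norm (D z)) \<le> V z" "\<And>z. C z \<noteq> 0 \<Longrightarrow> ln (norm (C z)) \<le> V z"
    and H: "\<And>z. C z \<noteq> 0 \<Longrightarrow> H z = D z / C z"
begin

text \<open>Near z the quotient is (w - z)^(d - e) times a nonvanishing holomorphic function, d and
  e being the multiplicities of D and C. Common zeros can only lower the order of the pole.\<close>

lemma pole_mult_quotient_le: "pole_mult H z \<le> zero_mult C z"
proof -
  obtain k where k: "k holomorphic_on UNIV" "\<And>w. D w = (w - z) ^ zero_mult D z * k w" "k z \<noteq> 0"
    using entire_factor_at[OF D, of z] by blast
  obtain l where l: "l holomorphic_on UNIV" "\<And>w. C w = (w - z) ^ zero_mult C z * l w" "l z \<noteq> 0"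
    using entire_factor_at[OF C, of z] by blast
  define S where "S = {w. l w \<noteq> 0}"
  have "open S" unfolding S_def
    by (intro open_Collect_neq holomorphic_on_imp_continuous_on[OF l(1)] continuous_on_const)
  moreover have "(\<lambda>w. k w / l w) holomorphic_on S"
    by (intro holomorphic_on_divide holomorphic_on_subset[OF k(1)] holomorphic_on_subset[OF l(1)]) (auto simp: S_def)
  moreover have "H w = k w / l w * (w - z) powi (int (zero_mult D z) - int (zero_mult C z))" if w: "w \<in> S" "w \<noteq> z" for w
  proof -
    have "C w \<noteq> 0" using w l(2)[of w] unfolding S_def by simp
    hence "H w = D w / C w" by (rule H)
    also have "\<dots> = ((w - z) ^ zero_mult D z * k w) / ((w - z) ^ zero_mult C z * l w)"
      unfolding k(2)[of w] l(2)[of w] ..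
    also have "\<dots> = k w / l w * (w - z) powi (int (zero_mult D z) - int (zero_mult C z))"
      using w by (simp add: power_int_diff mult.commute)
    finally show ?thesis .
  qed
  ultimately have "zorder H z = int (zero_mult D z) - int (zero_mult C z)"
    by (intro zorder_eqI[of S z "\<lambda>w. k w / l w"]) (use k(3) l(3) in \<open>auto simp: S_def\<close>)
  thus ?thesis unfolding pole_mult_def by (auto simp: nat_le_iff)
qed

text \<open>log^+ |D/C| + log |C| is the larger of log |D| and log |C|, hence at most V; Jensen
  replaces the mean of log |C| by its counting function.\<close>

lemma generic_quotient_char_le:
  obtains K where "K \<ge> 0" "\<And>R. R \<ge> 1 \<Longrightarrow> (\<And>w. norm w = R \<Longrightarrow> D w \<noteq> 0 \<and> C w \<noteq> 0) \<Longrightarrow>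
    circle_mean (\<lambda>z. ln_plus (norm (D z / C z))) R + int_count (zero_mult C) R \<le> circle_mean V R + K"
proof -
  obtain K where K: "\<And>R. R > 0 \<Longrightarrow> (\<And>w. norm w = R \<Longrightarrow> C w \<noteq> 0) \<Longrightarrow>
    circle_mean (\<lambda>w. ln (norm (C w))) R = K + int_count (zero_mult C) R" using jensen[OF C] by blast
  show ?thesis
  proof (rule that[of "\<bar>K\<bar>"])
    fix R :: real assume R: "R \<ge> 1" and nz: "\<And>w. norm w = R \<Longrightarrow> D w \<noteq> 0 \<and> C w \<noteq> 0"
    have R0: "R \<ge> 0" "R > 0" using R by auto
    have c1: "continuous_on (sphere 0 R) (\<lambda>z. ln_plus (norm (D z / C z)))"
      by (intro continuous_on_ln_plus continuous_on_norm continuous_on_divide holomorphic_on_imp_continuous_on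
        holomorphic_on_subset[OF D(1)] holomorphic_on_subset[OF C(1)]) (use nz in auto)
    have c2: "continuous_on (sphere 0 R) (\<lambda>z. ln (norm (C z)))"
      by (rule continuous_on_ln_norm[OF C(1)]) (use nz in auto)
    have "circle_mean (\<lambda>z. ln_plus (norm (D z / C z)) + ln (norm (C z))) R \<le> circle_mean V R"
    proof (rule circle_mean_mono[OF R0(1) continuous_on_add[OF c1 c2] continuous_on_subset[OF V(1)]])
      fix z :: complex assume "norm z = R"
      hence z: "D z \<noteq> 0" "C z \<noteq> 0" using nz by auto
      have "ln (norm (D z / C z)) = ln (norm (D z)) - ln (norm (C z))" using z by (simp add: norm_divide ln_div)
      moreover have "ln_plus (norm (D z / C z)) = 0 \<or> ln_plus (norm (D z / C z)) = ln (norm (D z / C z))"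
        unfolding ln_plus_def by (auto simp: max_def)
      ultimately show "ln_plus (norm (D z / C z)) + ln (norm (C z)) \<le> V z"
        using V(2)[OF z(1)] V(3)[OF z(2)] by linarith
    qed simp
    thus "circle_mean (\<lambda>z. ln_plus (norm (D z / C z))) R + int_count (zero_mult C) R \<le> circle_mean V R + \<bar>K\<bar>"
      using K[OF R0(2)] nz circle_mean_add[OF R0(1) c1 c2] by fastforce
  qed simp
qed

text \<open>The hyper-order is an upper limit over all radii, so r may be any radius here and only R
  is generic. The factor 3 bounds (R + r) / (R - r) for R > 2 r. Green's function is estimated by ln
  x \<le> 2 x^(1/2), whose singularities \<open>circle_powr_majorant\<close> can integrate even on
  the circle.\<close>

lemma ln_plus_quotient_le:
  assumes r: "1 \<le> r" "2 * r < R" and nz: "\<And>w. norm w = R \<Longrightarrow> D w \<noteq> 0 \<and> C w \<noteq> 0"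
    and z: "norm z = r" "C z \<noteq> 0"
  shows "ln_plus (norm (H z)) \<le> 3 * circle_mean (\<lambda>z. ln_plus (norm (D z / C z))) R
    + (\<Sum>b\<in>zeros_in C R. zero_mult C b * (2 * (2 * R) powr (1/2) * norm (z - b) powr (-1/2)))"
proof -
  let ?P = "\<lambda>z. ln_plus (norm (D z / C z))"
  have R: "R > 0" "norm z < R" using r z by auto
  have cP: "continuous_on (sphere 0 R) ?P"
    by (intro continuous_on_ln_plus continuous_on_norm continuous_on_divide holomorphic_on_imp_continuous_on
      holomorphic_on_subset[OF D(1)] holomorphic_on_subset[OF C(1)]) (use nz in auto)
  have m0: "circle_mean ?P R \<ge> 0" by (rule circle_mean_nonneg[OF less_imp_le[OF R(1)] cP]) simp
  have s0: "(\<Sum>b\<in>zeros_in C R. zero_mult C b * (2 * (2 * R) powr (1/2) * norm (z - b) powr (-1/2))) \<ge> 0"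
    by (intro sum_nonneg) simp
  show ?thesis
  proof (cases "D z = 0")
    case True
    hence "H z = 0" using H[OF z(2)] by simp
    thus ?thesis using m0 s0 unfolding ln_plus_def by simp
  next
    case False
    have cD: "continuous_on (sphere 0 R) (\<lambda>w. ln (norm (D w)))" "continuous_on (sphere 0 R) (\<lambda>w. ln (norm (C w)))"
      by (intro continuous_on_ln_norm D C; use nz in auto)+
    have "ln (norm (H z)) = ln (norm (D z)) - ln (norm (C z))"
      using H[OF z(2)] False z by (simp add: norm_divide ln_div)
    also have "\<dots> = poisson R (\<lambda>w. ln (norm (D w)) - ln (norm (C w))) z
       - (\<Sum>a\<in>zeros_in D R. zero_mult D a * green R z a) + (\<Sum>b\<in>zeros_in C R. zero_mult C b * green R z b)"
      using poisson_jensen[OF D(1) _ R(2) False] poisson_jensen[OF C(1) _ R(2) z(2)] nz poisson_diff[OF R(2) cD] by simp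
    also have "\<dots> \<le> 3 * circle_mean ?P R - 0 + (\<Sum>b\<in>zeros_in C R. zero_mult C b * (2 * (2 * R) powr (1/2) * norm (z - b) powr (-1/2)))"
    proof (intro add_mono diff_mono)
      have "poisson R (\<lambda>w. ln (norm (D w)) - ln (norm (C w))) z \<le> poisson R ?P z"
      proof (rule poisson_mono[OF R(2) continuous_on_diff[OF cD] cP])
        fix w :: complex assume "norm w = R"
        hence "D w \<noteq> 0" "C w \<noteq> 0" using nz by auto
        thus "ln (norm (D w)) - ln (norm (C w)) \<le> ?P w"
          using ln_le_ln_plus[of "norm (D w / C w)"] by (simp add: norm_divide ln_div)
      qed
      also have "\<dots> \<le> (R + norm z) / (R - norm z) * circle_mean ?P R"
        by (rule poisson_le_circle_mean[OF R(2) cP cP]) simp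
      also have "\<dots> \<le> 3 * circle_mean ?P R"
        by (intro mult_right_mono m0) (use r z in \<open>simp add: divide_le_eq\<close>)
      finally show "poisson R (\<lambda>w. ln (norm (D w)) - ln (norm (C w))) z \<le> 3 * circle_mean ?P R" .
      show "0 \<le> (\<Sum>a\<in>zeros_in D R. zero_mult D a * green R z a)"
      proof (intro sum_nonneg mult_nonneg_nonneg green_nonneg)
        fix a assume "a \<in> zeros_in D R"
        thus "norm a \<le> R" "z \<noteq> a" using False unfolding zeros_in_def by auto
      qed (use R in auto)
      show "(\<Sum>b\<in>zeros_in C R. zero_mult C b * green R z b) \<le> (\<Sum>b\<in>zeros_in C R. zero_mult C b * (2 * (2 * R) powr (1/2) * norm (z - b) powr (-1/2)))"
      proof (intro sum_mono mult_left_mono)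
        fix b assume "b \<in> zeros_in C R"
        hence b: "norm b \<le> R" "z \<noteq> b" using z unfolding zeros_in_def by auto
        have pos: "norm (z - b) > 0" using b by simp
        have "green R z b \<le> ln (2 * R / norm (z - b))" by (rule green_le[OF R(2) b R(1)])
        also have "\<dots> \<le> (2 * R / norm (z - b)) powr (1/2) / (1/2)"
        proof (rule ln_powr_bound)
          have "norm (z - b) \<le> 2 * R" using norm_triangle_ineq4[of z b] R b by linarith
          thus "1 \<le> 2 * R / norm (z - b)" using pos by simp
        qed simp
        also have "\<dots> = 2 * (2 * R) powr (1/2) * norm (z - b) powr (-1/2)"
          using pos R by (simp add: powr_divide powr_minus_divide)
        finally show "green R z b \<le> 2 * (2 * R) powr (1/2) * norm (z - b) powr (-1/2)" .
      qed simp
    qed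
    finally have "ln (norm (H z)) \<le> 3 * circle_mean ?P R + (\<Sum>b\<in>zeros_in C R. zero_mult C b * (2 * (2 * R) powr (1/2) * norm (z - b) powr (-1/2)))"
      by simp
    moreover have "ln_plus (norm (H z)) = 0 \<or> ln_plus (norm (H z)) = ln (norm (H z))"
      unfolding ln_plus_def by (auto simp: max_def)
    ultimately show ?thesis using m0 s0 by (auto intro: add_nonneg_nonneg)
  qed
qed

lemma countable_circle_preimage: "r > 0 \<Longrightarrow> countable {t. of_real r * cis t = (b::complex)}"
proof -
  assume r: "r > 0"
  have "{t. of_real r * cis t = b} \<subseteq> (\<lambda>k::int. Arg b + of_int k * pi) ` UNIV"
  proof
    fix t assume "t \<in> {t. of_real r * cis t = b}"
    hence "r * \<bar>sin (t - Arg b)\<bar> \<le> 0" using norm_circle_diff_ge[of r t b] r by simp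
    hence "r * \<bar>sin (t - Arg b)\<bar> = 0" using r by (simp add: mult_le_0_iff)
    hence "sin (t - Arg b) = 0" using r by simp
    then obtain k :: int where "t - Arg b = of_int k * pi" using sin_zero_iff_int2 by blast
    thus "t \<in> (\<lambda>k::int. Arg b + of_int k * pi) ` UNIV" by (auto intro!: image_eqI[of _ _ k])
  qed
  thus ?thesis by (rule countable_subset) simp
qed

text \<open>R carries Poisson-Jensen for points of modulus r, and R' bounds the number of zeros of C
  up to R. Both avoid zeros of D and C, whereas r is arbitrary.\<close>

lemma quotient_char_le:
  obtains K where "K \<ge> 0" "\<And>r R R'. 1 \<le> r \<Longrightarrow> 2 * r < R \<Longrightarrow> R < 3 * r \<Longrightarrow> 4 * r < R' \<Longrightarrow> R' < 5 * r \<Longrightarrow>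
    (\<And>w. norm w = R \<or> norm w = R' \<Longrightarrow> D w \<noteq> 0 \<and> C w \<noteq> 0) \<Longrightarrow>
    nevanlinna_char H r \<le> K * (circle_mean V R + K) + K * (circle_mean V R' + K)"
proof -
  obtain K0 where K0: "K0 \<ge> 0" "\<And>R. R \<ge> 1 \<Longrightarrow> (\<And>w. norm w = R \<Longrightarrow> D w \<noteq> 0 \<and> C w \<noteq> 0) \<Longrightarrow>
    circle_mean (\<lambda>z. ln_plus (norm (D z / C z))) R + int_count (zero_mult C) R \<le> circle_mean V R + K0"
    using generic_quotient_char_le by blast
  obtain Q where Q: "Q > 0" "\<And>r (a::complex). r > 0 \<Longrightarrow> \<exists>\<phi> I. (\<phi> has_integral I) {0..2*pi} \<and> I \<le> Q * r powr (-1/2) \<and>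
    (\<forall>t\<in>{0..2*pi}. norm (of_real r * cis t - a) powr (-1/2) \<le> \<phi> t)"
    using circle_powr_majorant[of "1/2"] by auto
  \<comment> \<open>The 4 comes from 3 m + N \<le> 4 (m + N). The last entry is the 4 of
    \<open>zn\<close> times the 2 Q 6^(1/2) of \<open>sle\<close>, where 6 stems from 2 R < 6
    r.\<close>
  define K where "K = max K0 (max 4 (8 * Q * 6 powr (1/2)))"
  have K: "K \<ge> K0" "K \<ge> 4" "K \<ge> 8 * Q * 6 powr (1/2)" unfolding K_def by auto
  have K00: "K \<ge> 0" using K by simp
  show ?thesis
  proof (rule that[OF K00])
    fix r R R' :: real
    assume r: "1 \<le> r" "2 * r < R" "R < 3 * r" "4 * r < R'" "R' < 5 * r"
      and nz: "\<And>w. norm w = R \<or> norm w = R' \<Longrightarrow> D w \<noteq> 0 \<and> C w \<noteq> 0"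
    define m where "m = circle_mean (\<lambda>z. ln_plus (norm (D z / C z))) R"
    have finC: "finite {z \<in> cball 0 R. zero_mult C z \<noteq> 0}" for R
      unfolding zero_mult_support[OF C] by (rule finite_zeros_in[OF C])
    have finP: "finite {z \<in> cball 0 R. pole_mult H z \<noteq> 0}" for R
      by (rule finite_subset[OF _ finC[of R]]) (use pole_mult_quotient_le in \<open>auto dest: le_trans simp: Suc_le_eq[symmetric]\<close>)
    have cont: "continuous_on (sphere 0 S) (\<lambda>z. ln_plus (norm (D z / C z)))" if "S = R \<or> S = R'" for S
      by (intro continuous_on_ln_plus continuous_on_norm continuous_on_divide holomorphic_on_imp_continuous_on
        holomorphic_on_subset[OF D(1)] holomorphic_on_subset[OF C(1)]) (use nz that in auto)
    have mnn: "circle_mean (\<lambda>z. ln_plus (norm (D z / C z))) S \<ge> 0" if "S = R \<or> S = R'" for S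
      by (rule circle_mean_nonneg[OF _ cont[OF that]]) (use r that in auto)
    have NC: "int_count (zero_mult C) S \<ge> 0" if "S \<ge> 1" for S by (rule int_count_nonneg[OF finC that])
    have bR: "m + int_count (zero_mult C) R \<le> circle_mean V R + K" unfolding m_def
      using K0(2)[of R] r nz K(1) by fastforce
    have bR': "int_count (zero_mult C) R' \<le> circle_mean V R' + K"
      using K0(2)[of R'] mnn[of R'] r nz K(1) by fastforce
    have pole: "int_count (pole_mult H) r \<le> int_count (zero_mult C) R"
    proof -
      have "int_count (pole_mult H) r \<le> int_count (zero_mult C) r"
      proof -
        define W where "W = zeros_in C r"
        have W: "finite W" "W \<subseteq> cball 0 r" unfolding W_def using finite_zeros_in[OF C] by (auto simp: zeros_in_def)
        have s1: "z \<in> W" if "norm z \<le> r" "zero_mult C z \<noteq> 0" for z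
          using that unfolding W_def zero_mult_support[OF C, symmetric] by simp
        have s2: "z \<in> W" if "norm z \<le> r" "pole_mult H z \<noteq> 0" for z
          using s1[OF that(1)] that(2) pole_mult_quotient_le[of z] by linarith
        have r0: "r > 0" using r by simp
        have "int_count (zero_mult C) r = (\<Sum>a\<in>W. zero_mult C a * log_weight r a)"
          by (rule int_count_eq_sum[OF r0 W]) (rule s1)
        moreover have "int_count (pole_mult H) r = (\<Sum>a\<in>W. pole_mult H a * log_weight r a)"
          by (rule int_count_eq_sum[OF r0 W]) (rule s2)
        moreover have "(\<Sum>a\<in>W. pole_mult H a * log_weight r a) \<le> (\<Sum>a\<in>W. zero_mult C a * log_weight r a)"
          by (intro sum_mono mult_right_mono log_weight_nonneg) (use pole_mult_quotient_le W(2) r in auto)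
        ultimately show ?thesis by simp
      qed
      also have "\<dots> \<le> int_count (zero_mult C) R"
      proof -
        have "(\<Sum>a\<in>{z \<in> cball 0 r. zero_mult C z \<noteq> 0}. real (zero_mult C a)) * ln (R / r) \<ge> 0"
          by (intro mult_nonneg_nonneg sum_nonneg) (use r in auto)
        thus ?thesis using int_count_mono_radius[OF finC, of r R] r by simp
      qed
      finally show ?thesis .
    qed
    have zn: "zeros_number C R \<le> 4 * int_count (zero_mult C) R'"
    proof -
      have "ln (R / R') \<le> R / R' - 1" using r by (intro ln_le_minus_one divide_pos_pos) auto
      also have "R / R' \<le> (3 * r) / (4 * r)" using r by (intro frac_le) auto
      finally have "ln (R' / R) \<ge> 1/4" using r by (simp add: ln_div)
      hence "zeros_number C R * (1/4) \<le> zeros_number C R * ln (R' / R)" by (intro mult_left_mono) auto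
      also have "\<dots> \<le> int_count (zero_mult C) R'" by (rule zeros_number_le[OF C]) (use r in auto)
      finally show ?thesis by simp
    qed
    have prox: "proximity H r \<le> 3 * m + K * int_count (zero_mult C) R'"
    proof -
      let ?h = "\<lambda>t. ln_plus (norm (H (of_real r * cis t)))"
      have r0: "r > 0" using r by simp
      have "\<forall>b. \<exists>\<phi> I. (\<phi> has_integral I) {0..2*pi} \<and> I \<le> Q * r powr (-1/2) \<and>
        (\<forall>t\<in>{0..2*pi}. norm (of_real r * cis t - b) powr (-1/2) \<le> \<phi> t)" using Q(2)[OF r0] by blast
      then obtain \<phi> I where \<phi>: "\<And>b. (\<phi> b has_integral I b) {0..2*pi}" "\<And>b. I b \<le> Q * r powr (-1/2)"
        "\<And>b t. t \<in> {0..2*pi} \<Longrightarrow> norm (of_real r * cis t - b) powr (-1/2) \<le> \<phi> b t" by metis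
      define s where "s = 2 * (2 * R) powr (1/2)"
      have s: "s \<ge> 0" unfolding s_def by simp
      define \<psi> where "\<psi> t = 3 * m + (\<Sum>b\<in>zeros_in C R. zero_mult C b * (s * \<phi> b t))" for t
      define B where "B = {t. C (of_real r * cis t) = 0}"
      have hi\<psi>: "(\<psi> has_integral (2*pi * (3 * m) + (\<Sum>b\<in>zeros_in C R. zero_mult C b * (s * I b)))) {0..2*pi}"
        unfolding \<psi>_def
      proof (intro has_integral_add has_integral_sum has_integral_mult_right \<phi> finite_zeros_in C)
        show "((\<lambda>t. 3 * m) has_integral 2 * pi * (3 * m)) {0..2 * pi}"
          using has_integral_const_real[of "3 * m" 0 "2*pi"] by simp
      qed
      have negB: "negligible B"
      proof -
        have "B \<subseteq> (\<Union>b\<in>{b. C b = 0}. {t. of_real r * cis t = b})" unfolding B_def by auto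
        moreover have "countable (\<Union>b\<in>{b. C b = 0}. {t. of_real r * cis t = b})"
          by (intro countable_UN countable_zeros[OF C] countable_circle_preimage r0)
        ultimately have "countable B" by (rule countable_subset)
        hence "negligible (\<Union>((\<lambda>t. {t}) ` B))" by (intro negligible_countable_Union) auto
        thus ?thesis by simp
      qed
      have pt: "?h t \<le> \<psi> t" if t: "t \<in> {0..2*pi}" "t \<notin> B" for t
      proof -
        have nr: "norm (of_real r * cis t) = r" using r0 by (simp add: norm_mult)
        have nC: "C (of_real r * cis t) \<noteq> 0" using t unfolding B_def by simp
        have nzR: "D w \<noteq> 0 \<and> C w \<noteq> 0" if "norm w = R" for w using nz that by blast
        have "?h t \<le> 3 * m + (\<Sum>b\<in>zeros_in C R. zero_mult C b * (s * norm (of_real r * cis t - b) powr (-1/2)))"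
          unfolding m_def s_def by (rule ln_plus_quotient_le[OF r(1,2) nzR nr nC])
        also have "\<dots> \<le> \<psi> t" unfolding \<psi>_def
          by (intro add_left_mono sum_mono mult_left_mono \<phi>(3) t s) auto
        finally show ?thesis .
      qed
      have sumI: "(\<Sum>b\<in>zeros_in C R. zero_mult C b * (s * I b)) \<le> zeros_number C R * (s * (Q * r powr (-1/2)))"
        unfolding zeros_number_def sum_distrib_right by (intro sum_mono mult_left_mono \<phi>(2) s) auto
      have sle: "s * (Q * r powr (-1/2)) \<le> 2 * Q * 6 powr (1/2)"
      proof -
        have "(2 * R) powr (1/2) \<le> (6 * r) powr (1/2)" using r by (intro powr_mono2) auto
        also have "\<dots> = 6 powr (1/2) * r powr (1/2)" using r by (simp add: powr_mult)
        finally have "s \<le> 2 * (6 powr (1/2) * r powr (1/2))" unfolding s_def by simp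
        hence "s * (Q * r powr (-1/2)) \<le> 2 * (6 powr (1/2) * r powr (1/2)) * (Q * r powr (-1/2))"
          using Q(1) by (intro mult_right_mono) auto
        also have "\<dots> = 2 * Q * 6 powr (1/2) * (r powr (1/2) * r powr (-1/2))" by simp
        also have "r powr (1/2) * r powr (-1/2) = 1" using r by (simp flip: powr_add)
        finally show ?thesis by simp
      qed
      have "integral {0..2*pi} ?h \<le> 2*pi * (3 * m) + (\<Sum>b\<in>zeros_in C R. zero_mult C b * (s * I b))"
      \<comment> \<open>A non-integrable function has integral 0, so the estimate holds in that case
        too once its right-hand side is known to be nonnegative.\<close>
      proof (cases "?h integrable_on {0..2*pi}")
        case True
        have "((\<lambda>t. if t \<in> B then ?h t else \<psi> t) has_integral (2*pi * (3 * m) + (\<Sum>b\<in>zeros_in C R. zero_mult C b * (s * I b)))) {0..2*pi}"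
          by (rule has_integral_spike[OF negB _ hi\<psi>]) auto
        from has_integral_le[OF integrable_integral[OF True] this] pt show ?thesis by auto
      next
        case False
        have "((\<lambda>t. if t \<in> B then 0 else \<psi> t) has_integral (2*pi * (3 * m) + (\<Sum>b\<in>zeros_in C R. zero_mult C b * (s * I b)))) {0..2*pi}"
          by (rule has_integral_spike[OF negB _ hi\<psi>]) auto
        moreover have "0 \<le> (if t \<in> B then 0 else \<psi> t)" if "t \<in> {0..2*pi}" for t
          using order_trans[OF ln_plus_nonneg pt[OF that]] by simp
        ultimately have "0 \<le> 2*pi * (3 * m) + (\<Sum>b\<in>zeros_in C R. zero_mult C b * (s * I b))"
          by (rule has_integral_nonneg)
        thus ?thesis using False by (simp add: not_integrable_integral)
      qed
      also have "\<dots> \<le> 2*pi * (3 * m) + zeros_number C R * (2 * Q * 6 powr (1/2))"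
        using sumI mult_left_mono[OF sle zeros_number_nonneg[of C R]] by linarith
      finally have "proximity H r \<le> (2*pi * (3 * m) + zeros_number C R * (2 * Q * 6 powr (1/2))) / (2*pi)"
        unfolding proximity_def by (intro divide_right_mono) auto
      also have "\<dots> = 3 * m + zeros_number C R * (2 * Q * 6 powr (1/2)) / (2*pi)" by (simp add: add_divide_distrib)
      also have "zeros_number C R * (2 * Q * 6 powr (1/2)) / (2*pi) \<le> zeros_number C R * (2 * Q * 6 powr (1/2)) / 1"
      proof (rule divide_left_mono)
        show "1 \<le> 2 * pi" using pi_gt3 by linarith
      qed (use Q(1) in auto)
      also have "\<dots> \<le> 4 * int_count (zero_mult C) R' * (2 * Q * 6 powr (1/2)) / 1"
        using zn Q(1) by (intro divide_right_mono mult_right_mono) auto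
      also have "\<dots> = (8 * Q * 6 powr (1/2)) * int_count (zero_mult C) R'" by simp
      also have "\<dots> \<le> K * int_count (zero_mult C) R'" using K(3) NC[of R'] r by (intro mult_right_mono) auto
      finally show ?thesis by simp
    qed
    have "nevanlinna_char H r \<le> (3 * m + int_count (zero_mult C) R) + K * int_count (zero_mult C) R'"
      unfolding nevanlinna_char_def using prox pole by simp
    also have "3 * m + int_count (zero_mult C) R \<le> 4 * (m + int_count (zero_mult C) R)"
      using mnn[of R] NC[of R] r unfolding m_def by simp
    also have "\<dots> \<le> K * (m + int_count (zero_mult C) R)"
      using K(2) mnn[of R] NC[of R] r unfolding m_def by (intro mult_right_mono) auto
    also have "\<dots> \<le> K * (circle_mean V R + K)" using bR K00 by (intro mult_left_mono)
    also have "K * int_count (zero_mult C) R' \<le> K * (circle_mean V R' + K)" using bR' K00 by (intro mult_left_mono)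
    finally show "nevanlinna_char H r \<le> K * (circle_mean V R + K) + K * (circle_mean V R' + K)" by simp
  qed
qed

end

section \<open>Quotients with shifted majorants\<close>

text \<open>The mean is in fact the larger of ln R and ln |b|.\<close>

lemma circle_mean_ln_diff_ge:
  assumes "R > 0" "norm b \<noteq> R"
  shows "circle_mean (\<lambda>z. ln (norm (z - b))) R \<ge> ln R"
proof (cases "b = 0")
  case True
  have "circle_mean (\<lambda>z. ln (norm (z - b))) R = circle_mean (\<lambda>_. ln R) R"
    by (rule circle_mean_cong) (use True assms in auto)
  thus ?thesis by simp
next
  case False
  have "circle_mean (\<lambda>z. ln (norm (z - b))) R = ln (norm (0 - b)) + (if norm b < R then green R 0 b else 0)"
    using poisson_ln_norm_diff[of b R 0] assms False by (simp add: poisson_0)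
  also have "\<dots> \<ge> ln R"
    using False assms by (auto simp: green_def ln_div power2_eq_square norm_mult ln_mult)
  finally show ?thesis .
qed

context curve
begin

text \<open>Only the hyper-order has to be preserved, so constants, ln R and the dilation to 7 R are
  harmless. U has no sign, but u = U - log |g_0| is nonnegative, so its Poisson integral is bounded
  by a multiple of its mean; the zeros of g_0 are paid for by Green terms, and the shifted log |g_0|
  by Jensen and \<open>shifted_count_le\<close>.\<close>

lemma shifted_mean_U_le:
  assumes g0: "\<exists>z. g 0 z \<noteq> 0" and \<sigma>: "\<sigma> \<ge> 0" and T: "eventually (\<lambda>r. T r \<le> exp (r powr \<sigma>)) at_top"
  obtains K R0 C where "countable C" "R0 \<ge> 1" "K \<ge> 0"
    "\<And>R. R \<ge> R0 \<Longrightarrow> R \<notin> C \<Longrightarrow> circle_mean (\<lambda>z. U (z + w)) R \<le> K * ((1 + ln R) * exp ((7 * R) powr \<sigma>))"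
proof -
  have h0: "g 0 holomorphic_on UNIV" by (rule holo) simp
  define C where "C = (\<Union>k\<in>{k. k \<le> n \<and> (\<exists>z. g k z \<noteq> 0)}. norm ` {z. g k z = 0}) \<union> norm ` (\<lambda>z. z - w) ` {z. g 0 z = 0}"
  have "countable C" unfolding C_def
    by (intro countable_Un countable_UN countable_image countable_zeros h0 g0) (use countable_zeros holo in auto)
  have C1: "g k z \<noteq> 0" if "norm z \<notin> C" "k \<le> n" "\<exists>z. g k z \<noteq> 0" for k z
    using that unfolding C_def by blast
  have C2: "norm (a - w) \<notin> {R}" if "g 0 a = 0" "R \<notin> C" for a R
    using that unfolding C_def by auto
  obtain R1 where R1: "\<And>r. r \<ge> R1 \<Longrightarrow> T r \<le> exp (r powr \<sigma>)"
    using T unfolding eventually_at_top_linorder by blast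
  have maj: "majorized (\<lambda>_. 0) (g 0)" by (rule majorized_component) (use g0 in auto)
  obtain K1 where K1: "\<And>R. R > 0 \<Longrightarrow> (\<And>w. norm w = R \<Longrightarrow> g 0 w \<noteq> 0) \<Longrightarrow> int_count (zero_mult (g 0)) R \<le> T R + circle_mean (\<lambda>_. 0) R + K1"
    using int_count_majorized[OF _ maj] by auto
  obtain Kj where Kj: "\<And>R. R > 0 \<Longrightarrow> (\<And>w. norm w = R \<Longrightarrow> g 0 w \<noteq> 0) \<Longrightarrow>
    circle_mean (\<lambda>w. ln (norm (g 0 w))) R = Kj + int_count (zero_mult (g 0)) R" using jensen[OF h0 g0] by blast
  define gw where "gw z = g 0 (z + w)" for z
  have gw: "gw holomorphic_on UNIV" "\<exists>z. gw z \<noteq> 0"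
  proof -
    show "gw holomorphic_on UNIV" unfolding gw_def by (rule shift_holomorphic[OF h0])
    obtain z where "g 0 z \<noteq> 0" using g0 by blast
    thus "\<exists>z. gw z \<noteq> 0" unfolding gw_def by (intro exI[of _ "z - w"]) simp
  qed
  obtain K2 where K2: "\<And>R. R > 0 \<Longrightarrow> (\<And>z. norm z = R \<Longrightarrow> gw z \<noteq> 0) \<Longrightarrow>
    circle_mean (\<lambda>z. ln (norm (gw z))) R = K2 + int_count (zero_mult gw) R" using jensen[OF gw] by blast
  obtain K3 where K3: "K3 \<ge> 0" "\<And>r. r \<ge> 1 \<Longrightarrow> int_count (zero_mult gw) r
    \<le> (1 + 1) * int_count (zero_mult (g 0)) (r + norm w) + K3 * (1 + ln r)"
    unfolding gw_def[abs_def] using shifted_count_le[OF h0 g0, of 1 w] by auto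
  define c1 where "c1 = \<bar>U 0\<bar> + \<bar>Kj\<bar>"
  define k1 where "k1 = \<bar>K1\<bar>"
  define K where "K = 3 + 3 * c1 + 54 * (1 + k1) + \<bar>K2\<bar> + 2 + 2 * k1 + K3"
  define R0 where "R0 = max 1 (max R1 (2 * norm w))"
  have R0: "R0 \<ge> 1" "R0 \<ge> R1" "R0 \<ge> 2 * norm w" unfolding R0_def by auto
  have nn: "c1 \<ge> 0" "k1 \<ge> 0" unfolding c1_def k1_def by auto
  show ?thesis
  proof (rule that[OF \<open>countable C\<close> R0(1)])
    show "K \<ge> 0" unfolding K_def using nn K3(1) by simp
    fix R :: real assume R: "R \<ge> R0" and RC: "R \<notin> C"
    have R': "R \<ge> 1" "R \<ge> R1" "R \<ge> 2 * norm w" "R > 0" "R \<ge> 0" using R R0 by linarith+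
    obtain S where S: "4 * R < S" "S < 5 * R" "S \<notin> C" using ex_not_countable[OF \<open>countable C\<close>, of "4*R" "5*R"] R' by auto
    obtain S' where S': "6 * R < S'" "S' < 7 * R" "S' \<notin> C" using ex_not_countable[OF \<open>countable C\<close>, of "6*R" "7*R"] R' by auto
    have Sp: "S > 0" "S' > 0" "S \<ge> 0" using S S' R' by auto
    define E where "E = exp ((7 * R) powr \<sigma>)"
    define b where "b = 1 + ln R"
    have E1: "E \<ge> 1" unfolding E_def by simp
    have b1: "b \<ge> 1" unfolding b_def using R' by simp
    have TE: "T S \<le> E" "T S' \<le> E"
    proof -
      have "S powr \<sigma> \<le> (7 * R) powr \<sigma>" "S' powr \<sigma> \<le> (7 * R) powr \<sigma>" using S S' R' \<sigma> by (auto intro!: powr_mono2)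
      thus "T S \<le> E" "T S' \<le> E" unfolding E_def using R1[of S] R1[of S'] S S' R'
        by (auto intro: order_trans)
    qed
    have nz: "g 0 z \<noteq> 0" if "norm z = S \<or> norm z = S'" for z
      by (rule C1) (use that S S' g0 in auto)
    have nzw: "gw z \<noteq> 0" if "norm z = R" for z
      using C2[of "z + w" R] RC that unfolding gw_def by auto
    have N: "int_count (zero_mult (g 0)) S \<le> E + k1" "int_count (zero_mult (g 0)) S' \<le> E + k1"
      using K1[OF Sp(1)] K1[OF Sp(2)] nz TE unfolding k1_def by fastforce+
    have N0: "int_count (zero_mult (g 0)) S \<ge> 0"
    proof (rule int_count_nonneg)
      show "finite {z \<in> cball 0 S. zero_mult (g 0) z \<noteq> 0}"
        unfolding zero_mult_support[OF h0 g0] by (rule finite_zeros_in[OF h0 g0])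
    qed (use S R' in linarith)
    define u where "u z = U z - ln (norm (g 0 z))" for z
    have c0: "continuous_on (sphere 0 S) (\<lambda>z. ln (norm (g 0 z)))"
      by (rule continuous_on_ln_norm[OF h0]) (use nz in auto)
    have cu: "continuous_on (sphere 0 S) u" unfolding u_def
      by (intro continuous_on_diff continuous_on_U c0)
    define \<mu> where "\<mu> = circle_mean u S"
    have u0: "u z \<ge> 0" if "norm z = S" for z
      unfolding u_def using ln_norm_le[of 0 z] nz that by simp
    have \<mu>: "0 \<le> \<mu>" "\<mu> \<le> E + c1"
    proof -
      show "0 \<le> \<mu>" unfolding \<mu>_def by (rule circle_mean_nonneg[OF Sp(3) cu u0])
      have "\<mu> = T S + U 0 - (Kj + int_count (zero_mult (g 0)) S)"
        unfolding \<mu>_def u_def using circle_mean_diff[OF Sp(3) continuous_on_U c0] circle_mean_U[of S] Kj[OF Sp(1)] nz by simp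
      thus "\<mu> \<le> E + c1" using TE N0 unfolding c1_def by linarith
    qed
    have zn: "zeros_number (g 0) S \<le> 6 * (E + k1)"
    proof -
      have "ln (S / S') \<le> S / S' - 1" using Sp by (intro ln_le_minus_one divide_pos_pos) auto
      also have "S / S' \<le> (5 * R) / (6 * R)" using S S' R' by (intro frac_le) auto
      finally have "ln (S' / S) \<ge> 1/6" using Sp R' by (simp add: ln_div)
      hence "zeros_number (g 0) S * (1/6) \<le> zeros_number (g 0) S * ln (S' / S)" by (intro mult_left_mono) auto
      also have "\<dots> \<le> int_count (zero_mult (g 0)) S'" by (rule zeros_number_le[OF h0 g0]) (use S S' R' in auto)
      finally show ?thesis using N(2) by simp
    qed
    have l10: "ln (2 * S) \<le> 9 * b"
    proof -
      have "ln (2 * S) \<le> ln (10 * R)" using S Sp by (intro ln_mono) auto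
      also have "\<dots> = ln 10 + ln R" using R' by (simp add: ln_mult)
      also have "ln 10 \<le> (10::real) - 1" by (rule ln_le_minus_one) simp
      finally show ?thesis unfolding b_def using ln_ge_zero[OF R'(1)] by simp
    qed
    define Z where "Z = zeros_in (g 0) S"
    have fZ: "finite Z" unfolding Z_def by (rule finite_zeros_in[OF h0 g0])
    have aw: "norm (a - w) \<noteq> R" if "a \<in> Z" for a
      using C2[of a R] RC that unfolding Z_def zeros_in_def by auto
    have pt: "U (z + w) - ln (norm (gw z)) \<le> 3 * \<mu> + (\<Sum>a\<in>Z. zero_mult (g 0) a * (ln (2 * S) - ln (norm (z - (a - w)))))"
      if z: "norm z = R" for z
    proof -
      have zw: "norm (z + w) \<le> 3/2 * R" using norm_triangle_ineq[of z w] z R' by simp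
      have zS: "norm (z + w) < S" using zw S R' by simp
      have gz: "g 0 (z + w) \<noteq> 0" using nzw[OF z] unfolding gw_def .
      obtain k where k: "k \<le> n" "g k (z + w) \<noteq> 0" "U (z + w) = ln (norm (g k (z + w)))" using attained by blast
      have nk: "g k x \<noteq> 0" if "norm x = S" for x by (rule C1) (use k that S in auto)
      \<comment> \<open>Subharmonicity of U, obtained from Poisson-Jensen for the component that
        attains the maximum at z + w.\<close>
      have "U (z + w) = poisson S (\<lambda>x. ln (norm (g k x))) (z + w) - (\<Sum>a\<in>zeros_in (g k) S. zero_mult (g k) a * green S (z + w) a)"
        unfolding k(3) by (rule poisson_jensen[OF holo[OF k(1)] nk zS k(2)])
      also have "\<dots> \<le> poisson S U (z + w) - 0"
      proof (intro diff_mono)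
        show "poisson S (\<lambda>x. ln (norm (g k x))) (z + w) \<le> poisson S U (z + w)"
        proof (rule poisson_mono[OF zS _ continuous_on_U])
          show "continuous_on (sphere 0 S) (\<lambda>x. ln (norm (g k x)))"
            by (rule continuous_on_ln_norm[OF holo[OF k(1)]]) (use nk in auto)
        qed (use ln_norm_le[OF k(1)] nk in auto)
        show "0 \<le> (\<Sum>a\<in>zeros_in (g k) S. zero_mult (g k) a * green S (z + w) a)"
        proof (intro sum_nonneg mult_nonneg_nonneg green_nonneg)
          fix a assume "a \<in> zeros_in (g k) S"
          thus "norm a \<le> S" "z + w \<noteq> a" using k unfolding zeros_in_def by auto
        qed (use Sp zS in auto)
      qed
      finally have 1: "U (z + w) \<le> poisson S U (z + w)" by simp
      have "ln (norm (gw z)) = poisson S (\<lambda>x. ln (norm (g 0 x))) (z + w) - (\<Sum>a\<in>Z. zero_mult (g 0) a * green S (z + w) a)"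
        unfolding gw_def Z_def by (rule poisson_jensen[OF h0 _ zS gz]) (use nz in auto)
      with 1 have "U (z + w) - ln (norm (gw z)) \<le> poisson S u (z + w) + (\<Sum>a\<in>Z. zero_mult (g 0) a * green S (z + w) a)"
        unfolding u_def using poisson_diff[OF zS continuous_on_U c0] by simp
      also have "\<dots> \<le> 3 * \<mu> + (\<Sum>a\<in>Z. zero_mult (g 0) a * (ln (2 * S) - ln (norm (z - (a - w)))))"
      proof (intro add_mono)
        have "poisson S u (z + w) \<le> (S + norm (z + w)) / (S - norm (z + w)) * \<mu>"
          unfolding \<mu>_def by (rule poisson_le_circle_mean[OF zS cu cu u0])
        also have "\<dots> \<le> 3 * \<mu>"
        proof (rule mult_right_mono[OF _ \<mu>(1)])
          have "S + norm (z + w) \<le> 3 * (S - norm (z + w))" using zw S R' by simp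
          thus "(S + norm (z + w)) / (S - norm (z + w)) \<le> 3" using zS by (simp add: divide_le_eq)
        qed
        finally show "poisson S u (z + w) \<le> 3 * \<mu>" .
        show "(\<Sum>a\<in>Z. zero_mult (g 0) a * green S (z + w) a) \<le> (\<Sum>a\<in>Z. zero_mult (g 0) a * (ln (2 * S) - ln (norm (z - (a - w)))))"
        proof (intro sum_mono mult_left_mono)
          fix a assume a: "a \<in> Z"
          hence ne: "norm a \<le> S" "z + w \<noteq> a" using gz unfolding Z_def zeros_in_def by auto
          have "green S (z + w) a \<le> ln (2 * S / norm (z + w - a))" by (rule green_le[OF zS ne Sp(1)])
          also have "\<dots> = ln (2 * S) - ln (norm (z + w - a))" using ne Sp by (simp add: ln_div)
          finally show "green S (z + w) a \<le> ln (2 * S) - ln (norm (z - (a - w)))" by (simp add: algebra_simps)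
        qed simp
      qed
      finally show ?thesis .
    qed
    have cgw: "continuous_on (sphere 0 R) (\<lambda>z. ln (norm (gw z)))"
      by (rule continuous_on_ln_norm[OF gw(1)]) (use nzw in auto)
    have cUw: "continuous_on (sphere 0 R) (\<lambda>z. U (z + w))"
      by (rule continuous_on_compose2[OF continuous_on_U[of UNIV]]) (auto intro: continuous_intros)
    have ca: "continuous_on (sphere 0 R) (\<lambda>z. zero_mult (g 0) a * (ln (2 * S) - ln (norm (z - (a - w)))))" if "a \<in> Z" for a
      by (intro continuous_intros) (use aw[OF that] in auto)
    have cs: "continuous_on (sphere 0 R) (\<lambda>z. \<Sum>a\<in>Z. zero_mult (g 0) a * (ln (2 * S) - ln (norm (z - (a - w)))))"
      by (rule continuous_on_sum) (rule ca)
    have "circle_mean (\<lambda>z. U (z + w)) R - circle_mean (\<lambda>z. ln (norm (gw z))) R = circle_mean (\<lambda>z. U (z + w) - ln (norm (gw z))) R"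
      by (rule circle_mean_diff[OF R'(5) cUw cgw, symmetric])
    also have "\<dots> \<le> circle_mean (\<lambda>z. 3 * \<mu> + (\<Sum>a\<in>Z. zero_mult (g 0) a * (ln (2 * S) - ln (norm (z - (a - w)))))) R"
      by (rule circle_mean_mono[OF R'(5) continuous_on_diff[OF cUw cgw] continuous_on_add[OF continuous_on_const cs] pt])
    also have "\<dots> = 3 * \<mu> + (\<Sum>a\<in>Z. circle_mean (\<lambda>z. zero_mult (g 0) a * (ln (2 * S) - ln (norm (z - (a - w))))) R)"
      using circle_mean_sum[OF fZ R'(5) ca] by (subst circle_mean_add[OF R'(5) continuous_on_const cs]) simp
    also have "\<dots> \<le> 3 * \<mu> + (\<Sum>a\<in>Z. zero_mult (g 0) a * ln (2 * S))"
    proof (intro add_left_mono sum_mono)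
      fix a assume a: "a \<in> Z"
      have "circle_mean (\<lambda>z. ln (2 * S) - ln (norm (z - (a - w)))) R = ln (2 * S) - circle_mean (\<lambda>z. ln (norm (z - (a - w)))) R"
        by (subst circle_mean_diff[OF R'(5) continuous_on_const]) (use aw[OF a] in \<open>auto intro!: continuous_intros\<close>)
      also have "\<dots> \<le> ln (2 * S)"
      proof -
        have "0 \<le> ln R" using R' by simp
        thus ?thesis using circle_mean_ln_diff_ge[OF R'(4) aw[OF a]] by linarith
      qed
      finally show "circle_mean (\<lambda>z. zero_mult (g 0) a * (ln (2 * S) - ln (norm (z - (a - w))))) R \<le> zero_mult (g 0) a * ln (2 * S)"
        unfolding circle_mean_cmult by (intro mult_left_mono) auto
    qed
    also have "(\<Sum>a\<in>Z. zero_mult (g 0) a * ln (2 * S)) = zeros_number (g 0) S * ln (2 * S)"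
      unfolding zeros_number_def Z_def by (simp add: sum_distrib_right)
    also have "\<dots> \<le> 6 * (E + k1) * (9 * b)"
    proof (rule mult_mono[OF zn l10])
      show "0 \<le> ln (2 * S)" using S R' by (intro ln_ge_zero) auto
    qed (use E1 nn in auto)
    finally have 2: "circle_mean (\<lambda>z. U (z + w)) R \<le> circle_mean (\<lambda>z. ln (norm (gw z))) R + 3 * \<mu> + 6 * (E + k1) * (9 * b)" by simp
    have "int_count (zero_mult (g 0)) (R + norm w) \<le> int_count (zero_mult (g 0)) S"
    proof -
      have fin: "finite {z \<in> cball 0 S. zero_mult (g 0) z \<noteq> 0}"
        using finite_zeros_in[OF h0 g0] by (simp only: zero_mult_support[OF h0 g0])
      have le: "0 < R + norm w" "R + norm w \<le> S" using R' S norm_ge_zero[of w] by linarith+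
      have "(\<Sum>a\<in>{z \<in> cball 0 (R + norm w). zero_mult (g 0) z \<noteq> 0}. real (zero_mult (g 0) a)) * ln (S / (R + norm w)) \<ge> 0"
        using le by (intro mult_nonneg_nonneg sum_nonneg) auto
      thus ?thesis using int_count_mono_radius[OF fin le] by linarith
    qed
    hence 3: "circle_mean (\<lambda>z. ln (norm (gw z))) R \<le> \<bar>K2\<bar> + 2 * (E + k1) + K3 * b"
      using K2[OF R'(4) nzw] K3(2)[OF R'(1)] N(1) unfolding b_def by simp
    have bE: "x \<le> x * (b * E)" if "x \<ge> 0" for x :: real
    proof -
      have "1 * 1 \<le> b * E" by (rule mult_mono) (use E1 b1 in auto)
      thus ?thesis using mult_left_mono[of 1 "b * E" x] that by simp
    qed
    have Eb: "E \<le> b * E" "b \<le> b * E" using E1 b1 by auto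
    have e1: "6 * (E + k1) * (9 * b) = 54 * ((E + k1) * b)" by simp
    have e2: "(E + k1) * b \<le> (1 + k1) * (b * E)"
      using mult_left_mono[OF Eb(2), of k1] nn by (simp add: algebra_simps)
    have e3: "K * (b * E) = 3 * (b * E) + 3 * (c1 * (b * E)) + 54 * ((1 + k1) * (b * E)) + \<bar>K2\<bar> * (b * E) + 2 * (b * E) + 2 * (k1 * (b * E)) + K3 * (b * E)"
      unfolding K_def by (simp add: distrib_right)
    have "x \<le> KP"
      if "x \<le> y + 3 * m + q" "y \<le> a + 2 * (E + k1) + d" "m \<le> E + c1" "q = 54 * t" "t \<le> s"
        "KP = 3 * P + 3 * cP + 54 * s + aP + 2 * P + 2 * kP + dP" "a \<le> aP" "k1 \<le> kP" "c1 \<le> cP" "d \<le> dP" "E \<le> P"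
      for x y m q a d t s P cP aP kP dP KP :: real using that by argo
    from this[OF 2 3 \<mu>(2) e1 e2 e3 bE[OF abs_ge_zero] bE[OF nn(2)] bE[OF nn(1)] mult_left_mono[OF Eb(2) K3(1)] Eb(1)]
    have "circle_mean (\<lambda>z. U (z + w)) R \<le> K * (b * E)" .
    thus "circle_mean (\<lambda>z. U (z + w)) R \<le> K * ((1 + ln R) * exp ((7 * R) powr \<sigma>))"
      unfolding b_def E_def by simp
  qed
qed

end

section \<open>Linear algebra for dependent columns\<close>

lemma fdet_transpose: "fdet N (\<lambda>i j. f j i) = fdet N f"
proof -
  have "Matrix.mat N N (\<lambda>(i,j). f j i) = transpose_mat (Matrix.mat N N (\<lambda>(i,j). f i j))"
    by (rule eq_matI) auto
  thus ?thesis unfolding fdet_def by (simp add: Determinant.det_transpose[of _ N])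
qed

lemma fdet_0_iff: "fdet N f = 0 \<longleftrightarrow> (\<exists>x. (\<exists>i<N. x i \<noteq> 0) \<and> (\<forall>i<N. (\<Sum>j<N. f i j * x j) = 0))"
proof -
  let ?A = "Matrix.mat N N (\<lambda>(i,j). f i j)"
  have "fdet N f = 0 \<longleftrightarrow> (\<exists>v. v \<in> carrier_vec N \<and> v \<noteq> 0\<^sub>v N \<and> ?A *\<^sub>v v = 0\<^sub>v N)"
    unfolding fdet_def by (rule det_0_iff_vec_prod_zero_field) simp
  also have "\<dots> \<longleftrightarrow> (\<exists>x. (\<exists>i<N. x i \<noteq> 0) \<and> (\<forall>i<N. (\<Sum>j<N. f i j * x j) = 0))"
  proof
    assume "\<exists>v. v \<in> carrier_vec N \<and> v \<noteq> 0\<^sub>v N \<and> ?A *\<^sub>v v = 0\<^sub>v N"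
    then obtain v where v: "v \<in> carrier_vec N" "v \<noteq> 0\<^sub>v N" "?A *\<^sub>v v = 0\<^sub>v N" by blast
    have "\<exists>i<N. Matrix.vec_index v i \<noteq> 0"
      using v(1,2) by (metis carrier_vecD eq_vecI index_zero_vec(1,2))
    moreover have "(\<Sum>j<N. f i j * Matrix.vec_index v j) = 0" if "i < N" for i
    proof -
      have "(\<Sum>j<N. f i j * Matrix.vec_index v j) = Matrix.vec_index (?A *\<^sub>v v) i"
        using that v(1) by (simp add: scalar_prod_def atLeast0LessThan)
      thus ?thesis using v(3) that by simp
    qed
    ultimately show "\<exists>x. (\<exists>i<N. x i \<noteq> 0) \<and> (\<forall>i<N. (\<Sum>j<N. f i j * x j) = 0)" by blast
  next
    assume "\<exists>x. (\<exists>i<N. x i \<noteq> 0) \<and> (\<forall>i<N. (\<Sum>j<N. f i j * x j) = 0)"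
    then obtain x where x: "\<exists>i<N. x i \<noteq> 0" "\<forall>i<N. (\<Sum>j<N. f i j * x j) = 0" by blast
    have "Matrix.vec N x \<noteq> 0\<^sub>v N" using x(1) by (metis index_vec index_zero_vec(1))
    moreover have "?A *\<^sub>v Matrix.vec N x = 0\<^sub>v N"
      by (rule eq_vecI) (use x(2) in \<open>auto simp: scalar_prod_def atLeast0LessThan\<close>)
    ultimately show "\<exists>v. v \<in> carrier_vec N \<and> v \<noteq> 0\<^sub>v N \<and> ?A *\<^sub>v v = 0\<^sub>v N"
      by (intro exI[of _ "Matrix.vec N x"]) auto
  qed
  finally show ?thesis .
qed

text \<open>A kernel vector of the larger matrix has a nonzero last entry, since otherwise its first
  k entries would lie in the kernel of the nonsingular minor. Dividing by it expresses the last
  column through the others.\<close>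

lemma fdet_dependent_column:
  assumes C: "fdet k f \<noteq> 0" and z: "fdet (Suc k) f = 0"
  shows "\<exists>x. \<forall>l\<le>k. (\<Sum>i<k. f l i * x i) = f l k"
proof -
  obtain v where v: "\<exists>i<Suc k. v i \<noteq> 0" "\<And>l. l < Suc k \<Longrightarrow> (\<Sum>i<Suc k. f l i * v i) = 0"
    using z unfolding fdet_0_iff by blast
  have "v k \<noteq> 0"
  proof
    assume v0: "v k = 0"
    have "\<forall>l<k. (\<Sum>i<k. f l i * v i) = 0" using v(2) v0 by (auto simp: less_Suc_eq)
    moreover have "\<exists>i<k. v i \<noteq> 0" using v(1) v0 by (auto simp: less_Suc_eq)
    ultimately show False using C unfolding fdet_0_iff by blast
  qed
  have "(\<Sum>i<k. f l i * (- v i / v k)) = f l k" if "l \<le> k" for l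
  proof -
    have "(\<Sum>i<k. f l i * v i) = - (f l k * v k)"
      using v(2)[of l] that by (simp add: eq_neg_iff_add_eq_0)
    moreover have "(\<Sum>i<k. f l i * (- v i / v k)) = - (\<Sum>i<k. f l i * v i) / v k"
      by (simp add: sum_divide_distrib sum_negf)
    ultimately show ?thesis using \<open>v k \<noteq> 0\<close> by simp
  qed
  thus ?thesis by (intro exI[of _ "\<lambda>i. - v i / v k"] allI impI)
qed

lemma eventually_nonzero_at:
  assumes "f holomorphic_on UNIV" "\<exists>w. f w \<noteq> 0"
  shows "eventually (\<lambda>w. f w \<noteq> 0) (at z)"
proof -
  obtain k where k: "k holomorphic_on UNIV" "\<And>w. f w = (w - z) ^ zero_mult f z * k w" "k z \<noteq> 0"
    using entire_factor_at[OF assms, of z] by blast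
  have "isCont k z" using holomorphic_on_imp_continuous_on[OF k(1)] by (simp add: continuous_on_eq_continuous_at)
  hence "eventually (\<lambda>w. k w \<noteq> 0) (at z)"
    unfolding isCont_def using k(3) by (rule tendsto_imp_eventually_ne)
  moreover have "eventually (\<lambda>w. w \<noteq> z) (at z)" by (simp add: eventually_at_filter)
  ultimately show ?thesis
  proof eventually_elim
    case (elim w)
    thus ?case by (subst k(2)) simp
  qed
qed

lemma nevanlinna_char_entire:
  assumes "f holomorphic_on UNIV"
  shows "nevanlinna_char f r = circle_mean (\<lambda>z. ln_plus (norm (f z))) r"
proof -
  have "\<not> is_pole f z" for z
    using not_is_pole_holomorphic[of UNIV z f] assms by simp
  hence "pole_mult f = (\<lambda>_. 0)" unfolding pole_mult_def by auto
  moreover have "int_count (\<lambda>_. 0) r = 0" unfolding int_count_def unint_count_def by simp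
  ultimately show ?thesis unfolding nevanlinna_char_def proximity_def circle_mean_def by simp
qed

lemma const_in_periodic_field: "(\<lambda>_. k) \<in> periodic_field c"
proof -
  have "nevanlinna_char (\<lambda>_. k) r = ln_plus (norm k)" for r
    by (subst nevanlinna_char_entire) auto
  moreover have "eventually (\<lambda>r. ln_plus (norm k) \<le> exp (r powr (1/2))) at_top"
  proof -
    have "filterlim (\<lambda>r::real. exp (r powr (1/2))) at_top at_top" by real_asymp
    thus ?thesis by (auto simp: filterlim_at_top)
  qed
  ultimately have "hyper_order (nevanlinna_char (\<lambda>_. k)) \<le> ereal (1/2)"
    by (intro hyper_order_le) auto
  hence "hyper_order (nevanlinna_char (\<lambda>_. k)) < 1"
    by (rule le_less_trans) (simp add: one_ereal_def)
  thus ?thesis unfolding periodic_field_def by auto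
qed

section \<open>The hyper-order of quotients bounded by shifted majorants\<close>

context curve
begin

lemma continuous_on_shift_U: "continuous_on S (\<lambda>z. U (z + w))"
  by (rule continuous_on_compose2[OF continuous_on_U[of UNIV]]) (auto intro: continuous_intros)

lemma shifted_sum_U_le:
  assumes g0: "\<exists>z. g 0 z \<noteq> 0" and \<sigma>: "\<sigma> \<ge> 0" and T: "eventually (\<lambda>r. T r \<le> exp (r powr \<sigma>)) at_top"
    and I: "finite I"
  obtains K R0 C where "countable C" "R0 \<ge> 1" "K \<ge> 0"
    "\<And>R. R \<ge> R0 \<Longrightarrow> R \<notin> C \<Longrightarrow> circle_mean (\<lambda>z. \<Sum>l\<in>I. U (z + w l)) R \<le> K * ((1 + ln R) * exp ((7 * R) powr \<sigma>))"
proof -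
  have "\<forall>l\<in>I. \<exists>K R0 C. countable C \<and> R0 \<ge> 1 \<and> K \<ge> 0 \<and>
    (\<forall>R\<ge>R0. R \<notin> C \<longrightarrow> circle_mean (\<lambda>z. U (z + w l)) R \<le> K * ((1 + ln R) * exp ((7 * R) powr \<sigma>)))"
  proof
    fix l assume "l \<in> I"
    show "\<exists>K R0 C. countable C \<and> R0 \<ge> 1 \<and> K \<ge> 0 \<and>
      (\<forall>R\<ge>R0. R \<notin> C \<longrightarrow> circle_mean (\<lambda>z. U (z + w l)) R \<le> K * ((1 + ln R) * exp ((7 * R) powr \<sigma>)))"
      by (rule shifted_mean_U_le[OF g0 \<sigma> T, of "w l"]) blast
  qed
  then obtain K R0 C where KRC: "\<And>l. l \<in> I \<Longrightarrow> countable (C l)" "\<And>l. l \<in> I \<Longrightarrow> R0 l \<ge> 1" "\<And>l. l \<in> I \<Longrightarrow> K l \<ge> 0"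
    "\<And>l R. l \<in> I \<Longrightarrow> R \<ge> R0 l \<Longrightarrow> R \<notin> C l \<Longrightarrow> circle_mean (\<lambda>z. U (z + w l)) R \<le> K l * ((1 + ln R) * exp ((7 * R) powr \<sigma>))"
    by metis
  show ?thesis
  proof (rule that[of "\<Union>l\<in>I. C l" "1 + (\<Sum>l\<in>I. R0 l)" "\<Sum>l\<in>I. K l"])
    show "countable (\<Union>l\<in>I. C l)" by (rule countable_UN[OF countable_finite[OF I] KRC(1)])
    show "1 + (\<Sum>l\<in>I. R0 l) \<ge> 1" using KRC(2) by (simp add: sum_nonneg order_trans[OF zero_le_one])
    show "(\<Sum>l\<in>I. K l) \<ge> 0" using KRC(3) by (rule sum_nonneg)
    fix R assume R: "R \<ge> 1 + (\<Sum>l\<in>I. R0 l)" "R \<notin> (\<Union>l\<in>I. C l)"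
    have Rl: "R \<ge> R0 l" if "l \<in> I" for l
    proof -
      have "R0 l \<le> (\<Sum>l\<in>I. R0 l)"
        by (rule member_le_sum[OF that _ I]) (use KRC(2) in \<open>auto intro: order_trans[OF zero_le_one]\<close>)
      thus ?thesis using R by simp
    qed
    have "(\<Sum>l\<in>I. R0 l) \<ge> 0" by (rule sum_nonneg) (rule order_trans[OF zero_le_one KRC(2)])
    hence R0: "R \<ge> 0" using R(1) by linarith
    have "circle_mean (\<lambda>z. \<Sum>l\<in>I. U (z + w l)) R = (\<Sum>l\<in>I. circle_mean (\<lambda>z. U (z + w l)) R)"
      by (rule circle_mean_sum[OF I R0]) (rule continuous_on_shift_U)
    also have "\<dots> \<le> (\<Sum>l\<in>I. K l * ((1 + ln R) * exp ((7 * R) powr \<sigma>)))"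
      by (intro sum_mono KRC(4) Rl) (use R in auto)
    finally show "circle_mean (\<lambda>z. \<Sum>l\<in>I. U (z + w l)) R \<le> (\<Sum>l\<in>I. K l) * ((1 + ln R) * exp ((7 * R) powr \<sigma>))"
      by (simp add: sum_distrib_right)
  qed
qed

text \<open>\<open>quotient_char_le\<close> uses radii below 5 r and \<open>shifted_sum_U_le\<close>
  a dilation by 7, whence (35 r)^\<sigma> in the exponent. An exponent between \<sigma> and 1
  absorbs this together with the logarithm and all constants.\<close>

lemma quotient_hyper_order:
  assumes T: "hyper_order T < 1" and g0: "\<exists>z. g 0 z \<noteq> 0"
    and D: "D holomorphic_on UNIV" "\<exists>w. D w \<noteq> 0" and C: "C holomorphic_on UNIV" "\<exists>w. C w \<noteq> 0"
    and I: "finite I"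
    and A: "continuous_on UNIV A" "K0 \<ge> 0" "countable X0" "eventually (\<lambda>r. r \<notin> X0 \<longrightarrow> circle_mean A r \<le> K1 + K0 * T r) at_top"
    and bD: "\<And>z. norm (D z) \<le> exp (A z + (\<Sum>l\<in>I. U (z + w l)))"
    and bC: "\<And>z. norm (C z) \<le> exp (A z + (\<Sum>l\<in>I. U (z + w l)))"
    and H: "\<And>z. C z \<noteq> 0 \<Longrightarrow> H z = D z / C z"
  shows "hyper_order (nevanlinna_char H) < 1"
proof (rule hyper_order_bound[OF T])
  fix \<sigma>0 assume \<sigma>0: "0 \<le> \<sigma>0" "\<sigma>0 < 1" "eventually (\<lambda>r. T r \<le> exp (r powr \<sigma>0)) at_top"
  \<comment> \<open>Still below 1, and now strictly positive, which the asymptotic comparison below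
    uses.\<close>
  define \<sigma> where "\<sigma> = max \<sigma>0 (1/2)"
  have \<sigma>: "0 < \<sigma>" "\<sigma> < 1" unfolding \<sigma>_def using \<sigma>0 by auto
  have ev: "eventually (\<lambda>r. T r \<le> exp (r powr \<sigma>)) at_top"
    using \<sigma>0(3) eventually_ge_at_top[of 1]
  proof eventually_elim
    case (elim r)
    have "r powr \<sigma>0 \<le> r powr \<sigma>" unfolding \<sigma>_def using elim by (intro powr_mono) auto
    thus ?case using elim by (meson exp_le_cancel_iff order_trans)
  qed
  define K2 where "K2 = \<bar>K1\<bar> + K0"
  have K2: "K2 \<ge> 0" unfolding K2_def using A(2) by simp
  have "eventually (\<lambda>r. r \<notin> X0 \<longrightarrow> circle_mean A r \<le> K2 * exp (r powr \<sigma>)) at_top"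
    using ev A(4)
  proof eventually_elim
    case (elim r)
    have "1 \<le> exp (r powr \<sigma>)" using powr_ge_zero[of r \<sigma>] by (simp only: one_le_exp_iff)
    hence "\<bar>K1\<bar> * 1 + K0 * T r \<le> \<bar>K1\<bar> * exp (r powr \<sigma>) + K0 * exp (r powr \<sigma>)"
      by (intro add_mono mult_left_mono elim(1) A(2)) auto
    thus ?case using elim(2) unfolding K2_def by (auto simp: distrib_right)
  qed
  then obtain R1 where R1: "\<And>r. r \<ge> R1 \<Longrightarrow> r \<notin> X0 \<Longrightarrow> circle_mean A r \<le> K2 * exp (r powr \<sigma>)"
    unfolding eventually_at_top_linorder by blast
  define V where "V z = A z + (\<Sum>l\<in>I. U (z + w l))" for z
  have cU: "continuous_on S (\<lambda>z. \<Sum>l\<in>I. U (z + w l))" for S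
    by (intro continuous_on_sum continuous_on_shift_U)
  have V: "continuous_on UNIV V" unfolding V_def by (intro continuous_on_add A(1) cU)
  have le: "ln (norm (F z)) \<le> V z" if "norm (F z) \<le> exp (A z + (\<Sum>l\<in>I. U (z + w l)))" "F z \<noteq> 0" for F :: "complex \<Rightarrow> complex" and z
  proof -
    have "ln (norm (F z)) \<le> ln (exp (A z + (\<Sum>l\<in>I. U (z + w l))))" using that by (intro ln_mono) auto
    thus ?thesis unfolding V_def by simp
  qed
  show ?thesis
  proof (rule shifted_sum_U_le[OF g0 less_imp_le[OF \<sigma>(1)] ev I, of w])
    fix K R0 X assume K: "countable X" "R0 \<ge> 1" "K \<ge> 0"
      "\<And>R. R \<ge> R0 \<Longrightarrow> R \<notin> X \<Longrightarrow> circle_mean (\<lambda>z. \<Sum>l\<in>I. U (z + w l)) R \<le> K * ((1 + ln R) * exp ((7 * R) powr \<sigma>))"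
    have leD: "ln (norm (D z)) \<le> V z" if "D z \<noteq> 0" for z by (rule le[of D, OF bD that])
    have leC: "ln (norm (C z)) \<le> V z" if "C z \<noteq> 0" for z by (rule le[of C, OF bC that])
    show ?thesis
    proof (rule quotient_char_le[OF D C V leD leC H])
      fix Q assume Q: "Q \<ge> 0" "\<And>r R R'. 1 \<le> r \<Longrightarrow> 2 * r < R \<Longrightarrow> R < 3 * r \<Longrightarrow> 4 * r < R' \<Longrightarrow> R' < 5 * r \<Longrightarrow>
        (\<And>w. norm w = R \<or> norm w = R' \<Longrightarrow> D w \<noteq> 0 \<and> C w \<noteq> 0) \<Longrightarrow>
        nevanlinna_char H r \<le> Q * (circle_mean V R + Q) + Q * (circle_mean V R' + Q)"
      define Y where "Y = X \<union> X0 \<union> norm ` {z. D z = 0} \<union> norm ` {z. C z = 0}"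
      have Y: "countable Y" unfolding Y_def
        by (intro countable_Un countable_image countable_zeros D C K A)
      define K' where "K' = K2 + K"
      define \<sigma>' where "\<sigma>' = (1 + \<sigma>) / 2"
      have \<sigma>': "\<sigma> < \<sigma>'" "\<sigma>' < 1" "0 \<le> \<sigma>'" unfolding \<sigma>'_def using \<sigma> by auto
      have "eventually (\<lambda>r. 2 * Q * (K' * ((1 + ln (5 * r)) * exp ((35 * r) powr \<sigma>)) + Q) \<le> exp (r powr \<sigma>')) at_top"
      proof -
        have "((\<lambda>r. (1 + ln (5 * r)) * exp ((35 * r) powr \<sigma>) / exp (r powr \<sigma>')) \<longlongrightarrow> 0) at_top"
          using \<sigma> \<sigma>' by real_asymp
        moreover have "((\<lambda>r. 1 / exp (r powr \<sigma>')) \<longlongrightarrow> 0) at_top" using \<sigma> \<sigma>' by real_asymp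
        ultimately have "((\<lambda>r. 2 * Q * (K' * ((1 + ln (5 * r)) * exp ((35 * r) powr \<sigma>) / exp (r powr \<sigma>')) + Q * (1 / exp (r powr \<sigma>')))) \<longlongrightarrow> 2 * Q * (K' * 0 + Q * 0)) at_top"
          by (intro tendsto_intros)
        hence "eventually (\<lambda>r. 2 * Q * (K' * ((1 + ln (5 * r)) * exp ((35 * r) powr \<sigma>) / exp (r powr \<sigma>')) + Q * (1 / exp (r powr \<sigma>'))) < 1) at_top"
          by (rule order_tendstoD(2)) simp
        thus ?thesis
        proof eventually_elim
          case (elim r)
          have "2 * Q * (K' * (x / e) + Q * (1 / e)) = 2 * Q * (K' * x + Q) / e" for x e :: real
            by (simp flip: add_divide_distrib)
          thus ?case using elim by (simp only:) simp
        qed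
      qed
      hence "eventually (\<lambda>r. nevanlinna_char H r \<le> exp (r powr \<sigma>')) at_top"
        using eventually_ge_at_top[of "max R0 R1"]
      proof eventually_elim
        case (elim r)
        have r: "r \<ge> 1" "r > 0" using elim K by auto
        obtain R where R: "2 * r < R" "R < 3 * r" "R \<notin> Y" using ex_not_countable[OF Y, of "2*r" "3*r"] r by auto
        obtain R' where R': "4 * r < R'" "R' < 5 * r" "R' \<notin> Y" using ex_not_countable[OF Y, of "4*r" "5*r"] r by auto
        have nz: "D x \<noteq> 0 \<and> C x \<noteq> 0" if "norm x = R \<or> norm x = R'" for x
          using that R(3) R'(3) unfolding Y_def by auto
        define G where "G = (1 + ln (5 * r)) * exp ((35 * r) powr \<sigma>)"
        have ln5: "ln (5 * r) \<ge> 0" using r by (intro ln_ge_zero) auto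
        have bV: "circle_mean V S + Q \<le> K' * G + Q"
          if S: "r \<le> S" "S \<le> 5 * r" "S \<notin> Y" for S
        proof -
          have S0: "S \<ge> 0" "S \<ge> R0" "S \<ge> R1" using S r elim by auto
          have "circle_mean V S = circle_mean A S + circle_mean (\<lambda>z. \<Sum>l\<in>I. U (z + w l)) S"
            unfolding V_def by (rule circle_mean_add[OF S0(1) continuous_on_subset[OF A(1)] cU]) simp
          also have "circle_mean A S \<le> K2 * exp (S powr \<sigma>)" by (rule R1[OF S0(3)]) (use S in \<open>auto simp: Y_def\<close>)
          also have "K2 * exp (S powr \<sigma>) \<le> K2 * G"
          proof (rule mult_left_mono)
            have "S powr \<sigma> \<le> (35 * r) powr \<sigma>" using S r \<sigma> by (intro powr_mono2) auto
            hence "1 * exp (S powr \<sigma>) \<le> (1 + ln (5 * r)) * exp ((35 * r) powr \<sigma>)"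
              using ln5 by (intro mult_mono) auto
            thus "exp (S powr \<sigma>) \<le> G" unfolding G_def by simp
          qed (rule K2)
          also have "circle_mean (\<lambda>z. \<Sum>l\<in>I. U (z + w l)) S \<le> K * ((1 + ln S) * exp ((7 * S) powr \<sigma>))"
            by (rule K(4)) (use S0 S in \<open>auto simp: Y_def\<close>)
          also have "\<dots> \<le> K * G"
            unfolding G_def
          proof (intro mult_left_mono mult_mono K(3))
            show "1 + ln S \<le> 1 + ln (5 * r)" using S r by (intro add_left_mono ln_mono) auto
            have "(7 * S) powr \<sigma> \<le> (35 * r) powr \<sigma>" using S r \<sigma> by (intro powr_mono2) auto
            thus "exp ((7 * S) powr \<sigma>) \<le> exp ((35 * r) powr \<sigma>)" by simp
            show "0 \<le> 1 + ln (5 * r)" using ln5 by simp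
          qed simp
          finally show ?thesis unfolding K'_def by (simp add: distrib_right)
        qed
        have "nevanlinna_char H r \<le> Q * (circle_mean V R + Q) + Q * (circle_mean V R' + Q)"
          by (rule Q(2)[OF r(1) R(1,2) R'(1,2) nz])
        also have "\<dots> \<le> Q * (K' * G + Q) + Q * (K' * G + Q)"
          by (intro add_mono mult_left_mono bV Q(1)) (use R R' r in auto)
        also have "\<dots> = 2 * Q * (K' * G + Q)" by simp
        also have "\<dots> \<le> exp (r powr \<sigma>')" using elim unfolding G_def by simp
        finally show ?case .
      qed
      hence "hyper_order (nevanlinna_char H) \<le> ereal \<sigma>'" by (rule hyper_order_le) (rule \<sigma>'(3))
      also have "\<dots> < 1" using \<sigma>'(2) by (simp add: one_ereal_def)
      finally show ?thesis .
    qed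
  qed
qed

end

section \<open>Casorati and Wronski determinants\<close>

lemma fdet_Nil [simp]: "fdet 0 f = 1"
  unfolding fdet_def by (rule det_dim_zero) simp

text \<open>k + 1 is the size of the smallest leading minor that vanishes identically. The case k =
  0 is covered, because the empty determinant is 1.\<close>

lemma minor_relation:
  assumes "\<forall>z. fdet N (\<lambda>l i. F l i z) = 0"
  obtains k where "k < N" "\<exists>z. fdet k (\<lambda>l i. F l i z) \<noteq> 0" "\<forall>z. fdet (Suc k) (\<lambda>l i. F l i z) = 0"
proof -
  define m where "m = (LEAST m. \<forall>z. fdet m (\<lambda>l i. F l i z) = 0)"
  have m: "\<forall>z. fdet m (\<lambda>l i. F l i z) = 0" "m \<le> N"
    unfolding m_def using assms by (rule LeastI, rule Least_le)
  have "m \<noteq> 0" using m(1) by (intro notI) simp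
  then obtain k where k: "m = Suc k" by (cases m) auto
  have "\<not> (\<forall>z. fdet k (\<lambda>l i. F l i z) = 0)"
    using not_less_Least[of k "\<lambda>m. \<forall>z. fdet m (\<lambda>l i. F l i z) = 0"] k unfolding m_def by simp
  thus ?thesis using that[of k] m k by auto
qed

definition cramer_minor :: "nat \<Rightarrow> (nat \<Rightarrow> nat \<Rightarrow> complex) \<Rightarrow> (nat \<Rightarrow> complex) \<Rightarrow> nat \<Rightarrow> complex" where
  "cramer_minor k f b i = fdet k (\<lambda>l j. if j = i then b l else f l j)"

lemma cramer_unique:
  assumes "fdet k f \<noteq> 0" "\<And>l. l < k \<Longrightarrow> (\<Sum>i<k. f l i * x i) = b l" "i < k"
  shows "x i = cramer_minor k f b i / fdet k f"
proof -
  have "cramer_minor k f b i = fdet k (\<lambda>l j. if j = i then \<Sum>j<k. f l j * x j else f l j)"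
    unfolding cramer_minor_def by (rule fdet_cong) (simp add: assms(2))
  also have "\<dots> = x i * fdet k f" by (rule fdet_cramer[OF assms(3)])
  finally show ?thesis using assms(1) by simp
qed

text \<open>The coefficients are determined by the rows below k but also satisfy the equation of row
  k. With this extra row the system can be shifted, or differentiated, once.\<close>

lemma cramer_solution:
  assumes "fdet k f \<noteq> 0" "fdet (Suc k) f = 0" "l \<le> k"
  shows "(\<Sum>i<k. f l i * (cramer_minor k f (\<lambda>l. f l k) i / fdet k f)) = f l k"
proof -
  obtain x where x: "\<forall>l\<le>k. (\<Sum>i<k. f l i * x i) = f l k"
    using fdet_dependent_column[OF assms(1,2)] by blast
  have "x i = cramer_minor k f (\<lambda>l. f l k) i / fdet k f" if "i < k" for i
    using x by (intro cramer_unique[OF assms(1) _ that]) auto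
  thus ?thesis using x assms(3) by auto
qed

lemma remove_sings_periodic:
  assumes "\<And>z. eventually (\<lambda>w. f (w + c) = f w) (at z)"
  shows "remove_sings f (z + c) = remove_sings f z"
proof -
  have "remove_sings f (z + c) = remove_sings (\<lambda>w. f ((z + c) + w)) 0" by (rule remove_sings_shift_0)
  also have "\<dots> = remove_sings (\<lambda>w. f (z + w)) 0"
  proof (rule remove_sings_cong)
    have "eventually (\<lambda>w. f (w + z + c) = f (w + z)) (at 0)"
      using assms[of z] unfolding at_to_0[of z] eventually_filtermap by (simp add: add_ac)
    thus "eventually (\<lambda>w. f ((z + c) + w) = f (z + w)) (at 0)" by eventually_elim (simp add: add_ac)
  qed simp
  also have "\<dots> = remove_sings f z" by (rule remove_sings_shift_0[symmetric])
  finally show ?thesis .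
qed

context curve
begin

text \<open>A vanishing determinant makes one column a combination of its predecessors with Cramer
  quotients \<open>D i / C\<close> as coefficients. They are periodic, and of hyper-order below 1
  since D i and C are bounded through sums of shifted U. \<open>remove_sings\<close> yields the
  normal form required in \<open>periodic_field\<close>. The bound B is evaluated at z for all
  shifts, which suits periodic coefficients.\<close>

lemma casorati_nonzero:
  assumes T: "hyper_order T < 1" and g0: "\<exists>z. g 0 z \<noteq> 0"
    and \<phi>: "\<And>i. i \<le> m \<Longrightarrow> \<phi> i holomorphic_on UNIV"
    and B: "continuous_on UNIV B" "K0 \<ge> 0" "countable X0" "eventually (\<lambda>r. r \<notin> X0 \<longrightarrow> circle_mean B r \<le> K1 + K0 * T r) at_top"
    and b: "\<And>i l z. i \<le> m \<Longrightarrow> norm (\<phi> i (z + of_nat l * c)) \<le> exp (B z + U (z + of_nat l * c))"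
    and indep: "lin_indep_over_periodic c {..m} \<phi>"
  shows "\<exists>z. fdet (Suc m) (\<lambda>l i. \<phi> i (z + of_nat l * c)) \<noteq> 0"
proof (rule ccontr)
  assume contra: "\<not> ?thesis"
  define F where "F l i z = \<phi> i (z + of_nat l * c)" for l i z
  have "\<forall>z. fdet (Suc m) (\<lambda>l i. F l i z) = 0" using contra unfolding F_def by blast
  from minor_relation[OF this] obtain k where
    k: "k < Suc m" "\<exists>z. fdet k (\<lambda>l i. F l i z) \<noteq> 0" "\<forall>z. fdet (Suc k) (\<lambda>l i. F l i z) = 0" .
  define C where "C z = fdet k (\<lambda>l i. F l i z)" for z
  define D where "D i z = cramer_minor k (\<lambda>l i. F l i z) (\<lambda>l. F l k z) i" for i z
  have F_holo: "F l i holomorphic_on UNIV" if "i \<le> m" for l i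
    unfolding F_def[abs_def] by (rule shift_holomorphic[OF \<phi>[OF that]])
  have C: "C holomorphic_on UNIV" "\<exists>z. C z \<noteq> 0"
    unfolding C_def[abs_def] using k by (auto intro!: fdet_holomorphic F_holo)
  have D: "D i holomorphic_on UNIV" for i
  proof -
    have "(\<lambda>z. fdet k (\<lambda>l j. (if j = i then F l k else F l j) z)) holomorphic_on UNIV"
      by (rule fdet_holomorphic) (use k F_holo in auto)
    moreover have "(\<lambda>z. fdet k (\<lambda>l j. (if j = i then F l k else F l j) z)) = D i"
      unfolding D_def cramer_minor_def by (intro ext fdet_cong) auto
    ultimately show ?thesis by simp
  qed
  have rel: "(\<Sum>i<k. F l i z * (D i z / C z)) = F l k z" if "C z \<noteq> 0" "l \<le> k" for z l
    using cramer_solution[of k "\<lambda>l i. F l i z" l] k(3) that unfolding C_def D_def by simp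
  \<comment> \<open>The rows 1, ..., k at z are the rows 0, ..., k - 1 at z + c. Hence both sets of
    quotients solve the same nonsingular system.\<close>
  have shift: "D i z / C z = D i (z + c) / C (z + c)" if nz: "C z \<noteq> 0" "C (z + c) \<noteq> 0" and i: "i < k" for z i
  proof -
    have "(\<Sum>i<k. F l i (z + c) * (D i z / C z)) = F l k (z + c)" if "l < k" for l
      using rel[OF nz(1), of "Suc l"] that unfolding F_def by (simp add: algebra_simps)
    from cramer_unique[OF nz(2)[unfolded C_def] this i] show ?thesis unfolding D_def C_def .
  qed
  define H where "H i = remove_sings (\<lambda>z. D i z / C z)" for i
  have evC: "eventually (\<lambda>w. C w \<noteq> 0 \<and> C (w + c) \<noteq> 0) (at z)" for z
  proof -
    have "\<exists>w. C (w + c) \<noteq> 0" using C(2) by (metis diff_add_cancel)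
    from eventually_nonzero_at[OF shift_holomorphic[OF C(1)] this, of z] eventually_nonzero_at[OF C, of z]
    show ?thesis by (rule eventually_elim2) simp
  qed
  have H_eq: "H i z = D i z / C z" if "C z \<noteq> 0" for i z
    unfolding H_def
  proof (rule remove_sings_at_analytic)
    have "D i analytic_on {z}" "C analytic_on {z}"
      using C(1) D[of i] analytic_on_subset[of _ UNIV "{z}"] by (auto simp: analytic_on_open)
    thus "(\<lambda>z. D i z / C z) analytic_on {z}" using that by (intro analytic_on_divide) auto
  qed
  have bound: "norm (fdet k (\<lambda>l j. F l (s l j) z)) \<le> exp ((ln (fact k) + real k * B z) + (\<Sum>l\<in>{0..<k}. U (z + of_nat l * c)))"
    if s: "\<And>l j. l < k \<Longrightarrow> j < k \<Longrightarrow> s l j \<le> m" for s z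
  proof -
    have "norm (fdet k (\<lambda>l j. F l (s l j) z)) \<le> fact k * exp (real k * B z + (\<Sum>l\<in>{0..<k}. U (z + of_nat l * c)))"
    proof (rule norm_fdet_le)
      fix p assume p: "p permutes {0..<k}"
      have "(\<Prod>i=0..<k. norm (F i (s i (p i)) z)) \<le> (\<Prod>i=0..<k. exp (B z + U (z + of_nat i * c)))"
      proof (intro prod_mono conjI norm_ge_zero)
        fix i assume i: "i \<in> {0..<k}"
        hence "p i \<in> {0..<k}" using permutes_in_image[OF p] by blast
        thus "norm (F i (s i (p i)) z) \<le> exp (B z + U (z + of_nat i * c))"
          unfolding F_def by (intro b s) (use i in auto)
      qed
      also have "\<dots> = exp (real k * B z + (\<Sum>l\<in>{0..<k}. U (z + of_nat l * c)))"
        by (simp add: exp_sum[symmetric] sum.distrib)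
      finally show "(\<Prod>i=0..<k. norm (F i (s i (p i)) z)) \<le> exp (real k * B z + (\<Sum>l\<in>{0..<k}. U (z + of_nat l * c)))" .
    qed
    thus ?thesis by (simp add: exp_add mult.assoc)
  qed
  have H_field: "H i \<in> periodic_field c" if i: "i < k" for i
  proof (cases "\<exists>z. D i z \<noteq> 0")
    case False
    hence "H i = remove_sings (\<lambda>_. 0)" unfolding H_def by simp
    also have "\<dots> = (\<lambda>_. 0)" by (intro ext remove_sings_eqI) simp
    finally show ?thesis using const_in_periodic_field[of 0 c] by simp
  next
    case True
    have "(\<lambda>z. D i z / C z) meromorphic_on UNIV"
      using C(1) D[of i] by (intro meromorphic_on_divide analytic_on_imp_meromorphic_on) (auto simp: analytic_on_open)
    hence "H i nicely_meromorphic_on UNIV" unfolding H_def by (rule remove_sings_nicely_meromorphic)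
    moreover have "H i (z + c) = H i z" for z
      unfolding H_def
    proof (rule remove_sings_periodic)
      fix z show "eventually (\<lambda>w. D i (w + c) / C (w + c) = D i w / C w) (at z)"
        using evC[of z] by eventually_elim (use shift i in auto)
    qed
    moreover have "hyper_order (nevanlinna_char (H i)) < 1"
    proof (rule quotient_hyper_order[OF T g0 D True C, where A = "\<lambda>z. ln (fact k) + real k * B z" and I = "{0..<k}" and w = "\<lambda>l. of_nat l * c"])
      show "continuous_on UNIV (\<lambda>z. ln (fact k) + real k * B z)" by (intro continuous_intros B)
      show "eventually (\<lambda>r. r \<notin> X0 \<longrightarrow> circle_mean (\<lambda>z. ln (fact k) + real k * B z) r \<le> (ln (fact k) + real k * K1) + (real k * K0) * T r) at_top"
        using B(4) eventually_ge_at_top[of 0]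
      proof eventually_elim
        case (elim r)
        show ?case
        proof
          assume r: "r \<notin> X0"
          have "circle_mean (\<lambda>z. ln (fact k) + real k * B z) r = ln (fact k) + real k * circle_mean B r"
            by (subst circle_mean_add) (use elim in \<open>auto intro!: continuous_intros continuous_on_subset[OF B(1)] simp: circle_mean_cmult\<close>)
          also have "\<dots> \<le> ln (fact k) + real k * (K1 + K0 * T r)"
            using elim(1) r by (intro add_left_mono mult_left_mono) auto
          finally show "circle_mean (\<lambda>z. ln (fact k) + real k * B z) r \<le> (ln (fact k) + real k * K1) + (real k * K0) * T r"
            by (simp add: algebra_simps)
        qed
      qed
      fix z
      have "D i z = fdet k (\<lambda>l j. F l (if j = i then k else j) z)"
        unfolding D_def cramer_minor_def by (rule fdet_cong) auto
      thus "norm (D i z) \<le> exp (ln (fact k) + real k * B z + (\<Sum>l\<in>{0..<k}. U (z + of_nat l * c)))"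
        using bound[of "\<lambda>l j. if j = i then k else j" z] k by simp
      show "norm (C z) \<le> exp (ln (fact k) + real k * B z + (\<Sum>l\<in>{0..<k}. U (z + of_nat l * c)))"
        unfolding C_def using bound[of "\<lambda>l j. j" z] k by simp
    qed (use B H_eq in auto)
    ultimately show ?thesis unfolding periodic_field_def by simp
  qed
  \<comment> \<open>The relation between column k and its predecessors, padded with zeros; the entry
    -1 at k makes it nontrivial.\<close>
  define h where "h i = (if i < k then H i else if i = k then (\<lambda>_. -1) else (\<lambda>_. 0))" for i
  have "\<forall>i\<in>{..m}. h i \<in> periodic_field c"
    unfolding h_def using H_field const_in_periodic_field by auto
  moreover have "\<forall>\<^sub>\<approx>z\<in>UNIV. (\<Sum>i\<in>{..m}. h i z * \<phi> i z) = 0"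
    unfolding eventually_cosparse_open_eq[OF open_UNIV]
  proof
    fix z :: complex
    show "eventually (\<lambda>z. (\<Sum>i\<in>{..m}. h i z * \<phi> i z) = 0) (at z)"
      using evC[of z]
    proof eventually_elim
      case (elim z)
      have "(\<Sum>i\<in>{..m}. h i z * \<phi> i z) = (\<Sum>i\<in>{..<Suc k}. h i z * \<phi> i z)"
        by (rule sum.mono_neutral_right) (use k in \<open>auto simp: h_def\<close>)
      also have "\<dots> = (\<Sum>i<k. F 0 i z * (D i z / C z)) - F 0 k z"
        using elim by (simp add: h_def H_eq F_def mult.commute)
      also have "\<dots> = 0" using rel[of z 0] elim by simp
      finally show ?case .
    qed
  qed
  ultimately have "\<forall>i\<in>{..m}. h i = (\<lambda>_. 0)"
    using indep[unfolded lin_indep_over_periodic_def, THEN spec, of h] by blast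
  moreover have "k \<in> {..m}" using k(1) by simp
  ultimately have "h k = (\<lambda>_. 0)" by (rule bspec)
  thus False unfolding h_def by (simp add: fun_eq_iff)
qed

end

text \<open>Parallel to \<open>casorati_nonzero\<close>, with differentiation in place of the shift:
  the derivatives of the Cramer quotients solve a homogeneous nonsingular system, so the quotients
  are constant on a disc, and the identity theorem extends the relation to the plane.\<close>

lemma wronski_nonzero:
  assumes s: "\<And>i. i \<le> m \<Longrightarrow> s i holomorphic_on UNIV"
    and indep: "\<And>x :: nat \<Rightarrow> complex. \<forall>z. (\<Sum>i\<le>m. x i * s i z) = 0 \<Longrightarrow> \<forall>i\<le>m. x i = 0"
  shows "\<exists>z. fdet (Suc m) (\<lambda>l i. (deriv ^^ l) (s i) z) \<noteq> 0"
proof (rule ccontr)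
  assume contra: "\<not> ?thesis"
  define F where "F l i z = (deriv ^^ l) (s i) z" for l i z
  have "\<forall>z. fdet (Suc m) (\<lambda>l i. F l i z) = 0" using contra unfolding F_def by blast
  from minor_relation[OF this] obtain k where
    k: "k < Suc m" "\<exists>z. fdet k (\<lambda>l i. F l i z) \<noteq> 0" "\<forall>z. fdet (Suc k) (\<lambda>l i. F l i z) = 0" .
  define C where "C z = fdet k (\<lambda>l i. F l i z)" for z
  define D where "D i z = cramer_minor k (\<lambda>l i. F l i z) (\<lambda>l. F l k z) i" for i z
  have F_holo: "F l i holomorphic_on UNIV" if "i \<le> m" for l i
    unfolding F_def[abs_def] by (rule holomorphic_higher_deriv[OF s[OF that]]) simp
  have F_deriv: "(F l i has_field_derivative F (Suc l) i z) (at z)" if "i \<le> m" for l i z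
    using holomorphic_derivI[OF F_holo[OF that] open_UNIV, of z] unfolding F_def by simp
  have C: "C holomorphic_on UNIV" "\<exists>z. C z \<noteq> 0"
    unfolding C_def[abs_def] using k by (auto intro!: fdet_holomorphic F_holo)
  have D: "D i holomorphic_on UNIV" for i
  proof -
    have "(\<lambda>z. fdet k (\<lambda>l j. (if j = i then F l k else F l j) z)) holomorphic_on UNIV"
      by (rule fdet_holomorphic) (use k F_holo in auto)
    moreover have "(\<lambda>z. fdet k (\<lambda>l j. (if j = i then F l k else F l j) z)) = D i"
      unfolding D_def cramer_minor_def by (intro ext fdet_cong) auto
    ultimately show ?thesis by simp
  qed
  have rel: "(\<Sum>i<k. F l i z * (D i z / C z)) = F l k z" if "C z \<noteq> 0" "l \<le> k" for z l
    using cramer_solution[of k "\<lambda>l i. F l i z" l] k(3) that unfolding C_def D_def by simp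
  define S where "S = {z. C z \<noteq> 0}"
  have S: "open S" unfolding S_def
    by (intro open_Collect_neq holomorphic_on_imp_continuous_on[OF C(1)] continuous_on_const)
  obtain z0 where "z0 \<in> S" using C(2) unfolding S_def by blast
  then obtain e where e: "e > 0" "ball z0 e \<subseteq> S" using S by (meson openE)
  have x_holo: "(\<lambda>z. D i z / C z) holomorphic_on S" for i
    by (intro holomorphic_on_divide holomorphic_on_subset[OF D] holomorphic_on_subset[OF C(1)]) (auto simp: S_def)
  have x_deriv: "((\<lambda>z. D i z / C z) has_field_derivative 0) (at z)" if z: "z \<in> S" and i: "i < k" for i z
  proof -
    define x' where "x' i = deriv (\<lambda>z. D i z / C z) z" for i
    have d: "((\<lambda>z. D i z / C z) has_field_derivative x' i) (at z)" for i
      unfolding x'_def by (rule holomorphic_derivI[OF x_holo S z])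
    have "(\<Sum>i<k. F l i z * x' i) = 0" if l: "l < k" for l
    proof -
      have "((\<lambda>z. \<Sum>i<k. F l i z * (D i z / C z)) has_field_derivative
          (\<Sum>i<k. F l i z * x' i + F (Suc l) i z * (D i z / C z))) (at z)"
        by (rule DERIV_sum, rule DERIV_mult') (use F_deriv d k in auto)
      moreover have "((\<lambda>z. \<Sum>i<k. F l i z * (D i z / C z)) has_field_derivative F (Suc l) k z) (at z)"
      proof (rule has_field_derivative_transform_within_open[OF _ S z])
        show "(F l k has_field_derivative F (Suc l) k z) (at z)" using F_deriv k by auto
        fix w assume "w \<in> S"
        thus "F l k w = (\<Sum>i<k. F l i w * (D i w / C w))" using rel[of w l] l unfolding S_def by simp
      qed
      ultimately have "(\<Sum>i<k. F l i z * x' i + F (Suc l) i z * (D i z / C z)) = F (Suc l) k z"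
        by (rule DERIV_unique)
      moreover have "(\<Sum>i<k. F (Suc l) i z * (D i z / C z)) = F (Suc l) k z"
        using rel[of z "Suc l"] z l unfolding S_def by simp
      ultimately show ?thesis by (simp add: sum.distrib)
    qed
    from cramer_unique[OF _ this i] z have "x' i = cramer_minor k (\<lambda>l i. F l i z) (\<lambda>_. 0) i / C z"
      unfolding S_def C_def by simp
    \<comment> \<open>The zero vector solves the same system, so the numerator in Cramer's formula
      vanishes.\<close>
    moreover from cramer_unique[of k "\<lambda>l i. F l i z" "\<lambda>_. 0" "\<lambda>_. 0" i] z i
    have "0 = cramer_minor k (\<lambda>l i. F l i z) (\<lambda>_. 0) i / C z" unfolding S_def C_def by simp
    ultimately have "x' i = 0" by simp
    thus ?thesis using d[of i] by simp
  qed
  define x where "x i = (if i < k then D i z0 / C z0 else if i = k then -1 else 0)" for i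
  have const: "D i z / C z = x i" if "z \<in> ball z0 e" "i < k" for z i
  proof -
    have "\<exists>c. \<forall>z\<in>ball z0 e. D i z / C z = c"
    proof (rule has_field_derivative_zero_constant[OF convex_ball])
      fix z assume "z \<in> ball z0 e"
      thus "((\<lambda>z. D i z / C z) has_field_derivative 0) (at z within ball z0 e)"
        using x_deriv[OF subsetD[OF e(2)] that(2)] has_field_derivative_at_within by blast
    qed
    thus ?thesis using that e unfolding x_def by auto
  qed
  define P where "P z = (\<Sum>i\<le>m. x i * s i z)" for z
  have P_ball: "P z = 0" if z: "z \<in> ball z0 e" for z
  proof -
    have "P z = (\<Sum>i\<in>{..<Suc k}. x i * s i z)" unfolding P_def
      by (rule sum.mono_neutral_right) (use k in \<open>auto simp: x_def\<close>)
    also have "\<dots> = (\<Sum>i<k. F 0 i z * (D i z / C z)) - F 0 k z"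
      using const[OF z] by (simp add: F_def mult.commute) (simp add: x_def)
    also have "\<dots> = 0" using rel[of z 0] z e unfolding S_def by auto
    finally show ?thesis .
  qed
  have P_holo: "P holomorphic_on UNIV" unfolding P_def[abs_def]
    by (intro holomorphic_on_sum holomorphic_on_mult holomorphic_on_const s) auto
  have "P z = 0" for z
    by (rule analytic_continuation_open[of "ball z0 e" UNIV P "\<lambda>_. 0"]) (use e P_ball P_holo in auto)
  hence "\<forall>i\<le>m. x i = 0" by (intro indep) (simp add: P_def)
  hence "x k = 0" using k(1) by auto
  thus False unfolding x_def by simp
qed

section \<open>Curves with periodic moving hyperplanes\<close>

lemma lin_indep_nonzero:
  assumes "lin_indep_over_periodic c J \<phi>" "finite J" "j \<in> J"
  shows "\<exists>z. \<phi> j z \<noteq> 0"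
proof (rule ccontr)
  assume "\<not> (\<exists>z. \<phi> j z \<noteq> 0)"
  hence z: "\<phi> j z = 0" for z by blast
  define h :: "nat \<Rightarrow> complex \<Rightarrow> complex" where "h i = (if i = j then (\<lambda>_. 1) else (\<lambda>_. 0))" for i
  have "(\<Sum>i\<in>J. h i z * \<phi> i z) = 0" for z
    by (rule sum.neutral) (use z in \<open>auto simp: h_def\<close>)
  hence "\<forall>\<^sub>\<approx>z\<in>UNIV. (\<Sum>i\<in>J. h i z * \<phi> i z) = 0" by simp
  moreover have "\<forall>i\<in>J. h i \<in> periodic_field c" unfolding h_def using const_in_periodic_field by auto
  ultimately have "\<forall>i\<in>J. h i = (\<lambda>_. 0)"
    using assms(1)[unfolded lin_indep_over_periodic_def, THEN spec, of h] by blast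
  hence "h j = (\<lambda>_. 0)" using assms(3) by (rule bspec)
  thus False unfolding h_def by (simp add: fun_eq_iff)
qed

lemma lin_indep_reindex:
  assumes "lin_indep_over_periodic c J \<phi>" "bij_betw e I J"
  shows "lin_indep_over_periodic c I (\<lambda>i. \<phi> (e i))"
  unfolding lin_indep_over_periodic_def
proof (intro allI impI)
  fix h assume h: "(\<forall>i\<in>I. h i \<in> periodic_field c) \<and> (\<forall>\<^sub>\<approx>z\<in>UNIV. (\<Sum>i\<in>I. h i z * \<phi> (e i) z) = 0)"
  define h' where "h' j = h (inv_into I e j)" for j
  have e: "h' (e i) = h i" if "i \<in> I" for i
    unfolding h'_def using that assms(2) by (simp add: bij_betw_def)
  have J: "J = e ` I" using assms(2) by (simp add: bij_betw_def)
  have "(\<Sum>j\<in>J. h' j z * \<phi> j z) = (\<Sum>i\<in>I. h i z * \<phi> (e i) z)" for z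
    using sum.reindex_bij_betw[OF assms(2), of "\<lambda>j. h' j z * \<phi> j z"] e by (simp cong: sum.cong)
  hence "\<forall>\<^sub>\<approx>z\<in>UNIV. (\<Sum>j\<in>J. h' j z * \<phi> j z) = 0" using h by simp
  moreover have "\<forall>j\<in>J. h' j \<in> periodic_field c" using h e unfolding J by auto
  ultimately have "\<forall>j\<in>J. h' j = (\<lambda>_. 0)"
    using assms(1)[unfolded lin_indep_over_periodic_def, THEN spec, of h'] by blast
  thus "\<forall>i\<in>I. h i = (\<lambda>_. 0)" using e unfolding J by auto
qed

locale paired_curve = curve n g for n g +
  fixes c :: complex and q :: nat and f :: "nat \<Rightarrow> complex \<Rightarrow> complex" and a :: "nat \<Rightarrow> nat \<Rightarrow> complex \<Rightarrow> complex"
  assumes n1: "n \<ge> 1"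
    and T_order: "hyper_order T < 1"
    and g_indep: "lin_indep_over_periodic c {..n} g"
    and q: "n < q"
    and a_holo: "\<And>i j. i \<le> n \<Longrightarrow> j \<le> q \<Longrightarrow> a i j holomorphic_on UNIV"
    and a_periodic: "\<And>i j z. i \<le> n \<Longrightarrow> j \<le> q \<Longrightarrow> a i j (z + c) = a i j z"
    and a_small: "\<And>i j. i \<le> n \<Longrightarrow> j \<le> q \<Longrightarrow> nevanlinna_char (a i j) \<in> o[at_top](T)"
    and f_eq: "\<And>j z. j \<le> q \<Longrightarrow> f j z = (\<Sum>i\<le>n. a i j z * g i z)"
    and f_indep: "\<And>J. J \<subseteq> {..q} \<Longrightarrow> card J = n + 1 \<Longrightarrow> lin_indep_over_periodic c J f"
    and paired: "\<And>j. j \<le> q \<Longrightarrow> derivative_like_paired c 0 (f j)"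
begin

lemma g_nz: "k \<le> n \<Longrightarrow> \<exists>z. g k z \<noteq> 0"
  by (rule lin_indep_nonzero[OF g_indep]) auto

lemma f_nz: assumes "j \<le> q" shows "\<exists>z. f j z \<noteq> 0"
proof -
  have "n \<le> card ({..q} - {j})" using assms q by simp
  then obtain J where J: "J \<subseteq> {..q} - {j}" "card J = n" "finite J" by (rule obtain_subset_with_card_n)
  have "card (insert j J) = n + 1" using J by (subst card_insert_disjoint) auto
  moreover have "insert j J \<subseteq> {..q}" using J assms by auto
  ultimately show ?thesis using lin_indep_nonzero[OF f_indep, of "insert j J" j] J by auto
qed

lemma f_holo: assumes "j \<le> q" shows "f j holomorphic_on UNIV"
proof -
  have "(\<lambda>z. \<Sum>i\<le>n. a i j z * g i z) holomorphic_on UNIV"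
    by (intro holomorphic_on_sum holomorphic_on_mult a_holo holo) (use assms in auto)
  thus ?thesis using f_eq[OF assms] by (simp add: fun_eq_iff[symmetric] cong: holomorphic_cong)
qed

lemma a_shift: "i \<le> n \<Longrightarrow> j \<le> q \<Longrightarrow> a i j (z + of_nat l * c) = a i j z"
proof (induction l)
  case (Suc l)
  have "a i j (z + of_nat (Suc l) * c) = a i j ((z + of_nat l * c) + c)" by (simp add: algebra_simps)
  thus ?case using Suc a_periodic[of i j "z + of_nat l * c"] by simp
qed simp

definition A :: "complex \<Rightarrow> real" where
  "A z = (\<Sum>(i,j)\<in>{..n} \<times> {..q}. ln_plus (norm (a i j z)))"

lemma A_nonneg: "A z \<ge> 0"
  unfolding A_def by (intro sum_nonneg) auto

lemma A_continuous: "continuous_on S A"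
  unfolding A_def
  by (intro continuous_on_sum)
    (auto intro!: continuous_on_ln_plus continuous_on_norm holomorphic_on_imp_continuous_on holomorphic_on_subset[OF a_holo])

lemma norm_a_le: assumes "i \<le> n" "j \<le> q" shows "norm (a i j z) \<le> exp (A z)"
proof -
  have "ln_plus (norm (a i j z)) \<le> A z"
    unfolding A_def using member_le_sum[of "(i,j)" "{..n} \<times> {..q}" "\<lambda>(i,j). ln_plus (norm (a i j z))"] assms by auto
  thus ?thesis using le_exp_ln_plus[of "norm (a i j z)"] by (meson exp_le_cancel_iff order_trans)
qed

text \<open>The logarithm pays for the n + 1 summands of f_j.\<close>

definition \<kappa> :: "complex \<Rightarrow> real" where "\<kappa> z = ln (real (Suc n)) + A z"

lemma \<kappa>_continuous: "continuous_on S \<kappa>"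
  unfolding \<kappa>_def by (intro continuous_intros A_continuous)

lemma \<kappa>_nonneg: "\<kappa> z \<ge> 0"
  unfolding \<kappa>_def using A_nonneg[of z] by simp

lemma norm_f_le: assumes j: "j \<le> q" shows "norm (f j z) \<le> exp (\<kappa> z + U z)"
proof -
  have "norm (f j z) \<le> (\<Sum>i\<le>n. norm (a i j z * g i z))" unfolding f_eq[OF j] by (rule norm_sum)
  also have "\<dots> \<le> (\<Sum>i\<le>n. exp (A z) * exp (U z))"
    unfolding norm_mult by (intro sum_mono mult_mono norm_a_le norm_le) (use j in auto)
  also have "\<dots> = real (Suc n) * exp (A z + U z)" by (simp add: exp_add)
  also have "\<dots> = exp (\<kappa> z + U z)" unfolding \<kappa>_def by (simp add: exp_add exp_ln)
  finally show ?thesis .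
qed

text \<open>By periodicity of the coefficients one majorant serves all shifts at once, as
  \<open>casorati_nonzero\<close> requires.\<close>

lemma \<kappa>_shift: "\<kappa> (z + of_nat l * c) = \<kappa> z"
  unfolding \<kappa>_def A_def by (auto intro!: sum.cong simp: a_shift)

lemma f_majorized: assumes j: "j \<le> q" shows "majorized \<kappa> (f j)"
  unfolding majorized_def
proof (intro conjI f_holo f_nz allI impI j)
  fix z assume "f j z \<noteq> 0"
  hence "ln (norm (f j z)) \<le> ln (exp (\<kappa> z + U z))" by (intro ln_mono norm_f_le j) auto
  thus "ln (norm (f j z)) \<le> U z + \<kappa> z" by simp
qed

text \<open>The coefficients are entire, so the mean of A is the sum of their characteristics. T
  appears with absolute value because the small-o relation compares absolute values and the sign of
  T is not known at this point.\<close>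

lemma mean_A_small: assumes \<epsilon>: "\<epsilon> > 0" shows "eventually (\<lambda>r. circle_mean A r \<le> \<epsilon> * \<bar>T r\<bar>) at_top"
proof -
  define m where "m = real (Suc n * Suc q)"
  have m: "m > 0" unfolding m_def by (simp only: of_nat_0_less_iff) simp
  have "eventually (\<lambda>r. \<forall>p\<in>{..n} \<times> {..q}. norm (nevanlinna_char (a (fst p) (snd p)) r) \<le> \<epsilon> / m * norm (T r)) at_top"
  proof (intro eventually_ball_finite ballI)
    fix p assume "p \<in> {..n} \<times> {..q}"
    hence "nevanlinna_char (a (fst p) (snd p)) \<in> o[at_top](T)" by (intro a_small) auto
    thus "eventually (\<lambda>r. norm (nevanlinna_char (a (fst p) (snd p)) r) \<le> \<epsilon> / m * norm (T r)) at_top"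
      by (rule landau_o.smallD) (use \<epsilon> m in simp)
  qed simp
  with eventually_ge_at_top[of 0] show ?thesis
  proof eventually_elim
    case (elim r)
    have "circle_mean A r = (\<Sum>p\<in>{..n} \<times> {..q}. circle_mean (\<lambda>z. ln_plus (norm (a (fst p) (snd p) z))) r)"
      unfolding A_def case_prod_beta
      by (rule circle_mean_sum) (use elim in \<open>auto intro!: continuous_on_ln_plus continuous_on_norm
        holomorphic_on_imp_continuous_on holomorphic_on_subset[OF a_holo]\<close>)
    also have "\<dots> = (\<Sum>p\<in>{..n} \<times> {..q}. nevanlinna_char (a (fst p) (snd p)) r)"
      by (intro sum.cong refl nevanlinna_char_entire[symmetric] a_holo) auto
    also have "\<dots> \<le> (\<Sum>p\<in>{..n} \<times> {..q}. \<epsilon> / m * \<bar>T r\<bar>)"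
    proof (rule sum_mono)
      fix p assume "p \<in> {..n} \<times> {..q}"
      from elim(2)[rule_format, OF this] show "nevanlinna_char (a (fst p) (snd p)) r \<le> \<epsilon> / m * \<bar>T r\<bar>"
        unfolding real_norm_def by (rule order_trans[OF abs_ge_self])
    qed
    also have "\<dots> = m * (\<epsilon> / m * \<bar>T r\<bar>)"
      unfolding m_def by (simp only: sum_constant card_cartesian_product card_atMost)
    also have "\<dots> = \<epsilon> * \<bar>T r\<bar>" using m by simp
    finally show ?case .
  qed
qed

lemma mean_\<kappa>: "r \<ge> 0 \<Longrightarrow> circle_mean \<kappa> r = ln (real (Suc n)) + circle_mean A r"
  unfolding \<kappa>_def by (subst circle_mean_add) (auto intro: A_continuous)

text \<open>
  By periodicity of the coefficients, the Casorati matrix of \<open>f\<close> over \<open>J\<close> is the product of the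
  Casorati matrix of \<open>g\<close> and the coefficient matrix of \<open>J\<close>, so both factors are nonsingular.
\<close>

lemma casorati_f_nonzero:
  assumes J: "J \<subseteq> {..q}" "card J = Suc n"
  shows "\<exists>z. fdet (Suc n) (\<lambda>l i. g i (z + of_nat l * c)) \<noteq> 0 \<and> fdet (Suc n) (\<lambda>l i. a i (enum J l) z) \<noteq> 0"
proof -
  have bij: "bij_betw (enum J) {0..<Suc n} J"
    by (rule bij_betw_enum) (use J finite_subset in auto)
  have eq: "enum J l \<le> q" if "l \<le> n" for l using bij J that unfolding bij_betw_def by auto
  have h0: "g 0 holomorphic_on UNIV" and n0: "\<exists>z. g 0 z \<noteq> 0" by (rule holo g_nz; simp)+
  have m0: "majorized (\<lambda>_. 0) (g 0)" using majorized_component[of 0 "\<lambda>_. 0"] g_nz[of 0] by simp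
  obtain K where K: "\<And>R. R > 0 \<Longrightarrow> (\<And>w. norm w = R \<Longrightarrow> g 0 w \<noteq> 0) \<Longrightarrow> int_count (zero_mult (g 0)) R \<le> T R + circle_mean (\<lambda>_. 0) R + K"
    using int_count_majorized[OF continuous_on_const m0] by blast
  have "\<exists>z. fdet (Suc n) (\<lambda>l i. f (enum J i) (z + of_nat l * c)) \<noteq> 0"
  proof (rule casorati_nonzero[OF T_order g_nz[of 0], where B = \<kappa> and ?K0.0 = 1 and ?K1.0 = "ln (real (Suc n)) + 2 * \<bar>K\<bar>"
      and ?X0.0 = "norm ` {z. g 0 z = 0}"])
    show "eventually (\<lambda>r. r \<notin> norm ` {z. g 0 z = 0} \<longrightarrow> circle_mean \<kappa> r \<le> ln (real (Suc n)) + 2 * \<bar>K\<bar> + 1 * T r) at_top"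
      using mean_A_small[of 1, simplified] eventually_ge_at_top[of 1]
    proof eventually_elim
      case (elim r)
      show ?case
      proof
        assume r: "r \<notin> norm ` {z. g 0 z = 0}"
        have "int_count (zero_mult (g 0)) r \<le> T r + K" using K[of r] r elim(2) by auto
        moreover have "int_count (zero_mult (g 0)) r \<ge> 0"
          by (rule int_count_nonneg) (use elim finite_zeros_in[OF h0 n0, of r] zero_mult_support[OF h0 n0, of r] in auto)
        \<comment> \<open>The counting function of g_0 is nonnegative, so T is bounded below by -K
          and its absolute value exceeds it by at most 2 |K|.\<close>
        ultimately have "\<bar>T r\<bar> \<le> T r + 2 * \<bar>K\<bar>" by linarith
        thus "circle_mean \<kappa> r \<le> ln (real (Suc n)) + 2 * \<bar>K\<bar> + 1 * T r"
          using elim mean_\<kappa>[of r] by simp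
      qed
    qed
    show "countable (norm ` {z. g 0 z = 0})" by (intro countable_image countable_zeros holo g_nz) auto
    show "norm (f (enum J i) (z + of_nat l * c)) \<le> exp (\<kappa> z + U (z + of_nat l * c))" if "i \<le> n" for i l z
      using norm_f_le[OF eq[OF that], of "z + of_nat l * c"] \<kappa>_shift by simp
    have "lin_indep_over_periodic c J f" using f_indep J by simp
    from lin_indep_reindex[OF this bij] show "lin_indep_over_periodic c {..n} (\<lambda>i. f (enum J i))"
      by (simp only: atLeast0LessThan lessThan_Suc_atMost)
  qed (use eq f_holo \<kappa>_continuous in auto)
  then obtain z where z: "fdet (Suc n) (\<lambda>l i. f (enum J i) (z + of_nat l * c)) \<noteq> 0" by blast
  have "fdet (Suc n) (\<lambda>l i. f (enum J i) (z + of_nat l * c)) = fdet (Suc n) (\<lambda>l i. \<Sum>k<Suc n. g k (z + of_nat l * c) * a k (enum J i) z)"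
  proof (rule fdet_cong)
    fix l i assume "i < Suc n"
    hence i: "enum J i \<le> q" using eq by simp
    show "f (enum J i) (z + of_nat l * c) = (\<Sum>k<Suc n. g k (z + of_nat l * c) * a k (enum J i) z)"
      unfolding f_eq[OF i] lessThan_Suc_atMost
      by (rule sum.cong) (use a_shift i in \<open>simp_all add: mult.commute\<close>)
  qed
  also have "\<dots> = fdet (Suc n) (\<lambda>l k. g k (z + of_nat l * c)) * fdet (Suc n) (\<lambda>k i. a k (enum J i) z)" by (rule fdet_mult)
  also have "fdet (Suc n) (\<lambda>k i. a k (enum J i) z) = fdet (Suc n) (\<lambda>l i. a i (enum J l) z)" by (rule fdet_transpose)
  finally show ?thesis using z by auto
qed

end

section \<open>Characteristic functions growing faster than the logarithm\<close>

context paired_curve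
begin

definition JS :: "nat set set" where "JS = {J. J \<subseteq> {..q} \<and> card J = Suc n}"

text \<open>
  No relevant function vanishes on a circle whose radius lies outside this countable set; such
  radii suffice, because a limes superior only has to be bounded from below.
\<close>

definition critical :: "real set" where
  "critical = (\<Union>k\<in>{..n}. \<Union>j\<in>{..q}. norm ` {z. f j (z + of_nat k * c) = 0})
    \<union> (\<Union>k\<in>{..n}. norm ` {z. g 0 (z + of_nat k * c) = 0})
    \<union> (\<Union>J\<in>JS. norm ` {z. fdet (Suc n) (\<lambda>l i. a i (enum J l) z) = 0})
    \<union> norm ` {z. fdet (Suc n) (\<lambda>i k. g i (z + of_nat k * c)) = 0}
    \<union> (\<Union>i\<in>{..n}. norm ` {z. g i z = 0})
    \<union> (\<Union>i\<in>{..n}. \<Union>j\<in>{..q}. norm ` {z. a i j z = 0 \<and> (\<exists>w. a i j w \<noteq> 0)})"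

lemma detA_nz: "J \<subseteq> {..q} \<Longrightarrow> card J = Suc n \<Longrightarrow> \<exists>z. fdet (Suc n) (\<lambda>l i. a i (enum J l) z) \<noteq> 0"
  using casorati_f_nonzero by blast

lemma casorati_g: "\<exists>z. fdet (Suc n) (\<lambda>i k. g i (z + of_nat k * c)) \<noteq> 0"
proof -
  have "{..n} \<subseteq> {..q}" "card {..n} = Suc n" using q by auto
  from casorati_f_nonzero[OF this] obtain z where "fdet (Suc n) (\<lambda>l i. g i (z + of_nat l * c)) \<noteq> 0" by blast
  hence "fdet (Suc n) (\<lambda>i k. g i (z + of_nat k * c)) \<noteq> 0"
    using fdet_transpose[of "Suc n" "\<lambda>l i. g i (z + of_nat l * c)"] by simp
  thus ?thesis by (rule exI)
qed

lemma enum_le: "J \<in> JS \<Longrightarrow> l < Suc n \<Longrightarrow> enum J l \<le> q"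
  using bij_betw_enum[of J "Suc n"] finite_subset[of J "{..q}"] unfolding JS_def bij_betw_def by auto

lemma shift_nz: "\<exists>z. \<phi> z \<noteq> (0::complex) \<Longrightarrow> \<exists>z. \<phi> (z + w) \<noteq> (0::complex)"
  for w :: complex by (metis diff_add_cancel)

lemma countable_critical: "countable critical"
proof -
  have 1: "countable (norm ` {z. f j (z + of_nat k * c) = 0})" if "j \<le> q" for j k
    by (intro countable_image countable_zeros shift_holomorphic shift_nz f_holo f_nz that)
  have 2: "countable (norm ` {z. g 0 (z + of_nat k * c) = 0})" for k
    by (intro countable_image countable_zeros shift_holomorphic shift_nz holo g_nz) auto
  have 3: "countable (norm ` {z. fdet (Suc n) (\<lambda>l i. a i (enum J l) z) = 0})" if "J \<in> JS" for J
    by (intro countable_image countable_zeros fdet_holomorphic a_holo detA_nz)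
      (use that enum_le[OF that] in \<open>auto simp: JS_def\<close>)
  have 4: "countable (norm ` {z. fdet (Suc n) (\<lambda>i k. g i (z + of_nat k * c)) = 0})"
    by (intro countable_image countable_zeros fdet_holomorphic casorati_g shift_holomorphic holo) auto
  have 5: "countable {..n}" "countable {..q}" "countable JS" unfolding JS_def by (auto intro: countable_finite)
  have "countable (\<Union>k\<in>{..n}. \<Union>j\<in>{..q}. norm ` {z. f j (z + of_nat k * c) = 0})"
    by (intro countable_UN 5 1) simp
  moreover have "countable (\<Union>k\<in>{..n}. norm ` {z. g 0 (z + of_nat k * c) = 0})"
    by (intro countable_UN 5 2)
  moreover have "countable (\<Union>J\<in>JS. norm ` {z. fdet (Suc n) (\<lambda>l i. a i (enum J l) z) = 0})"
    by (intro countable_UN 5 3)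
  moreover have "countable (\<Union>i\<in>{..n}. norm ` {z. g i z = 0})"
    by (intro countable_UN 5 countable_image countable_zeros holo g_nz) auto
  moreover have "countable (\<Union>i\<in>{..n}. \<Union>j\<in>{..q}. norm ` {z. a i j z = 0 \<and> (\<exists>w. a i j w \<noteq> 0)})"
  proof (intro countable_UN 5 countable_image)
    fix i j assume ij: "i \<in> {..n}" "j \<in> {..q}"
    show "countable {z. a i j z = 0 \<and> (\<exists>w. a i j w \<noteq> 0)}"
    proof (cases "\<exists>w. a i j w \<noteq> 0")
      case True
      have "countable {z. a i j z = 0}" by (rule countable_zeros[OF a_holo True]) (use ij in auto)
      thus ?thesis by (rule countable_subset[rotated]) auto
    qed simp
  qed
  ultimately show ?thesis unfolding critical_def by (intro countable_Un 4)
qed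

lemma detA_critical: "norm w \<notin> critical \<Longrightarrow> J \<in> JS \<Longrightarrow> fdet (Suc n) (\<lambda>l i. a i (enum J l) w) \<noteq> 0"
  unfolding critical_def by auto

lemma detL_critical: "norm w \<notin> critical \<Longrightarrow> fdet (Suc n) (\<lambda>i k. g i (w + of_nat k * c)) \<noteq> 0"
  unfolding critical_def by auto

lemma g_critical: "norm w \<notin> critical \<Longrightarrow> i \<le> n \<Longrightarrow> g i w \<noteq> 0"
  unfolding critical_def by auto

lemma a_critical:
  assumes "norm w \<notin> critical" "i \<le> n" "j \<le> q" "\<exists>w. a i j w \<noteq> 0"
  shows "a i j w \<noteq> 0"
proof
  assume "a i j w = 0"
  hence "w \<in> {z. a i j z = 0 \<and> (\<exists>w. a i j w \<noteq> 0)}" using assms by blast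
  hence "norm w \<in> norm ` {z. a i j z = 0 \<and> (\<exists>w. a i j w \<noteq> 0)}" by (rule imageI)
  moreover have "i \<in> {..n}" "j \<in> {..q}" using assms(2,3) by auto
  ultimately have "norm w \<in> (\<Union>i\<in>{..n}. \<Union>j\<in>{..q}. norm ` {z. a i j z = 0 \<and> (\<exists>w. a i j w \<noteq> 0)})"
    by (intro UN_I)
  hence "norm w \<in> critical" unfolding critical_def by (rule UnI2)
  thus False using assms(1) by contradiction
qed

text \<open>Asked for on arbitrarily large radii only: a sum of upper limits dominates the limit
  along any sequence of radii. Positivity of T is recorded for the division by T.\<close>

definition main_bound :: bool where
  "main_bound \<longleftrightarrow> (\<forall>\<epsilon>>0. \<forall>r0. \<exists>r\<ge>r0. T r > 0 \<and> real (q - n) * T r \<le> (\<Sum>j\<le>q. trunc_count_zeros n (f j) r) + \<epsilon> * T r)"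

text \<open>Exceptional zeros are pulled back along every shift up to n c, so that from any point
  outside this set the pairing can be iterated along z, z + c, z + 2 c, up to n times.\<close>

definition unpaired :: "complex set" where
  "unpaired = (\<Union>j\<in>{..q}. \<Union>k\<in>{..n}. (\<lambda>w. w - of_nat k * c) ` {z. f j z = 0 \<and> zero_mult (f j) (z + c) \<noteq> zero_mult (f j) z - 1})"

lemma finite_unpaired: "finite unpaired"
  unfolding unpaired_def
proof (intro finite_UN_I finite_imageI)
  fix j assume "j \<in> {..q}"
  thus "finite {z. f j z = 0 \<and> zero_mult (f j) (z + c) \<noteq> zero_mult (f j) z - 1}"
    using paired[of j] unfolding derivative_like_paired_def by simp
qed auto

text \<open>Each pairing lowers the multiplicity by at most one. If the chain has already reached a
  point where f_j does not vanish, the induction hypothesis forces the initial multiplicity to be at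
  most k.\<close>

lemma zero_mult_shift_ge:
  assumes z: "z \<notin> unpaired" and j: "j \<le> q" and k: "k \<le> n"
  shows "zero_mult (f j) z - k \<le> zero_mult (f j) (z + of_nat k * c)"
  using k
proof (induction k)
  case (Suc k)
  let ?w = "z + of_nat k * c"
  have w: "z + of_nat (Suc k) * c = ?w + c" by (simp add: algebra_simps)
  show ?case
  proof (cases "f j ?w = 0")
    case True
    have "zero_mult (f j) (?w + c) = zero_mult (f j) ?w - 1"
    proof (rule ccontr)
      assume "zero_mult (f j) (?w + c) \<noteq> zero_mult (f j) ?w - 1"
      hence "z \<in> (\<lambda>w. w - of_nat k * c) ` {z. f j z = 0 \<and> zero_mult (f j) (z + c) \<noteq> zero_mult (f j) z - 1}"
        using True by (intro image_eqI[of _ _ ?w]) auto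
      thus False using z j Suc.prems unfolding unpaired_def by auto
    qed
    thus ?thesis using Suc unfolding w by simp
  next
    case False
    hence "zero_mult (f j) ?w = 0" unfolding zero_mult_def by simp
    thus ?thesis using Suc by simp
  qed
qed simp

text \<open>The second main inequality for shifts. Its error splits into S from shifting g_0, Y from
  the logarithmic differences of the f_j / g_0, and Z from the coefficients, the constants and the
  unpaired points; each is o(T) on suitable radii.\<close>

lemma shift_bound:
  assumes ln_T: "\<And>\<epsilon>. \<epsilon> > 0 \<Longrightarrow> eventually (\<lambda>r. r \<notin> critical \<longrightarrow> ln r \<le> \<epsilon> * T r) at_top"
  shows main_bound
proof -
  define L where "L k i z = g i (z + of_nat k * c)" for k i z
  have M_eq: "(\<Sum>i\<le>n. a i j z * L k i z) = f j (z + of_nat k * c)" if "j \<le> q" for j k z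
    unfolding f_eq[OF that] L_def by (intro sum.cong refl) (use that a_shift in auto)
  interpret O: operator_curve n g q a f L unpaired
  proof
    show "\<exists>z. fdet (Suc n) (\<lambda>i k. L k i z) \<noteq> 0" using casorati_g unfolding L_def .
    fix z k j assume z: "z \<notin> unpaired" and kj: "k \<le> n" "j \<le> q"
    have "zero_mult (f j) z - n \<le> zero_mult (f j) z - k" using kj by simp
    also have "\<dots> \<le> zero_mult (f j) (z + of_nat k * c)" by (rule zero_mult_shift_ge[OF z kj(2,1)])
    also have "\<dots> = zero_mult (\<lambda>z. f j (z + of_nat k * c)) z"
      by (rule zero_mult_shift[symmetric]) (use f_holo f_nz kj in auto)
    finally show "ord_ge (\<lambda>w. \<Sum>i\<le>n. a i j w * L k i w) z (zero_mult (f j) z - n)"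
      unfolding M_eq[OF kj(2)]
      by (subst ord_ge_zero_mult) (use shift_holomorphic[OF f_holo] shift_nz[OF f_nz] kj in auto)
  qed (use q a_holo f_eq f_nz detA_nz finite_unpaired in \<open>auto simp: L_def[abs_def] intro: shift_holomorphic holo\<close>)
  have OA: "O.A = A" unfolding O.A_def[abs_def] A_def[abs_def] ..
  have ge1: "eventually (\<lambda>r. r \<notin> critical \<longrightarrow> 1 \<le> T r) at_top"
    using ln_T[of 1, simplified] eventually_ge_at_top[of "exp 1"]
  proof eventually_elim
    case (elim r)
    have "r > 0" using elim(2) less_le_trans[OF exp_gt_zero] by blast
    hence "ln r \<ge> 1" using elim(2) by (simp add: ln_ge_iff)
    thus ?case using elim(1) by auto
  qed
  have \<kappa>_small: "eventually (\<lambda>r. r \<notin> critical \<longrightarrow> circle_mean \<kappa> r \<le> \<epsilon> * T r) at_top" if \<epsilon>: "\<epsilon> > 0" for \<epsilon>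
  proof -
    have e2: "\<epsilon> / 2 > 0" using \<epsilon> by simp
    define K where "K = ln (real (Suc n))"
    have "eventually (\<lambda>r. K / (\<epsilon> / 2) \<le> ln r) at_top" using ln_at_top by (auto simp: filterlim_at_top)
    with ln_T[of 1, simplified] mean_A_small[OF e2] ge1 eventually_ge_at_top[of 0]
    show ?thesis
    proof eventually_elim
      case (elim r)
      show ?case
      proof
        assume r: "r \<notin> critical"
        have "K / (\<epsilon> / 2) \<le> T r" using elim(1,5) r by simp
        hence "K \<le> \<epsilon> / 2 * T r" using e2 by (simp add: field_simps)
        moreover have "circle_mean A r \<le> \<epsilon> / 2 * T r" using elim(2,3) r by simp
        moreover have "\<epsilon> * T r = \<epsilon> / 2 * T r + \<epsilon> / 2 * T r" by simp
        ultimately show "circle_mean \<kappa> r \<le> \<epsilon> * T r" using mean_\<kappa>[OF elim(4)] unfolding K_def by linarith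
      qed
    qed
  qed
  obtain \<sigma> where \<sigma>: "0 \<le> \<sigma>" "\<sigma> < 1" "eventually (\<lambda>r. T r \<le> exp (r powr \<sigma>)) at_top"
    using hyper_order_bound[OF T_order] by blast
  \<comment> \<open>Any value in (0, 1 - \<sigma>) would be admissible in
    \<open>growth_window\<close>.\<close>
  define \<beta> where "\<beta> = (1 - \<sigma>) / 2"
  have \<beta>: "0 < \<beta>" "\<beta> < 1 - \<sigma>" "\<beta> < 1" unfolding \<beta>_def using \<sigma> by auto
  interpret G: growing_curve n g critical \<kappa> \<beta>
    by unfold_locales (use \<kappa>_continuous \<kappa>_nonneg \<beta> countable_critical ln_T \<kappa>_small in auto)
  have cov_f: "covers critical (\<lambda>z. f j (z + of_nat k * c))" if "j \<le> q" "k \<le> n" for j k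
    using that unfolding covers_def critical_def by blast
  have cov_g: "covers critical (\<lambda>z. g 0 (z + of_nat k * c))" if "k \<le> n" for k
    using that unfolding covers_def critical_def by blast
  have cov_f0: "covers critical (f j)" if "j \<le> q" for j using cov_f[OF that, of 0] by simp
  have cov_g0: "covers critical (g 0)" using cov_g[of 0] by simp
  have maj_g: "majorized \<kappa> (g 0)" by (rule majorized_component) (use g_nz \<kappa>_nonneg in auto)
  \<comment> \<open>The mean of |log |f_j|| is not controlled by T, since a zero-free common factor
    changes it; that of |log |f_j / g_0|| is. These weights turn the shifted f_j over f_j into a
    quotient of values of f_j / g_0, at the price S.\<close>
  define \<omega> where "\<omega> k z = norm (g 0 z) / norm (g 0 (z + of_nat k * c))" for k z
  define X where "X k j z = \<bar>(ln (norm (f j (z + of_nat k * c))) - ln (norm (g 0 (z + of_nat k * c)))) - (ln (norm (f j z)) - ln (norm (g 0 z)))\<bar>" for k j z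
  define S where "S r = (\<Sum>k\<le>n. circle_mean (\<lambda>z. ln (norm (g 0 (z + of_nat k * c)))) r - circle_mean (\<lambda>z. ln (norm (g 0 z))) r)" for r
  define Y where "Y r = (\<Sum>p\<in>{..n} \<times> {..q}. circle_mean (X (fst p) (snd p)) r)" for r
  have S_small: "G.small S" unfolding S_def
    by (intro G.small_sum G.small_shift_mean maj_g cov_g0 cov_g) auto
  have Y_small: "G.small Y" unfolding Y_def X_def
    by (intro G.small_sum G.small_log_difference maj_g f_majorized cov_g0 cov_g cov_f0 cov_f) auto
  obtain K where K: "K \<ge> 0" "\<And>r \<omega>. O.admissible r \<Longrightarrow>
    (\<And>k. k \<le> n \<Longrightarrow> continuous_on (sphere 0 r) (\<omega> k)) \<Longrightarrow> (\<And>k z. k \<le> n \<Longrightarrow> norm z = r \<Longrightarrow> \<omega> k z > (0::real)) \<Longrightarrow>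
    real (q - n) * T r \<le> (\<Sum>j\<le>q. trunc_count_zeros n (f j) r) - (\<Sum>k\<le>n. circle_mean (\<lambda>z. ln (\<omega> k z)) r)
     + (\<Sum>(k,j)\<in>{..n} \<times> {..q}. circle_mean (\<lambda>z. ln_plus (norm (O.M k j z) * \<omega> k z / norm (f j z))) r)
     + K * (1 + circle_mean O.A r) + K * (if unpaired = {} then 0 else ln r)"
    by (rule O.second_main_inequality) blast
  define Z where "Z r = (K + 1) * circle_mean \<kappa> r + ((K + 1) * ln r + (K + 1))" for r
  have "G.small (circle_mean \<kappa>)" unfolding G.small_def
  proof (intro allI impI)
    fix \<epsilon> :: real assume "\<epsilon> > 0"
    from \<kappa>_small[OF this] show "eventually (\<lambda>r. G.win r \<longrightarrow> circle_mean \<kappa> r \<le> \<epsilon> * T r) at_top"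
      by eventually_elim (auto simp: G.win_def)
  qed
  hence Z_small: "G.small Z" unfolding Z_def
    by (intro G.small_add G.small_cmult G.small_ln G.small_const) (use K(1) in auto)
  have bound: "real (q - n) * T r \<le> (\<Sum>j\<le>q. trunc_count_zeros n (f j) r) + (S r + (Y r + Z r))"
    if r: "r \<notin> critical" "r \<ge> 1" for r
  proof -
    have r0: "r \<ge> 0" using r by simp
    have nz_f: "f j (z + of_nat k * c) \<noteq> 0" if "norm z = r" "j \<le> q" "k \<le> n" for z j k
      using coversD[OF cov_f[OF that(2,3)] r(1) that(1)] .
    have nz_g: "g 0 (z + of_nat k * c) \<noteq> 0" if "norm z = r" "k \<le> n" for z k
      using coversD[OF cov_g[OF that(2)] r(1) that(1)] .
    have nz0: "f j z \<noteq> 0" "g 0 z \<noteq> 0" if "norm z = r" "j \<le> q" for z j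
      using nz_f[OF that, of 0] nz_g[OF that(1), of 0] by auto
    have adm: "O.admissible r" unfolding O.admissible_def
    proof (intro conjI r(2) allI impI ballI)
      fix w :: complex assume w: "norm w = r"
      have wc: "norm w \<notin> critical" using w r(1) by simp
      show "O.detL w \<noteq> 0" unfolding O.detL_def L_def by (rule detL_critical[OF wc])
      show "f j w \<noteq> 0" if "j \<le> q" for j by (rule nz0(1)[OF w that])
      fix J assume "J \<in> O.JJ"
      hence "J \<in> JS" unfolding O.JJ_def JS_def .
      thus "O.detA J w \<noteq> 0" unfolding O.detA_def by (rule detA_critical[OF wc])
    qed
    have hg: "g 0 holomorphic_on UNIV" "(\<lambda>z. g 0 (z + w)) holomorphic_on UNIV" for w
      by (intro shift_holomorphic holo; simp)+
    have hf: "f j holomorphic_on UNIV" "(\<lambda>z. f j (z + w)) holomorphic_on UNIV" if "j \<le> q" for j w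
      by (intro shift_holomorphic f_holo that)+
    have cg: "continuous_on (sphere 0 r) (\<lambda>z. ln (norm (g 0 (z + of_nat k * c))))" if "k \<le> n" for k
      by (rule continuous_on_ln_norm[OF hg(2)]) (use nz_g that in auto)
    have cg0: "continuous_on (sphere 0 r) (\<lambda>z. ln (norm (g 0 z)))"
      by (rule continuous_on_ln_norm[OF hg(1)]) (use nz0 in auto)
    have cf: "continuous_on (sphere 0 r) (\<lambda>z. ln (norm (f j (z + of_nat k * c))))" if "k \<le> n" "j \<le> q" for k j
      by (rule continuous_on_ln_norm[OF hf(2)[OF that(2)]]) (use nz_f that in auto)
    have cf0: "continuous_on (sphere 0 r) (\<lambda>z. ln (norm (f j z)))" if "j \<le> q" for j
      by (rule continuous_on_ln_norm[OF hf(1)[OF that]]) (use nz0 that in auto)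
    have c\<omega>: "continuous_on (sphere 0 r) (\<omega> k)" if "k \<le> n" for k
      unfolding \<omega>_def[abs_def]
      by (intro continuous_on_divide continuous_on_norm holomorphic_on_imp_continuous_on
          holomorphic_on_subset[OF hg(1)] holomorphic_on_subset[OF hg(2)]) (use nz_g that in auto)
    have \<omega>_pos: "\<omega> k z > 0" if "k \<le> n" "norm z = r" for k z
      unfolding \<omega>_def using nz_g[OF that(2,1)] nz0(2)[OF that(2), of 0] by simp
    have "- (\<Sum>k\<le>n. circle_mean (\<lambda>z. ln (\<omega> k z)) r) = S r"
      unfolding S_def sum_negf[symmetric]
    proof (rule sum.cong[OF refl])
      fix k assume "k \<in> {..n}"
      hence k: "k \<le> n" by simp
      have "circle_mean (\<lambda>z. ln (\<omega> k z)) r = circle_mean (\<lambda>z. ln (norm (g 0 z)) - ln (norm (g 0 (z + of_nat k * c)))) r"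
        by (rule circle_mean_cong[OF _ r0]) (use nz_g k nz0(2)[of _ 0] in \<open>auto simp: \<omega>_def ln_div\<close>)
      also have "\<dots> = circle_mean (\<lambda>z. ln (norm (g 0 z))) r - circle_mean (\<lambda>z. ln (norm (g 0 (z + of_nat k * c)))) r"
        by (rule circle_mean_diff[OF r0 cg0 cg[OF k]])
      finally show "- circle_mean (\<lambda>z. ln (\<omega> k z)) r = circle_mean (\<lambda>z. ln (norm (g 0 (z + of_nat k * c)))) r - circle_mean (\<lambda>z. ln (norm (g 0 z))) r"
        by simp
    qed
    moreover have "(\<Sum>(k,j)\<in>{..n} \<times> {..q}. circle_mean (\<lambda>z. ln_plus (norm (O.M k j z) * \<omega> k z / norm (f j z))) r) \<le> Y r"
      unfolding Y_def case_prod_beta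
    proof (rule sum_mono)
      fix p assume "p \<in> {..n} \<times> {..q}"
      then obtain k j where p: "p = (k, j)" "k \<le> n" "j \<le> q" by auto
      have M: "O.M k j z = f j (z + of_nat k * c)" for z unfolding O.M_def by (rule M_eq[OF p(3)])
      have "circle_mean (\<lambda>z. ln_plus (norm (f j (z + of_nat k * c)) * \<omega> k z / norm (f j z))) r \<le> circle_mean (X k j) r"
      proof (rule circle_mean_mono[OF r0])
        show "continuous_on (sphere 0 r) (\<lambda>z. ln_plus (norm (f j (z + of_nat k * c)) * \<omega> k z / norm (f j z)))"
          by (intro continuous_on_ln_plus continuous_on_divide continuous_on_mult c\<omega> p continuous_on_norm
            holomorphic_on_imp_continuous_on holomorphic_on_subset[OF hf(1)] holomorphic_on_subset[OF hf(2)])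
            (use nz0 p in auto)
        show "continuous_on (sphere 0 r) (X k j)" unfolding X_def[abs_def]
          by (intro continuous_on_rabs continuous_on_diff cf cg cf0 cg0 p)
        fix z :: complex assume z: "norm z = r"
        define x where "x = norm (f j (z + of_nat k * c)) * \<omega> k z / norm (f j z)"
        have pos: "norm (f j (z + of_nat k * c)) > 0" "norm (g 0 (z + of_nat k * c)) > 0" "norm (f j z) > 0" "norm (g 0 z) > 0"
          using nz_f[OF z p(3,2)] nz_g[OF z p(2)] nz0[OF z p(3)] by auto
        have "ln (x1 * (x4 / x2) / x3) = (ln x1 - ln x2) - (ln x3 - ln x4)" if "x1 > 0" "x2 > 0" "x3 > 0" "x4 > 0" for x1 x2 x3 x4 :: real
          using that by (simp add: ln_mult_pos ln_div)
        from this[OF pos] have "\<bar>ln x\<bar> = X k j z" unfolding x_def \<omega>_def X_def by simp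
        moreover have "ln_plus x \<le> \<bar>ln x\<bar>" unfolding ln_plus_def by (auto simp: max_def)
        ultimately show "ln_plus (norm (f j (z + of_nat k * c)) * \<omega> k z / norm (f j z)) \<le> X k j z"
          unfolding x_def by simp
      qed
      thus "circle_mean (\<lambda>z. ln_plus (norm (O.M (fst p) (snd p) z) * \<omega> (fst p) z / norm (f (snd p) z))) r \<le> circle_mean (X (fst p) (snd p)) r"
        unfolding p(1) fst_conv snd_conv M .
    qed
    moreover have "K * (1 + circle_mean O.A r) + K * (if unpaired = {} then 0 else ln r) \<le> Z r"
    proof -
      have "circle_mean A r \<le> circle_mean \<kappa> r" using mean_\<kappa>[OF r0] by simp
      moreover have "circle_mean \<kappa> r \<ge> 0" by (rule circle_mean_nonneg[OF r0]) (auto intro: \<kappa>_continuous \<kappa>_nonneg)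
      moreover have "K * circle_mean A r \<le> K * circle_mean \<kappa> r" by (intro mult_left_mono calculation(1) K(1))
      moreover have "K * (if unpaired = {} then 0 else ln r) \<le> K * ln r" by (intro mult_left_mono K(1)) (use r in auto)
      moreover have "ln r \<ge> 0" using r by simp
      moreover have "Z r = K * circle_mean \<kappa> r + circle_mean \<kappa> r + (K * ln r + ln r + K + 1)" unfolding Z_def by (simp add: algebra_simps)
      moreover have "K * (1 + circle_mean O.A r) = K + K * circle_mean A r" unfolding OA by (simp add: algebra_simps)
      ultimately show ?thesis by linarith
    qed
    moreover note K(2)[OF adm, of \<omega>, OF c\<omega> \<omega>_pos]
    ultimately show ?thesis by linarith
  qed
  show ?thesis unfolding main_bound_def
  proof (intro allI impI)
    fix \<epsilon> r0 :: real assume \<epsilon>: "\<epsilon> > 0"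
    have "G.small (\<lambda>r. S r + (Y r + Z r))" by (intro G.small_add S_small Y_small Z_small)
    hence 1: "eventually (\<lambda>r. G.win r \<longrightarrow> S r + (Y r + Z r) \<le> \<epsilon> * T r) at_top" using \<epsilon> unfolding G.small_def by blast
    obtain r1 where r1: "\<And>r. r \<ge> r1 \<Longrightarrow> (r \<notin> critical \<longrightarrow> 1 \<le> T r) \<and> T r \<le> exp (r powr \<sigma>)
       \<and> (G.win r \<longrightarrow> S r + (Y r + Z r) \<le> \<epsilon> * T r)"
      using eventually_conj[OF ge1 eventually_conj[OF \<sigma>(3) 1]] unfolding eventually_at_top_linorder by blast
    \<comment> \<open>Beyond r1 the bounds 1 \<le> T \<le> exp (r^\<sigma>) hold off
      \<open>critical\<close>, so a radius with a controlled window exists; this is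
      \<open>G.win\<close>.\<close>
    have "\<exists>r\<ge>max r0 (max r1 1). r \<notin> critical \<and> (\<forall>s. s \<notin> critical \<longrightarrow> r \<le> s \<longrightarrow> s \<le> r + r powr \<beta> \<longrightarrow> T s \<le> 2 * T r)"
      by (rule growth_window[OF countable_critical \<beta>(1,2) \<sigma>(1), of r1 T]) (use r1 in auto)
    then obtain r where r: "r \<ge> max r0 (max r1 1)" "G.win r" unfolding G.win_def by blast
    have rC: "r \<notin> critical" using r(2) unfolding G.win_def by blast
    have "real (q - n) * T r \<le> (\<Sum>j\<le>q. trunc_count_zeros n (f j) r) + (S r + (Y r + Z r))"
      by (rule bound[OF rC]) (use r in auto)
    moreover have "S r + (Y r + Z r) \<le> \<epsilon> * T r" "1 \<le> T r" using r1[of r] r rC by auto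
    ultimately have "T r > 0 \<and> real (q - n) * T r \<le> (\<Sum>j\<le>q. trunc_count_zeros n (f j) r) + \<epsilon> * T r" by linarith
    thus "\<exists>r\<ge>r0. T r > 0 \<and> real (q - n) * T r \<le> (\<Sum>j\<le>q. trunc_count_zeros n (f j) r) + \<epsilon> * T r"
      using r(1) by auto
  qed
qed

end

section \<open>Entire functions of logarithmic growth\<close>

text \<open>A Liouville argument along a sequence of radii. The Poisson integral on |w| = r gives
  |f| \<le> r^(3C) on |z| = r/2, where 3 = (r + r/2) / (r - r/2), and Cauchy's estimate bounds the
  derivative by a multiple of r^(3C - k), which tends to 0.\<close>

lemma higher_deriv_zero_of_log_growth:
  assumes f: "f holomorphic_on UNIV" "\<exists>z. f z \<noteq> 0"
    and growth: "\<And>r0. \<exists>r\<ge>r0. (\<forall>w. norm w = r \<longrightarrow> f w \<noteq> 0) \<and> circle_mean (\<lambda>z. ln_plus (norm (f z))) r \<le> C * ln r"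
    and k: "3 * C < real k"
  shows "(deriv ^^ k) f 0 = 0"
proof (rule ccontr)
  assume nz: "(deriv ^^ k) f 0 \<noteq> 0"
  define d where "d = norm ((deriv ^^ k) f 0)"
  have d: "d > 0" unfolding d_def using nz by simp
  have "((\<lambda>r. r powr (3 * C - real k)) \<longlongrightarrow> 0) at_top"
    by (rule tendsto_neg_powr) (use k in \<open>auto intro: filterlim_ident\<close>)
  hence "((\<lambda>r. (fact k * 2 ^ k) * r powr (3 * C - real k)) \<longlongrightarrow> (fact k * 2 ^ k) * 0) at_top" by (intro tendsto_intros)
  hence "eventually (\<lambda>r. (fact k * 2 ^ k) * r powr (3 * C - real k) < d) at_top" using d by (intro order_tendstoD(2)) auto
  then obtain r1 where r1: "\<And>r. r \<ge> r1 \<Longrightarrow> (fact k * 2 ^ k) * r powr (3 * C - real k) < d"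
    unfolding eventually_at_top_linorder by blast
  obtain r where r: "r \<ge> max 1 r1" "\<And>w. norm w = r \<Longrightarrow> f w \<noteq> 0" "circle_mean (\<lambda>z. ln_plus (norm (f z))) r \<le> C * ln r"
    using growth[of "max 1 r1"] by blast
  have r0: "r > 0" using r by simp
  let ?P = "\<lambda>z. ln_plus (norm (f z))"
  have cP: "continuous_on (sphere 0 r) ?P"
    by (intro continuous_on_ln_plus continuous_on_norm holomorphic_on_imp_continuous_on holomorphic_on_subset[OF f(1)]) auto
  have cf: "continuous_on (sphere 0 r) (\<lambda>w. ln (norm (f w)))" by (rule continuous_on_ln_norm[OF f(1)]) (use r(2) in auto)
  have bound: "norm (f z) \<le> r powr (3 * C)" if z: "norm z = r / 2" for z
  proof (cases "f z = 0")
    case False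
    have zr: "norm z < r" using z r0 by simp
    have "ln (norm (f z)) = poisson r (\<lambda>w. ln (norm (f w))) z - (\<Sum>a\<in>zeros_in f r. zero_mult f a * green r z a)"
      by (rule poisson_jensen[OF f(1) _ zr False]) (use r(2) in auto)
    also have "\<dots> \<le> poisson r (\<lambda>w. ln (norm (f w))) z"
    proof -
      have "(\<Sum>a\<in>zeros_in f r. zero_mult f a * green r z a) \<ge> 0"
      proof (intro sum_nonneg mult_nonneg_nonneg green_nonneg)
        fix a assume "a \<in> zeros_in f r"
        thus "norm a \<le> r" "z \<noteq> a" using False unfolding zeros_in_def by auto
      qed (use zr r0 in auto)
      thus ?thesis by simp
    qed
    also have "\<dots> \<le> poisson r ?P z"
      by (rule poisson_mono[OF zr cf cP]) (use r(2) in \<open>auto intro: ln_le_ln_plus\<close>)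
    also have "\<dots> \<le> (r + norm z) / (r - norm z) * circle_mean ?P r"
      by (rule poisson_le_circle_mean[OF zr cP cP]) simp
    also have "(r + norm z) / (r - norm z) = 3" unfolding z using r0 by (simp add: field_simps)
    also have "3 * circle_mean ?P r \<le> 3 * (C * ln r)" using r(3) by simp
    finally have "ln (norm (f z)) \<le> 3 * C * ln r" by simp
    thus ?thesis using r0 False by (metis exp_le_cancel_iff exp_ln powr_def less_numeral_extra(3) zero_less_norm_iff)
  qed (use r0 in simp)
  have "d \<le> fact k * r powr (3 * C) / (r / 2) ^ k"
    unfolding d_def
    by (rule Cauchy_inequality) (use bound r0 in \<open>auto intro: holomorphic_on_subset[OF f(1)]
      holomorphic_on_imp_continuous_on[OF holomorphic_on_subset[OF f(1)]]\<close>)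
  also have "\<dots> = (fact k * 2 ^ k) * r powr (3 * C - real k)"
    using r0 by (simp add: powr_diff powr_realpow power_divide)
  also have "\<dots> < d" by (rule r1) (use r(1) in simp)
  finally show False by simp
qed

lemma entire_eq_poly:
  assumes f: "f holomorphic_on UNIV" and z: "\<And>k. k \<ge> N \<Longrightarrow> (deriv ^^ k) f 0 = 0"
  shows "f = poly (\<Sum>k<N. monom ((deriv ^^ k) f 0 / fact k) k)"
proof
  fix z :: complex
  have "z \<in> ball 0 (norm z + 1)" by simp
  from holomorphic_power_series[OF holomorphic_on_subset[OF f] this]
  have "(\<lambda>k. (deriv ^^ k) f 0 / fact k * z ^ k) sums f z" by simp
  moreover have "(\<lambda>k. (deriv ^^ k) f 0 / fact k * z ^ k) sums (\<Sum>k<N. (deriv ^^ k) f 0 / fact k * z ^ k)"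
    by (rule sums_finite) (use assms(2) in auto)
  ultimately have "f z = (\<Sum>k<N. (deriv ^^ k) f 0 / fact k * z ^ k)" by (rule sums_unique2)
  thus "f z = poly (\<Sum>k<N. monom ((deriv ^^ k) f 0 / fact k) k) z"
    by (simp add: poly_sum poly_monom)
qed

lemma entire_finite_zeros:
  assumes "finite Z" "f holomorphic_on UNIV" "\<exists>z. f z \<noteq> 0" "{z. f z = 0} \<subseteq> Z"
  shows "\<exists>p h. p \<noteq> 0 \<and> h holomorphic_on UNIV \<and> (\<forall>z. h z \<noteq> 0) \<and> (\<forall>z. f z = poly p z * h z)"
  using assms
proof (induction Z arbitrary: f rule: finite_induct)
  case empty
  thus ?case by (intro exI[of _ 1] exI[of _ f]) auto
next
  case (insert b Z)
  obtain k where k: "k holomorphic_on UNIV" "\<And>w. f w = (w - b) ^ zero_mult f b * k w" "k b \<noteq> 0"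
    using entire_factor_at[OF insert.prems(1,2), of b] by blast
  have "{z. k z = 0} \<subseteq> Z"
  proof
    fix z assume "z \<in> {z. k z = 0}"
    hence "k z = 0" by simp
    moreover from this have "f z = 0" using k(2)[of z] by simp
    ultimately show "z \<in> Z" using insert.prems(3) k(3) by auto
  qed
  then obtain p h where ph: "p \<noteq> 0" "h holomorphic_on UNIV" "\<And>z. h z \<noteq> 0" "\<And>z. k z = poly p z * h z"
    using insert.IH[OF k(1)] k(3) by blast
  show ?case
  proof (intro exI[of _ "[:- b, 1:] ^ zero_mult f b * p"] exI[of _ h] conjI allI ph)
    show "[:- b, 1:] ^ zero_mult f b * p \<noteq> 0" using ph(1) by simp
    show "f z = poly ([:- b, 1:] ^ zero_mult f b * p) z * h z" for z
      using k(2)[of z] ph(4)[of z] by (simp add: mult.assoc poly_power)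
  qed
qed

text \<open>With more than C zeros inside a fixed disc, the counting function would outgrow C log r
  on all large radii, so growth on a sequence is enough to bound their number.\<close>

lemma finite_zeros_of_log_growth:
  assumes f: "f holomorphic_on UNIV" "\<exists>z. f z \<noteq> 0"
    and growth: "\<And>r0. \<exists>r\<ge>r0. int_count (zero_mult f) r \<le> C * ln r + K"
  shows "finite {z. f z = 0}"
proof (rule ccontr)
  assume inf: "infinite {z. f z = 0}"
  obtain N :: nat where N: "real N \<ge> C + 1" using real_arch_simple by blast
  obtain W where W: "W \<subseteq> {z. f z = 0}" "finite W" "card W = N"
    using infinite_arbitrarily_large[OF inf] by blast
  define R where "R = 1 + (\<Sum>w\<in>W. norm w)"
  have R: "R \<ge> 1" unfolding R_def by (simp add: sum_nonneg)
  have WR: "W \<subseteq> zeros_in f R"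
  proof
    fix w assume w: "w \<in> W"
    have "norm w \<le> (\<Sum>w\<in>W. norm w)" by (rule member_le_sum[OF w _ W(2)]) simp
    thus "w \<in> zeros_in f R" using w W(1) unfolding zeros_in_def R_def by auto
  qed
  have "real N = (\<Sum>w\<in>W. 1)" using W(3) by simp
  also have "\<dots> \<le> (\<Sum>w\<in>W. real (zero_mult f w))"
  proof (rule sum_mono)
    fix w assume "w \<in> W"
    hence "zero_mult f w > 0" using W(1) zero_mult_pos_iff[OF f, of w] by auto
    thus "1 \<le> real (zero_mult f w)" by linarith
  qed
  also have "\<dots> \<le> zeros_number f R" unfolding zeros_number_def
    by (rule sum_mono2[OF finite_zeros_in[OF f] WR]) simp
  finally have NR: "real N \<le> zeros_number f R" .
  define L where "L = \<bar>K\<bar> + real N * ln R + 1"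
  obtain r where r: "r \<ge> max (R + 1) (exp L)" "int_count (zero_mult f) r \<le> C * ln r + K" using growth by blast
  have r1: "R < r" "r > 0" "exp L \<le> r" using r R by auto
  have lnr: "ln r \<ge> L" using r1 by (simp add: ln_ge_iff)
  have "real N * ln (r / R) \<le> zeros_number f R * ln (r / R)"
    by (rule mult_right_mono[OF NR]) (use r1 R in simp)
  also have "\<dots> \<le> int_count (zero_mult f) r" by (rule zeros_number_le[OF f R r1(1)])
  finally have "real N * ln r - real N * ln R \<le> C * ln r + K"
    using r r1 R by (simp add: ln_div right_diff_distrib)
  moreover have "(C + 1) * ln r \<le> real N * ln r"
  proof (rule mult_right_mono[OF N])
    have "L \<ge> 0" unfolding L_def using R by simp
    thus "0 \<le> ln r" using lnr by simp
  qed
  ultimately show False using lnr unfolding L_def by (simp add: algebra_simps)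
qed

lemma ord_ge_deriv:
  assumes "ord_ge f z m"
  shows "ord_ge (deriv f) z (m - 1)"
proof -
  obtain e where e: "e holomorphic_on UNIV" "\<And>w. f w = (w - z) ^ m * e w" using assms unfolding ord_ge_def by blast
  have de: "(e has_field_derivative deriv e w) (at w)" for w using holomorphic_derivI[OF e(1) open_UNIV] by simp
  have f: "f = (\<lambda>w. (w - z) ^ m * e w)" using e(2) by blast
  \<comment> \<open>For m = 0 the exponent m - 1 is 0, not -1, so the factor w - z of the second
    term is replaced by 1.\<close>
  have "deriv f w = (w - z) ^ (m - 1) * (of_nat m * e w + (if m = 0 then 1 else w - z) * deriv e w)" for w
  proof -
    have "(f has_field_derivative (of_nat m * (w - z) ^ (m - 1) * e w + deriv e w * (w - z) ^ m)) (at w)"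
      unfolding f by (rule derivative_eq_intros de refl | simp)+
    hence "deriv f w = of_nat m * (w - z) ^ (m - 1) * e w + deriv e w * (w - z) ^ m" by (rule DERIV_imp_deriv)
    thus ?thesis by (cases m) (simp_all add: algebra_simps)
  qed
  moreover have "(\<lambda>w. of_nat m * e w + (if m = 0 then 1 else w - z) * deriv e w) holomorphic_on UNIV"
    by (cases "m = 0") (auto intro!: holomorphic_intros e holomorphic_deriv)
  ultimately show ?thesis unfolding ord_ge_def by blast
qed

lemma ord_ge_higher_deriv: "ord_ge f z m \<Longrightarrow> ord_ge ((deriv ^^ k) f) z (m - k)"
proof (induction k)
  case (Suc k)
  from ord_ge_deriv[OF Suc.IH[OF Suc.prems]] show ?case by simp
qed simp

section \<open>Derivatives of polynomials and bounded quotients near infinity\<close>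

lemma higher_deriv_poly: "(deriv ^^ k) (poly p) = poly ((pderiv ^^ k) (p :: complex poly))"
proof (induction k)
  case (Suc k)
  have "deriv (poly r) = poly (pderiv r)" for r :: "complex poly"
    by (rule ext) (rule DERIV_imp_deriv[OF poly_DERIV])
  thus ?case using Suc by simp
qed simp

lemma pderiv_sum: "pderiv (\<Sum>i\<in>I. p i) = (\<Sum>i\<in>I. pderiv (p i :: complex poly))"
  by (induction I rule: infinite_finite_induct) (auto simp: pderiv_add)

lemma higher_pderiv_sum_smult:
  fixes p :: "'i \<Rightarrow> complex poly"
  shows "(pderiv ^^ k) (\<Sum>i\<in>I. Polynomial.smult (x i) (p i)) = (\<Sum>i\<in>I. Polynomial.smult (x i) ((pderiv ^^ k) (p i)))"
  by (induction k) (simp_all add: pderiv_sum pderiv_smult)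

lemma degree_higher_pderiv_le: "degree ((pderiv ^^ k) p) \<le> degree (p :: complex poly)"
  by (induction k) (auto simp: degree_pderiv)

lemma poly_quotient_bounded:
  fixes p s :: "complex poly"
  assumes "p \<noteq> 0" "degree s \<le> degree p"
  shows "\<exists>B r0. \<forall>z. norm z \<ge> r0 \<longrightarrow> norm (poly s z / poly p z) \<le> B"
proof -
  have "((\<lambda>z. poly s z / z ^ degree s) \<longlongrightarrow> lead_coeff s) at_infinity" by (rule poly_divide_tendsto_aux)
  hence "((\<lambda>z. norm (poly s z / z ^ degree s)) \<longlongrightarrow> norm (lead_coeff s)) at_infinity" by (rule tendsto_norm)
  hence 1: "eventually (\<lambda>z. norm (poly s z / z ^ degree s) < norm (lead_coeff s) + 1) at_infinity"
    by (rule order_tendstoD) simp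
  have "((\<lambda>z. poly p z / z ^ degree p) \<longlongrightarrow> lead_coeff p) at_infinity" by (rule poly_divide_tendsto_aux)
  hence "((\<lambda>z. norm (poly p z / z ^ degree p)) \<longlongrightarrow> norm (lead_coeff p)) at_infinity" by (rule tendsto_norm)
  hence 2: "eventually (\<lambda>z. norm (poly p z / z ^ degree p) > norm (lead_coeff p) / 2) at_infinity"
    by (rule order_tendstoD) (use assms(1) in simp)
  obtain r0 where r0: "\<And>z. norm z \<ge> r0 \<Longrightarrow> norm (poly s z / z ^ degree s) < norm (lead_coeff s) + 1 \<and>
     norm (poly p z / z ^ degree p) > norm (lead_coeff p) / 2"
    using eventually_conj[OF 1 2] unfolding eventually_at_infinity by blast
  define B where "B = (norm (lead_coeff s) + 1) / (norm (lead_coeff p) / 2)"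
  have "norm (poly s z / poly p z) \<le> B" if z: "norm z \<ge> max r0 1" for z
  proof -
    have z1: "norm z \<ge> 1" "z \<noteq> 0" using z by auto
    have lp: "norm (lead_coeff p) / 2 > 0" using assms(1) by simp
    have zd: "norm z ^ degree s \<le> norm z ^ degree p" by (rule power_increasing[OF assms(2) z1(1)])
    have zp: "norm z ^ degree p > 0" using z1 by simp
    have "norm (poly s z) \<le> (norm (lead_coeff s) + 1) * norm z ^ degree s"
      using r0[of z] z z1 by (simp add: norm_divide norm_power field_simps)
    also have "\<dots> \<le> (norm (lead_coeff s) + 1) * norm z ^ degree p" by (intro mult_left_mono zd) simp
    finally have s: "norm (poly s z) \<le> (norm (lead_coeff s) + 1) * norm z ^ degree p" .
    have p: "norm (lead_coeff p) / 2 * norm z ^ degree p \<le> norm (poly p z)"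
      using r0[of z] z z1 by (simp add: norm_divide norm_power field_simps)
    have "norm (poly s z) / norm (poly p z) \<le> ((norm (lead_coeff s) + 1) * norm z ^ degree p) / (norm (lead_coeff p) / 2 * norm z ^ degree p)"
      by (rule frac_le[OF _ s _ p]) (use lp zp in \<open>auto intro!: mult_pos_pos\<close>)
    also have "\<dots> = B" unfolding B_def using zp z1 by simp
    finally show ?thesis by (simp add: norm_divide)
  qed
  thus ?thesis by blast
qed

section \<open>Characteristic functions of logarithmic growth\<close>

context paired_curve
begin

lemma f_critical:
  assumes "norm w \<notin> critical" "j \<le> q"
  shows "f j w \<noteq> 0"
proof
  assume "f j w = 0"
  hence "w \<in> {z. f j (z + of_nat 0 * c) = 0}" by simp
  hence "norm w \<in> norm ` {z. f j (z + of_nat 0 * c) = 0}" by (rule imageI)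
  moreover have "0 \<in> {..n}" "j \<in> {..q}" using assms(2) by auto
  ultimately have "norm w \<in> (\<Union>k\<in>{..n}. \<Union>j\<in>{..q}. norm ` {z. f j (z + of_nat k * c) = 0})"
    by (intro UN_I)
  hence "norm w \<in> critical" unfolding critical_def by blast
  thus False using assms(1) by contradiction
qed

text \<open>g_0 has finitely many zeros, so g_0 = p0 h with h zero-free. The quotients s_i = g_i / h
  have proximity functions at most T + O(1): log |h| has constant means, and log |g_0| \<le> U with
  |p0| bounded below near infinity controls the positive part. Growth O(log r) on a sequence then
  makes the s_i polynomials and the coefficients constant.\<close>

lemma poly_bound:
  assumes freq: "\<And>r0. \<exists>r\<ge>r0. r \<notin> critical \<and> T r \<le> C * ln r" and C: "C > 0"
  shows main_bound
proof -
  have h0: "g 0 holomorphic_on UNIV" and n0: "\<exists>z. g 0 z \<noteq> 0" by (rule holo g_nz; simp)+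
  have m0: "majorized (\<lambda>_. 0) (g 0)" using majorized_component[of 0 "\<lambda>_. 0"] n0 by simp
  obtain K0 where K0: "\<And>R. R > 0 \<Longrightarrow> (\<And>w. norm w = R \<Longrightarrow> g 0 w \<noteq> 0) \<Longrightarrow> int_count (zero_mult (g 0)) R \<le> T R + circle_mean (\<lambda>_. 0) R + K0"
    using int_count_majorized[OF continuous_on_const m0] by blast
  have count_le: "int_count (zero_mult (g 0)) r \<le> T r + K0" if "r \<ge> 1" "r \<notin> critical" for r
    using K0[of r] g_critical[of _ 0] that by auto
  have "finite {z. g 0 z = 0}"
  proof (rule finite_zeros_of_log_growth[OF h0 n0])
    fix r0
    obtain r where r: "r \<ge> max r0 1" "r \<notin> critical" "T r \<le> C * ln r" using freq by blast
    thus "\<exists>r\<ge>r0. int_count (zero_mult (g 0)) r \<le> C * ln r + K0" using count_le[of r] by (intro exI[of _ r]) auto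
  qed
  from entire_finite_zeros[OF this h0 n0 order_refl] obtain p0 h where
    p0: "p0 \<noteq> 0" "h holomorphic_on UNIV" "\<forall>z. h z \<noteq> 0" "\<forall>z. g 0 z = poly p0 z * h z" by blast
  have h: "h holomorphic_on UNIV" "\<And>z. h z \<noteq> 0" and hn: "\<exists>z. h z \<noteq> 0" using p0 by auto
  \<comment> \<open>Jensen's formula for a zero-free function.\<close>
  obtain Kh where Kh: "\<And>R. R > 0 \<Longrightarrow> circle_mean (\<lambda>z. ln (norm (h z))) R = Kh"
  proof (rule jensen[OF h(1) hn])
    fix K assume K: "\<And>R. R > 0 \<Longrightarrow> (\<And>w. norm w = R \<Longrightarrow> h w \<noteq> 0) \<Longrightarrow> circle_mean (\<lambda>w. ln (norm (h w))) R = K + int_count (zero_mult h) R"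
    have "zero_mult h = (\<lambda>_. 0)" unfolding zero_mult_def using h(2) by auto
    hence "int_count (zero_mult h) R = 0" for R unfolding int_count_def unint_count_def by simp
    thus thesis using that[of K] K h(2) by simp
  qed
  have ch: "continuous_on S (\<lambda>z. ln (norm (h z)))" for S by (rule continuous_on_ln_norm[OF h(1)]) (rule h(2))
  define s where "s i z = g i z / h z" for i z
  have s_holo: "s i holomorphic_on UNIV" if "i \<le> n" for i
    unfolding s_def[abs_def] by (intro holomorphic_on_divide holo that h)
  have gs: "g i z = h z * s i z" for i z unfolding s_def using h(2) by simp
  have s_nz: "\<exists>z. s i z \<noteq> 0" if "i \<le> n" for i using g_nz[OF that] h(2) unfolding s_def by auto
  have "\<exists>B r0. \<forall>z. norm z \<ge> r0 \<longrightarrow> norm (poly 1 z / poly p0 z) \<le> B"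
    by (rule poly_quotient_bounded[OF p0(1)]) simp
  then obtain B0 \<rho>0 where B0: "\<And>z. norm z \<ge> \<rho>0 \<Longrightarrow> norm (poly 1 z / poly p0 z) \<le> B0" by blast
  define B1 where "B1 = max B0 1"
  define K1 where "K1 = U 0 - Kh + ln B1"
  have B1: "ln B1 \<ge> 0" unfolding B1_def by simp
  have mean_s: "circle_mean (\<lambda>z. ln_plus (norm (s i z))) r \<le> T r + K1"
    if r: "r \<ge> 1" "r \<ge> \<rho>0" "r \<notin> critical" and i: "i \<le> n" for r i
  proof -
    have r0: "r \<ge> 0" "r > 0" using r by auto
    have "circle_mean (\<lambda>z. ln_plus (norm (s i z))) r \<le> circle_mean (\<lambda>z. (U z - ln (norm (h z))) + ln B1) r"
    proof (rule circle_mean_mono[OF r0(1)])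
      show "continuous_on (sphere 0 r) (\<lambda>z. ln_plus (norm (s i z)))"
        by (intro continuous_on_ln_plus continuous_on_norm holomorphic_on_imp_continuous_on holomorphic_on_subset[OF s_holo[OF i]]) auto
      show "continuous_on (sphere 0 r) (\<lambda>z. (U z - ln (norm (h z))) + ln B1)"
        by (intro continuous_on_add continuous_on_diff continuous_on_U ch continuous_on_const)
      fix z :: complex assume z: "norm z = r"
      have zc: "norm z \<notin> critical" using z r(3) by simp
      have g: "g i z \<noteq> 0" "g 0 z \<noteq> 0" using g_critical[OF zc] i by auto
      have pz: "poly p0 z \<noteq> 0" using g(2) p0(4) by auto
      have "norm (1 / poly p0 z) \<le> B1" using B0[of z] z r unfolding B1_def by simp
      hence "ln (norm (1 / poly p0 z)) \<le> ln B1" using pz by (intro ln_mono) auto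
      hence "- ln (norm (poly p0 z)) \<le> ln B1" using pz by (simp add: norm_divide ln_div)
      moreover have "ln (norm (g 0 z)) = ln (norm (poly p0 z)) + ln (norm (h z))"
        using p0(4) pz h(2)[of z] by (simp add: norm_mult ln_mult_pos)
      moreover have "ln (norm (g 0 z)) \<le> U z" "ln (norm (g i z)) \<le> U z" using ln_norm_le g i by auto
      moreover have "ln (norm (s i z)) = ln (norm (g i z)) - ln (norm (h z))"
        unfolding s_def using g h(2)[of z] by (simp add: norm_divide ln_div)
      moreover have "ln_plus (norm (s i z)) = 0 \<or> ln_plus (norm (s i z)) = ln (norm (s i z))"
        unfolding ln_plus_def by (auto simp: max_def)
      ultimately show "ln_plus (norm (s i z)) \<le> (U z - ln (norm (h z))) + ln B1" using B1 by linarith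
    qed
    also have "\<dots> = circle_mean (\<lambda>z. U z - ln (norm (h z))) r + ln B1"
      by (subst circle_mean_add[OF r0(1) continuous_on_diff[OF continuous_on_U ch] continuous_on_const]) simp
    also have "circle_mean (\<lambda>z. U z - ln (norm (h z))) r = (T r + U 0) - Kh"
      by (subst circle_mean_diff[OF r0(1) continuous_on_U ch]) (simp add: circle_mean_U Kh[OF r0(2)])
    finally show ?thesis unfolding K1_def by simp
  qed
  have freq': "\<exists>r\<ge>r0. r \<ge> 1 \<and> r \<notin> critical \<and> T r \<le> C * ln r \<and> K \<le> ln r" for r0 K
  proof -
    obtain r where r: "r \<ge> max (max r0 1) (exp K)" "r \<notin> critical" "T r \<le> C * ln r" using freq by blast
    have "r > 0" "exp K \<le> r" using r(1) by auto
    hence "K \<le> ln r" by (simp add: ln_ge_iff)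
    thus ?thesis using r by (intro exI[of _ r]) auto
  qed
  obtain N :: nat where N: "3 * (C + 1) < real N" using reals_Archimedean2 by blast
  have "\<exists>p. s i = poly p" if i: "i \<le> n" for i
  proof (rule exI, rule entire_eq_poly[OF s_holo[OF i]])
    fix k assume k: "k \<ge> N"
    show "(deriv ^^ k) (s i) 0 = 0"
    proof (rule higher_deriv_zero_of_log_growth[OF s_holo[OF i] s_nz[OF i]])
      show "3 * (C + 1) < real k" using N k by simp
      fix r0
      obtain r where r: "r \<ge> max r0 \<rho>0" "r \<ge> 1" "r \<notin> critical" "T r \<le> C * ln r" "K1 \<le> ln r" using freq' by blast
      have "\<forall>w. norm w = r \<longrightarrow> s i w \<noteq> 0" unfolding s_def using g_critical[OF _ i] h(2) r(3) by auto
      moreover have "circle_mean (\<lambda>z. ln_plus (norm (s i z))) r \<le> (C + 1) * ln r"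
        using mean_s[of r, OF _ _ _ i] r by (simp add: distrib_right)
      ultimately show "\<exists>r\<ge>r0. (\<forall>w. norm w = r \<longrightarrow> s i w \<noteq> 0) \<and> circle_mean (\<lambda>z. ln_plus (norm (s i z))) r \<le> (C + 1) * ln r"
        using r(1) by (intro exI[of _ r]) auto
    qed
  qed
  hence "\<exists>p. \<forall>i\<in>{..n}. s i = poly (p i)" by (intro bchoice) auto
  then obtain p where p: "\<And>i. i \<le> n \<Longrightarrow> s i = poly (p i)" by auto
  define \<alpha> where "\<alpha> i j = a i j 0" for i j
  have a_const: "a i j z = \<alpha> i j" if ij: "i \<le> n" "j \<le> q" for i j z
  proof (cases "\<exists>w. a i j w \<noteq> 0")
    case False
    thus ?thesis unfolding \<alpha>_def by simp
  next
    case True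
    \<comment> \<open>Since |T| \<le> (C + 1) log r on the chosen radii, the coefficient gets a
      growth constant 1/6, and 3 * (1/6) < 1 annihilates every derivative of order at least
      1.\<close>
    define \<epsilon> where "\<epsilon> = 1 / (6 * (C + 1))"
    have \<epsilon>: "\<epsilon> > 0" unfolding \<epsilon>_def using C by simp
    obtain r1 where r1: "\<And>r. r \<ge> r1 \<Longrightarrow> circle_mean A r \<le> \<epsilon> * \<bar>T r\<bar>"
      using mean_A_small[OF \<epsilon>] unfolding eventually_at_top_linorder by blast
    have "a i j = poly (\<Sum>k<1. monom ((deriv ^^ k) (a i j) 0 / fact k) k)"
    proof (rule entire_eq_poly[OF a_holo[OF ij]])
      fix k :: nat assume k: "k \<ge> 1"
      show "(deriv ^^ k) (a i j) 0 = 0"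
      proof (rule higher_deriv_zero_of_log_growth[OF a_holo[OF ij] True])
        show "3 * (1/6) < real k" using k by simp
        fix r0
        obtain r where r: "r \<ge> max r0 r1" "r \<ge> 1" "r \<notin> critical" "T r \<le> C * ln r" "2 * \<bar>K0\<bar> \<le> ln r" using freq' by blast
        have r0': "r \<ge> 0" using r by simp
        have "\<forall>w. norm w = r \<longrightarrow> a i j w \<noteq> 0" using a_critical[OF _ ij True] r(3) by auto
        moreover have "circle_mean (\<lambda>z. ln_plus (norm (a i j z))) r \<le> 1/6 * ln r"
        proof -
          have "circle_mean (\<lambda>z. ln_plus (norm (a i j z))) r \<le> circle_mean A r"
          proof (rule circle_mean_mono[OF r0' _ A_continuous])
            show "continuous_on (sphere 0 r) (\<lambda>z. ln_plus (norm (a i j z)))"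
              by (intro continuous_on_ln_plus continuous_on_norm holomorphic_on_imp_continuous_on holomorphic_on_subset[OF a_holo[OF ij]]) auto
            show "ln_plus (norm (a i j z)) \<le> A z" for z
              unfolding A_def using member_le_sum[of "(i,j)" "{..n} \<times> {..q}" "\<lambda>(i,j). ln_plus (norm (a i j z))"] ij by auto
          qed
          also have "\<dots> \<le> \<epsilon> * \<bar>T r\<bar>" by (rule r1) (use r in simp)
          also have "\<dots> \<le> \<epsilon> * ((C + 1) * ln r)"
          proof (rule mult_left_mono[OF _ less_imp_le[OF \<epsilon>]])
            have "int_count (zero_mult (g 0)) r \<ge> 0"
              by (rule int_count_nonneg) (use r finite_zeros_in[OF h0 n0, of r] zero_mult_support[OF h0 n0, of r] in auto)
            hence "- K0 \<le> T r" using count_le[OF r(2,3)] by simp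
            hence "\<bar>T r\<bar> \<le> T r + 2 * \<bar>K0\<bar>" by linarith
            also have "\<dots> \<le> (C + 1) * ln r" using r by (simp add: distrib_right)
            finally show "\<bar>T r\<bar> \<le> (C + 1) * ln r" .
          qed
          also have "\<dots> = 1/6 * ln r" unfolding \<epsilon>_def using C by (simp add: field_simps)
          finally show ?thesis .
        qed
        ultimately show "\<exists>r\<ge>r0. (\<forall>w. norm w = r \<longrightarrow> a i j w \<noteq> 0) \<and> circle_mean (\<lambda>z. ln_plus (norm (a i j z))) r \<le> 1/6 * ln r"
          using r(1) by (intro exI[of _ r]) auto
      qed
    qed
    hence "a i j z = poly (\<Sum>k<1. monom ((deriv ^^ k) (a i j) 0 / fact k) k) z" by metis
    thus ?thesis unfolding \<alpha>_def by (simp add: poly_monom)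
  qed
  have indep: "\<forall>i\<le>n. x i = 0" if x: "\<forall>z. (\<Sum>i\<le>n. x i * s i z) = 0" for x :: "nat \<Rightarrow> complex"
  proof -
    have "(\<Sum>i\<in>{..n}. x i * g i z) = 0" for z
    proof -
      have "(\<Sum>i\<in>{..n}. x i * g i z) = h z * (\<Sum>i\<le>n. x i * s i z)"
        unfolding gs sum_distrib_left by (simp add: algebra_simps)
      thus ?thesis using x by simp
    qed
    hence 1: "\<forall>\<^sub>\<approx>z\<in>UNIV. (\<Sum>i\<in>{..n}. (\<lambda>_. x i) z * g i z) = 0" by simp
    have 2: "\<forall>i\<in>{..n}. (\<lambda>_. x i) \<in> periodic_field c" using const_in_periodic_field by blast
    have "\<forall>i\<in>{..n}. (\<lambda>_::complex. x i) = (\<lambda>_. 0)"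
      using g_indep[unfolded lin_indep_over_periodic_def, THEN spec, of "\<lambda>i _. x i"] 1 2 by blast
    thus ?thesis by (metis atMost_iff)
  qed
  define F where "F j = (\<Sum>i\<le>n. Polynomial.smult (\<alpha> i j) (p i))" for j
  \<comment> \<open>The polynomials s_i are differentiated rather than the g_i. The factor h then
    cancels in every quotient by f_j = h F_j.\<close>
  define L where "L k i z = h z * (deriv ^^ k) (s i) z" for k i z
  have M_eq: "(\<Sum>i\<le>n. a i j z * L k i z) = h z * poly ((pderiv ^^ k) (F j)) z" if j: "j \<le> q" for j k z
  proof -
    have "(\<Sum>i\<le>n. a i j z * L k i z) = (\<Sum>i\<le>n. h z * (\<alpha> i j * poly ((pderiv ^^ k) (p i)) z))"
      by (rule sum.cong) (use j in \<open>simp_all add: a_const L_def p higher_deriv_poly\<close>)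
    thus ?thesis unfolding F_def higher_pderiv_sum_smult poly_sum by (simp add: sum_distrib_left)
  qed
  have f_F: "f j z = h z * poly (F j) z" if j: "j \<le> q" for j z
    using M_eq[OF j, of z 0] unfolding f_eq[OF j] L_def by (simp add: gs)
  have F_nz: "\<exists>z. poly (F j) z \<noteq> 0" if j: "j \<le> q" for j using f_nz[OF j] f_F[OF j] by auto
  have F0: "F j \<noteq> 0" if "j \<le> q" for j using F_nz[OF that] by auto
  have poly_holo: "poly r holomorphic_on UNIV" for r :: "complex poly" by (intro holomorphic_intros)
  interpret O: operator_curve n g q a f L "{}"
  proof
    obtain z where z: "fdet (Suc n) (\<lambda>l i. (deriv ^^ l) (s i) z) \<noteq> 0"
      using wronski_nonzero[of n s, OF s_holo indep] by blast
    have "fdet (Suc n) (\<lambda>i k. L k i z) \<noteq> 0"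
    proof
      assume "fdet (Suc n) (\<lambda>i k. L k i z) = 0"
      then obtain x where x: "\<exists>i<Suc n. x i \<noteq> 0" "\<forall>i<Suc n. (\<Sum>k<Suc n. L k i z * x k) = 0" unfolding fdet_0_iff by blast
      have "(\<Sum>k<Suc n. (deriv ^^ k) (s i) z * x k) = 0" if "i < Suc n" for i
      proof -
        have "(\<Sum>k<Suc n. L k i z * x k) = h z * (\<Sum>k<Suc n. (deriv ^^ k) (s i) z * x k)"
          unfolding L_def sum_distrib_left by (simp add: mult.assoc)
        thus ?thesis using x(2)[rule_format, OF that] h(2)[of z] by simp
      qed
      with x(1) have "fdet (Suc n) (\<lambda>i k. (deriv ^^ k) (s i) z) = 0" unfolding fdet_0_iff by blast
      thus False using z fdet_transpose[of "Suc n" "\<lambda>l i. (deriv ^^ l) (s i) z"] by simp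
    qed
    thus "\<exists>z. fdet (Suc n) (\<lambda>i k. L k i z) \<noteq> 0" by (rule exI)
    fix z k j assume kj: "k \<le> n" "j \<le> q"
    have "zero_mult (f j) z = zero_mult (\<lambda>z. h z * poly (F j) z) z" using f_F[OF kj(2)] by presburger
    also have "\<dots> = zero_mult h z + zero_mult (poly (F j)) z" by (rule zero_mult_mult[OF h(1) hn poly_holo F_nz[OF kj(2)]])
    also have "zero_mult h z = 0" unfolding zero_mult_def using h(2) by simp
    finally have "ord_ge (poly (F j)) z (zero_mult (f j) z)"
      by (subst ord_ge_zero_mult[OF poly_holo F_nz[OF kj(2)]]) simp
    hence "ord_ge (poly ((pderiv ^^ k) (F j))) z (zero_mult (f j) z - k)"
      unfolding higher_deriv_poly[symmetric] by (rule ord_ge_higher_deriv)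
    hence "ord_ge (poly ((pderiv ^^ k) (F j))) z (zero_mult (f j) z - n)" by (rule ord_ge_mono) (use kj in simp)
    from ord_ge_mult[OF ord_ge_0[OF h(1)] this]
    show "ord_ge (\<lambda>w. \<Sum>i\<le>n. a i j w * L k i w) z (zero_mult (f j) z - n)" unfolding M_eq[OF kj(2)] by simp
  next
    fix k i assume "i \<le> n"
    thus "L k i holomorphic_on UNIV" unfolding L_def[abs_def]
      by (intro holomorphic_on_mult h holomorphic_higher_deriv s_holo open_UNIV)
  qed (use q a_holo f_eq f_nz detA_nz in auto)
  \<comment> \<open>As n \<ge> 1, two constant components would be linearly dependent over the
    constants, which lie in \<open>periodic_field c\<close>. A nonconstant component forces T(r)
    \<ge> log r - O(1), so that bounded errors are negligible.\<close>
  have "\<exists>i\<le>n. degree (p i) \<ge> 1"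
  proof (rule ccontr)
    assume "\<not> ?thesis"
    hence "degree (p 0) = 0" "degree (p 1) = 0" using n1 by (auto simp: not_less_eq_eq)
    then obtain x0 x1 where x: "p 0 = [:x0:]" "p 1 = [:x1:]" by (metis degree_eq_zeroE)
    define x where "x i = (if i = 0 then x1 else if i = (1::nat) then - x0 else 0)" for i
    have "(\<Sum>i\<le>n. x i * s i z) = 0" for z
    proof -
      have "(\<Sum>i\<le>n. x i * s i z) = (\<Sum>i\<in>{0,1}. x i * s i z)"
        by (rule sum.mono_neutral_right) (use n1 in \<open>auto simp: x_def\<close>)
      also have "\<dots> = 0" using p[of 0] p[of 1] n1 x by (simp add: x_def)
      finally show ?thesis .
    qed
    hence "\<forall>i\<le>n. x i = 0" by (intro indep) simp
    hence "x 0 = 0" by simp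
    hence "x1 = 0" unfolding x_def by simp
    hence "s 1 z = 0" for z using p[of 1] n1 x by simp
    thus False using s_nz[OF n1] by simp
  qed
  then obtain i0 where i0: "i0 \<le> n" "degree (p i0) \<ge> 1" by blast
  have "\<exists>B r0. \<forall>z. norm z \<ge> r0 \<longrightarrow> norm (poly [:0, 1:] z / poly (p i0) z) \<le> B"
    by (rule poly_quotient_bounded) (use i0 in auto)
  then obtain B2 \<rho>2 where B2: "\<And>z. norm z \<ge> \<rho>2 \<Longrightarrow> norm (poly [:0, 1:] z / poly (p i0) z) \<le> B2" by blast
  define B3 where "B3 = max B2 1"
  have T_ge: "ln r - ln B3 + Kh - U 0 \<le> T r" if r: "r \<ge> 1" "r \<ge> \<rho>2" "r \<notin> critical" for r
  proof -
    have r0: "r \<ge> 0" "r > 0" using r by auto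
    have "ln r - ln B3 + Kh = circle_mean (\<lambda>z. (ln r - ln B3) + ln (norm (h z))) r"
      by (subst circle_mean_add[OF r0(1) continuous_on_const ch]) (simp add: Kh[OF r0(2)])
    also have "\<dots> \<le> circle_mean U r"
    proof (rule circle_mean_mono[OF r0(1) continuous_on_add[OF continuous_on_const ch] continuous_on_U])
      fix z :: complex assume z: "norm z = r"
      have g: "g i0 z \<noteq> 0" using g_critical[of z i0] i0 z r(3) by auto
      have pz: "poly (p i0) z \<noteq> 0" using g gs[of i0 z] p[OF i0(1)] by auto
      have "norm (z / poly (p i0) z) \<le> B3" using B2[of z] z r unfolding B3_def by simp
      hence "ln (norm (z / poly (p i0) z)) \<le> ln B3" using pz z r0 by (intro ln_mono) auto
      hence "ln r - ln (norm (poly (p i0) z)) \<le> ln B3" using pz z r0 by (simp add: norm_divide ln_div)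
      moreover have "ln (norm (g i0 z)) = ln (norm (h z)) + ln (norm (poly (p i0) z))"
        unfolding gs[of i0 z] p[OF i0(1)] using pz h(2)[of z] by (simp add: norm_mult ln_mult_pos)
      moreover have "ln (norm (g i0 z)) \<le> U z" by (rule ln_norm_le[OF i0(1) g])
      ultimately show "(ln r - ln B3) + ln (norm (h z)) \<le> U z" by linarith
    qed
    finally show ?thesis by (simp add: circle_mean_U)
  qed
  have "\<forall>x\<in>{..n} \<times> {..q}. \<exists>y. \<forall>z. norm z \<ge> snd y \<longrightarrow> norm (poly ((pderiv ^^ (fst x)) (F (snd x))) z / poly (F (snd x)) z) \<le> fst y"
  proof
    fix x assume "x \<in> {..n} \<times> {..q}"
    then obtain B r0 where "\<forall>z. norm z \<ge> r0 \<longrightarrow> norm (poly ((pderiv ^^ (fst x)) (F (snd x))) z / poly (F (snd x)) z) \<le> B"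
      using poly_quotient_bounded[OF F0 degree_higher_pderiv_le, of "snd x" "fst x"] by auto
    thus "\<exists>y. \<forall>z. norm z \<ge> snd y \<longrightarrow> norm (poly ((pderiv ^^ (fst x)) (F (snd x))) z / poly (F (snd x)) z) \<le> fst y"
      by (intro exI[of _ "(B, r0)"]) simp
  qed
  from bchoice[OF this] obtain Y where Y: "\<And>x z. x \<in> {..n} \<times> {..q} \<Longrightarrow> norm z \<ge> snd (Y x) \<Longrightarrow>
    norm (poly ((pderiv ^^ (fst x)) (F (snd x))) z / poly (F (snd x)) z) \<le> fst (Y x)" by blast
  define \<rho> where "\<rho> = (\<Sum>x\<in>{..n} \<times> {..q}. \<bar>snd (Y x)\<bar>)"
  obtain K where K: "K \<ge> 0" "\<And>r \<omega>. O.admissible r \<Longrightarrow>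
    (\<And>k. k \<le> n \<Longrightarrow> continuous_on (sphere 0 r) (\<omega> k)) \<Longrightarrow> (\<And>k z. k \<le> n \<Longrightarrow> norm z = r \<Longrightarrow> \<omega> k z > (0::real)) \<Longrightarrow>
    real (q - n) * T r \<le> (\<Sum>j\<le>q. trunc_count_zeros n (f j) r) - (\<Sum>k\<le>n. circle_mean (\<lambda>z. ln (\<omega> k z)) r)
     + (\<Sum>(k,j)\<in>{..n} \<times> {..q}. circle_mean (\<lambda>z. ln_plus (norm (O.M k j z) * \<omega> k z / norm (f j z))) r)
     + K * (1 + circle_mean O.A r) + K * (if ({}::complex set) = {} then 0 else ln r)"
    by (rule O.second_main_inequality) blast
  define Q where "Q = (\<Sum>x\<in>{..n} \<times> {..q}. ln_plus (fst (Y x))) + K * (1 + A 0)"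
  have OA: "O.A = (\<lambda>z. A 0)" unfolding O.A_def[abs_def] A_def
    by (intro ext sum.cong) (auto simp: a_const)
  have bound: "real (q - n) * T r \<le> (\<Sum>j\<le>q. trunc_count_zeros n (f j) r) + Q" if r: "O.admissible r" "r \<ge> \<rho>" for r
  proof -
    have r0: "r \<ge> 0" using r(1) unfolding O.admissible_def by simp
    have nz: "f j z \<noteq> 0" if "norm z = r" "j \<le> q" for j z using r(1) that unfolding O.admissible_def by blast
    have "(\<Sum>(k,j)\<in>{..n} \<times> {..q}. circle_mean (\<lambda>z. ln_plus (norm (O.M k j z) * 1 / norm (f j z))) r) \<le> (\<Sum>x\<in>{..n} \<times> {..q}. ln_plus (fst (Y x)))"
      unfolding case_prod_beta
    proof (rule sum_mono)
      fix x assume x: "x \<in> {..n} \<times> {..q}"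
      hence x': "fst x \<le> n" "snd x \<le> q" by auto
      have "circle_mean (\<lambda>z. ln_plus (norm (O.M (fst x) (snd x) z) * 1 / norm (f (snd x) z))) r \<le> circle_mean (\<lambda>_. ln_plus (fst (Y x))) r"
      proof (rule circle_mean_mono[OF r0 _ continuous_on_const])
        show "continuous_on (sphere 0 r) (\<lambda>z. ln_plus (norm (O.M (fst x) (snd x) z) * 1 / norm (f (snd x) z)))"
          by (intro continuous_on_ln_plus continuous_on_divide continuous_on_mult continuous_on_const continuous_on_norm
            holomorphic_on_imp_continuous_on holomorphic_on_subset[OF O.M_holo[OF x']] holomorphic_on_subset[OF f_holo[OF x'(2)]])
            (use nz x' in auto)
        fix z :: complex assume z: "norm z = r"
        have "\<bar>snd (Y x)\<bar> \<le> \<rho>" unfolding \<rho>_def by (rule member_le_sum[OF x]) auto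
        hence "norm (poly ((pderiv ^^ (fst x)) (F (snd x))) z / poly (F (snd x)) z) \<le> fst (Y x)"
          by (intro Y[OF x]) (use z r in linarith)
        moreover have "norm (O.M (fst x) (snd x) z) * 1 / norm (f (snd x) z) = norm (poly ((pderiv ^^ (fst x)) (F (snd x))) z / poly (F (snd x)) z)"
          unfolding O.M_def M_eq[OF x'(2)] f_F[OF x'(2)] using h(2)[of z] by (simp add: norm_mult norm_divide)
        ultimately show "ln_plus (norm (O.M (fst x) (snd x) z) * 1 / norm (f (snd x) z)) \<le> ln_plus (fst (Y x))"
          unfolding ln_plus_def by (intro ln_mono) auto
      qed
      thus "circle_mean (\<lambda>z. ln_plus (norm (O.M (fst x) (snd x) z) * 1 / norm (f (snd x) z))) r \<le> ln_plus (fst (Y x))" by simp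
    qed
    \<comment> \<open>Trivial weights suffice: the quotient of \<open>O.M k j\<close> by f_j is that
      of the k-th derivative of F_j by F_j, bounded near infinity. With E empty no logarithm
      enters.\<close>
    moreover have "real (q - n) * T r \<le> (\<Sum>j\<le>q. trunc_count_zeros n (f j) r) - (\<Sum>k\<le>n. circle_mean (\<lambda>z. ln 1) r)
      + (\<Sum>(k,j)\<in>{..n} \<times> {..q}. circle_mean (\<lambda>z. ln_plus (norm (O.M k j z) * 1 / norm (f j z))) r)
      + K * (1 + circle_mean O.A r) + K * (if ({}::complex set) = {} then 0 else ln r)"
      by (rule K(2)[OF r(1), of "\<lambda>_ _. 1"]) auto
    ultimately show ?thesis unfolding OA Q_def by simp
  qed
  show ?thesis unfolding main_bound_def
  proof (intro allI impI)
    fix \<epsilon> r0 :: real assume \<epsilon>: "\<epsilon> > 0"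
    \<comment> \<open>Here \<open>O.detL\<close> comes from the Wronskian, whereas
      \<open>critical\<close> deals with the zeros of the Casorati determinant; its zeros are
      therefore added.\<close>
    define X where "X = critical \<union> norm ` {z. O.detL z = 0}"
    have "countable X" unfolding X_def
      by (intro countable_Un countable_critical countable_image countable_zeros O.detL_holo O.detL_nonzero)
    define t where "t = \<bar>Q\<bar> / \<epsilon> + 1 + ln B3 - Kh + U 0"
    define R where "R = \<bar>r0\<bar> + \<bar>\<rho>\<bar> + \<bar>\<rho>2\<bar> + 1 + exp t"
    obtain r where r: "R < r" "r < R + 1" "r \<notin> X" using ex_not_countable[OF \<open>countable X\<close>, of R "R + 1"] by auto
    have rr: "r \<ge> r0" "r \<ge> \<rho>" "r \<ge> \<rho>2" "r \<ge> 1" "exp t \<le> r" "r > 0"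
      using r(1) exp_gt_zero[of t] unfolding R_def by linarith+
    have rC: "r \<notin> critical" using r(3) unfolding X_def by simp
    have adm: "O.admissible r" unfolding O.admissible_def
    proof (intro conjI rr(4) allI impI ballI)
      fix w :: complex assume w: "norm w = r"
      have wc: "norm w \<notin> critical" using w rC by simp
      show "O.detL w \<noteq> 0" using w r(3) unfolding X_def by auto
      show "f j w \<noteq> 0" if "j \<le> q" for j by (rule f_critical[OF wc that])
      fix J assume "J \<in> O.JJ"
      hence "J \<in> JS" unfolding O.JJ_def JS_def .
      thus "O.detA J w \<noteq> 0" unfolding O.detA_def by (rule detA_critical[OF wc])
    qed
    have "t \<le> ln r" using rr by (simp add: ln_ge_iff)
    hence Tr: "\<bar>Q\<bar> / \<epsilon> + 1 \<le> T r" using T_ge[OF rr(4,3) rC] unfolding t_def by linarith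
    have "\<bar>Q\<bar> / \<epsilon> \<ge> 0" using \<epsilon> by simp
    hence pos: "T r > 0" using Tr by linarith
    have "\<bar>Q\<bar> / \<epsilon> \<le> T r" using Tr by simp
    hence "\<bar>Q\<bar> \<le> \<epsilon> * T r" using \<epsilon> by (simp add: field_simps)
    hence "real (q - n) * T r \<le> (\<Sum>j\<le>q. trunc_count_zeros n (f j) r) + \<epsilon> * T r" using bound[OF adm rr(2)] by linarith
    thus "\<exists>r\<ge>r0. T r > 0 \<and> real (q - n) * T r \<le> (\<Sum>j\<le>q. trunc_count_zeros n (f j) r) + \<epsilon> * T r"
      using rr(1) pos by blast
  qed
qed

text \<open>Negating log r = o(T) off \<open>critical\<close> gives T \<le> C log r on a sequence of
  noncritical radii, which is precisely the hypothesis of \<open>poly_bound\<close>.\<close>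

lemma main_bound: main_bound
proof (cases "\<forall>\<epsilon>>0. eventually (\<lambda>r. r \<notin> critical \<longrightarrow> ln r \<le> \<epsilon> * T r) at_top")
  case True
  thus ?thesis by (intro shift_bound) blast
next
  case False
  then obtain \<epsilon> where \<epsilon>: "\<epsilon> > 0" "\<not> eventually (\<lambda>r. r \<notin> critical \<longrightarrow> ln r \<le> \<epsilon> * T r) at_top" by blast
  have "\<exists>r\<ge>r0. r \<notin> critical \<and> T r \<le> 1 / \<epsilon> * ln r" for r0
  proof -
    obtain r where "r \<ge> r0" "r \<notin> critical" "\<not> ln r \<le> \<epsilon> * T r"
      using \<epsilon>(2) unfolding eventually_at_top_linorder by blast
    thus ?thesis using \<epsilon>(1) by (intro exI[of _ r]) (auto simp: field_simps)
  qed
  thus ?thesis by (rule poly_bound) (use \<epsilon>(1) in simp)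
qed

end

section \<open>The deficiency relation\<close>

lemma eventually_less_of_Limsup_less:
  fixes x :: "real \<Rightarrow> real"
  assumes "Limsup at_top (\<lambda>r. ereal (x r)) < ereal l"
  shows "eventually (\<lambda>r. x r < l) at_top"
  using Limsup_lessD[OF assms] by simp

text \<open>A radius beyond all eventual bounds x j < y j + \<epsilon>, y j being the upper limits,
  yields q - n \<le> sum of the y j up to a multiple of \<epsilon>. The q + 1 terms 1 - y j then add
  up to at most n + 1.\<close>

lemma sum_deficiency_le:
  fixes x :: "nat \<Rightarrow> real \<Rightarrow> real"
  assumes n: "n < q"
    and nonneg: "\<And>j r0. j \<le> q \<Longrightarrow> \<exists>r\<ge>r0. 0 \<le> x j r"
    and bound: "\<And>\<epsilon> r0. \<epsilon> > 0 \<Longrightarrow> \<exists>r\<ge>r0. real (q - n) \<le> (\<Sum>j\<le>q. x j r) + \<epsilon>"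
  shows "(\<Sum>j\<le>q. 1 - Limsup at_top (\<lambda>r. ereal (x j r))) \<le> ereal (real (n + 1))"
proof -
  define l where "l j = Limsup at_top (\<lambda>r. ereal (x j r))" for j
  \<comment> \<open>An upper limit -infinity would give a deficiency of +infinity; this excludes
    it.\<close>
  have l0: "l j \<ge> 0" if j: "j \<le> q" for j
  proof (rule ccontr)
    assume "\<not> l j \<ge> 0"
    hence "l j < ereal 0" by (simp add: zero_ereal_def)
    hence "eventually (\<lambda>r. x j r < 0) at_top" unfolding l_def by (rule eventually_less_of_Limsup_less)
    then obtain r0 where "\<And>r. r \<ge> r0 \<Longrightarrow> x j r < 0" unfolding eventually_at_top_linorder by blast
    thus False using nonneg[OF j, of r0] by force
  qed
  show ?thesis
  proof (cases "\<exists>j\<le>q. l j = \<infinity>")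
    case True
    then obtain j where j: "j \<le> q" "l j = \<infinity>" by blast
    \<comment> \<open>One deficiency is -infinity and none is +infinity, so the sum in
      \<open>ereal\<close> is -infinity.\<close>
    have "1 - l i \<noteq> \<infinity>" if "i \<le> q" for i using l0[OF that] by (cases "l i") (auto simp: one_ereal_def)
    hence "(\<Sum>i\<in>{..q} - {j}. 1 - l i) \<noteq> \<infinity>" unfolding sum_Pinfty by auto
    moreover have "(\<Sum>i\<le>q. 1 - l i) = (1 - l j) + (\<Sum>i\<in>{..q} - {j}. 1 - l i)"
      by (rule sum.remove) (use j in auto)
    ultimately have "(\<Sum>i\<le>q. 1 - l i) = -\<infinity>" using j(2) by (auto simp: one_ereal_def)
    thus ?thesis unfolding l_def by simp
  next
    case False
    define y where "y j = real_of_ereal (l j)" for j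
    have ly: "l j = ereal (y j)" if "j \<le> q" for j
      using False l0[OF that] that unfolding y_def by (cases "l j") auto
    have "real (q - n) \<le> (\<Sum>j\<le>q. y j)"
    proof (rule field_le_epsilon)
      fix e :: real assume e: "e > 0"
      \<comment> \<open>One \<epsilon> for each of the q + 1 functions and one for
        \<open>bound\<close>.\<close>
      define \<epsilon> where "\<epsilon> = e / (real q + 2)"
      have \<epsilon>: "\<epsilon> > 0" unfolding \<epsilon>_def using e by simp
      have "\<forall>j\<in>{..q}. eventually (\<lambda>r. x j r < y j + \<epsilon>) at_top"
      proof
        fix j assume "j \<in> {..q}"
        hence "l j < ereal (y j + \<epsilon>)" using ly[of j] \<epsilon> by simp
        thus "eventually (\<lambda>r. x j r < y j + \<epsilon>) at_top" unfolding l_def by (rule eventually_less_of_Limsup_less)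
      qed
      hence "eventually (\<lambda>r. \<forall>j\<in>{..q}. x j r < y j + \<epsilon>) at_top" by (intro eventually_ball_finite) auto
      then obtain r0 where r0: "\<And>r. r \<ge> r0 \<Longrightarrow> \<forall>j\<in>{..q}. x j r < y j + \<epsilon>" unfolding eventually_at_top_linorder by blast
      obtain r where r: "r \<ge> r0" "real (q - n) \<le> (\<Sum>j\<le>q. x j r) + \<epsilon>" using bound[OF \<epsilon>] by blast
      have "(\<Sum>j\<le>q. x j r) \<le> (\<Sum>j\<le>q. y j + \<epsilon>)" using r0[OF r(1)] by (intro sum_mono less_imp_le) auto
      hence "real (q - n) \<le> (\<Sum>j\<le>q. y j) + ((real q + 1) * \<epsilon> + \<epsilon>)" using r(2) by (simp add: sum.distrib algebra_simps)
      also have "(real q + 1) * \<epsilon> + \<epsilon> = (real q + 2) * \<epsilon>" by (simp add: algebra_simps)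
      also have "\<dots> = e" unfolding \<epsilon>_def by simp
      finally show "real (q - n) \<le> (\<Sum>j\<le>q. y j) + e" .
    qed
    moreover have "(\<Sum>j\<le>q. 1 - l j) = ereal (\<Sum>j\<le>q. 1 - y j)"
      unfolding sum_ereal[symmetric] by (rule sum.cong) (auto simp: ly one_ereal_def)
    moreover have "(\<Sum>j\<le>q. 1 - y j) = real q + 1 - (\<Sum>j\<le>q. y j)" by (simp add: sum_subtractf)
    ultimately show ?thesis using n unfolding l_def[symmetric] by simp
  qed
qed

theorem corollary4p8:
  fixes c :: complex and n q :: nat
    and g f :: "nat \<Rightarrow> complex \<Rightarrow> complex"
    and a :: "nat \<Rightarrow> nat \<Rightarrow> complex \<Rightarrow> complex"
  assumes "n \<ge> 1"
    and "reduced_rep n g"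
    and "hyper_order (cartan_char n g) < 1"
    and "lin_indep_over_periodic c {..n} g"
    and "q > n"
    and "\<And>i j. i \<le> n \<Longrightarrow> j \<le> q \<Longrightarrow> a i j holomorphic_on UNIV"
    and "\<And>i j z. i \<le> n \<Longrightarrow> j \<le> q \<Longrightarrow> a i j (z + c) = a i j z"
    and "\<And>i j. i \<le> n \<Longrightarrow> j \<le> q \<Longrightarrow> nevanlinna_char (a i j) \<in> o[at_top](cartan_char n g)"
    and "\<And>j z. j \<le> q \<Longrightarrow> f j z = (\<Sum>i\<le>n. a i j z * g i z)"
    and "\<And>J. J \<subseteq> {..q} \<Longrightarrow> card J = n + 1 \<Longrightarrow> lin_indep_over_periodic c J f"
    and "\<And>j. j \<le> q \<Longrightarrow> derivative_like_paired c 0 (f j)"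
  shows "(\<Sum>j\<le>q. trunc_deficiency n n g (f j)) \<le> ereal (real (n + 1))"
proof -
  interpret paired_curve n g c q f a
    by unfold_locales (use assms in auto)
  have count0: "trunc_count_zeros n (f j) r \<ge> 0" if "j \<le> q" "r \<ge> 1" for j r
    unfolding trunc_count_zeros_def
  proof (rule int_count_nonneg[OF _ that(2)])
    have "finite {z \<in> cball 0 r. zero_mult (f j) z \<noteq> 0}"
      unfolding zero_mult_support[OF f_holo[OF that(1)] f_nz[OF that(1)]]
      by (rule finite_zeros_in[OF f_holo[OF that(1)] f_nz[OF that(1)]])
    thus "finite {z \<in> cball 0 r. min (zero_mult (f j) z) n \<noteq> 0}"
      by (rule finite_subset[rotated]) auto
  qed
  show ?thesis
    unfolding trunc_deficiency_def
  proof (rule sum_deficiency_le[OF assms(5)])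
    show "\<exists>r\<ge>r0. real (q - n) \<le> (\<Sum>j\<le>q. trunc_count_zeros n (f j) r / T r) + \<epsilon>" if \<epsilon>: "\<epsilon> > 0" for \<epsilon> r0
    proof -
      obtain r where r: "r \<ge> r0" "T r > 0" "real (q - n) * T r \<le> (\<Sum>j\<le>q. trunc_count_zeros n (f j) r) + \<epsilon> * T r"
        using main_bound \<epsilon> unfolding main_bound_def by blast
      have "real (q - n) \<le> ((\<Sum>j\<le>q. trunc_count_zeros n (f j) r) + \<epsilon> * T r) / T r"
        using r by (simp add: le_divide_eq)
      thus ?thesis using r by (intro exI[of _ r]) (simp add: add_divide_distrib sum_divide_distrib)
    qed
    \<comment> \<open>T is known to be positive on the radii of \<open>main_bound\<close>, so
      nonnegativity is supplied on arbitrarily large radii rather than on all large ones.\<close>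
    show "\<exists>r\<ge>r0. 0 \<le> trunc_count_zeros n (f j) r / T r" if j: "j \<le> q" for j r0
    proof -
      obtain r where "r \<ge> max r0 1" "T r > 0"
        using main_bound[unfolded main_bound_def, rule_format, of 1 "max r0 1"] by auto
      thus ?thesis using count0[OF j, of r] by (intro exI[of _ r]) auto
    qed
  qed
qed

end
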